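(* Let $\alpha_1,\beta_1\in\mathbb R$, $\mu_1\in\mathbb C$, and consider on $\mathbb T$ the equation $$ i\partial_t\phi+|\phi|^2\partial_{xx}\phi+\alpha_1\phi|\partial_x\phi|^2+\beta_1\overline{\phi}(\partial_x\phi)^2+\mu_1|\phi|^2\phi=0. \qquad (\ast)$$ Let $\sigma_c=-(\frac{\alpha_1}{2}+\beta_1-1)$ and $s_c=\max\{2,\lfloor\sigma_c-\frac12\rfloor+1\}$. Assume that there exists a solution $f\in L^\infty([0,\delta];C^{s_c+1,1}(\mathbb T))$ of $(\ast)$, for some $\delta>0$, whose initial data $f_0=f(t=0)$ is linearly degenerate, i.e. there exists $x_0\in\mathbb T$ with $f_0(x_0)=0$ and $f_0'(x_0)\neq 0$. Then there is $c_0>0$ depending only on $f$ such that for any $\epsilon>0$, $s_0\ge s_c$ and $0<\delta'\le\delta$, there exists $\widetilde\phi_0\in C^\infty(\mathbb T)$ with $\|\widetilde\phi_0\|_{C^{s_0}}\le\epsilon$ such that one of the following holds: (i) there exists no solution of $(\ast)$ in $L^\infty([0,\delta'];C^{s_c}(\mathbb T))$ with initial data $f_0+\widetilde\phi_0$; or (ii) any solution $\phi\in L^\infty([0,\delta'];C^{s_c}(\mathbb T))$ of $(\ast)$ with $\phi(t=0)=f_0+\widetilde\phi_0$ satisfies $$\sup_{0<t<\delta'}\|\phi(t,\cdot)-f(t,\cdot)\|_{C^{s_c}(\mathbb T)}>c_0(\delta')^{-1/2}.$$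
   Context: $\mathbb T$ is the one-dimensional torus; $C^{k,1}$ denotes functions with $k$ derivatives, the $k$-th being Lipschitz; $C^{s}$ for integer $s$ is the space of $s$ times continuously differentiable functions with its usual norm. *)

theory Defs
  imports "HOL-Analysis.Analysis"
begin

text \<open>Functions on the torus T = R / 2 pi Z are represented as 2 pi-periodic
  functions real => complex.  Space-time functions are curried: phi t x.\<close>

definition periodic_T :: "(real \<Rightarrow> complex) \<Rightarrow> bool" where
  "periodic_T g \<longleftrightarrow> (\<forall>x. g (x + 2 * pi) = g x)"

definition dx :: "nat \<Rightarrow> (real \<Rightarrow> complex) \<Rightarrow> real \<Rightarrow> complex" where
  "dx j g = ((\<lambda>h x. vector_derivative h (at x)) ^^ j) g"

definition Cs :: "nat \<Rightarrow> (real \<Rightarrow> complex) \<Rightarrow> bool" where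
  "Cs s g \<longleftrightarrow> periodic_T g
     \<and> (\<forall>j<s. \<forall>x. (dx j g has_vector_derivative dx (Suc j) g x) (at x))
     \<and> (\<forall>j\<le>s. continuous_on UNIV (dx j g))"

definition Cinf :: "(real \<Rightarrow> complex) \<Rightarrow> bool" where
  "Cinf g \<longleftrightarrow> (\<forall>s. Cs s g)"

definition Cnorm :: "nat \<Rightarrow> (real \<Rightarrow> complex) \<Rightarrow> real" where
  "Cnorm s g = (\<Sum>j\<le>s. (SUP x. norm (dx j g x)))"

definition Nl :: "real \<Rightarrow> real \<Rightarrow> complex \<Rightarrow> (real \<Rightarrow> complex) \<Rightarrow> real \<Rightarrow> complex" where
  "Nl \<alpha> \<beta> \<mu> u x =
     of_real ((cmod (u x))\<^sup>2) * dx 2 u x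
     + of_real \<alpha> * u x * of_real ((cmod (dx 1 u x))\<^sup>2)
     + of_real \<beta> * cnj (u x) * (dx 1 u x)\<^sup>2
     + \<mu> * of_real ((cmod (u x))\<^sup>2) * u x"

text \<open>phi is a solution of the equation on [0,T] (in integral / mild-in-time
  form, d_t phi = i N(phi)).\<close>
definition solves :: "real \<Rightarrow> real \<Rightarrow> complex \<Rightarrow> real \<Rightarrow> (real \<Rightarrow> real \<Rightarrow> complex) \<Rightarrow> bool" where
  "solves \<alpha> \<beta> \<mu> T phi \<longleftrightarrow>
     (\<forall>t\<in>{0..T}. \<forall>x.
        set_integrable lborel {0..t} (\<lambda>\<tau>. Nl \<alpha> \<beta> \<mu> (phi \<tau>) x)
        \<and> phi t x = phi 0 x + \<i> * (LINT \<tau>:{0..t}|lborel. Nl \<alpha> \<beta> \<mu> (phi \<tau>) x))"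

definition Linf_Cs :: "real \<Rightarrow> nat \<Rightarrow> (real \<Rightarrow> real \<Rightarrow> complex) \<Rightarrow> bool" where
  "Linf_Cs T s phi \<longleftrightarrow> (\<exists>M. \<forall>t\<in>{0..T}. Cs s (phi t) \<and> Cnorm s (phi t) \<le> M)"

definition Linf_Ck1 :: "real \<Rightarrow> nat \<Rightarrow> (real \<Rightarrow> real \<Rightarrow> complex) \<Rightarrow> bool" where
  "Linf_Ck1 T k phi \<longleftrightarrow> (\<exists>M. \<forall>t\<in>{0..T}. Cs k (phi t) \<and> Cnorm k (phi t) \<le> M
      \<and> (\<forall>x y. norm (dx k (phi t) x - dx k (phi t) y) \<le> M * \<bar>x - y\<bar>))"

definition sigma_c :: "real \<Rightarrow> real \<Rightarrow> real" where
  "sigma_c \<alpha> \<beta> = - (\<alpha> / 2 + \<beta> - 1)"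

definition s_c :: "real \<Rightarrow> real \<Rightarrow> nat" where
  "s_c \<alpha> \<beta> = max 2 (nat (\<lfloor>sigma_c \<alpha> \<beta> - 1/2\<rfloor> + 1))"

end

theory Submission
  imports Defs
begin

text \<open>After a generic perturbation c (1 - cos (x - x0)) the point x0 is the only zero of the data. A solution h with such data
  keeps this zero, with |h'(x0)|^2 = A constant in time, so near x0 the equation linearized at h is governed by
  A (x - x0)^2 d_xx. A packet at the scale m^(-8) with frequency m^4 in ln (x - x0) is therefore transported to the scale
  m^(-8) exp (-2 A m) within the time m^(-3). Add kappa times this packet to the data of h and let phi be a solution with
  these data that is bounded in C^k, k = s_c. The weight |h|^(-2 sigma) with sigma = sigma_c cancels the first order terms
  in the energy identity, so the weighted L2 norm of phi - h stays of the size of its initial value. Hence the pairing of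
  phi - h with a dual packet moving along the same ray loses at most half of its initial value. On the other hand phi - h
  vanishes to order k at x0, and since k > sigma - 1/2 this makes the final pairing exponentially small in m: kappa is
  at most C exp (-c m). But kappa = epsilon m^(-N) is small enough for the C^s0 norm, a contradiction for large m. Any uniform
  bound on the C^k distance to f gives the bound in C^k used here, so the value of c0 is irrelevant.\<close>

section \<open>Functions with a bounded rate of change\<close>

text \<open>The reference solution h is not f. Its existence, like that of phi, comes from denying
  the conclusion: then every small smooth perturbation of the data has a solution within a fixed C^k
  distance of f. So both solutions have only k derivatives in x, and in time they satisfy an
  integral equation with a measurable rate; \<open>has_rate\<close> is the calculus for this.
  Differentiating the equation at x0 would cost two derivatives, so jets at x0 are reached through
  Taylor quotients in x. The exponents are balanced: replacing |h|^2 by A x^2 leaves x^3 against a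
  second derivative of size frequency^2 / x^2, so x may be at most frequency^(-2), that is m^(-8).
  The time m^(-3) moves the packet by a multiple of m in ln x, which beats every power of m, while
  an error rate of size m adds up to m^(-2) only. Such times are short enough to absorb half of a
  supremum where Gronwall would be used. The difference phi - h is small in weighted L2, but its
  derivatives are only bounded; terms quadratic in it are therefore integrated by parts like the
  linear ones.\<close>

lemma caratheodory_borel:
  fixes k :: "real \<Rightarrow> real \<Rightarrow> real"
  assumes "\<And>x. (\<lambda>\<tau>. k \<tau> x) \<in> borel_measurable borel"
    and "\<And>\<tau>. continuous_on UNIV (k \<tau>)"
  shows "case_prod k \<in> borel_measurable (lborel \<Otimes>\<^sub>M lborel)"
proof (rule borel_measurable_LIMSEQ_metric)
  show "(\<lambda>w. k (fst w) (real_of_int \<lfloor>real (Suc i) * snd w\<rfloor> / real (Suc i)))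
      \<in> borel_measurable (lborel \<Otimes>\<^sub>M lborel)" for i
  proof (rule measurable_compose_countable[where g="\<lambda>w. \<lfloor>real (Suc i) * snd w\<rfloor>"
        and f="\<lambda>j w. k (fst w) (real_of_int j / real (Suc i))"])
    show "(\<lambda>w. k (fst w) (real_of_int j / real (Suc i))) \<in> borel_measurable (lborel \<Otimes>\<^sub>M lborel)" for j
      by (rule measurable_compose[OF measurable_fst]) (use assms(1) in simp)
  qed measurable
next
  fix w :: "real \<times> real"
  have "(\<lambda>i. real_of_int \<lfloor>real (Suc i) * snd w\<rfloor> / real (Suc i)) \<longlonglongrightarrow> snd w"
  proof (rule LIMSEQ_I)
    fix r :: real assume "r > 0"
    then obtain N where N: "1 / r < real N" using reals_Archimedean2 by blast
    have "norm (real_of_int \<lfloor>real (Suc i) * snd w\<rfloor> / real (Suc i) - snd w) < r" if "i \<ge> N" for i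
    proof -
      have i: "1 < r * real (Suc i)"
      proof -
        have "1 / r < real (Suc i)" using N that by linarith
        then show ?thesis using \<open>r > 0\<close> by (simp add: field_simps)
      qed
      have "\<bar>real_of_int \<lfloor>real (Suc i) * snd w\<rfloor> - real (Suc i) * snd w\<bar> \<le> 1"
        by linarith
      then have "\<bar>real_of_int \<lfloor>real (Suc i) * snd w\<rfloor> - real (Suc i) * snd w\<bar> < r * real (Suc i)"
        using i by linarith
      moreover have "real_of_int \<lfloor>real (Suc i) * snd w\<rfloor> / real (Suc i) - snd w
          = (real_of_int \<lfloor>real (Suc i) * snd w\<rfloor> - real (Suc i) * snd w) / real (Suc i)"
        by (simp add: field_simps)
      ultimately show ?thesis
        by (simp add: abs_divide pos_divide_less_eq del: of_nat_Suc)
    qed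
    then show "\<exists>no. \<forall>n\<ge>no. norm (real_of_int \<lfloor>real (Suc n) * snd w\<rfloor> / real (Suc n) - snd w) < r"
      by blast
  qed
  then show "(\<lambda>i. k (fst w) (real_of_int \<lfloor>real (Suc i) * snd w\<rfloor> / real (Suc i)))
      \<longlonglongrightarrow> case_prod k w"
    using assms(2)[of "fst w"]
    by (auto simp: case_prod_beta continuous_on_eq_continuous_at isCont_def
        intro!: isCont_tendsto_compose[where g="k (fst w)"] simp del: of_nat_Suc)
qed

text \<open>The evolution law is an integral in time for each fixed x, so bounding a spatial
  integral means exchanging the two integrations. Joint measurability for Fubini comes from
  continuity in x together with measurability in time.\<close>

lemma integral_time_space_le:
  fixes k :: "real \<Rightarrow> real \<Rightarrow> real"
  assumes "0 \<le> t" "p \<le> q"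
    and cont: "\<And>\<tau>. \<tau> \<in> {0..t} \<Longrightarrow> continuous_on {p..q} (k \<tau>)"
    and meas: "\<And>x. x \<in> {p..q} \<Longrightarrow> set_integrable lborel {0..t} (\<lambda>\<tau>. k \<tau> x)"
    and bd: "\<And>\<tau> x. \<tau> \<in> {0..t} \<Longrightarrow> x \<in> {p..q} \<Longrightarrow> \<bar>k \<tau> x\<bar> \<le> M"
    and B: "\<And>\<tau>. \<tau> \<in> {0..t} \<Longrightarrow> integral {p..q} (k \<tau>) \<le> B"
  shows "integral {p..q} (\<lambda>x. LINT \<tau>:{0..t}|lborel. k \<tau> x) \<le> B * t"
proof -
  \<comment> \<open>Clamping x to {p..q} extends \<open>k\<close> continuously to the whole line,
    where \<open>caratheodory_borel\<close> applies.\<close>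
  define c where "c x = max p (min q x)" for x :: real
  have c: "c x \<in> {p..q}" "x \<in> {p..q} \<Longrightarrow> c x = x" for x
    using \<open>p \<le> q\<close> by (auto simp: c_def)
  have cc: "continuous_on UNIV c" unfolding c_def by (intro continuous_intros)
  define F where "F \<tau> x = indicator {0..t} \<tau> * k \<tau> (c x)" for \<tau> x
  have F1: "case_prod F \<in> borel_measurable (lborel \<Otimes>\<^sub>M lborel)"
  proof (rule caratheodory_borel)
    show "(\<lambda>\<tau>. F \<tau> x) \<in> borel_measurable borel" for x
      using borel_measurable_integrable[OF meas[OF c(1)[of x], unfolded set_integrable_def]]
      by (simp add: F_def)
    show "continuous_on UNIV (F \<tau>)" for \<tau>
    proof (cases "\<tau> \<in> {0..t}")
      case True
      have "continuous_on UNIV (\<lambda>x. k \<tau> (c x))"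
        by (rule continuous_on_compose2[OF cont[OF True] cc]) (use c in auto)
      then show ?thesis using True by (simp add: F_def[abs_def])
    qed (simp add: F_def[abs_def])
  qed
  define G where "G \<tau> x = indicator {p..q} x * F \<tau> x" for \<tau> x
  have G1[measurable]: "case_prod G \<in> borel_measurable (lborel \<Otimes>\<^sub>M lborel)"
  proof -
    have "case_prod G = (\<lambda>w. indicator {p..q} (snd w) * case_prod F w)"
      by (auto simp: G_def)
    then show ?thesis using F1 by simp
  qed
  have GM: "\<bar>G \<tau> x\<bar> \<le> \<bar>M\<bar>" for \<tau> x
    using bd[of \<tau> "c x"] c by (auto simp: G_def F_def indicator_def abs_mult intro: order_trans)
  have int: "integrable (lborel \<Otimes>\<^sub>M lborel) (case_prod G)"
  proof (rule integrableI_bounded_set[where A="{0..t} \<times> {p..q}" and B="\<bar>M\<bar>"])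
    show "emeasure (lborel \<Otimes>\<^sub>M lborel) ({0..t} \<times> {p..q}) < \<infinity>"
      using \<open>0 \<le> t\<close> \<open>p \<le> q\<close>
      by (subst lborel.emeasure_pair_measure_Times) (auto simp: ennreal_mult_less_top)
    show "AE w in lborel \<Otimes>\<^sub>M lborel. w \<in> {0..t} \<times> {p..q} \<longrightarrow> norm (case_prod G w) \<le> \<bar>M\<bar>"
      using GM by (intro always_eventually) (auto simp: case_prod_beta)
    show "AE w in lborel \<Otimes>\<^sub>M lborel. w \<notin> {0..t} \<times> {p..q} \<longrightarrow> case_prod G w = 0"
      by (intro always_eventually) (auto simp: G_def F_def indicator_def)
  qed measurable
  have E1: "(\<integral>x. G \<tau> x \<partial>lborel) = indicator {0..t} \<tau> * integral {p..q} (k \<tau>)" for \<tau>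
  proof (cases "\<tau> \<in> {0..t}")
    case True
    have "set_integrable lborel {p..q} (k \<tau>)"
      using cont[OF True] borel_integrable_compact[of "{p..q}" "k \<tau>"]
      by (simp add: set_integrable_def indicator_def scaleR_conv_of_real if_distrib cong: if_cong)
    note set_borel_integral_eq_integral(2)[OF this]
    moreover have "(\<integral>x. G \<tau> x \<partial>lborel) = (LINT x:{p..q}|lborel. k \<tau> x)"
      unfolding set_lebesgue_integral_def
      by (rule Bochner_Integration.integral_cong) (use True c in \<open>auto simp: G_def F_def indicator_def\<close>)
    ultimately show ?thesis using True by simp
  qed (simp add: G_def F_def)
  have E2: "(\<integral>\<tau>. G \<tau> x \<partial>lborel) = indicator {p..q} x * (LINT \<tau>:{0..t}|lborel. k \<tau> x)" for x
    by (cases "x \<in> {p..q}") (auto simp: G_def F_def c set_lebesgue_integral_def)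
  have fub: "(\<integral>x. (\<integral>\<tau>. G \<tau> x \<partial>lborel) \<partial>lborel) = (\<integral>\<tau>. (\<integral>x. G \<tau> x \<partial>lborel) \<partial>lborel)"
    by (rule lborel_pair.Fubini_integral[OF int])
  have "set_integrable lborel {p..q} (\<lambda>x. LINT \<tau>:{0..t}|lborel. k \<tau> x)"
    using lborel_pair.integrable_snd[OF int] by (simp add: E2 set_integrable_def)
  then have "integral {p..q} (\<lambda>x. LINT \<tau>:{0..t}|lborel. k \<tau> x)
      = (LINT x:{p..q}|lborel. (LINT \<tau>:{0..t}|lborel. k \<tau> x))"
    by (simp add: set_borel_integral_eq_integral(2))
  also have "\<dots> = (\<integral>\<tau>. (\<integral>x. G \<tau> x \<partial>lborel) \<partial>lborel)"
    unfolding fub[symmetric] E2 by (simp add: set_lebesgue_integral_def)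
  also have "\<dots> = (\<integral>\<tau>. indicator {0..t} \<tau> * integral {p..q} (k \<tau>) \<partial>lborel)"
    by (simp add: E1)
  also have "\<dots> \<le> (\<integral>\<tau>. indicator {0..t} \<tau> * B \<partial>lborel)"
  proof (rule integral_mono)
    show "integrable lborel (\<lambda>\<tau>. indicator {0..t} \<tau> * integral {p..q} (k \<tau>))"
      using lborel_pair.integrable_fst[OF int] by (simp add: E1)
    show "integrable lborel (\<lambda>\<tau>. indicator {0..t} \<tau> * B)"
      by (intro integrable_mult_left integrable_real_indicator) (use \<open>0 \<le> t\<close> in auto)
  qed (use B in \<open>auto simp: indicator_def\<close>)
  also have "\<dots> = B * t" using \<open>0 \<le> t\<close> by simp
  finally show ?thesis .
qed

text \<open>A solution is only bounded in time with values in C^s, so its time derivative is a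
  bounded measurable function and the law of motion is an integral identity. The bound on
  \<open>k\<close> makes \<open>u\<close> Lipschitz, and the product and chain rules rest on
  that.\<close>

definition has_rate :: "real \<Rightarrow> (real \<Rightarrow> 'a::{banach,second_countable_topology}) \<Rightarrow> (real \<Rightarrow> 'a) \<Rightarrow> bool" where
  "has_rate T u k \<longleftrightarrow> set_integrable lborel {0..T} k \<and> (\<exists>M. \<forall>\<tau>\<in>{0..T}. norm (k \<tau>) \<le> M) \<and>
     (\<forall>t\<in>{0..T}. u t = u 0 + (LINT \<tau>:{0..t}|lborel. k \<tau>))"

lemma has_rate_bounded:
  assumes "has_rate T u k"
  obtains M where "\<And>\<tau>. \<tau> \<in> {0..T} \<Longrightarrow> norm (k \<tau>) \<le> M"
  using assms that unfolding has_rate_def by (metis (no_types))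

lemma has_rate_eq:
  "has_rate T u k \<Longrightarrow> t \<in> {0..T} \<Longrightarrow> u t = u 0 + (LINT \<tau>:{0..t}|lborel. k \<tau>)"
  unfolding has_rate_def by blast

lemma has_rate_integrable: "has_rate T u k \<Longrightarrow> set_integrable lborel {0..T} k"
  unfolding has_rate_def by blast

lemma set_lebesgue_integral_norm_le:
  fixes k :: "real \<Rightarrow> 'a::{banach,second_countable_topology}"
  assumes "set_integrable lborel {s..t} k" "\<And>\<tau>. \<tau> \<in> {s..t} \<Longrightarrow> norm (k \<tau>) \<le> M" "s \<le> t"
  shows "norm (LINT \<tau>:{s..t}|lborel. k \<tau>) \<le> M * (t - s)"
proof -
  have "norm (LINT \<tau>:{s..t}|lborel. k \<tau>) \<le> (LINT \<tau>:{s..t}|lborel. norm (k \<tau>))"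
    by (rule set_integral_norm_bound[OF assms(1)])
  also have "\<dots> \<le> (LINT \<tau>:{s..t}|lborel. M)"
    by (rule set_integral_mono[OF set_integrable_norm[OF assms(1)]])
      (use assms in \<open>auto simp: set_integrable_def\<close>)
  also have "\<dots> = M * (t - s)" using assms(3) by (simp add: set_lebesgue_integral_def)
  finally show ?thesis .
qed

lemma set_lebesgue_integral_singleton:
  fixes k :: "real \<Rightarrow> 'a::{banach,second_countable_topology}"
  shows "(LINT \<tau>:{s..s}|lborel. k \<tau>) = 0"
  unfolding set_lebesgue_integral_def
  by (rule integral_eq_zero_AE, rule AE_I[where N="{s}"]) (auto simp: indicator_def)

lemma has_rate_diff:
  assumes "has_rate T u k" "0 \<le> s" "s \<le> t" "t \<le> T"
  shows "u t - u s = (LINT \<tau>:{s..t}|lborel. k \<tau>)"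
proof -
  have k: "set_integrable lborel {0..T} k" by (rule has_rate_integrable[OF assms(1)])
  have "set_integrable lborel {0..s} k" "set_integrable lborel {s..t} k"
    using assms by (auto intro: set_integrable_subset[OF k])
  moreover have "(LINT \<tau>:{0..t}|lborel. k \<tau>) = (LINT \<tau>:{0..s} \<union> {s..t}|lborel. k \<tau>)"
    using assms by (simp add: ivl_disj_un_two_touch)
  moreover have "AE x in lborel. \<not> (x \<in> {0..s} \<and> x \<in> {s..t})"
    by (rule AE_I[where N="{s}"]) auto
  ultimately have "(LINT \<tau>:{0..t}|lborel. k \<tau>) = (LINT \<tau>:{0..s}|lborel. k \<tau>) + (LINT \<tau>:{s..t}|lborel. k \<tau>)"
    by (simp add: set_integral_Un_AE)
  moreover have "u t = u 0 + (LINT \<tau>:{0..t}|lborel. k \<tau>)" "u s = u 0 + (LINT \<tau>:{0..s}|lborel. k \<tau>)"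
    using assms by (auto intro: has_rate_eq[OF assms(1)])
  ultimately show ?thesis by simp
qed

lemma has_rate_lipschitz:
  assumes "has_rate T u k" "\<And>\<tau>. \<tau> \<in> {0..T} \<Longrightarrow> norm (k \<tau>) \<le> M" "0 \<le> s" "s \<le> t" "t \<le> T"
  shows "norm (u t - u s) \<le> M * (t - s)"
  unfolding has_rate_diff[OF assms(1,3-5)]
proof (rule set_lebesgue_integral_norm_le)
  show "set_integrable lborel {s..t} k"
    using assms by (auto intro: set_integrable_subset[OF has_rate_integrable])
qed (use assms in auto)

lemma has_rate_continuous_on:
  assumes "has_rate T u k" shows "continuous_on {0..T} u"
proof -
  obtain M where M: "\<And>\<tau>. \<tau> \<in> {0..T} \<Longrightarrow> norm (k \<tau>) \<le> M"
    using has_rate_bounded[OF assms] by blast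
  have "norm (u t - u s) \<le> M * \<bar>t - s\<bar>" if "s \<in> {0..T}" "t \<in> {0..T}" for s t
    using has_rate_lipschitz[OF assms M, of s t] has_rate_lipschitz[OF assms M, of t s] that
    by (cases "s \<le> t") (auto simp: norm_minus_commute)
  then have "norm (u t - u s) \<le> (\<bar>M\<bar> + 1) * \<bar>t - s\<bar>" if "s \<in> {0..T}" "t \<in> {0..T}" for s t
    using that by (smt (verit) mult_right_mono abs_ge_zero)
  then have "(\<bar>M\<bar> + 1)-lipschitz_on {0..T} u"
    by (auto simp: lipschitz_on_def dist_norm real_norm_def)
  then show ?thesis by (rule lipschitz_on_continuous_on)
qed

text \<open>A quadratically small defect over every subinterval has derivative zero, hence vanishes.\<close>

lemma has_rateI:
  fixes u k :: "real \<Rightarrow> 'a::{banach,second_countable_topology}"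
  assumes k: "set_integrable lborel {0..T} k"
    and M: "\<And>\<tau>. \<tau> \<in> {0..T} \<Longrightarrow> norm (k \<tau>) \<le> M"
    and C: "\<And>s t. 0 \<le> s \<Longrightarrow> s \<le> t \<Longrightarrow> t \<le> T \<Longrightarrow>
       norm (u t - u s - (LINT \<tau>:{s..t}|lborel. k \<tau>)) \<le> C * (t - s)^2"
  shows "has_rate T u k"
  unfolding has_rate_def
proof (intro conjI ballI)
  fix t assume t: "t \<in> {0..T}"
  define v where "v t = (LINT \<tau>:{0..t}|lborel. k \<tau>)" for t
  have v: "has_rate T v k"
    unfolding has_rate_def
  proof (intro conjI exI[of _ M] ballI)
  qed (use k M in \<open>auto simp del: atLeastAtMost_singleton simp: v_def set_lebesgue_integral_singleton\<close>)
  define P where "P t = u t - v t" for t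
  have P: "norm (P t - P s) \<le> \<bar>C\<bar> * (t - s)^2" if "s \<in> {0..T}" "t \<in> {0..T}" for s t
  proof -
    have *: "norm (P t - P s) \<le> \<bar>C\<bar> * (t - s)^2" if "0 \<le> s" "s \<le> t" "t \<le> T" for s t
    proof -
      have "norm (P t - P s) \<le> C * (t - s)^2"
        using C[OF that] by (simp add: P_def has_rate_diff[OF v that, symmetric] algebra_simps)
      also have "\<dots> \<le> \<bar>C\<bar> * (t - s)^2" by (simp add: mult_right_mono)
      finally show ?thesis .
    qed
    show ?thesis using *[of s t] *[of t s] that
      by (cases "s \<le> t") (auto simp: norm_minus_commute power2_commute)
  qed
  have "(P has_derivative (\<lambda>_. 0)) (at s within {0..T})" if s: "s \<in> {0..T}" for s
  proof (rule has_derivativeI_sandwich[where e=1 and H="\<lambda>y. \<bar>C\<bar> * \<bar>y - s\<bar>"])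
    show "norm (P y - P s - 0) / norm (y - s) \<le> \<bar>C\<bar> * \<bar>y - s\<bar>" if "y \<in> {0..T}" "y \<noteq> s" for y
      using P[OF s that(1)] that
      by (simp add: divide_le_eq power2_eq_square abs_mult_self_eq mult.assoc)
    have "((\<lambda>y. \<bar>C\<bar> * \<bar>y - s\<bar>) \<longlongrightarrow> \<bar>C\<bar> * \<bar>s - s\<bar>) (at s within {0..T})"
      by (intro tendsto_intros)
    then show "((\<lambda>y. \<bar>C\<bar> * \<bar>y - s\<bar>) \<longlongrightarrow> 0) (at s within {0..T})" by simp
  qed auto
  then obtain c where "\<And>x. x \<in> {0..T} \<Longrightarrow> P x = c"
    using has_derivative_zero_constant[of "{0..T}" P] by auto
  then have "P t = P 0" using t by simp
  moreover have "v 0 = 0" by (simp add: v_def set_lebesgue_integral_singleton del: atLeastAtMost_singleton)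
  ultimately have "u t = u 0 + v t" unfolding P_def by (metis diff_eq_eq diff_zero)
  then show "u t = u 0 + (LINT \<tau>:{0..t}|lborel. k \<tau>)" by (simp only: v_def)
next
  show "\<exists>M. \<forall>\<tau>\<in>{0..T}. norm (k \<tau>) \<le> M" using M by blast
qed (rule k)

lemma continuous_on_Icc_norm_bound:
  fixes c :: "real \<Rightarrow> 'a::real_normed_vector"
  assumes "continuous_on {p..q} c"
  obtains N where "\<And>x. x \<in> {p..q} \<Longrightarrow> norm (c x) \<le> N"
proof -
  have "bounded (c ` {p..q})"
    using assms by (intro compact_imp_bounded compact_continuous_image) auto
  then show ?thesis using that unfolding bounded_iff by (metis imageI)
qed

lemma set_integrable_Icc_mono:
  fixes k :: "real \<Rightarrow> 'a::{banach,second_countable_topology}"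
  assumes "set_integrable lborel {0..T} k" "0 \<le> s" "t \<le> T"
  shows "set_integrable lborel {s..t} k"
  by (rule set_integrable_subset[OF assms(1)]) (use assms in auto)

text \<open>In a product rule each rate is multiplied by a function that has a rate itself and is
  therefore continuous in time; such a factor preserves measurability and integrability.\<close>

lemma set_integrable_continuous_scale:
  fixes k :: "real \<Rightarrow> 'a::{banach,second_countable_topology}"
    and c :: "real \<Rightarrow> 'b::{banach,second_countable_topology}"
    and B :: "'b \<Rightarrow> 'a \<Rightarrow> 'c::{banach,second_countable_topology}"
  assumes "bounded_bilinear B" "continuous_on {0..T} c" "set_integrable lborel {0..T} k"
  shows "set_integrable lborel {0..T} (\<lambda>\<tau>. B (c \<tau>) (k \<tau>))"
proof -
  interpret bounded_bilinear B by fact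
  obtain K where K: "\<And>a b. norm (B a b) \<le> norm a * norm b * K" "K > 0" using pos_bounded by blast
  obtain N where N: "\<And>\<tau>. \<tau> \<in> {0..T} \<Longrightarrow> norm (c \<tau>) \<le> N"
    using continuous_on_Icc_norm_bound[OF assms(2)] by blast
  have m: "(\<lambda>\<tau>. indicator {0..T} \<tau> *\<^sub>R c \<tau>) \<in> borel_measurable lborel"
    using borel_measurable_continuous_on_indicator[OF _ assms(2)] by simp
  have k: "integrable lborel (\<lambda>\<tau>. indicator {0..T} \<tau> *\<^sub>R k \<tau>)"
    using assms(3) by (simp add: set_integrable_def)
  have eq: "indicator {0..T} \<tau> *\<^sub>R B (c \<tau>) (k \<tau>)
      = B (indicator {0..T} \<tau> *\<^sub>R c \<tau>) (indicator {0..T} \<tau> *\<^sub>R k \<tau>)" for \<tau>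
    by (auto simp: indicator_def zero_left zero_right)
  have "integrable lborel (\<lambda>\<tau>. indicator {0..T} \<tau> *\<^sub>R B (c \<tau>) (k \<tau>))"
  proof (rule Bochner_Integration.integrable_bound)
    show "integrable lborel (\<lambda>\<tau>. (N * K) *\<^sub>R (indicator {0..T} \<tau> *\<^sub>R k \<tau>))"
      using k by (rule integrable_scaleR_right)
    show "(\<lambda>\<tau>. indicator {0..T} \<tau> *\<^sub>R B (c \<tau>) (k \<tau>)) \<in> borel_measurable lborel"
      unfolding eq
      by (rule borel_measurable_continuous_Pair[OF m borel_measurable_integrable[OF k]])
        (intro continuous_on bounded_bilinear.continuous_on[OF assms(1)] continuous_intros)
    show "AE \<tau> in lborel. norm (indicator {0..T} \<tau> *\<^sub>R B (c \<tau>) (k \<tau>))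
        \<le> norm ((N * K) *\<^sub>R (indicator {0..T} \<tau> *\<^sub>R k \<tau>))"
    proof (rule always_eventually, rule allI)
      fix \<tau>
      show "norm (indicator {0..T} \<tau> *\<^sub>R B (c \<tau>) (k \<tau>))
        \<le> norm ((N * K) *\<^sub>R (indicator {0..T} \<tau> *\<^sub>R k \<tau>))"
      proof (cases "\<tau> \<in> {0..T}")
        case True
        have "norm (c \<tau>) * norm (k \<tau>) * K \<le> N * norm (k \<tau>) * K"
          using N[OF True] K(2) by (intro mult_right_mono) auto
        also have "\<dots> \<le> \<bar>N * K\<bar> * norm (k \<tau>)"
          by (metis abs_ge_self mult.assoc mult.commute mult_right_mono norm_ge_zero)
        finally show ?thesis using K(1)[of "c \<tau>" "k \<tau>"] True by simp
      qed simp
    qed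
  qed
  then show ?thesis by (simp add: set_integrable_def)
qed

text \<open>The product rule without pointwise derivatives. The increment splits exactly with
  \<open>u\<close> frozen at the left end and \<open>v\<close> at the right end; moving either to
  the running time costs a Lipschitz constant times the length of the interval, so the defect is
  quadratic in the length and \<open>has_rateI\<close> applies.\<close>

lemma has_rate_bilinear:
  fixes u k :: "real \<Rightarrow> 'a::{banach,second_countable_topology}"
    and v l :: "real \<Rightarrow> 'b::{banach,second_countable_topology}"
    and B :: "'a \<Rightarrow> 'b \<Rightarrow> 'c::{banach,second_countable_topology}"
  assumes B: "bounded_bilinear B" and u: "has_rate T u k" and v: "has_rate T v l"
  shows "has_rate T (\<lambda>t. B (u t) (v t)) (\<lambda>t. B (u t) (l t) + B (k t) (v t))"
proof -
  interpret bounded_bilinear B by fact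
  obtain K where K: "\<And>a b. norm (B a b) \<le> norm a * norm b * K" "K > 0" using pos_bounded by blast
  note cu = has_rate_continuous_on[OF u] and cv = has_rate_continuous_on[OF v]
  obtain Mu where Mu: "\<And>\<tau>. \<tau> \<in> {0..T} \<Longrightarrow> norm (u \<tau>) \<le> Mu"
    using continuous_on_Icc_norm_bound[OF cu] by blast
  obtain Mv where Mv: "\<And>\<tau>. \<tau> \<in> {0..T} \<Longrightarrow> norm (v \<tau>) \<le> Mv"
    using continuous_on_Icc_norm_bound[OF cv] by blast
  obtain Mk where Mk: "\<And>\<tau>. \<tau> \<in> {0..T} \<Longrightarrow> norm (k \<tau>) \<le> Mk" using has_rate_bounded[OF u] by blast
  obtain Ml where Ml: "\<And>\<tau>. \<tau> \<in> {0..T} \<Longrightarrow> norm (l \<tau>) \<le> Ml" using has_rate_bounded[OF v] by blast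
  have ik: "set_integrable lborel {0..T} k" and il: "set_integrable lborel {0..T} l"
    using has_rate_integrable[OF u] has_rate_integrable[OF v] by auto
  have i1: "set_integrable lborel {0..T} (\<lambda>t. B (u t) (l t))"
    by (rule set_integrable_continuous_scale[OF B cu il])
  have i2: "set_integrable lborel {0..T} (\<lambda>t. B (k t) (v t))"
    by (rule set_integrable_continuous_scale[OF flip cv ik])
  show ?thesis
  proof (rule has_rateI[where M="Mu * Ml * K + Mk * Mv * K" and C="2 * (Mk * Ml * K)"])
    show "set_integrable lborel {0..T} (\<lambda>t. B (u t) (l t) + B (k t) (v t))"
      by (rule set_integral_add(1)[OF i1 i2])
    fix \<tau> assume \<tau>: "\<tau> \<in> {0..T}"
    have "norm (B (u \<tau>) (l \<tau>)) \<le> Mu * Ml * K"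
      using Mu[OF \<tau>] Ml[OF \<tau>] K(2)
      by (intro order_trans[OF K(1)] mult_mono) (auto intro: order_trans[OF norm_ge_zero] mult_nonneg_nonneg)
    moreover have "norm (B (k \<tau>) (v \<tau>)) \<le> Mk * Mv * K"
      using Mk[OF \<tau>] Mv[OF \<tau>] K(2)
      by (intro order_trans[OF K(1)] mult_mono) (auto intro: order_trans[OF norm_ge_zero] mult_nonneg_nonneg)
    ultimately show "norm (B (u \<tau>) (l \<tau>) + B (k \<tau>) (v \<tau>)) \<le> Mu * Ml * K + Mk * Mv * K"
      by (rule norm_triangle_mono)
  next
    fix s t assume st: "0 \<le> s" "s \<le> t" "t \<le> T"
    note sub = set_integrable_Icc_mono[OF _ st(1,3)]
    have ik': "set_integrable lborel {s..t} k" and il': "set_integrable lborel {s..t} l"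
      and i1': "set_integrable lborel {s..t} (\<lambda>t. B (u t) (l t))"
      and i2': "set_integrable lborel {s..t} (\<lambda>t. B (k t) (v t))"
      using ik il i1 i2 by (auto intro: sub)
    have j1: "set_integrable lborel {s..t} (\<lambda>\<tau>. B (u s) (l \<tau>))"
      using il' integrable_bounded_linear[OF bounded_linear_right]
      by (simp add: set_integrable_def flip: scaleR_right)
    have j2: "set_integrable lborel {s..t} (\<lambda>\<tau>. B (k \<tau>) (v t))"
      using ik' integrable_bounded_linear[OF bounded_linear_left]
      by (simp add: set_integrable_def flip: scaleR_left)
    have e1: "(LINT \<tau>:{s..t}|lborel. B (u s) (l \<tau>)) = B (u s) (v t - v s)"
      using il' unfolding has_rate_diff[OF v st]
      by (simp add: set_lebesgue_integral_def set_integrable_def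
            integral_bounded_linear[OF bounded_linear_right, symmetric] flip: scaleR_right)
    have e2: "(LINT \<tau>:{s..t}|lborel. B (k \<tau>) (v t)) = B (u t - u s) (v t)"
      using ik' unfolding has_rate_diff[OF u st]
      by (simp add: set_lebesgue_integral_def set_integrable_def
            integral_bounded_linear[OF bounded_linear_left, symmetric] flip: scaleR_left)
    let ?D = "\<lambda>\<tau>. (B (u s) (l \<tau>) + B (k \<tau>) (v t)) - (B (u \<tau>) (l \<tau>) + B (k \<tau>) (v \<tau>))"
    have "B (u t) (v t) - B (u s) (v s) = B (u s) (v t - v s) + B (u t - u s) (v t)"
      by (simp add: diff_left diff_right)
    then have "B (u t) (v t) - B (u s) (v s) - (LINT \<tau>:{s..t}|lborel. B (u \<tau>) (l \<tau>) + B (k \<tau>) (v \<tau>))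
      = (LINT \<tau>:{s..t}|lborel. ?D \<tau>)"
      using i1' i2' j1 j2 e1 e2 by (simp add: set_integral_diff set_integral_add)
    also have "norm \<dots> \<le> (2 * (Mk * Ml * K) * (t - s)) * (t - s)"
    proof (rule set_lebesgue_integral_norm_le[OF _ _ st(2)])
      show "set_integrable lborel {s..t} ?D" using i1' i2' j1 j2 by (intro set_integral_diff set_integral_add) auto
      fix \<tau> assume \<tau>: "\<tau> \<in> {s..t}"
      then have \<tau>T: "\<tau> \<in> {0..T}" using st by auto
      have pos: "0 \<le> Mk" "0 \<le> Ml" using Mk[OF \<tau>T] Ml[OF \<tau>T] norm_ge_zero order_trans by blast+
      have "norm (u s - u \<tau>) \<le> Mk * (\<tau> - s)"
        using has_rate_lipschitz[OF u Mk, of s \<tau>] st \<tau> by (auto simp: norm_minus_commute)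
      then have a: "norm (u s - u \<tau>) \<le> Mk * (t - s)"
        using \<tau> pos by (smt (verit) atLeastAtMost_iff mult_left_mono)
      have "norm (v t - v \<tau>) \<le> Ml * (t - \<tau>)"
        using has_rate_lipschitz[OF v Ml, of \<tau> t] st \<tau> by auto
      then have b: "norm (v t - v \<tau>) \<le> Ml * (t - s)"
        using \<tau> pos by (smt (verit) atLeastAtMost_iff mult_left_mono)
      have "?D \<tau> = B (u s - u \<tau>) (l \<tau>) + B (k \<tau>) (v t - v \<tau>)"
        by (simp add: diff_left diff_right)
      also have "norm \<dots> \<le> norm (u s - u \<tau>) * norm (l \<tau>) * K + norm (k \<tau>) * norm (v t - v \<tau>) * K"
        by (intro norm_triangle_mono K(1))
      also have "\<dots> \<le> (Mk * (t - s)) * Ml * K + Mk * (Ml * (t - s)) * K"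
        using a b Mk[OF \<tau>T] Ml[OF \<tau>T] K(2) pos st
        by (intro add_mono mult_right_mono mult_mono) auto
      finally show "norm (?D \<tau>) \<le> 2 * (Mk * Ml * K) * (t - s)" by (simp add: algebra_simps)
    qed
    finally show "norm (B (u t) (v t) - B (u s) (v s) - (LINT \<tau>:{s..t}|lborel. B (u \<tau>) (l \<tau>) + B (k \<tau>) (v \<tau>)))
      \<le> 2 * (Mk * Ml * K) * (t - s)\<^sup>2" by (simp add: power2_eq_square mult.assoc)
  qed
qed

lemma has_rate_linear:
  fixes u k :: "real \<Rightarrow> 'a::{banach,second_countable_topology}"
    and L :: "'a \<Rightarrow> 'b::{banach,second_countable_topology}"
  assumes L: "bounded_linear L" and u: "has_rate T u k"
  shows "has_rate T (\<lambda>t. L (u t)) (\<lambda>t. L (k t))"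
proof -
  interpret bounded_linear L by fact
  obtain K where K: "\<And>a. norm (L a) \<le> norm a * K" "K > 0" using pos_bounded by blast
  obtain M where M: "\<And>\<tau>. \<tau> \<in> {0..T} \<Longrightarrow> norm (k \<tau>) \<le> M" using has_rate_bounded[OF u] by blast
  have i: "set_integrable lborel {0..T} k" by (rule has_rate_integrable[OF u])
  show ?thesis
    unfolding has_rate_def
  proof (intro conjI exI[of _ "M * K"] ballI)
    show "set_integrable lborel {0..T} (\<lambda>t. L (k t))"
      using i integrable_bounded_linear[OF L] by (simp add: set_integrable_def flip: scaleR)
    show "norm (L (k \<tau>)) \<le> M * K" if "\<tau> \<in> {0..T}" for \<tau>
      using M[OF that] K by (meson mult_right_mono order_trans less_imp_le)
    fix t assume t: "t \<in> {0..T}"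
    then have "set_integrable lborel {0..t} k" by (intro set_integrable_subset[OF i]) auto
    then have "(LINT \<tau>:{0..t}|lborel. L (k \<tau>)) = L (LINT \<tau>:{0..t}|lborel. k \<tau>)"
      by (simp add: set_lebesgue_integral_def set_integrable_def integral_bounded_linear[OF L, symmetric] flip: scaleR)
    moreover have "u t = u 0 + (LINT \<tau>:{0..t}|lborel. k \<tau>)" by (rule has_rate_eq[OF u t])
    ultimately show "L (u t) = L (u 0) + (LINT \<tau>:{0..t}|lborel. L (k \<tau>))" by (simp only: add)
  qed
qed

lemma has_rate_add:
  assumes u: "has_rate T u k" and v: "has_rate T v l"
  shows "has_rate T (\<lambda>t. u t + v t) (\<lambda>t. k t + l t)"
proof -
  obtain Mk where Mk: "\<And>\<tau>. \<tau> \<in> {0..T} \<Longrightarrow> norm (k \<tau>) \<le> Mk" using has_rate_bounded[OF u] by blast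
  obtain Ml where Ml: "\<And>\<tau>. \<tau> \<in> {0..T} \<Longrightarrow> norm (l \<tau>) \<le> Ml" using has_rate_bounded[OF v] by blast
  show ?thesis unfolding has_rate_def
  proof (intro conjI exI[of _ "Mk + Ml"] ballI)
    show "set_integrable lborel {0..T} (\<lambda>t. k t + l t)"
      by (rule set_integral_add(1)[OF has_rate_integrable[OF u] has_rate_integrable[OF v]])
    show "norm (k \<tau> + l \<tau>) \<le> Mk + Ml" if "\<tau> \<in> {0..T}" for \<tau>
      using Mk[OF that] Ml[OF that] by (rule norm_triangle_mono)
    fix t assume t: "t \<in> {0..T}"
    then have "set_integrable lborel {0..t} k" "set_integrable lborel {0..t} l"
      using has_rate_integrable[OF u] has_rate_integrable[OF v]
      by (auto intro: set_integrable_subset)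
    then have "(LINT \<tau>:{0..t}|lborel. k \<tau> + l \<tau>)
        = (LINT \<tau>:{0..t}|lborel. k \<tau>) + (LINT \<tau>:{0..t}|lborel. l \<tau>)"
      by (rule set_integral_add)
    then show "u t + v t = u 0 + v 0 + (LINT \<tau>:{0..t}|lborel. k \<tau> + l \<tau>)"
      unfolding has_rate_eq[OF u t] has_rate_eq[OF v t] by (simp only: add_ac)
  qed
qed

lemma has_rate_compose:
  fixes r k :: "real \<Rightarrow> real"
  assumes r: "has_rate T r k" and S: "convex S" "\<And>t. t \<in> {0..T} \<Longrightarrow> r t \<in> S"
    and F: "\<And>x. x \<in> S \<Longrightarrow> (F has_real_derivative F' x) (at x within S)"
    and L: "\<And>x y. x \<in> S \<Longrightarrow> y \<in> S \<Longrightarrow> \<bar>F' x - F' y\<bar> \<le> C * \<bar>x - y\<bar>"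
  shows "has_rate T (\<lambda>t. F (r t)) (\<lambda>t. F' (r t) * k t)"
proof -
  note cr = has_rate_continuous_on[OF r]
  obtain M where M: "\<And>\<tau>. \<tau> \<in> {0..T} \<Longrightarrow> norm (k \<tau>) \<le> M" using has_rate_bounded[OF r] by blast
  have ik: "set_integrable lborel {0..T} k" by (rule has_rate_integrable[OF r])
  have L': "\<bar>F' x - F' y\<bar> \<le> \<bar>C\<bar> * \<bar>x - y\<bar>" if "x \<in> S" "y \<in> S" for x y
    using L[OF that] by (meson abs_ge_self abs_ge_zero mult_right_mono order_trans)
  have "\<bar>C\<bar>-lipschitz_on S F'"
    using L' by (auto simp: lipschitz_on_def dist_real_def)
  then have cF: "continuous_on {0..T} (\<lambda>t. F' (r t))"
    by (intro continuous_on_compose2[OF lipschitz_on_continuous_on cr]) (use S in auto)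
  obtain N where N: "\<And>\<tau>. \<tau> \<in> {0..T} \<Longrightarrow> \<bar>F' (r \<tau>)\<bar> \<le> N"
    using continuous_on_Icc_norm_bound[OF cF] unfolding real_norm_def by blast
  have i1: "set_integrable lborel {0..T} (\<lambda>t. F' (r t) * k t)"
    by (rule set_integrable_continuous_scale[OF bounded_bilinear_mult cF ik])
  show ?thesis
  proof (rule has_rateI[where M="N * M" and C="2 * \<bar>C\<bar> * M * M"])
    show "norm (F' (r \<tau>) * k \<tau>) \<le> N * M" if "\<tau> \<in> {0..T}" for \<tau>
      using N[OF that] M[OF that] unfolding norm_mult
      by (intro mult_mono) (auto intro: order_trans[OF abs_ge_zero])
  next
    fix s t assume st: "0 \<le> s" "s \<le> t" "t \<le> T"
    have sT: "s \<in> {0..T}" "t \<in> {0..T}" using st by auto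
    note sub = set_integrable_Icc_mono[OF _ st(1,3)]
    have ik': "set_integrable lborel {s..t} k" and i1': "set_integrable lborel {s..t} (\<lambda>t. F' (r t) * k t)"
      using ik i1 by (auto intro: sub)
    have M0: "0 \<le> M" using M[OF sT(1)] norm_ge_zero order_trans by blast
    have rl: "\<bar>r \<tau> - r s\<bar> \<le> M * (t - s)" if "\<tau> \<in> {s..t}" for \<tau>
    proof -
      have "\<bar>r \<tau> - r s\<bar> \<le> M * (\<tau> - s)"
        using has_rate_lipschitz[OF r M, of s \<tau>] st that by auto
      also have "\<dots> \<le> M * (t - s)" using that M0 by (intro mult_left_mono) auto
      finally show ?thesis .
    qed
    have seg: "closed_segment (r s) (r t) \<subseteq> S"
      using S sT by (simp add: closed_segment_subset)
    have "norm ((F (r t) - F' (r s) * r t) - (F (r s) - F' (r s) * r s)) \<le> (\<bar>C\<bar> * \<bar>r t - r s\<bar>) * norm (r t - r s)"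
    proof (rule field_differentiable_bound[of "closed_segment (r s) (r t)"])
      show "((\<lambda>x. F x - F' (r s) * x) has_field_derivative F' z - F' (r s)) (at z within closed_segment (r s) (r t))"
        if "z \<in> closed_segment (r s) (r t)" for z
        using DERIV_subset[OF F seg] that seg by (auto intro!: derivative_eq_intros)
      show "norm (F' z - F' (r s)) \<le> \<bar>C\<bar> * \<bar>r t - r s\<bar>" if "z \<in> closed_segment (r s) (r t)" for z
      proof -
        have "\<bar>z - r s\<bar> \<le> \<bar>r t - r s\<bar>"
          using segment_bound1[OF that] by (simp add: abs_minus_commute)
        then show ?thesis using L'[of z "r s"] that seg S sT
          by (smt (verit) mult_left_mono real_norm_def subsetD)
      qed
    qed auto
    also have "\<dots> \<le> (\<bar>C\<bar> * (M * (t - s))) * (M * (t - s))"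
      using rl[of t] st M0 by (intro mult_mono) auto
    finally have a: "\<bar>F (r t) - F (r s) - F' (r s) * (r t - r s)\<bar> \<le> \<bar>C\<bar> * M * M * (t - s)^2"
      by (simp add: algebra_simps power2_eq_square)
    have "norm (LINT \<tau>:{s..t}|lborel. F' (r s) * k \<tau> - F' (r \<tau>) * k \<tau>) \<le> (\<bar>C\<bar> * M * M * (t - s)) * (t - s)"
    proof (rule set_lebesgue_integral_norm_le[OF _ _ st(2)])
      show "set_integrable lborel {s..t} (\<lambda>\<tau>. F' (r s) * k \<tau> - F' (r \<tau>) * k \<tau>)"
        using i1' ik' by (intro set_integral_diff set_integrable_mult_right) auto
      fix \<tau> assume \<tau>: "\<tau> \<in> {s..t}"
      then have \<tau>T: "\<tau> \<in> {0..T}" using st by auto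
      have "\<bar>F' (r s) - F' (r \<tau>)\<bar> \<le> \<bar>C\<bar> * (M * (t - s))"
        using L'[of "r s" "r \<tau>"] rl[OF \<tau>] S \<tau>T sT
        by (smt (verit) abs_ge_zero abs_minus_commute mult_left_mono)
      then have "\<bar>F' (r s) - F' (r \<tau>)\<bar> * norm (k \<tau>) \<le> \<bar>C\<bar> * (M * (t - s)) * M"
        using M[OF \<tau>T] M0 st by (intro mult_mono) auto
      then show "norm (F' (r s) * k \<tau> - F' (r \<tau>) * k \<tau>) \<le> \<bar>C\<bar> * M * M * (t - s)"
        unfolding left_diff_distrib[symmetric] real_norm_def abs_mult by (simp only: mult_ac)
    qed
    moreover have "(LINT \<tau>:{s..t}|lborel. F' (r s) * k \<tau> - F' (r \<tau>) * k \<tau>)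
       = F' (r s) * (r t - r s) - (LINT \<tau>:{s..t}|lborel. F' (r \<tau>) * k \<tau>)"
      unfolding has_rate_diff[OF r st]
      by (subst set_integral_diff(2)[OF set_integrable_mult_right[OF ik'] i1']) simp
    ultimately have b: "\<bar>F' (r s) * (r t - r s) - (LINT \<tau>:{s..t}|lborel. F' (r \<tau>) * k \<tau>)\<bar> \<le> \<bar>C\<bar> * M * M * (t - s)^2"
      by (simp only: power2_eq_square mult.assoc real_norm_def)
    show "norm (F (r t) - F (r s) - (LINT \<tau>:{s..t}|lborel. F' (r \<tau>) * k \<tau>)) \<le> 2 * \<bar>C\<bar> * M * M * (t - s)\<^sup>2"
      using a b unfolding real_norm_def by linarith
  qed (rule i1)
qed

lemma has_rate_C1:
  fixes u k :: "real \<Rightarrow> 'a::euclidean_space"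
  assumes "\<And>t. t \<in> {0..T} \<Longrightarrow> (u has_vector_derivative k t) (at t within {0..T})" "continuous_on {0..T} k"
  shows "has_rate T u k"
proof -
  have i: "set_integrable lborel {0..T} k"
    using assms(2) borel_integrable_compact[of "{0..T}" k] by (simp add: set_integrable_def indicator_def if_distrib[where f="\<lambda>x. x *\<^sub>R _"] cong: if_cong)
  obtain M where M: "\<And>\<tau>. \<tau> \<in> {0..T} \<Longrightarrow> norm (k \<tau>) \<le> M"
    using continuous_on_Icc_norm_bound[OF assms(2)] by blast
  show ?thesis unfolding has_rate_def
  proof (intro conjI exI[of _ M] ballI i M)
    fix t assume t: "t \<in> {0..T}"
    have "(k has_integral u t - u 0) {0..t}"
    proof (rule fundamental_theorem_of_calculus)
      show "(u has_vector_derivative k x) (at x within {0..t})" if "x \<in> {0..t}" for x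
        by (rule has_vector_derivative_within_subset[OF assms(1)]) (use t that in auto)
    qed (use t in simp)
    moreover have "set_integrable lborel {0..t} k"
      using t by (intro set_integrable_subset[OF i]) auto
    ultimately have "(LINT \<tau>:{0..t}|lborel. k \<tau>) = u t - u 0"
      using set_borel_integral_eq_integral(2) integral_unique by metis
    then show "u t = u 0 + (LINT \<tau>:{0..t}|lborel. k \<tau>)" by simp
  qed
qed

section \<open>Families with polynomially bounded derivatives\<close>

text \<open>The parameter \<open>n\<close> is the m of the packet. Only polynomial growth in it
  matters, because it is beaten by exp (- c m) in the end; this is why constants and exponents stay
  anonymous.\<close>

definition poly_bounded :: "(real \<Rightarrow> real \<Rightarrow> complex) \<Rightarrow> bool" where
  "poly_bounded F \<longleftrightarrow> (\<exists>C N. \<forall>n\<ge>1. continuous_on UNIV (F n) \<and> (\<forall>x. norm (F n x) \<le> C * n ^ (N::nat)))"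

text \<open>The derivative is an existential witness instead of \<open>dx\<close>, so that closure
  under sums, products and compositions follows by induction on the number of derivatives.
  \<open>PB_dx\<close> identifies the witnesses with \<open>dx\<close> at the end.\<close>

primrec PB :: "nat \<Rightarrow> (real \<Rightarrow> real \<Rightarrow> complex) \<Rightarrow> bool" where
  "PB 0 F = poly_bounded F"
| "PB (Suc j) F = (poly_bounded F \<and>
     (\<exists>F'. (\<forall>n\<ge>1. \<forall>x. (F n has_vector_derivative F' n x) (at x)) \<and> PB j F'))"

lemma poly_boundedI:
  assumes "\<And>n. n \<ge> 1 \<Longrightarrow> continuous_on UNIV (F n)" "\<And>n x. n \<ge> 1 \<Longrightarrow> norm (F n x) \<le> C * n ^ N"
  shows "poly_bounded F"
  using assms unfolding poly_bounded_def by blast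

lemma PB_poly_bounded: "PB j F \<Longrightarrow> poly_bounded F"
  by (cases j) auto

lemma PB_Suc_D: "PB (Suc j) F \<Longrightarrow> PB j F"
proof (induction j arbitrary: F)
  case (Suc j)
  then show ?case by (metis PB.simps(2))
qed simp

lemma PB_add:
  assumes "PB j F" "PB j G" shows "PB j (\<lambda>n x. F n x + G n x)"
  using assms
proof (induction j arbitrary: F G)
  case 0
  then obtain C N D M where
    F: "\<And>n x. n \<ge> 1 \<Longrightarrow> norm (F n x) \<le> C * n ^ N" and G: "\<And>n x. n \<ge> 1 \<Longrightarrow> norm (G n x) \<le> D * n ^ M"
    and cF: "\<And>n. n \<ge> 1 \<Longrightarrow> continuous_on UNIV (F n)" and cG: "\<And>n. n \<ge> 1 \<Longrightarrow> continuous_on UNIV (G n)"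
    unfolding PB.simps poly_bounded_def by metis
  have "norm (F n x + G n x) \<le> (\<bar>C\<bar> + \<bar>D\<bar>) * n ^ (N + M)" if "n \<ge> 1" for n x
  proof -
    have "C * n ^ N \<le> \<bar>C\<bar> * n ^ (N + M)" "D * n ^ M \<le> \<bar>D\<bar> * n ^ (N + M)"
      using that by (auto intro!: mult_mono power_increasing)
    then show ?thesis using F[OF that, of x] G[OF that, of x] norm_triangle_ineq[of "F n x" "G n x"]
      by (simp add: algebra_simps)
  qed
  then have "poly_bounded (\<lambda>n x. F n x + G n x)"
    using cF cG by (intro poly_boundedI) (auto intro!: continuous_intros)
  then show ?case by simp
next
  case (Suc j)
  obtain F' G' where
    F': "\<And>n x. n \<ge> 1 \<Longrightarrow> (F n has_vector_derivative F' n x) (at x)" "PB j F'" and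
    G': "\<And>n x. n \<ge> 1 \<Longrightarrow> (G n has_vector_derivative G' n x) (at x)" "PB j G'"
    using Suc.prems unfolding PB.simps by metis
  have "poly_bounded (\<lambda>n x. F n x + G n x)"
    using Suc.IH[OF Suc.prems[THEN PB_Suc_D]] by (rule PB_poly_bounded)
  moreover have "PB j (\<lambda>n x. F' n x + G' n x)" using F' G' Suc.IH by blast
  ultimately show ?case using F'(1) G'(1) unfolding PB.simps
    by (intro conjI exI[of _ "\<lambda>n x. F' n x + G' n x"]) (auto intro: has_vector_derivative_add)
qed

lemma PB_mult:
  assumes "PB j F" "PB j G" shows "PB j (\<lambda>n x. F n x * G n x)"
  using assms
proof (induction j arbitrary: F G)
  case 0
  then obtain C N D M where
    F: "\<And>n x. n \<ge> 1 \<Longrightarrow> norm (F n x) \<le> C * n ^ N" and G: "\<And>n x. n \<ge> 1 \<Longrightarrow> norm (G n x) \<le> D * n ^ M"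
    and cF: "\<And>n. n \<ge> 1 \<Longrightarrow> continuous_on UNIV (F n)" and cG: "\<And>n. n \<ge> 1 \<Longrightarrow> continuous_on UNIV (G n)"
    unfolding PB.simps poly_bounded_def by metis
  have "norm (F n x * G n x) \<le> (C * D) * n ^ (N + M)" if "n \<ge> 1" for n x
  proof -
    have "norm (F n x) * norm (G n x) \<le> (C * n ^ N) * (D * n ^ M)"
      using F[OF that] G[OF that] by (intro mult_mono) (auto intro: order_trans[OF norm_ge_zero])
    then show ?thesis by (simp add: norm_mult power_add mult_ac)
  qed
  then have "poly_bounded (\<lambda>n x. F n x * G n x)"
    using cF cG by (intro poly_boundedI) (auto intro!: continuous_intros)
  then show ?case by simp
next
  case (Suc j)
  obtain F' G' where
    F': "\<And>n x. n \<ge> 1 \<Longrightarrow> (F n has_vector_derivative F' n x) (at x)" "PB j F'" and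
    G': "\<And>n x. n \<ge> 1 \<Longrightarrow> (G n has_vector_derivative G' n x) (at x)" "PB j G'"
    using Suc.prems unfolding PB.simps by metis
  have "poly_bounded (\<lambda>n x. F n x * G n x)"
    using Suc.IH[OF Suc.prems[THEN PB_Suc_D]] by (rule PB_poly_bounded)
  moreover have "PB j (\<lambda>n x. F n x * G' n x + F' n x * G n x)"
    using F' G' Suc.prems[THEN PB_Suc_D] by (intro PB_add Suc.IH)
  ultimately show ?case using F'(1) G'(1) unfolding PB.simps
    by (intro conjI exI[of _ "\<lambda>n x. F n x * G' n x + F' n x * G n x"]) (auto intro: has_vector_derivative_mult)
qed

lemma PB_const:
  assumes "\<And>n. n \<ge> 1 \<Longrightarrow> norm (c n) \<le> C * n ^ N" shows "PB j (\<lambda>n x. c n)"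
  using assms
proof (induction j arbitrary: c C N)
  case 0
  then show ?case by (auto intro!: poly_boundedI[where C=C and N=N])
next
  case (Suc j)
  have "PB j (\<lambda>n x. 0)" by (rule Suc.IH[of _ 0 0]) auto
  moreover have "poly_bounded (\<lambda>n x. c n)"
    by (rule poly_boundedI[where C=C and N=N]) (use Suc.prems in auto)
  ultimately show ?case
    by (auto intro!: exI[of _ "\<lambda>n x. 0"])
qed

lemma PB_affine:
  assumes "PB j F" "\<And>n. n \<ge> 1 \<Longrightarrow> \<bar>c n\<bar> \<le> C * n ^ N"
  shows "PB j (\<lambda>n x. F n (c n * x + d n))"
  using assms(1)
proof (induction j arbitrary: F)
  case 0
  then obtain D M where
    F: "\<And>n x. n \<ge> 1 \<Longrightarrow> norm (F n x) \<le> D * n ^ M" "\<And>n. n \<ge> 1 \<Longrightarrow> continuous_on UNIV (F n)"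
    unfolding PB.simps poly_bounded_def by metis
  then have "poly_bounded (\<lambda>n x. F n (c n * x + d n))"
    by (intro poly_boundedI[where C=D and N=M] continuous_on_compose2[OF F(2), of _ UNIV])
      (auto intro!: continuous_intros)
  then show ?case by simp
next
  case (Suc j)
  obtain F' where
    F': "\<And>n x. n \<ge> 1 \<Longrightarrow> (F n has_vector_derivative F' n x) (at x)" "PB j F'"
    using Suc.prems unfolding PB.simps by metis
  have "poly_bounded (\<lambda>n x. F n (c n * x + d n))"
    using Suc.IH[OF Suc.prems[THEN PB_Suc_D]] by (rule PB_poly_bounded)
  moreover have "PB j (\<lambda>n x. complex_of_real (c n) * F' n (c n * x + d n))"
    by (intro PB_mult PB_const[of _ C N] Suc.IH F') (use assms(2) in auto)
  moreover have "((\<lambda>x. F n (c n * x + d n)) has_vector_derivative complex_of_real (c n) * F' n (c n * x + d n)) (at x)"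
    if "n \<ge> 1" for n x
  proof -
    have "((\<lambda>x. c n * x + d n) has_vector_derivative c n) (at x)"
      by (auto intro!: derivative_eq_intros simp flip: has_real_derivative_iff_has_vector_derivative)
    from vector_diff_chain_at[OF this F'(1)[OF that]]
    show ?thesis by (simp add: o_def scaleR_conv_of_real)
  qed
  ultimately show ?case unfolding PB.simps
    by (intro conjI exI[of _ "\<lambda>n x. complex_of_real (c n) * F' n (c n * x + d n)"]) auto
qed

section \<open>A smooth cutoff from exp (-1/x)\<close>

definition flat_exp :: "nat \<Rightarrow> real \<Rightarrow> real" where
  "flat_exp m x = (if x \<le> 0 then 0 else (1 / x) ^ m * exp (- (1 / x)))"

text \<open>One term of the exponential series at 1 / x. The exponent \<open>p\<close> is free
  because p = 0 gives boundedness and p = 2 gives the vanishing derivative at 0.\<close>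

lemma flat_exp_le: "flat_exp m x \<le> fact (m + p) * \<bar>x\<bar> ^ p" and flat_exp_nonneg: "0 \<le> flat_exp m x"
proof -
  show "flat_exp m x \<le> fact (m + p) * \<bar>x\<bar> ^ p"
  proof (cases "x \<le> 0")
    case False
    then have x: "x > 0" by simp
    have e: "(1 / x) ^ (m + p) \<le> fact (m + p) * exp (1 / x)"
    proof -
      have "(\<Sum>n\<in>{m+p}. (1 / x) ^ n /\<^sub>R fact n) \<le> (\<Sum>n. (1 / x) ^ n /\<^sub>R fact n)"
        by (rule sum_le_suminf[OF summable_exp_generic]) (use x in auto)
      then have "(1 / x) ^ (m + p) / fact (m + p) \<le> exp (1 / x)"
        by (simp add: exp_def scaleR_conv_of_real divide_inverse mult.commute)
      then show ?thesis by (simp only: pos_divide_le_eq[OF fact_gt_zero] mult.commute)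
    qed
    have "flat_exp m x = (1 / x) ^ (m + p) * x ^ p * exp (- (1 / x))"
      using x by (simp add: flat_exp_def power_add power_divide)
    also have "\<dots> \<le> fact (m + p) * exp (1 / x) * x ^ p * exp (- (1 / x))"
      using e x by (intro mult_right_mono) auto
    also have "\<dots> = fact (m + p) * x ^ p" by (simp add: exp_minus)
    finally show ?thesis using x by simp
  qed (simp add: flat_exp_def)
  show "0 \<le> flat_exp m x" by (simp add: flat_exp_def)
qed

text \<open>The negative powers of x belong to the family because they make it closed under
  differentiation, so that all derivatives come out of a single induction.\<close>

lemma flat_exp_has_derivative:
  "(flat_exp m has_real_derivative flat_exp (m + 2) x - real m * flat_exp (m + 1) x) (at x)"
proof -
  consider "x < 0" | "x = 0" | "x > 0" by linarith
  then show ?thesis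
  proof cases
    case 1
    have "((\<lambda>x. 0) has_real_derivative 0) (at x)" by simp
    then show ?thesis using 1
      by (rule_tac has_field_derivative_transform_within_open[of "\<lambda>x. 0" _ _ "{..<0}"])
        (auto simp: flat_exp_def)
  next
    case 2
    have "(flat_exp m has_derivative (\<lambda>_. 0)) (at 0)"
    proof (rule has_derivativeI_sandwich[where e=1 and H="\<lambda>y. fact (m + 2) * \<bar>y\<bar>"])
      show "norm (flat_exp m y - flat_exp m 0 - 0) / norm (y - 0) \<le> fact (m + 2) * \<bar>y\<bar>"
        if "y \<noteq> 0" for y
        using flat_exp_le[of m y 2] flat_exp_nonneg[of m y] that
        by (simp add: flat_exp_def[of m 0] divide_le_eq power2_eq_square mult.assoc)
      have "((\<lambda>y. fact (m + 2) * \<bar>y\<bar>) \<longlongrightarrow> fact (m + 2) * \<bar>0 :: real\<bar>) (at 0)"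
        by (intro tendsto_intros)
      then show "((\<lambda>y::real. fact (m + 2) * \<bar>y\<bar> :: real) \<longlongrightarrow> 0) (at 0)" by simp
    qed auto
    then have "(flat_exp m has_real_derivative 0) (at 0)"
      by (simp add: has_field_derivative_def lambda_zero)
    then show ?thesis using 2 by (simp add: flat_exp_def[of _ 0])
  next
    case 3
    have "((\<lambda>x. (1 / x) ^ m * exp (- (1 / x))) has_real_derivative
        real m * (1 / x) ^ (m - 1) * (- (1 / x^2)) * exp (- (1 / x)) + (1 / x) ^ m * (exp (- (1 / x)) * (1 / x^2))) (at x)"
      using 3 by (auto intro!: derivative_eq_intros simp: power2_eq_square)
    moreover have "real m * (1 / x) ^ (m - 1) * (- (1 / x^2)) * exp (- (1 / x)) + (1 / x) ^ m * (exp (- (1 / x)) * (1 / x^2))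
      = flat_exp (m + 2) x - real m * flat_exp (m + 1) x"
      using 3 by (cases m) (auto simp: flat_exp_def power2_eq_square power_divide field_simps)
    ultimately have "((\<lambda>x. (1 / x) ^ m * exp (- (1 / x))) has_real_derivative
        flat_exp (m + 2) x - real m * flat_exp (m + 1) x) (at x)" by simp
    then show ?thesis using 3
      by (rule_tac has_field_derivative_transform_within_open[of "\<lambda>x. (1 / x) ^ m * exp (- (1 / x))" _ _ "{0<..}"])
        (auto simp: flat_exp_def)
  qed
qed

lemma PB_flat_exp: "PB j (\<lambda>n x. complex_of_real (flat_exp m x))"
proof (induction j arbitrary: m)
  case 0
  have "continuous_on UNIV (flat_exp m)"
    using DERIV_isCont[OF flat_exp_has_derivative] by (intro continuous_at_imp_continuous_on) blast
  then have "poly_bounded (\<lambda>n x. complex_of_real (flat_exp m x))"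
    using flat_exp_le[of m _ 0] flat_exp_nonneg
    by (intro poly_boundedI[where C="fact m" and N=0]) (auto intro!: continuous_intros)
  then show ?case by simp
next
  case (Suc j)
  have d: "((\<lambda>x. complex_of_real (flat_exp m x)) has_vector_derivative
      complex_of_real (flat_exp (m + 2) x) + (- of_nat m) * complex_of_real (flat_exp (m + 1) x)) (at x)" for x
    using has_vector_derivative_of_real[OF flat_exp_has_derivative[of m x]]
    by simp
  have "PB j (\<lambda>n x. complex_of_real (flat_exp (m + 2) x) + (- of_nat m) * complex_of_real (flat_exp (m + 1) x))"
    by (intro PB_add PB_mult Suc.IH PB_const[of _ "real m" 0]) simp
  then show ?case
    unfolding PB.simps using PB_poly_bounded[OF Suc.IH[of m]] d
    by (intro conjI exI[of _ "\<lambda>n x. complex_of_real (flat_exp (m + 2) x) + (- of_nat m) * complex_of_real (flat_exp (m + 1) x)"]) auto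
qed

text \<open>Derivatives are unique, so the witness vanishes wherever the function vanishes locally.
  This carries the support conditions through the inductions below.\<close>

lemma PB_Suc_local_zero:
  assumes "PB (Suc j) F"
  obtains F' where "\<And>n x. n \<ge> 1 \<Longrightarrow> (F n has_vector_derivative F' n x) (at x)" "PB j F'"
    "\<And>n x S. n \<ge> 1 \<Longrightarrow> open S \<Longrightarrow> x \<in> S \<Longrightarrow> (\<And>y. y \<in> S \<Longrightarrow> F n y = 0) \<Longrightarrow> F' n x = 0"
proof -
  obtain F' where F': "\<And>n x. n \<ge> 1 \<Longrightarrow> (F n has_vector_derivative F' n x) (at x)" "PB j F'"
    using assms unfolding PB.simps by metis
  have Fz: "F' n x = 0" if "n \<ge> 1" "open S" "x \<in> S" "\<And>y. y \<in> S \<Longrightarrow> F n y = 0" for n x S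
  proof -
    have "(F n has_vector_derivative 0) (at x)"
      by (rule has_vector_derivative_transform_within_open[of "\<lambda>_. 0" 0 x S]) (use that in auto)
    from vector_derivative_unique_at[OF F'(1)[OF that(1)] this] show ?thesis .
  qed
  show ?thesis by (rule that[OF F' Fz])
qed

text \<open>Differentiating a phase in ln z produces factors 1 / z. They are harmless because the
  function lives on z \<ge> 1, where \<open>max 1 z\<close> can stand for z.\<close>

lemma PB_divide:
  assumes "PB j F" "\<And>n z. n \<ge> 1 \<Longrightarrow> z < 1 \<Longrightarrow> F n z = 0"
  shows "PB j (\<lambda>n z. F n z / complex_of_real z)"
  using assms
proof (induction j arbitrary: F)
  case 0
  obtain C N where
    F: "\<And>n x. n \<ge> 1 \<Longrightarrow> norm (F n x) \<le> C * n ^ N" and cF: "\<And>n. n \<ge> 1 \<Longrightarrow> continuous_on UNIV (F n)"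
    using 0(1) unfolding PB.simps poly_bounded_def by metis
  have "poly_bounded (\<lambda>n z. F n z / complex_of_real z)"
  proof (rule poly_boundedI)
    fix n :: real assume n: "n \<ge> 1"
    have "(\<lambda>z. F n z / complex_of_real z) = (\<lambda>z. F n z / complex_of_real (max 1 z))"
    proof
      fix z show "F n z / complex_of_real z = F n z / complex_of_real (max 1 z)"
        using 0(2)[OF n, of z] by (cases "z < 1") (auto simp: max_def)
    qed
    moreover have "continuous_on UNIV (\<lambda>z. F n z / complex_of_real (max 1 z))"
      using cF[OF n] by (intro continuous_intros) auto
    ultimately show "continuous_on UNIV (\<lambda>z. F n z / complex_of_real z)" by (simp only:)
    show "norm (F n z / complex_of_real z) \<le> C * n ^ N" for z
    proof (cases "z < 1")
      case True
      then show ?thesis using 0(2)[OF n] F[OF n, of z] by simp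
    next
      case False
      then have "norm (F n z) / z \<le> norm (F n z) / 1" by (intro divide_left_mono) auto
      then show ?thesis using F[OF n, of z] False by (simp add: norm_divide)
    qed
  qed
  then show ?case by simp
next
  case (Suc j)
  obtain F' where
    F': "\<And>n x. n \<ge> 1 \<Longrightarrow> (F n has_vector_derivative F' n x) (at x)" "PB j F'" and
    Fz: "\<And>n x S. n \<ge> 1 \<Longrightarrow> open S \<Longrightarrow> x \<in> S \<Longrightarrow> (\<And>y. y \<in> S \<Longrightarrow> F n y = 0) \<Longrightarrow> F' n x = 0"
    using PB_Suc_local_zero[OF Suc.prems(1)] by metis
  have F0: "F' n z = 0" if "n \<ge> 1" "z < 1" for n z
    by (rule Fz[of n "{..<1}"]) (use that Suc.prems(2) in auto)
  have IHF: "PB j (\<lambda>n z. F n z / complex_of_real z)"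
    by (rule Suc.IH[OF PB_Suc_D[OF Suc.prems(1)]]) (rule Suc.prems(2))
  let ?D = "\<lambda>n z. F' n z / complex_of_real z + (-1) * (F n z / complex_of_real z / complex_of_real z)"
  have a: "PB j (\<lambda>n z. F' n z / complex_of_real z)" by (rule Suc.IH[OF F'(2) F0])
  have b: "PB j (\<lambda>n z. F n z / complex_of_real z / complex_of_real z)"
    by (rule Suc.IH[OF IHF]) (simp add: Suc.prems(2))
  have c: "PB j (\<lambda>n z. -1)" by (rule PB_const[of _ 1 0]) simp
  have "PB j ?D" by (rule PB_add[OF a PB_mult[OF c b]])
  moreover have "((\<lambda>z. F n z / complex_of_real z) has_vector_derivative ?D n z) (at z)" if n: "n \<ge> 1" for n z
  proof (cases "z < 1")
    case True
    then have "((\<lambda>z. F n z / complex_of_real z) has_vector_derivative 0) (at z)"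
      by (rule_tac has_vector_derivative_transform_within_open[of "\<lambda>_. 0" 0 z "{..<1}"]) (use n Suc.prems(2) in auto)
    then show ?thesis using F0[OF n True] Suc.prems(2)[OF n True] by simp
  next
    case False
    then have "((\<lambda>z. inverse z) has_real_derivative - (inverse z * inverse z)) (at z)"
      by (auto intro!: derivative_eq_intros)
    then have "((\<lambda>z. complex_of_real (inverse z)) has_vector_derivative complex_of_real (- (inverse z * inverse z))) (at z)"
      by (intro has_vector_derivative_of_real) (simp add: has_real_derivative_iff_has_vector_derivative)
    from has_vector_derivative_mult[OF F'(1)[OF n, of z] this]
    show ?thesis by (simp add: divide_inverse mult_ac add_ac)
  qed
  ultimately show ?case unfolding PB.simps using PB_poly_bounded[OF IHF]
    by (intro conjI exI[of _ ?D]) auto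
qed

lemma has_vector_derivative_cis_compose:
  assumes "(f has_real_derivative f') (at z within S)"
  shows "((\<lambda>z. cis (f z)) has_vector_derivative f' *\<^sub>R (\<i> * cis (f z))) (at z within S)"
proof -
  have "((\<lambda>w. exp (\<i> * w)) has_field_derivative \<i> * exp (\<i> * of_real (f z))) (at (of_real (f z)))"
    by (auto intro!: derivative_eq_intros)
  from has_vector_derivative_real_field[OF this, of "f ` S"]
  have "(cis has_vector_derivative \<i> * cis (f z)) (at (f z) within f ` S)"
    by (simp add: cis_conv_exp[abs_def])
  from vector_diff_chain_within[OF assms[unfolded has_real_derivative_iff_has_vector_derivative] this]
  show ?thesis by (simp add: o_def)
qed

text \<open>Each derivative of the phase costs a factor n^p / z. The power of n is allowed in the
  class and \<open>PB_divide\<close> takes care of the quotient, so the induction closes.\<close>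

lemma PB_phase:
  assumes "PB j F" "\<And>n z. n \<ge> 1 \<Longrightarrow> z < 1 \<Longrightarrow> F n z = 0"
  shows "PB j (\<lambda>n z. F n z * cis (- (n ^ p) * ln z))"
  using assms
proof (induction j arbitrary: F)
  case 0
  obtain C N where
    F: "\<And>n x. n \<ge> 1 \<Longrightarrow> norm (F n x) \<le> C * n ^ N" and cF: "\<And>n. n \<ge> 1 \<Longrightarrow> continuous_on UNIV (F n)"
    using 0(1) unfolding PB.simps poly_bounded_def by metis
  have "poly_bounded (\<lambda>n z. F n z * cis (- (n ^ p) * ln z))"
  proof (rule poly_boundedI[where C=C and N=N])
    fix n :: real assume n: "n \<ge> 1"
    have "(\<lambda>z. F n z * cis (- (n ^ p) * ln z)) = (\<lambda>z. F n z * cis (- (n ^ p) * ln (max 1 z)))"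
    proof
      fix z show "F n z * cis (- (n ^ p) * ln z) = F n z * cis (- (n ^ p) * ln (max 1 z))"
        using 0(2)[OF n, of z] by (cases "z < 1") (auto simp: max_def)
    qed
    moreover have "continuous_on UNIV (\<lambda>z. F n z * cis (- (n ^ p) * ln (max 1 z)))"
      using cF[OF n] by (intro continuous_intros) auto
    ultimately show "continuous_on UNIV (\<lambda>z. F n z * cis (- (n ^ p) * ln z))" by (simp only:)
    show "norm (F n z * cis (- (n ^ p) * ln z)) \<le> C * n ^ N" for z
      using F[OF n, of z] by (simp add: norm_mult)
  qed
  then show ?case by simp
next
  case (Suc j)
  obtain F' where
    F': "\<And>n x. n \<ge> 1 \<Longrightarrow> (F n has_vector_derivative F' n x) (at x)" "PB j F'" and
    Fz: "\<And>n x S. n \<ge> 1 \<Longrightarrow> open S \<Longrightarrow> x \<in> S \<Longrightarrow> (\<And>y. y \<in> S \<Longrightarrow> F n y = 0) \<Longrightarrow> F' n x = 0"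
    using PB_Suc_local_zero[OF Suc.prems(1)] by metis
  have F0: "F' n z = 0" if "n \<ge> 1" "z < 1" for n z
    by (rule Fz[of n "{..<1}"]) (use that Suc.prems(2) in auto)
  have IHF: "PB j (\<lambda>n z. F n z * cis (- (n ^ p) * ln z))"
    by (rule Suc.IH[OF PB_Suc_D[OF Suc.prems(1)]]) (rule Suc.prems(2))
  have dv: "PB j (\<lambda>n z. F n z / complex_of_real z)"
    by (rule PB_divide[OF PB_Suc_D[OF Suc.prems(1)] Suc.prems(2)])
  let ?D = "\<lambda>n z. F' n z * cis (- (n ^ p) * ln z)
      + (- \<i> * complex_of_real (n ^ p)) * ((F n z / complex_of_real z) * cis (- (n ^ p) * ln z))"
  have a: "PB j (\<lambda>n z. F' n z * cis (- (n ^ p) * ln z))" by (rule Suc.IH[OF F'(2) F0])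
  have b: "PB j (\<lambda>n z. (F n z / complex_of_real z) * cis (- (n ^ p) * ln z))"
    by (rule Suc.IH[OF dv]) (simp add: Suc.prems(2))
  have c: "PB j (\<lambda>n z. - \<i> * complex_of_real (n ^ p))"
    by (rule PB_const[of _ 1 p]) (simp add: norm_mult norm_power)
  have "PB j ?D" by (rule PB_add[OF a PB_mult[OF c b]])
  moreover have "((\<lambda>z. F n z * cis (- (n ^ p) * ln z)) has_vector_derivative ?D n z) (at z)" if n: "n \<ge> 1" for n z
  proof (cases "z < 1")
    case True
    then have "((\<lambda>z. F n z * cis (- (n ^ p) * ln z)) has_vector_derivative 0) (at z)"
      by (rule_tac has_vector_derivative_transform_within_open[of "\<lambda>_. 0" 0 z "{..<1}"]) (use n Suc.prems(2) in auto)
    then show ?thesis using F0[OF n True] Suc.prems(2)[OF n True] by simp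
  next
    case False
    then have "((\<lambda>z. - (n ^ p) * ln z) has_real_derivative - (n ^ p) / z) (at z)"
      by (auto intro!: derivative_eq_intros)
    then have "((\<lambda>z. cis (- (n ^ p) * ln z)) has_vector_derivative (- (n ^ p) / z) *\<^sub>R (\<i> * cis (- (n ^ p) * ln z))) (at z)"
      by (rule has_vector_derivative_cis_compose)
    from has_vector_derivative_mult[OF F'(1)[OF n, of z] this]
    show ?thesis by (simp add: divide_inverse mult_ac add_ac scaleR_conv_of_real)
  qed
  ultimately show ?case unfolding PB.simps using PB_poly_bounded[OF IHF]
    by (intro conjI exI[of _ ?D]) auto
qed

text \<open>The values are copied from the fundamental domain [0, 2 pi). This is smooth across the
  multiples of 2 pi when F is supported in [lo, 3] with lo > 0, as it is for the packet.\<close>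

definition periodize :: "(real \<Rightarrow> complex) \<Rightarrow> real \<Rightarrow> complex" where
  "periodize F x = F (x - 2 * pi * of_int \<lfloor>x / (2 * pi)\<rfloor>)"

lemma periodize_periodic: "periodize F (x + 2 * pi) = periodize F x"
  by (simp add: periodize_def add_divide_distrib algebra_simps)

lemma periodize_eq: "0 \<le> x \<Longrightarrow> x < 2 * pi \<Longrightarrow> periodize F x = F x"
proof -
  assume "0 \<le> x" "x < 2 * pi"
  then have "\<lfloor>x / (2 * pi)\<rfloor> = 0" by (simp add: floor_eq_iff)
  then show ?thesis by (simp add: periodize_def)
qed

text \<open>Near every point the periodization is one fixed translate of F, so continuity and
  derivatives can be read off from F.\<close>

lemma periodize_locally:
  assumes F: "\<And>x. x < lo \<Longrightarrow> F x = 0" "\<And>x. x > 3 \<Longrightarrow> F x = 0" and lo: "lo > 0"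
  obtains S m where "open S" "x \<in> S" "x - 2 * pi * of_int m < 2 * pi" "x - 2 * pi * of_int m \<ge> 0"
    "m = \<lfloor>x / (2 * pi)\<rfloor>"
    "\<And>y. y \<in> S \<Longrightarrow> periodize F y = F (y - 2 * pi * of_int m)"
proof -
  define m where "m = \<lfloor>x / (2 * pi)\<rfloor>"
  have pi3: "2 * pi > 4" using pi_gt3 by simp
  have m: "of_int m \<le> x / (2 * pi)" "x / (2 * pi) < of_int m + 1" by (auto simp: m_def)
  then have m': "x - 2 * pi * of_int m \<ge> 0" "x - 2 * pi * of_int m < 2 * pi"
    by (simp_all add: field_simps)
  \<comment> \<open>The neighbourhood sticks out of the cell by 1 on the left. There the copy
    belonging to the previous cell is F at an argument above 2 pi - 1 > 3, and the present copy is F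
    at a negative argument; both are zero.\<close>
  define S where "S = {2 * pi * of_int m - 1 <..< 2 * pi * of_int m + 2 * pi}"
  have "periodize F y = F (y - 2 * pi * of_int m)" if "y \<in> S" for y
  proof (cases "y < 2 * pi * of_int m")
    case False
    then have "\<lfloor>y / (2 * pi)\<rfloor> = m" using that by (auto simp: floor_eq_iff S_def field_simps)
    then show ?thesis by (simp add: periodize_def)
  next
    case True
    have "\<lfloor>y / (2 * pi)\<rfloor> = m - 1"
    proof (rule floor_unique)
      have "2 * pi * of_int m - 2 * pi \<le> y" using that pi_gt3 by (simp add: S_def)
      then have "of_int (m - 1) * (2 * pi) \<le> y" by (simp add: algebra_simps)
      then show "of_int (m - 1) \<le> y / (2 * pi)" by (simp only: pos_le_divide_eq[of "2 * pi"] pi_gt_zero mult_pos_pos zero_less_numeral)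
      have "y < (of_int (m - 1) + 1) * (2 * pi)" using True by (simp add: algebra_simps)
      then show "y / (2 * pi) < of_int (m - 1) + 1" by (simp only: pos_divide_less_eq[of "2 * pi"] pi_gt_zero mult_pos_pos zero_less_numeral)
    qed
    then have "periodize F y = F (y - 2 * pi * of_int (m - 1))" by (simp only: periodize_def)
    also have "y - 2 * pi * of_int (m - 1) = y - 2 * pi * of_int m + 2 * pi" by (simp add: algebra_simps)
    finally have "periodize F y = F (y - 2 * pi * of_int m + 2 * pi)" .
    also have "\<dots> = 0" using that pi_gt3 by (intro F(2)) (auto simp: S_def)
    also have "\<dots> = F (y - 2 * pi * of_int m)" using True lo by (subst F(1)) auto
    finally show ?thesis .
  qed
  moreover have "open S" "x \<in> S" using m' by (auto simp: S_def)
  ultimately show ?thesis using that[OF _ _ m'(2,1) m_def] by blast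
qed

lemma PB_periodize:
  assumes "PB j F" "\<And>n. n \<ge> 1 \<Longrightarrow> lo n > 0"
    "\<And>n x. n \<ge> 1 \<Longrightarrow> x < lo n \<Longrightarrow> F n x = 0" "\<And>n x. n \<ge> 1 \<Longrightarrow> x > 3 \<Longrightarrow> F n x = 0"
  shows "PB j (\<lambda>n. periodize (F n))"
  using assms(1,3,4)
proof (induction j arbitrary: F)
  case 0
  obtain C N where
    F: "\<And>n x. n \<ge> 1 \<Longrightarrow> norm (F n x) \<le> C * n ^ N" and cF: "\<And>n. n \<ge> 1 \<Longrightarrow> continuous_on UNIV (F n)"
    using 0(1) unfolding PB.simps poly_bounded_def by metis
  have "poly_bounded (\<lambda>n. periodize (F n))"
  proof (rule poly_boundedI[where C=C and N=N])
    fix n :: real assume n: "n \<ge> 1"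
    have "isCont (periodize (F n)) x" for x
    proof -
      obtain S m where S: "open S" "x \<in> S" "\<And>y. y \<in> S \<Longrightarrow> periodize (F n) y = F n (y - 2 * pi * of_int m)"
        using periodize_locally[of "lo n" "F n" x] 0(2,3)[OF n] assms(2)[OF n] by metis
      have "continuous_on UNIV (\<lambda>y. F n (y - 2 * pi * of_int m))"
        by (rule continuous_on_compose2[OF cF[OF n]]) (auto intro!: continuous_intros)
      then have "continuous_on S (\<lambda>y. F n (y - 2 * pi * of_int m))"
        by (rule continuous_on_subset) simp
      moreover have "continuous_on S (periodize (F n)) \<longleftrightarrow> continuous_on S (\<lambda>y. F n (y - 2 * pi * of_int m))"
        by (rule continuous_on_cong) (simp_all add: S(3))
      ultimately have "continuous_on S (periodize (F n))" by (simp only:)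
      then show ?thesis using S(1,2) by (simp only: continuous_on_eq_continuous_at)
    qed
    then show "continuous_on UNIV (periodize (F n))" by (simp add: continuous_at_imp_continuous_on)
    show "norm (periodize (F n) x) \<le> C * n ^ N" for x using F[OF n] by (simp add: periodize_def)
  qed
  then show ?case by simp
next
  case (Suc j)
  obtain F' where
    F': "\<And>n x. n \<ge> 1 \<Longrightarrow> (F n has_vector_derivative F' n x) (at x)" "PB j F'" and
    Fz: "\<And>n x S. n \<ge> 1 \<Longrightarrow> open S \<Longrightarrow> x \<in> S \<Longrightarrow> (\<And>y. y \<in> S \<Longrightarrow> F n y = 0) \<Longrightarrow> F' n x = 0"
    using PB_Suc_local_zero[OF Suc.prems(1)] by metis
  have F0: "F' n z = 0" if "n \<ge> 1" "z < lo n" for n z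
    by (rule Fz[of n "{..<lo n}"]) (use that Suc.prems(2) in auto)
  have F1: "F' n z = 0" if "n \<ge> 1" "z > 3" for n z
    by (rule Fz[of n "{3<..}"]) (use that Suc.prems(3) in auto)
  have "(periodize (F n) has_vector_derivative periodize (F' n) x) (at x)" if n: "n \<ge> 1" for n x
  proof -
    obtain S m where S: "open S" "x \<in> S" "\<And>y. y \<in> S \<Longrightarrow> periodize (F n) y = F n (y - 2 * pi * of_int m)"
      and m: "m = \<lfloor>x / (2 * pi)\<rfloor>"
      using periodize_locally[of "lo n" "F n" x] Suc.prems(2,3)[OF n] assms(2)[OF n] by metis
    have "((\<lambda>y. F n (y - 2 * pi * of_int m)) has_vector_derivative F' n (x - 2 * pi * of_int m)) (at x)"
    proof -
      have "((\<lambda>y. y - 2 * pi * of_int m) has_vector_derivative 1) (at x)"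
        by (auto intro!: derivative_eq_intros simp flip: has_real_derivative_iff_has_vector_derivative)
      from vector_diff_chain_at[OF this F'(1)[OF n]]
      show ?thesis by (simp add: o_def)
    qed
    then have "(periodize (F n) has_vector_derivative F' n (x - 2 * pi * of_int m)) (at x)"
      by (rule has_vector_derivative_transform_within_open[OF _ S(1,2)]) (simp add: S(3))
    then show ?thesis by (simp add: periodize_def m)
  qed
  moreover have "PB j (\<lambda>n. periodize (F' n))" by (rule Suc.IH[OF F'(2)]) (fact F0 F1)+
  moreover have "PB j (\<lambda>n. periodize (F n))"
    by (rule Suc.IH[OF PB_Suc_D[OF Suc.prems(1)]]) (fact Suc.prems)+
  ultimately show ?case using PB_poly_bounded[of j "\<lambda>n. periodize (F n)"] unfolding PB.simps
    by (intro conjI exI[of _ "\<lambda>n. periodize (F' n)"] allI impI)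
qed

section \<open>From polynomially bounded families to iterated derivatives\<close>

lemma dx_0 [simp]: "dx 0 g = g"
  by (simp add: dx_def)

lemma dx_Suc: "dx (Suc j) g x = vector_derivative (dx j g) (at x)"
  by (simp add: dx_def)

lemma dx_Suc2: "dx (Suc j) g = dx j (dx 1 g)"
  unfolding dx_def by (simp only: funpow_Suc_right comp_apply One_nat_def funpow_0)

text \<open>A witnessed derivative is the \<open>vector_derivative\<close>, so the j-th
  \<open>dx\<close> is the j-fold witness and inherits its polynomial bound.\<close>

lemma PB_dx:
  assumes "PB j F"
  shows "poly_bounded (\<lambda>n. dx j (F n))"
    and "i < j \<Longrightarrow> n \<ge> 1 \<Longrightarrow> (dx i (F n) has_vector_derivative dx (Suc i) (F n) x) (at x)"
proof -
  have dx1: "dx 1 (F n) = F' n" if "n \<ge> 1" "\<And>n x. n \<ge> 1 \<Longrightarrow> (F n has_vector_derivative F' n x) (at x)" for F F' n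
    using that(2)[OF that(1)] by (auto simp: dx_def fun_eq_iff intro: vector_derivative_at)
  have "poly_bounded (\<lambda>n. dx j (F n)) \<and>
    (\<forall>i<j. \<forall>n\<ge>1. \<forall>x. (dx i (F n) has_vector_derivative dx (Suc i) (F n) x) (at x))"
    using assms
  proof (induction j arbitrary: F)
    case (Suc j)
    obtain F' where F': "\<And>n x. n \<ge> 1 \<Longrightarrow> (F n has_vector_derivative F' n x) (at x)" "PB j F'"
      using Suc.prems unfolding PB.simps by metis
    have d1: "dx 1 (F n) = F' n" if "n \<ge> 1" for n by (rule dx1[OF that]) (rule F'(1))
    have d2: "dx (Suc i) (F n) = dx i (F' n)" if "n \<ge> 1" for i n
      unfolding dx_Suc2[of i] d1[OF that] ..
    have "poly_bounded (\<lambda>n. dx j (F' n))" using Suc.IH[OF F'(2)] by blast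
    then obtain C N where "\<forall>n\<ge>1. continuous_on UNIV (dx j (F' n)) \<and> (\<forall>x. norm (dx j (F' n) x) \<le> C * n ^ (N::nat))"
      unfolding poly_bounded_def by blast
    then have "poly_bounded (\<lambda>n. dx (Suc j) (F n))"
      unfolding poly_bounded_def by (intro exI[of _ C] exI[of _ N]) (metis d2)
    moreover have "(dx i (F n) has_vector_derivative dx (Suc i) (F n) x) (at x)" if "i < Suc j" "n \<ge> 1" for i n x
    proof (cases i)
      case 0
      show ?thesis unfolding 0 d2[OF that(2)] dx_0 by (rule F'(1)[OF that(2)])
    next
      case (Suc i')
      have "(dx i' (F' n) has_vector_derivative dx (Suc i') (F' n) x) (at x)"
        using Suc.IH[OF F'(2), THEN conjunct2, rule_format, of i' n x] that Suc by simp
      then show ?thesis unfolding Suc d2[OF that(2)] .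
    qed
    ultimately show ?case by blast
  qed simp
  then show "poly_bounded (\<lambda>n. dx j (F n))"
    and "i < j \<Longrightarrow> n \<ge> 1 \<Longrightarrow> (dx i (F n) has_vector_derivative dx (Suc i) (F n) x) (at x)" by blast+
qed

lemma PB_Cs:
  assumes "\<And>j. PB j F" "\<And>n x. n \<ge> 1 \<Longrightarrow> F n (x + 2 * pi) = F n x" "n \<ge> 1"
  shows "Cinf (F n)"
proof -
  have "continuous_on UNIV (dx j (F n))" for j
    using PB_dx(1)[OF assms(1)[of j]] assms(3) unfolding poly_bounded_def by metis
  moreover have "(dx i (F n) has_vector_derivative dx (Suc i) (F n) x) (at x)" for i x
    using PB_dx(2)[OF assms(1)[of "Suc i"]] assms(3) by blast
  ultimately show ?thesis using assms(2,3) by (simp add: Cinf_def Cs_def periodic_T_def)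
qed

text \<open>One constant and one power serve all orders up to s. This is the price of the packet in
  C^s, and its amplitude is later chosen proportional to the reciprocal.\<close>

lemma PB_dx_bound:
  assumes "\<And>j. PB j F"
  obtains C N where "C > 0" "\<And>n x j. n \<ge> 1 \<Longrightarrow> j \<le> s \<Longrightarrow> norm (dx j (F n) x) \<le> C * n ^ (N::nat)"
proof -
  have "\<exists>C N. \<forall>n\<ge>1. \<forall>x. norm (dx j (F n) x) \<le> C * n ^ (N::nat)" for j
    using PB_dx(1)[OF assms(1)[of j]] unfolding poly_bounded_def by metis
  then obtain C N where CN: "\<And>j n x. n \<ge> 1 \<Longrightarrow> norm (dx j (F n) x) \<le> C j * n ^ (N j :: nat)" by metis
  define C' where "C' = 1 + (\<Sum>j\<le>s. \<bar>C j\<bar>)"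
  define N' where "N' = (\<Sum>j\<le>s. N j)"
  have "norm (dx j (F n) x) \<le> C' * n ^ N'" if "n \<ge> 1" "j \<le> s" for j n x
  proof -
    have "\<bar>C j\<bar> \<le> (\<Sum>j\<le>s. \<bar>C j\<bar>)" "N j \<le> N'" using that unfolding N'_def
      by (auto intro!: member_le_sum)
    then have "C j * n ^ N j \<le> C' * n ^ N'" using that unfolding C'_def
      by (intro mult_mono power_increasing) auto
    then show ?thesis using CN[OF that(1), of j x] by linarith
  qed
  moreover have "C' > 0" unfolding C'_def by (smt (verit) abs_ge_zero sum_nonneg)
  ultimately show ?thesis using that by blast
qed

text \<open>The phase is a function of ln x because x^2 d_xx has constant coefficients in this variable.\<close>

definition bump :: "real \<Rightarrow> real" where
  "bump z = flat_exp 0 (z - 1) * flat_exp 0 (2 - z)"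

definition packet :: "real \<Rightarrow> real \<Rightarrow> complex" where
  "packet n = periodize (\<lambda>x. complex_of_real (bump (n ^ 8 * x)) * cis (- (n ^ 4) * ln (n ^ 8 * x)))"

lemma bump_zero: "z \<le> 1 \<Longrightarrow> bump z = 0" "z \<ge> 2 \<Longrightarrow> bump z = 0"
  by (auto simp: bump_def flat_exp_def)

lemma bump_nonneg: "bump z \<ge> 0"
  by (simp add: bump_def flat_exp_nonneg)

lemma PB_bump: "PB j (\<lambda>n z. complex_of_real (bump z))"
proof -
  have "PB j (\<lambda>n z. complex_of_real (flat_exp 0 (1 * z + (-1))))"
    using PB_affine[OF PB_flat_exp, of "\<lambda>_. 1" 1 0 j 0 "\<lambda>_. -1"] by simp
  moreover have "PB j (\<lambda>n z. complex_of_real (flat_exp 0 ((-1) * z + 2)))"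
    using PB_affine[OF PB_flat_exp, of "\<lambda>_. -1" 1 0 j 0 "\<lambda>_. 2"] by simp
  ultimately show ?thesis using PB_mult by (fastforce simp: bump_def)
qed

lemma bump_has_derivatives:
  obtains V1 V2 where "\<And>z. (bump has_real_derivative V1 z) (at z)" "\<And>z. (V1 has_real_derivative V2 z) (at z)"
    "continuous_on UNIV V2"
proof -
  have 1: "((\<lambda>z. flat_exp m (z - 1)) has_real_derivative flat_exp (m + 2) (z - 1) - real m * flat_exp (m + 1) (z - 1)) (at z)" for m z
  proof -
    have "((\<lambda>z. z - 1) has_real_derivative 1) (at z)" by (auto intro!: derivative_eq_intros)
    from DERIV_chain2[where f="flat_exp m" and g="\<lambda>z. z - 1", OF flat_exp_has_derivative this]
    show ?thesis by (simp only: mult_1_right)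
  qed
  have 2: "((\<lambda>z. flat_exp m (2 - z)) has_real_derivative - (flat_exp (m + 2) (2 - z) - real m * flat_exp (m + 1) (2 - z))) (at z)" for m z
  proof -
    have "((\<lambda>z. 2 - z) has_real_derivative -1) (at z)" by (auto intro!: derivative_eq_intros)
    from DERIV_chain2[where f="flat_exp m" and g="\<lambda>z. 2 - z", OF flat_exp_has_derivative this]
    show ?thesis by (simp only: mult_minus1_right)
  qed
  have c: "continuous_on UNIV (\<lambda>z. flat_exp m (z - 1))" "continuous_on UNIV (\<lambda>z. flat_exp m (2 - z))" for m
    using DERIV_isCont[OF 1] DERIV_isCont[OF 2] by (auto intro!: continuous_at_imp_continuous_on)
  let ?V1 = "\<lambda>z. flat_exp 2 (z - 1) * flat_exp 0 (2 - z) - flat_exp 0 (z - 1) * flat_exp 2 (2 - z)"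
  let ?V2 = "\<lambda>z. (flat_exp 4 (z - 1) - 2 * flat_exp 3 (z - 1)) * flat_exp 0 (2 - z)
     - 2 * (flat_exp 2 (z - 1) * flat_exp 2 (2 - z)) + flat_exp 0 (z - 1) * (flat_exp 4 (2 - z) - 2 * flat_exp 3 (2 - z))"
  show ?thesis
  proof
    note one = 1[of 0, simplified] 1[of 2, simplified] 2[of 0, simplified] 2[of 2, simplified]
    show "(bump has_real_derivative ?V1 z) (at z)" for z
      unfolding bump_def by (rule derivative_eq_intros one refl)+ (simp add: algebra_simps numeral_2_eq_2)
    show "(?V1 has_real_derivative ?V2 z) (at z)" for z
      by (rule derivative_eq_intros one refl)+ (simp add: algebra_simps eval_nat_numeral)
    show "continuous_on UNIV ?V2" by (intro continuous_intros c)
  qed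
qed

lemma PB_packet: "PB j packet"
proof -
  have "PB j (\<lambda>n z. complex_of_real (bump z) * cis (- (n ^ 4) * ln z))"
    by (rule PB_phase[OF PB_bump]) (simp add: bump_zero)
  from PB_affine[OF this, of "\<lambda>n. n ^ 8" 1 8 "\<lambda>_. 0"]
  have "PB j (\<lambda>n x. complex_of_real (bump (n ^ 8 * x)) * cis (- (n ^ 4) * ln (n ^ 8 * x)))"
    by simp
  then show ?thesis unfolding packet_def[abs_def]
  proof (rule PB_periodize)
    fix n :: real assume n: "n \<ge> 1"
    show "1 / n ^ 8 > 0" using n by simp
    show "complex_of_real (bump (n ^ 8 * x)) * cis (- (n ^ 4) * ln (n ^ 8 * x)) = 0" if "x < 1 / n ^ 8" for x
      using that n by (simp add: bump_zero field_simps)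
    show "complex_of_real (bump (n ^ 8 * x)) * cis (- (n ^ 4) * ln (n ^ 8 * x)) = 0" if "x > 3" for x
    proof -
      have "1 * 2 \<le> n ^ 8 * x" using n that by (intro mult_mono) auto
      then show ?thesis by (simp add: bump_zero)
    qed
  qed
qed

section \<open>The nonlinearity and the weighted energy\<close>

text \<open>The nonlinearity as a function of the 2-jet at one point, so that the algebra of the
  equation is carried out with complex numbers alone.\<close>

definition NN :: "real \<Rightarrow> real \<Rightarrow> complex \<Rightarrow> complex \<Rightarrow> complex \<Rightarrow> complex \<Rightarrow> complex" where
  "NN \<alpha> \<beta> \<mu> u u1 u2 = of_real ((cmod u)\<^sup>2) * u2 + of_real \<alpha> * u * of_real ((cmod u1)\<^sup>2)
     + of_real \<beta> * cnj u * u1\<^sup>2 + \<mu> * of_real ((cmod u)\<^sup>2) * u"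

lemma norm_mult_le: "norm a \<le> A \<Longrightarrow> norm b \<le> B \<Longrightarrow> norm (a * b) \<le> A * (B :: real)"
  for a b :: complex
  unfolding norm_mult by (intro mult_mono) (auto intro: order_trans[OF norm_ge_zero])

lemma norm_add_le: "norm a \<le> A \<Longrightarrow> norm b \<le> B \<Longrightarrow> norm (a + b) \<le> A + (B :: real)"
  and norm_diff_le: "norm a \<le> A \<Longrightarrow> norm b \<le> B \<Longrightarrow> norm (a - b) \<le> A + (B :: real)"
  for a b :: complex
  by (fact norm_triangle_mono, rule norm_triangle_le_diff) simp

text \<open>Every term carries a factor u or its conjugate. This is why zeros of the data persist
  and why, at each x separately, |u| changes over a short time by a small fraction of
  itself.\<close>

lemma NN_bound:
  assumes "norm u \<le> K" "norm u1 \<le> K" "norm u2 \<le> K"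
  shows "norm (NN \<alpha> \<beta> \<mu> u u1 u2) \<le> (1 + \<bar>\<alpha>\<bar> + \<bar>\<beta>\<bar> + norm \<mu>) * K\<^sup>2 * norm u"
proof -
  have K: "0 \<le> K" using assms(1) norm_ge_zero order_trans by blast
  have 1: "norm (u * cnj u * u2) \<le> norm u * K * K"
    using assms by (intro norm_mult_le) auto
  have 2: "norm (of_real \<alpha> * u * (u1 * cnj u1)) \<le> \<bar>\<alpha>\<bar> * norm u * (K * K)"
    using assms by (intro norm_mult_le) auto
  have 3: "norm (of_real \<beta> * cnj u * (u1 * u1)) \<le> \<bar>\<beta>\<bar> * norm u * (K * K)"
    using assms by (intro norm_mult_le) auto
  have 4: "norm (\<mu> * (u * cnj u) * u) \<le> norm \<mu> * (norm u * K) * K"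
    using assms by (intro norm_mult_le) auto
  have "NN \<alpha> \<beta> \<mu> u u1 u2 = u * cnj u * u2 + of_real \<alpha> * u * (u1 * cnj u1)
      + of_real \<beta> * cnj u * (u1 * u1) + \<mu> * (u * cnj u) * u"
    unfolding NN_def complex_norm_square unfolding power2_eq_square by (rule refl)
  also have "norm \<dots> \<le> norm u * K * K + \<bar>\<alpha>\<bar> * norm u * (K * K) + \<bar>\<beta>\<bar> * norm u * (K * K) + norm \<mu> * (norm u * K) * K"
    by (intro norm_add_le 1 2 3 4)
  also have "\<dots> = (1 + \<bar>\<alpha>\<bar> + \<bar>\<beta>\<bar> + norm \<mu>) * K\<^sup>2 * norm u"
    by (simp add: algebra_simps power2_eq_square)
  finally show ?thesis .
qed

text \<open>The part of the difference of two nonlinearities in which w is undifferentiated. The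
  derivatives \<open>f1\<close>, \<open>f2\<close> of the other solution appear as coefficients, for
  which the bound K is enough.\<close>

definition ZZ :: "real \<Rightarrow> real \<Rightarrow> complex \<Rightarrow> complex \<Rightarrow> complex \<Rightarrow> complex \<Rightarrow> complex \<Rightarrow> complex \<Rightarrow> complex" where
  "ZZ \<alpha> \<beta> \<mu> h h2 w f1 f2 = ((h + w) * cnj (h + w) - h * cnj h) * f2 + of_real \<alpha> * w * (f1 * cnj f1)
    + of_real \<beta> * cnj w * (f1 * f1) + \<mu> * ((h + w) * cnj (h + w) * (h + w) - h * cnj h * h)"

text \<open>The second order term is split with the coefficient |h|^2 of the reference solution, so that
  the rough second derivative of the other solution only enters multiplied by the difference w.\<close>

lemma NN_diff:
  "NN \<alpha> \<beta> \<mu> (h + w) (h1 + w1) (h2 + w2) - NN \<alpha> \<beta> \<mu> h h1 h2 =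
    h * cnj h * w2 + (of_real \<alpha> * h * cnj h1 + 2 * of_real \<beta> * cnj h * h1) * w1
    + of_real \<alpha> * h * h1 * cnj w1 + (of_real \<alpha> * h * cnj w1 + of_real \<beta> * cnj h * w1) * w1
    + ZZ \<alpha> \<beta> \<mu> h h2 w (h1 + w1) (h2 + w2)"
  unfolding NN_def ZZ_def complex_norm_square complex_cnj_add by algebra

lemma ZZ_bound:
  assumes "norm h \<le> K" "norm (h + w) \<le> K" "norm f1 \<le> K" "norm f2 \<le> K"
  shows "norm (ZZ \<alpha> \<beta> \<mu> h h2 w f1 f2) \<le> 3 * (1 + \<bar>\<alpha>\<bar> + \<bar>\<beta>\<bar> + norm \<mu>) * K\<^sup>2 * norm w"
proof -
  have K: "0 \<le> K" using assms(1) norm_ge_zero order_trans by blast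
  let ?f = "h + w"
  have w: "norm w \<le> norm w" by simp
  have 1: "norm ((w * cnj ?f + h * cnj w) * f2) \<le> (norm w * K + K * norm w) * K"
    using assms by (intro norm_mult_le norm_add_le) (auto simp del: complex_cnj_add)
  have 2: "norm (of_real \<alpha> * w * (f1 * cnj f1)) \<le> \<bar>\<alpha>\<bar> * norm w * (K * K)"
    using assms by (intro norm_mult_le) auto
  have 3: "norm (of_real \<beta> * cnj w * (f1 * f1)) \<le> \<bar>\<beta>\<bar> * norm w * (K * K)"
    using assms by (intro norm_mult_le) auto
  have 4: "norm (\<mu> * (w * cnj ?f * ?f + h * cnj w * ?f + h * cnj h * w))
      \<le> norm \<mu> * (norm w * K * K + K * norm w * K + K * K * norm w)"
    using assms by (intro norm_mult_le norm_add_le) (auto simp del: complex_cnj_add)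
  have "ZZ \<alpha> \<beta> \<mu> h h2 w f1 f2 = (w * cnj ?f + h * cnj w) * f2 + of_real \<alpha> * w * (f1 * cnj f1)
    + of_real \<beta> * cnj w * (f1 * f1) + \<mu> * (w * cnj ?f * ?f + h * cnj w * ?f + h * cnj h * w)"
    unfolding ZZ_def complex_cnj_add by algebra
  also have "norm \<dots> \<le> (norm w * K + K * norm w) * K + \<bar>\<alpha>\<bar> * norm w * (K * K) + \<bar>\<beta>\<bar> * norm w * (K * K)
      + norm \<mu> * (norm w * K * K + K * norm w * K + K * K * norm w)"
    by (intro norm_add_le 1 2 3 4)
  also have "\<dots> = (2 + \<bar>\<alpha>\<bar> + \<bar>\<beta>\<bar> + 3 * norm \<mu>) * (K\<^sup>2 * norm w)"
    by (simp add: algebra_simps power2_eq_square)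
  also have "\<dots> \<le> (3 * (1 + \<bar>\<alpha>\<bar> + \<bar>\<beta>\<bar> + norm \<mu>)) * (K\<^sup>2 * norm w)"
    by (intro mult_right_mono) auto
  finally show ?thesis by (simp add: mult.assoc)
qed

text \<open>Up to sign, the first-order terms contribute (\<alpha> + 2 \<beta> - 2) Re (cnj h * h1)
  Im (w1 * cnj w), and the derivative of the weight contributes the same product with the factor 2
  \<sigma>; the sum is zero for this \<sigma>. The real part of w1 * cnj w is half of the derivative
  of |w|^2, and a flux with coefficient (2 \<beta> - \<alpha>) / 2 removes it.\<close>

lemma energy_cancel:
  assumes s: "s * (cmod h)\<^sup>2 = - \<sigma> * (2 * Re (cnj h * h1))" and sg: "\<sigma> = 1 - \<alpha> / 2 - \<beta>"
  shows "Re (\<i> * ((of_real \<alpha> * h * cnj h1 + 2 * of_real \<beta> * cnj h * h1) * w1 * cnj w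
      - (h1 * cnj h + h * cnj h1) * w1 * cnj w - h * cnj h * w1 * cnj w1
      - of_real ((2 * \<beta> - \<alpha>) / 2) * (cnj h1 * h1 * w * cnj w + cnj h * h1 * (w1 * cnj w + w * cnj w1))))
    - s * Re (\<i> * (h * cnj h * w1 * cnj w)) = 0"
proof -
  define q where "q = Im (w1 * cnj w)"
  have 1: "Re (\<i> * (h * cnj h * w1 * cnj w)) = - (cmod h)\<^sup>2 * q"
  proof -
    have "h * cnj h * w1 * cnj w = of_real ((cmod h)\<^sup>2) * (w1 * cnj w)"
      unfolding complex_norm_square by (simp only: mult_ac)
    moreover have "Im (of_real r * z) = r * Im z" for r z by simp
    ultimately show ?thesis unfolding q_def Re_i_times by (metis mult_minus_left)
  qed
  have "- (s * (- (cmod h)\<^sup>2 * q)) = (s * (cmod h)\<^sup>2) * q" by simp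
  also have "\<dots> = - \<sigma> * (2 * Re (cnj h * h1)) * q" by (simp only: s)
  finally have 2: "- (s * Re (\<i> * (h * cnj h * w1 * cnj w))) = - \<sigma> * (2 * Re (cnj h * h1)) * q"
    by (simp only: 1)
  have "Re (\<i> * ((of_real \<alpha> * h * cnj h1 + 2 * of_real \<beta> * cnj h * h1) * w1 * cnj w
      - (h1 * cnj h + h * cnj h1) * w1 * cnj w - h * cnj h * w1 * cnj w1
      - of_real ((2 * \<beta> - \<alpha>) / 2) * (cnj h1 * h1 * w * cnj w + cnj h * h1 * (w1 * cnj w + w * cnj w1))))
     = \<sigma> * (2 * Re (cnj h * h1)) * q"
    unfolding q_def sg by (simp add: algebra_simps add_divide_distrib diff_divide_distrib)
  then show ?thesis using 2 by linarith
qed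

text \<open>Here \<open>s\<close> is the logarithmic derivative of the weight, of size 1 / |h|;
  every flux term has a factor h or its conjugate, which compensates it. After the cancellation all
  terms contain w or its conjugate twice, and the other factors are bounded by multiples of K, be
  they values or derivatives of h or derivatives of w.\<close>

lemma energy_pointwise:
  assumes s: "s * (cmod h)\<^sup>2 = - \<sigma> * (2 * Re (cnj h * h1))" and sg: "\<sigma> = 1 - \<alpha> / 2 - \<beta>"
    and K: "norm h \<le> K" "norm h1 \<le> K" "norm h2 \<le> K" "norm w1 \<le> 2 * K" "norm w2 \<le> 2 * K"
    and s2: "\<bar>s\<bar> * cmod h \<le> 2 * \<bar>\<sigma>\<bar> * K"
  shows "\<bar>Re (cnj w * (\<i> * (h * cnj h * w2 + (of_real \<alpha> * h * cnj h1 + 2 * of_real \<beta> * cnj h * h1) * w1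
        + of_real \<alpha> * h * h1 * cnj w1 + (of_real \<alpha> * h * cnj w1 + of_real \<beta> * cnj h * w1) * w1)))
      - s * Re (\<i> * (h * cnj h * w1 * cnj w + of_real ((2 * \<beta> - \<alpha>) / 2) * cnj h * h1 * w * cnj w
          + of_real (\<alpha> / 2) * h * h1 * cnj w * cnj w + of_real (\<alpha> / 2) * h * w1 * cnj w * cnj w
          + of_real \<beta> * cnj h * w * w1 * cnj w - of_real (\<beta> / 2) * cnj h * cnj w1 * w * w))
      - Re (\<i> * ((h1 * cnj h + h * cnj h1) * w1 * cnj w + h * cnj h * w2 * cnj w + h * cnj h * w1 * cnj w1
          + of_real ((2 * \<beta> - \<alpha>) / 2) * ((cnj h1 * h1 + cnj h * h2) * w * cnj w + cnj h * h1 * (w1 * cnj w + w * cnj w1))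
          + of_real (\<alpha> / 2) * ((h1 * h1 + h * h2) * cnj w * cnj w + 2 * h * h1 * cnj w * cnj w1)
          + of_real (\<alpha> / 2) * ((h1 * w1 + h * w2) * cnj w * cnj w + 2 * h * w1 * cnj w * cnj w1)
          + of_real \<beta> * (cnj h1 * w * w1 * cnj w + cnj h * w1 * w1 * cnj w + cnj h * w * w2 * cnj w + cnj h * w * w1 * cnj w1)
          - of_real (\<beta> / 2) * ((cnj h1 * cnj w1 + cnj h * cnj w2) * w * w + 2 * cnj h * cnj w1 * w * w1)))\<bar>
     \<le> (7 + 8 * \<bar>\<sigma>\<bar>) * (1 + \<bar>\<alpha>\<bar> + \<bar>\<beta>\<bar>) * K\<^sup>2 * (cmod w)\<^sup>2" (is "\<bar>?A - s * ?B - ?C\<bar> \<le> _")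
proof -
  have K0: "0 \<le> K" using K(1) norm_ge_zero order_trans by blast
  let ?W = "norm w"
  define R1 where "R1 = of_real ((2 * \<beta> - \<alpha>) / 2) * h1 * w * cnj w
          + of_real (\<alpha> / 2) * h1 * cnj w * cnj w + of_real (\<alpha> / 2) * w1 * cnj w * cnj w
          + of_real \<beta> * w * w1 * cnj w - of_real (\<beta> / 2) * cnj w1 * w * w"
  define R1' where "R1' = of_real ((2 * \<beta> - \<alpha>) / 2) * cnj h * h1 * w * cnj w
          + of_real (\<alpha> / 2) * h * h1 * cnj w * cnj w + of_real (\<alpha> / 2) * h * w1 * cnj w * cnj w
          + of_real \<beta> * cnj h * w * w1 * cnj w - of_real (\<beta> / 2) * cnj h * cnj w1 * w * w"
  define R2 where "R2 = of_real ((2 * \<beta> - \<alpha>) / 2) * (cnj h * h2 * w * cnj w)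
          + of_real (\<alpha> / 2) * ((h1 * h1 + h * h2) * cnj w * cnj w)
          + of_real (\<alpha> / 2) * ((h1 * w1 + h * w2) * cnj w * cnj w)
          + of_real \<beta> * (cnj h1 * w * w1 * cnj w + cnj h * w * w2 * cnj w)
          - of_real (\<beta> / 2) * ((cnj h1 * cnj w1 + cnj h * cnj w2) * w * w)"
  \<comment> \<open>\<open>M\<close> and \<open>P\<close> contain everything that the size of w does
    not control; \<open>energy_cancel\<close> removes them together.\<close>
  define M where "M = \<i> * ((of_real \<alpha> * h * cnj h1 + 2 * of_real \<beta> * cnj h * h1) * w1 * cnj w
      - (h1 * cnj h + h * cnj h1) * w1 * cnj w - h * cnj h * w1 * cnj w1
      - of_real ((2 * \<beta> - \<alpha>) / 2) * (cnj h1 * h1 * w * cnj w + cnj h * h1 * (w1 * cnj w + w * cnj w1)))"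
  define P where "P = \<i> * (h * cnj h * w1 * cnj w)"
  define a2 b2 e where "a2 = complex_of_real (\<alpha> / 2)" and "b2 = complex_of_real (\<beta> / 2)"
    and "e = complex_of_real ((2 * \<beta> - \<alpha>) / 2)"
  have ab2: "complex_of_real \<alpha> = 2 * a2" "complex_of_real \<beta> = 2 * b2" by (simp_all add: a2_def b2_def)
  note abe = a2_def[symmetric] b2_def[symmetric] e_def[symmetric] ab2
  have ac: "?A - ?C = Re (M - \<i> * R2)"
    unfolding minus_complex.sel(1)[symmetric] M_def R2_def abe
    by (rule arg_cong[where f=Re]) algebra
  have b: "?B = Re (P + \<i> * R1')"
    unfolding P_def R1'_def by (rule arg_cong[where f=Re]) (simp add: algebra_simps)
  have mp: "Re M - s * Re P = 0" unfolding M_def P_def by (rule energy_cancel[OF s sg])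
  have "a - b - c = (a - c) - b" for a b c :: real by simp
  then have "?A - s * ?B - ?C = (?A - ?C) - s * ?B" .
  also have "\<dots> = Re (M - \<i> * R2) - s * Re (P + \<i> * R1')" by (simp only: ac b)
  also have "\<dots> = - Re (\<i> * R2) - s * Re (\<i> * R1')"
    using mp unfolding minus_complex.sel plus_complex.sel distrib_left by linarith
  finally have eq: "?A - s * ?B - ?C = - Re (\<i> * R2) - s * Re (\<i> * R1')" .
  have ab: "\<bar>(2 * \<beta> - \<alpha>) / 2\<bar> \<le> \<bar>\<beta>\<bar> + \<bar>\<alpha>\<bar> / 2" by (simp add: field_simps abs_if)
  have n1: "norm (complex_of_real ((2 * \<beta> - \<alpha>) / 2)) \<le> \<bar>\<beta>\<bar> + \<bar>\<alpha>\<bar> / 2"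
    using ab by (simp only: norm_of_real)
  have n2: "norm (complex_of_real (\<alpha> / 2)) \<le> \<bar>\<alpha>\<bar> / 2" "norm (complex_of_real \<beta>) \<le> \<bar>\<beta>\<bar>"
    "norm (complex_of_real (\<beta> / 2)) \<le> \<bar>\<beta>\<bar> / 2" by simp_all
  have w: "norm w \<le> ?W" "norm (cnj w) \<le> ?W" by auto
  have cK: "norm (cnj h) \<le> K" "norm (cnj h1) \<le> K" "norm (cnj w1) \<le> 2 * K" "norm (cnj w2) \<le> 2 * K"
    using K by auto
  have ch: "norm h \<le> cmod h" "norm (cnj h) \<le> cmod h" by auto
  have "norm R1' \<le> (\<bar>\<beta>\<bar> + \<bar>\<alpha>\<bar> / 2) * cmod h * K * ?W * ?W + \<bar>\<alpha>\<bar> / 2 * cmod h * K * ?W * ?W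
      + \<bar>\<alpha>\<bar> / 2 * cmod h * (2 * K) * ?W * ?W + \<bar>\<beta>\<bar> * cmod h * ?W * (2 * K) * ?W + \<bar>\<beta>\<bar> / 2 * cmod h * (2 * K) * ?W * ?W"
    unfolding R1'_def by (intro norm_diff_le norm_add_le norm_mult_le n1 n2 w K cK ch)
  also have "\<dots> = (2 * \<bar>\<alpha>\<bar> + 4 * \<bar>\<beta>\<bar>) * K * ?W\<^sup>2 * cmod h"
    by (simp add: algebra_simps power2_eq_square)
  finally have R1': "norm R1' \<le> (2 * \<bar>\<alpha>\<bar> + 4 * \<bar>\<beta>\<bar>) * K * ?W\<^sup>2 * cmod h" .
  have "\<bar>s * Re (\<i> * R1')\<bar> \<le> \<bar>s\<bar> * norm (\<i> * R1')"
    unfolding abs_mult by (intro mult_left_mono abs_Re_le_cmod) auto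
  also have "\<dots> \<le> \<bar>s\<bar> * ((2 * \<bar>\<alpha>\<bar> + 4 * \<bar>\<beta>\<bar>) * K * ?W\<^sup>2 * cmod h)"
    using R1' by (intro mult_left_mono) (auto simp: norm_mult)
  also have "\<dots> = (\<bar>s\<bar> * cmod h) * ((2 * \<bar>\<alpha>\<bar> + 4 * \<bar>\<beta>\<bar>) * K * ?W\<^sup>2)" by (simp add: mult_ac)
  also have "\<dots> \<le> (2 * \<bar>\<sigma>\<bar> * K) * ((2 * \<bar>\<alpha>\<bar> + 4 * \<bar>\<beta>\<bar>) * K * ?W\<^sup>2)"
    using s2 K0 by (intro mult_right_mono) auto
  also have "\<dots> = (2 * \<bar>\<alpha>\<bar> + 4 * \<bar>\<beta>\<bar>) * (2 * \<bar>\<sigma>\<bar> * K\<^sup>2 * ?W\<^sup>2)" by (simp add: power2_eq_square mult_ac)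
  also have "\<dots> \<le> (4 * (1 + \<bar>\<alpha>\<bar> + \<bar>\<beta>\<bar>)) * (2 * \<bar>\<sigma>\<bar> * K\<^sup>2 * ?W\<^sup>2)"
    by (intro mult_right_mono) auto
  also have "\<dots> = 8 * \<bar>\<sigma>\<bar> * ((1 + \<bar>\<alpha>\<bar> + \<bar>\<beta>\<bar>) * K\<^sup>2 * ?W\<^sup>2)" by simp
  finally have b1: "\<bar>s * Re (\<i> * R1')\<bar> \<le> 8 * \<bar>\<sigma>\<bar> * ((1 + \<bar>\<alpha>\<bar> + \<bar>\<beta>\<bar>) * K\<^sup>2 * ?W\<^sup>2)" .
  have "norm R2 \<le> (\<bar>\<beta>\<bar> + \<bar>\<alpha>\<bar> / 2) * (K * K * ?W * ?W) + \<bar>\<alpha>\<bar> / 2 * ((K * K + K * K) * ?W * ?W)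
      + \<bar>\<alpha>\<bar> / 2 * ((K * (2 * K) + K * (2 * K)) * ?W * ?W) + \<bar>\<beta>\<bar> * (K * ?W * (2 * K) * ?W + K * ?W * (2 * K) * ?W)
      + \<bar>\<beta>\<bar> / 2 * ((K * (2 * K) + K * (2 * K)) * ?W * ?W)"
    unfolding R2_def by (intro norm_diff_le norm_add_le norm_mult_le n1 n2 w K cK)
  also have "\<dots> = (7 / 2 * \<bar>\<alpha>\<bar> + 7 * \<bar>\<beta>\<bar>) * (K\<^sup>2 * ?W\<^sup>2)"
    by (simp add: algebra_simps power2_eq_square)
  also have "\<dots> \<le> (7 * (1 + \<bar>\<alpha>\<bar> + \<bar>\<beta>\<bar>)) * (K\<^sup>2 * ?W\<^sup>2)"
    by (intro mult_right_mono) auto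
  also have "\<dots> = 7 * ((1 + \<bar>\<alpha>\<bar> + \<bar>\<beta>\<bar>) * K\<^sup>2 * ?W\<^sup>2)" by simp
  finally have "norm (\<i> * R2) \<le> 7 * ((1 + \<bar>\<alpha>\<bar> + \<bar>\<beta>\<bar>) * K\<^sup>2 * ?W\<^sup>2)" by (simp only: norm_mult norm_ii mult_1)
  then have b2: "\<bar>Re (\<i> * R2)\<bar> \<le> 7 * ((1 + \<bar>\<alpha>\<bar> + \<bar>\<beta>\<bar>) * K\<^sup>2 * ?W\<^sup>2)"
    by (rule order_trans[OF abs_Re_le_cmod])
  have "(7 + 8 * \<bar>\<sigma>\<bar>) * (1 + \<bar>\<alpha>\<bar> + \<bar>\<beta>\<bar>) * K\<^sup>2 * (cmod w)\<^sup>2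
     = 7 * ((1 + \<bar>\<alpha>\<bar> + \<bar>\<beta>\<bar>) * K\<^sup>2 * ?W\<^sup>2) + 8 * \<bar>\<sigma>\<bar> * ((1 + \<bar>\<alpha>\<bar> + \<bar>\<beta>\<bar>) * K\<^sup>2 * ?W\<^sup>2)"
    by (simp add: algebra_simps)
  then show ?thesis unfolding eq using b1 b2 by linarith
qed

section \<open>The energy flux and the weight\<close>

lemma has_vector_derivative_cnj:
  "(f has_vector_derivative f') F \<Longrightarrow> ((\<lambda>x. cnj (f x)) has_vector_derivative cnj f') F"
  by (rule bounded_linear.has_vector_derivative[OF bounded_linear_cnj])

lemma has_vector_derivative_Re:
  "(f has_vector_derivative f') F \<Longrightarrow> ((\<lambda>x. Re (f x)) has_real_derivative Re f') F"
  unfolding has_real_derivative_iff_has_vector_derivative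
  by (rule bounded_linear.has_vector_derivative[OF bounded_linear_Re])

lemma has_vector_derivative_cmult:
  fixes f :: "real \<Rightarrow> complex"
  shows "(f has_vector_derivative f') F \<Longrightarrow> ((\<lambda>x. c * f x) has_vector_derivative c * f') F"
  by (rule bounded_linear.has_vector_derivative[OF bounded_linear_mult_right])

text \<open>The first three terms of the flux belong to the second-order term of the equation, to
  the real part of w1 * cnj w, and to the coupling with cnj w1. The last three integrate the terms
  quadratic in w1: in w1 * cnj w1 * cnj w the last two factors are half of the derivative of (cnj
  w)^2, while w1 * w1 * cnj w takes two integrations, and the second one produces the coefficient -
  \<beta> / 2.\<close>

lemma energy_antiderivative:
  fixes h h1 w w1 :: "real \<Rightarrow> complex"
  assumes h: "(h has_vector_derivative h1 x) F" and h1: "(h1 has_vector_derivative h2) F"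
    and w: "(w has_vector_derivative w1 x) F" and w1: "(w1 has_vector_derivative w2) F"
    and F: "F = at x within S"
  shows "((\<lambda>x. \<i> * (h x * cnj (h x) * w1 x * cnj (w x) + of_real ((2 * \<beta> - \<alpha>) / 2) * cnj (h x) * h1 x * w x * cnj (w x)
          + of_real (\<alpha> / 2) * h x * h1 x * cnj (w x) * cnj (w x) + of_real (\<alpha> / 2) * h x * w1 x * cnj (w x) * cnj (w x)
          + of_real \<beta> * cnj (h x) * w x * w1 x * cnj (w x) - of_real (\<beta> / 2) * cnj (h x) * cnj (w1 x) * w x * w x))
    has_vector_derivative
      \<i> * ((h1 x * cnj (h x) + h x * cnj (h1 x)) * w1 x * cnj (w x) + h x * cnj (h x) * w2 * cnj (w x) + h x * cnj (h x) * w1 x * cnj (w1 x)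
          + of_real ((2 * \<beta> - \<alpha>) / 2) * ((cnj (h1 x) * h1 x + cnj (h x) * h2) * w x * cnj (w x) + cnj (h x) * h1 x * (w1 x * cnj (w x) + w x * cnj (w1 x)))
          + of_real (\<alpha> / 2) * ((h1 x * h1 x + h x * h2) * cnj (w x) * cnj (w x) + 2 * h x * h1 x * cnj (w x) * cnj (w1 x))
          + of_real (\<alpha> / 2) * ((h1 x * w1 x + h x * w2) * cnj (w x) * cnj (w x) + 2 * h x * w1 x * cnj (w x) * cnj (w1 x))
          + of_real \<beta> * (cnj (h1 x) * w x * w1 x * cnj (w x) + cnj (h x) * w1 x * w1 x * cnj (w x) + cnj (h x) * w x * w2 * cnj (w x) + cnj (h x) * w x * w1 x * cnj (w1 x))
          - of_real (\<beta> / 2) * ((cnj (h1 x) * cnj (w1 x) + cnj (h x) * cnj w2) * w x * w x + 2 * cnj (h x) * cnj (w1 x) * w x * w1 x))) F"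
  unfolding F
  by (rule has_vector_derivative_eq_rhs, (rule has_vector_derivative_cmult has_vector_derivative_add has_vector_derivative_diff
        has_vector_derivative_mult has_vector_derivative_const has_vector_derivative_cnj assms[unfolded F])+, algebra)

lemma integral_le_of_derivative:
  fixes X k e :: "real \<Rightarrow> real"
  assumes "p \<le> q" "\<And>x. x \<in> {p..q} \<Longrightarrow> (X has_real_derivative X' x) (at x within {p..q})"
    and "k integrable_on {p..q}" "e integrable_on {p..q}"
    and "\<And>x. x \<in> {p..q} \<Longrightarrow> k x \<le> X' x + e x"
  shows "integral {p..q} k \<le> X q - X p + integral {p..q} e"
proof -
  have X: "(X' has_integral X q - X p) {p..q}"
    by (rule fundamental_theorem_of_calculus[OF assms(1)])
      (use assms(2) in \<open>simp add: has_real_derivative_iff_has_vector_derivative\<close>)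
  have "integral {p..q} k \<le> integral {p..q} (\<lambda>x. X' x + e x)"
    using X assms by (intro integral_le integrable_add) (auto simp: has_integral_integrable)
  also have "\<dots> = X q - X p + integral {p..q} e"
    using X assms(4) by (subst integral_add) (auto simp: has_integral_integrable integral_unique)
  finally show ?thesis .
qed

text \<open>Written through |z|^2, which is bilinear in z and its conjugate, so that its derivatives
  in x and its rate in time come from product rules.\<close>

definition weight :: "real \<Rightarrow> complex \<Rightarrow> real" where
  "weight \<sigma> z = ((cmod z)\<^sup>2) powr (- \<sigma>)"

definition weight' :: "real \<Rightarrow> complex \<Rightarrow> complex \<Rightarrow> real" where
  "weight' \<sigma> z z' = - \<sigma> * ((cmod z)\<^sup>2) powr (- \<sigma> - 1) * (2 * Re (cnj z * z'))"

lemma weight_nonneg: "weight \<sigma> z \<ge> 0"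
  by (simp add: weight_def)

text \<open>The derivative of the weight is the weight times a factor of size |z'| / |z|. For the
  x-derivative of h this is singular at the zero; for the time derivative of h, which is itself
  O(|h|), it is bounded. The proof of the energy estimate uses both cases.\<close>

lemma weight'_eq:
  assumes "z \<noteq> 0"
  obtains s where "weight' \<sigma> z z' = s * weight \<sigma> z" "s * (cmod z)\<^sup>2 = - \<sigma> * (2 * Re (cnj z * z'))"
    "\<bar>s\<bar> * cmod z \<le> 2 * \<bar>\<sigma>\<bar> * cmod z'"
proof -
  define s where "s = - \<sigma> * (2 * Re (cnj z * z')) / (cmod z)\<^sup>2"
  have "((cmod z)\<^sup>2) powr (- \<sigma> - 1) = ((cmod z)\<^sup>2) powr (- \<sigma>) / (cmod z)\<^sup>2"
    using assms by (simp add: powr_diff)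
  then have 1: "weight' \<sigma> z z' = s * weight \<sigma> z"
    by (simp add: weight'_def weight_def s_def)
  have 2: "s * (cmod z)\<^sup>2 = - \<sigma> * (2 * Re (cnj z * z'))" using assms by (simp add: s_def)
  have "(\<bar>s\<bar> * cmod z) * cmod z = \<bar>s * (cmod z)\<^sup>2\<bar>"
    by (simp add: abs_mult power2_eq_square)
  also have "\<dots> = 2 * \<bar>\<sigma>\<bar> * \<bar>Re (cnj z * z')\<bar>" unfolding 2 by (simp only: abs_mult abs_minus_cancel abs_numeral mult_ac)
  also have "\<dots> \<le> 2 * \<bar>\<sigma>\<bar> * (cmod z' * cmod z)"
    using abs_Re_le_cmod[of "cnj z * z'"] by (intro mult_left_mono) (auto simp: norm_mult mult.commute)
  finally have "\<bar>s\<bar> * cmod z \<le> 2 * \<bar>\<sigma>\<bar> * cmod z'" using assms by (simp add: mult.assoc[symmetric])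
  with 1 2 show ?thesis using that by blast
qed

lemma weight_has_derivative:
  assumes "(h has_vector_derivative h') (at x within S)" "h x \<noteq> 0"
  shows "((\<lambda>x. weight \<sigma> (h x)) has_real_derivative weight' \<sigma> (h x) h') (at x within S)"
proof -
  have eq: "(cmod z)\<^sup>2 = Re (z * cnj z)" for z
    by (simp flip: complex_norm_square)
  have "((\<lambda>x. Re (h x * cnj (h x))) has_real_derivative Re (h x * cnj h' + h' * cnj (h x))) (at x within S)"
    by (intro has_vector_derivative_Re has_vector_derivative_mult has_vector_derivative_cnj assms)
  moreover have "Re (h x * cnj h' + h' * cnj (h x)) = 2 * Re (cnj (h x) * h')" by simp
  ultimately have "((\<lambda>x. (cmod (h x))\<^sup>2) has_real_derivative 2 * Re (cnj (h x) * h')) (at x within S)"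
    by (simp only: eq)
  from DERIV_chain2[where f="\<lambda>r. r powr (-\<sigma>)", OF has_real_derivative_powr this]
  show ?thesis using assms(2) by (simp add: weight_def weight'_def)
qed

lemma energy_sum_aux:
  fixes a t y z q r u v :: real
  assumes "a = q + r" "q - y - z \<le> 7 * u + 8 * v" "r \<le> 3 * u" "t \<le> 2 * v" "0 \<le> u" "0 \<le> v"
  shows "2 * a + t - 2 * (y + z) \<le> 20 * u + 20 * v"
  using assms by (simp add: algebra_simps)

text \<open>Integration by parts in the weighted energy identity. The weight |h|^(-2 sigma) is the one for which the
  momentum terms Im (cnj w * w1), which w alone does not control, cancel.\<close>

lemma energy_fixed_time:
  fixes h h1 h2 w w1 w2 ht :: "real \<Rightarrow> complex"
  assumes pq: "p \<le> q" and sg: "\<sigma> = 1 - \<alpha> / 2 - \<beta>"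
    and h: "\<And>x. x \<in> {p..q} \<Longrightarrow> (h has_vector_derivative h1 x) (at x within {p..q})"
    and h1: "\<And>x. x \<in> {p..q} \<Longrightarrow> (h1 has_vector_derivative h2 x) (at x within {p..q})"
    and w: "\<And>x. x \<in> {p..q} \<Longrightarrow> (w has_vector_derivative w1 x) (at x within {p..q})"
    and w1: "\<And>x. x \<in> {p..q} \<Longrightarrow> (w1 has_vector_derivative w2 x) (at x within {p..q})"
    and h0: "\<And>x. x \<in> {p..q} \<Longrightarrow> h x \<noteq> 0"
    and Kh: "\<And>x. x \<in> {p..q} \<Longrightarrow> norm (h x) \<le> K \<and> norm (h1 x) \<le> K \<and> norm (h2 x) \<le> K"
    and Kf: "\<And>x. x \<in> {p..q} \<Longrightarrow> norm (h x + w x) \<le> K \<and> norm (h1 x + w1 x) \<le> K \<and> norm (h2 x + w2 x) \<le> K"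
    and L: "L = 1 + \<bar>\<alpha>\<bar> + \<bar>\<beta>\<bar> + norm \<mu>"
    and ht: "\<And>x. x \<in> {p..q} \<Longrightarrow> norm (ht x) \<le> L * K\<^sup>2 * norm (h x)"
    and ki: "(\<lambda>x. weight \<sigma> (h x) * (2 * Re (cnj (w x) * (\<i> * (NN \<alpha> \<beta> \<mu> (h x + w x) (h1 x + w1 x) (h2 x + w2 x)
          - NN \<alpha> \<beta> \<mu> (h x) (h1 x) (h2 x))))) + weight' \<sigma> (h x) (ht x) * (cmod (w x))\<^sup>2) integrable_on {p..q}"
    and ei: "(\<lambda>x. weight \<sigma> (h x) * (cmod (w x))\<^sup>2) integrable_on {p..q}"
    and bd: "\<And>x. x \<in> {p, q} \<Longrightarrow> weight \<sigma> (h x) * ((cmod (h x))\<^sup>2 * cmod (w x) * cmod (w1 x) + cmod (h x) * (cmod (w x))\<^sup>2) \<le> b"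
    and K1: "K \<ge> 1"
  shows "integral {p..q} (\<lambda>x. weight \<sigma> (h x) * (2 * Re (cnj (w x) * (\<i> * (NN \<alpha> \<beta> \<mu> (h x + w x) (h1 x + w1 x) (h2 x + w2 x)
          - NN \<alpha> \<beta> \<mu> (h x) (h1 x) (h2 x))))) + weight' \<sigma> (h x) (ht x) * (cmod (w x))\<^sup>2)
     \<le> 16 * L * K * b + 20 * (1 + \<bar>\<sigma>\<bar>) * L * K\<^sup>2 * integral {p..q} (\<lambda>x. weight \<sigma> (h x) * (cmod (w x))\<^sup>2)"
    (is "integral _ ?k \<le> _ + ?C * integral _ ?e")
proof -
  have K0: "0 \<le> K" using K1 by simp
  have L1: "L \<ge> 1" using L by simp
  define Yc where "Yc x = \<i> * (h x * cnj (h x) * w1 x * cnj (w x) + of_real ((2 * \<beta> - \<alpha>) / 2) * cnj (h x) * h1 x * w x * cnj (w x)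
          + of_real (\<alpha> / 2) * h x * h1 x * cnj (w x) * cnj (w x) + of_real (\<alpha> / 2) * h x * w1 x * cnj (w x) * cnj (w x)
          + of_real \<beta> * cnj (h x) * w x * w1 x * cnj (w x) - of_real (\<beta> / 2) * cnj (h x) * cnj (w1 x) * w x * w x)" for x
  define Y' where "Y' x = \<i> * ((h1 x * cnj (h x) + h x * cnj (h1 x)) * w1 x * cnj (w x) + h x * cnj (h x) * w2 x * cnj (w x) + h x * cnj (h x) * w1 x * cnj (w1 x)
          + of_real ((2 * \<beta> - \<alpha>) / 2) * ((cnj (h1 x) * h1 x + cnj (h x) * h2 x) * w x * cnj (w x) + cnj (h x) * h1 x * (w1 x * cnj (w x) + w x * cnj (w1 x)))
          + of_real (\<alpha> / 2) * ((h1 x * h1 x + h x * h2 x) * cnj (w x) * cnj (w x) + 2 * h x * h1 x * cnj (w x) * cnj (w1 x))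
          + of_real (\<alpha> / 2) * ((h1 x * w1 x + h x * w2 x) * cnj (w x) * cnj (w x) + 2 * h x * w1 x * cnj (w x) * cnj (w1 x))
          + of_real \<beta> * (cnj (h1 x) * w x * w1 x * cnj (w x) + cnj (h x) * w1 x * w1 x * cnj (w x) + cnj (h x) * w x * w2 x * cnj (w x) + cnj (h x) * w x * w1 x * cnj (w1 x))
          - of_real (\<beta> / 2) * ((cnj (h1 x) * cnj (w1 x) + cnj (h x) * cnj (w2 x)) * w x * w x + 2 * cnj (h x) * cnj (w1 x) * w x * w1 x))" for x
  have Y: "(Yc has_vector_derivative Y' x) (at x within {p..q})" if "x \<in> {p..q}" for x
    unfolding Yc_def[abs_def] Y'_def
    by (rule energy_antiderivative[OF h[OF that] h1[OF that] w[OF that] w1[OF that] refl])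
  \<comment> \<open>The factor 2 belongs to the rate 2 Re (cnj w * w_t) of |w|^2.\<close>
  define X where "X x = 2 * (weight \<sigma> (h x) * Re (Yc x))" for x
  define X' where "X' x = 2 * (weight' \<sigma> (h x) (h1 x) * Re (Yc x) + Re (Y' x) * weight \<sigma> (h x))" for x
  have Xd: "(X has_real_derivative X' x) (at x within {p..q})" if "x \<in> {p..q}" for x
    unfolding X_def[abs_def] X'_def
    by (intro DERIV_cmult DERIV_mult weight_has_derivative[OF h[OF that] h0[OF that]] has_vector_derivative_Re Y that)
  have kX: "?k x \<le> X' x + ?C * ?e x" if x: "x \<in> {p..q}" for x
  proof -
    obtain s where s: "weight' \<sigma> (h x) (h1 x) = s * weight \<sigma> (h x)" "s * (cmod (h x))\<^sup>2 = - \<sigma> * (2 * Re (cnj (h x) * h1 x))"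
      "\<bar>s\<bar> * cmod (h x) \<le> 2 * \<bar>\<sigma>\<bar> * cmod (h1 x)"
      using weight'_eq[OF h0[OF x]] by metis
    obtain st where st: "weight' \<sigma> (h x) (ht x) = st * weight \<sigma> (h x)"
      "\<bar>st\<bar> * cmod (h x) \<le> 2 * \<bar>\<sigma>\<bar> * cmod (ht x)"
      using weight'_eq[OF h0[OF x]] by metis
    have "\<bar>st\<bar> * cmod (h x) \<le> (2 * \<bar>\<sigma>\<bar> * (L * K\<^sup>2)) * cmod (h x)"
      using order_trans[OF st(2) mult_left_mono[OF ht[OF x], of "2 * \<bar>\<sigma>\<bar>"]] by (simp add: mult_ac)
    then have st': "\<bar>st\<bar> \<le> 2 * \<bar>\<sigma>\<bar> * (L * K\<^sup>2)" using h0[OF x] by simp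
    have s': "\<bar>s\<bar> * cmod (h x) \<le> 2 * \<bar>\<sigma>\<bar> * K"
      using s(3) Kh[OF x] by (meson abs_ge_zero mult_left_mono mult_nonneg_nonneg order_trans zero_le_numeral)
    have wK: "norm (w1 x) \<le> 2 * K" "norm (w2 x) \<le> 2 * K"
      using norm_triangle_ineq4[of "h1 x + w1 x" "h1 x"] norm_triangle_ineq4[of "h2 x + w2 x" "h2 x"] Kh[OF x] Kf[OF x] by auto
    define Q where "Q = h x * cnj (h x) * w2 x + (of_real \<alpha> * h x * cnj (h1 x) + 2 * of_real \<beta> * cnj (h x) * h1 x) * w1 x
        + of_real \<alpha> * h x * h1 x * cnj (w1 x) + (of_real \<alpha> * h x * cnj (w1 x) + of_real \<beta> * cnj (h x) * w1 x) * w1 x"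
    define Z where "Z = ZZ \<alpha> \<beta> \<mu> (h x) (h2 x) (w x) (h1 x + w1 x) (h2 x + w2 x)"
    define D where "D = NN \<alpha> \<beta> \<mu> (h x + w x) (h1 x + w1 x) (h2 x + w2 x) - NN \<alpha> \<beta> \<mu> (h x) (h1 x) (h2 x)"
    have D: "D = Q + Z" unfolding D_def Q_def Z_def by (rule NN_diff)
    have Zb: "norm Z \<le> 3 * L * K\<^sup>2 * norm (w x)" unfolding Z_def L
      by (rule ZZ_bound) (use Kh[OF x] Kf[OF x] in auto)
    have pw: "\<bar>Re (cnj (w x) * (\<i> * Q)) - s * Re (Yc x) - Re (Y' x)\<bar>
        \<le> (7 + 8 * \<bar>\<sigma>\<bar>) * (1 + \<bar>\<alpha>\<bar> + \<bar>\<beta>\<bar>) * K\<^sup>2 * (cmod (w x))\<^sup>2"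
      unfolding Q_def Yc_def Y'_def
      by (rule energy_pointwise[OF s(2) sg _ _ _ wK s']) (use Kh[OF x] in auto)
    also have "\<dots> \<le> (7 + 8 * \<bar>\<sigma>\<bar>) * L * K\<^sup>2 * (cmod (w x))\<^sup>2"
      unfolding L by (intro mult_right_mono mult_left_mono) auto
    finally have pw: "Re (cnj (w x) * (\<i> * Q)) - s * Re (Yc x) - Re (Y' x) \<le> (7 + 8 * \<bar>\<sigma>\<bar>) * L * K\<^sup>2 * (cmod (w x))\<^sup>2" by linarith
    have "Re (cnj (w x) * (\<i> * Z)) \<le> norm (cnj (w x) * (\<i> * Z))" by (rule complex_Re_le_cmod)
    also have "\<dots> \<le> norm (w x) * (3 * L * K\<^sup>2 * norm (w x))"
      using Zb by (simp add: norm_mult mult_left_mono)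
    finally have zz: "Re (cnj (w x) * (\<i> * Z)) \<le> 3 * L * K\<^sup>2 * (cmod (w x))\<^sup>2" by (simp add: power2_eq_square mult_ac)
    have "st * (cmod (w x))\<^sup>2 \<le> \<bar>st\<bar> * (cmod (w x))\<^sup>2" by (intro mult_right_mono) auto
    also have "\<dots> \<le> (2 * \<bar>\<sigma>\<bar> * (L * K\<^sup>2)) * (cmod (w x))\<^sup>2" using st' by (intro mult_right_mono) auto
    finally have stt: "st * (cmod (w x))\<^sup>2 \<le> 2 * \<bar>\<sigma>\<bar> * L * K\<^sup>2 * (cmod (w x))\<^sup>2" by (simp add: mult_ac)
    have sum: "2 * Re (cnj (w x) * (\<i> * D)) + st * (cmod (w x))\<^sup>2 - 2 * (s * Re (Yc x) + Re (Y' x))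
      \<le> ?C * (cmod (w x))\<^sup>2"
    proof -
      have A: "Re (cnj (w x) * (\<i> * D)) = Re (cnj (w x) * (\<i> * Q)) + Re (cnj (w x) * (\<i> * Z))"
        unfolding D distrib_left plus_complex.sel by (rule refl)
      define u where "u = L * K\<^sup>2 * (cmod (w x))\<^sup>2"
      have e: "(7 + 8 * \<bar>\<sigma>\<bar>) * L * K\<^sup>2 * (cmod (w x))\<^sup>2 = 7 * u + 8 * (\<bar>\<sigma>\<bar> * u)"
        "3 * L * K\<^sup>2 * (cmod (w x))\<^sup>2 = 3 * u" "2 * \<bar>\<sigma>\<bar> * L * K\<^sup>2 * (cmod (w x))\<^sup>2 = 2 * (\<bar>\<sigma>\<bar> * u)"
        "?C * (cmod (w x))\<^sup>2 = 20 * u + 20 * (\<bar>\<sigma>\<bar> * u)" by (simp_all add: u_def algebra_simps)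
      have p: "u \<ge> 0" "\<bar>\<sigma>\<bar> * u \<ge> 0" using L1 by (auto simp: u_def)
      show ?thesis unfolding e(4) by (rule energy_sum_aux[OF A pw[unfolded e] zz[unfolded e] stt[unfolded e] p])
    qed
    have "?k x - X' x = weight \<sigma> (h x) * (2 * Re (cnj (w x) * (\<i> * D)) + st * (cmod (w x))\<^sup>2 - 2 * (s * Re (Yc x) + Re (Y' x)))"
      unfolding X'_def s(1) st(1) D_def by (simp only: algebra_simps)
    also have "\<dots> \<le> weight \<sigma> (h x) * (?C * (cmod (w x))\<^sup>2)"
      by (rule mult_left_mono[OF sum weight_nonneg])
    finally show ?thesis by (simp add: mult_ac)
  qed
  \<comment> \<open>The values of the flux at the two ends are all that is left of it; the
    combination bounded by \<open>b\<close> is the one that the flatness of w makes small.\<close>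
  have Xb: "\<bar>X x\<bar> \<le> 8 * L * K * b" if "x \<in> {p, q}" for x
  proof -
    have x: "x \<in> {p..q}" using that pq by auto
    have n1: "norm (complex_of_real ((2 * \<beta> - \<alpha>) / 2)) \<le> \<bar>\<beta>\<bar> + \<bar>\<alpha>\<bar> / 2"
      unfolding norm_of_real by (simp add: field_simps abs_if)
    have n2: "norm (complex_of_real (\<alpha> / 2)) \<le> \<bar>\<alpha>\<bar> / 2" "norm (complex_of_real \<beta>) \<le> \<bar>\<beta>\<bar>"
      "norm (complex_of_real (\<beta> / 2)) \<le> \<bar>\<beta>\<bar> / 2" by simp_all
    have wK: "norm (w1 x) \<le> 2 * K"
      using norm_triangle_ineq4[of "h1 x + w1 x" "h1 x"] Kh[OF x] Kf[OF x] by auto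
    have cc: "norm (h x) \<le> norm (h x)" "norm (cnj (h x)) \<le> norm (h x)" "norm (w x) \<le> norm (w x)" "norm (cnj (w x)) \<le> norm (w x)"
      "norm (w1 x) \<le> norm (w1 x)" "norm (cnj (w1 x)) \<le> 2 * K" using wK by auto
    have hK: "norm (h1 x) \<le> K" using Kh[OF x] by auto
    let ?H = "norm (h x)" let ?W = "norm (w x)"
    have "norm (Yc x) \<le> 1 * (?H * ?H * norm (w1 x) * ?W + (\<bar>\<beta>\<bar> + \<bar>\<alpha>\<bar> / 2) * ?H * K * ?W * ?W
          + \<bar>\<alpha>\<bar> / 2 * ?H * K * ?W * ?W + \<bar>\<alpha>\<bar> / 2 * ?H * (2 * K) * ?W * ?W
          + \<bar>\<beta>\<bar> * ?H * ?W * (2 * K) * ?W + \<bar>\<beta>\<bar> / 2 * ?H * (2 * K) * ?W * ?W)"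
      unfolding Yc_def by (intro norm_diff_le norm_add_le norm_mult_le n1 n2 wK cc hK) simp
    also have "\<dots> = ?H\<^sup>2 * ?W * norm (w1 x) + (2 * \<bar>\<alpha>\<bar> + 4 * \<bar>\<beta>\<bar>) * (K * (?H * ?W\<^sup>2))"
      by (simp add: algebra_simps power2_eq_square)
    also have "\<dots> \<le> (4 * (L * K)) * (?H\<^sup>2 * ?W * norm (w1 x)) + (4 * L) * (K * (?H * ?W\<^sup>2))"
    proof (intro add_mono mult_right_mono)
      have "1 * 1 \<le> L * K" using L1 K1 by (intro mult_mono) auto
      then have "1 \<le> 4 * (L * K)" by simp
      then show "?H\<^sup>2 * ?W * norm (w1 x) \<le> (4 * (L * K)) * (?H\<^sup>2 * ?W * norm (w1 x))"
        using mult_right_mono[of 1 "4 * (L * K)" "?H\<^sup>2 * ?W * norm (w1 x)"] by simp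
      show "2 * \<bar>\<alpha>\<bar> + 4 * \<bar>\<beta>\<bar> \<le> 4 * L" using L by simp
    qed (use K0 in auto)
    finally have Yb: "norm (Yc x) \<le> 4 * L * K * (?H\<^sup>2 * ?W * norm (w1 x) + ?H * ?W\<^sup>2)" by (simp add: algebra_simps)
    have "\<bar>X x\<bar> = 2 * (weight \<sigma> (h x) * \<bar>Re (Yc x)\<bar>)"
      using weight_nonneg by (simp add: X_def abs_mult)
    also have "\<dots> \<le> 2 * (weight \<sigma> (h x) * (4 * L * K * (?H\<^sup>2 * ?W * norm (w1 x) + ?H * ?W\<^sup>2)))"
      using order_trans[OF abs_Re_le_cmod Yb] weight_nonneg by (intro mult_left_mono) auto
    also have "\<dots> = 8 * L * K * (weight \<sigma> (h x) * (?H\<^sup>2 * ?W * norm (w1 x) + ?H * ?W\<^sup>2))" by simp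
    also have "\<dots> \<le> 8 * L * K * b" using bd[OF that] L1 K0 by (intro mult_left_mono) auto
    finally show ?thesis .
  qed
  have "integral {p..q} ?k \<le> X q - X p + integral {p..q} (\<lambda>x. ?C * ?e x)"
    by (rule integral_le_of_derivative[OF pq Xd ki integrable_on_mult_right[OF ei] kX])
  also have "integral {p..q} (\<lambda>x. ?C * ?e x) = ?C * integral {p..q} ?e" by (rule integral_mult_right)
  finally show ?thesis using Xb[of p] Xb[of q] by simp
qed

section \<open>Duality with a wave\<close>

text \<open>All derivatives are moved from w to g, which vanishes to first order at both ends. The
  coupling with cnj w becomes one with w because a number and its conjugate have the same real part;
  this is where the conjugate of g enters. In the quadratic terms one factor w1 is integrated by
  parts and the other one serves as a coefficient. What stands next to w in the end is the residual
  of g in the adjoint equation.\<close>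

lemma duality_fixed_time:
  fixes h h1 h2 w w1 w2 g g1 g2 gt :: "real \<Rightarrow> complex" and e :: "real \<Rightarrow> real"
  assumes pq: "p \<le> q"
    and h: "\<And>x. x \<in> {p..q} \<Longrightarrow> (h has_vector_derivative h1 x) (at x within {p..q})"
    and h1: "\<And>x. x \<in> {p..q} \<Longrightarrow> (h1 has_vector_derivative h2 x) (at x within {p..q})"
    and w: "\<And>x. x \<in> {p..q} \<Longrightarrow> (w has_vector_derivative w1 x) (at x within {p..q})"
    and w1: "\<And>x. x \<in> {p..q} \<Longrightarrow> (w1 has_vector_derivative w2 x) (at x within {p..q})"
    and g: "\<And>x. x \<in> {p..q} \<Longrightarrow> (g has_vector_derivative g1 x) (at x within {p..q})"
    and g1: "\<And>x. x \<in> {p..q} \<Longrightarrow> (g1 has_vector_derivative g2 x) (at x within {p..q})"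
    and g0: "g p = 0" "g1 p = 0" "g q = 0" "g1 q = 0"
    and ki: "(\<lambda>x. Re (\<i> * (NN \<alpha> \<beta> \<mu> (h x + w x) (h1 x + w1 x) (h2 x + w2 x)
          - NN \<alpha> \<beta> \<mu> (h x) (h1 x) (h2 x)) * g x + w x * gt x)) integrable_on {p..q}"
    and ei: "e integrable_on {p..q}"
    and R: "\<And>x. x \<in> {p..q} \<Longrightarrow> norm (\<i> * ((h2 x * cnj (h x) + 2 * h1 x * cnj (h1 x) + h x * cnj (h2 x)) * g x
             + 2 * (h1 x * cnj (h x) + h x * cnj (h1 x)) * g1 x + h x * cnj (h x) * g2 x)
          - \<i> * ((of_real \<alpha> * (h1 x * cnj (h1 x) + h x * cnj (h2 x)) + 2 * of_real \<beta> * (cnj (h1 x) * h1 x + cnj (h x) * h2 x)) * g x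
             + (of_real \<alpha> * h x * cnj (h1 x) + 2 * of_real \<beta> * cnj (h x) * h1 x) * g1 x)
          + \<i> * cnj (of_real \<alpha> * (h1 x * h1 x + h x * h2 x) * g x + of_real \<alpha> * h x * h1 x * g1 x) + gt x
          - \<i> * ((of_real \<alpha> * (h1 x * cnj (w1 x) + h x * cnj (w2 x)) + of_real \<beta> * (cnj (h1 x) * w1 x + cnj (h x) * w2 x)) * g x
             + (of_real \<alpha> * h x * cnj (w1 x) + of_real \<beta> * cnj (h x) * w1 x) * g1 x)) * norm (w x)
        + norm (ZZ \<alpha> \<beta> \<mu> (h x) (h2 x) (w x) (h1 x + w1 x) (h2 x + w2 x)) * norm (g x) \<le> e x"
  shows "integral {p..q} (\<lambda>x. Re (\<i> * (NN \<alpha> \<beta> \<mu> (h x + w x) (h1 x + w1 x) (h2 x + w2 x)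
          - NN \<alpha> \<beta> \<mu> (h x) (h1 x) (h2 x)) * g x + w x * gt x)) \<le> integral {p..q} e"
    (is "integral _ ?k \<le> _")
proof -
  define Xc where "Xc x = \<i> * (h x * cnj (h x) * g x * w1 x - (h1 x * cnj (h x) + h x * cnj (h1 x)) * g x * w x
      - h x * cnj (h x) * g1 x * w x + (of_real \<alpha> * (h x * cnj (h1 x)) + 2 * of_real \<beta> * (cnj (h x) * h1 x)) * g x * w x
      + (of_real \<alpha> * (h x * cnj (w1 x)) + of_real \<beta> * (cnj (h x) * w1 x)) * g x * w x
      + of_real \<alpha> * (h x * h1 x) * g x * cnj (w x))" for x
  define X' where "X' x = \<i> * (h x * cnj (h x) * g x * w2 x + (h x * cnj (h x) * g1 x + (h1 x * cnj (h x) + h x * cnj (h1 x)) * g x) * w1 x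
      - ((h1 x * cnj (h x) + h x * cnj (h1 x)) * g x * w1 x + ((h1 x * cnj (h x) + h x * cnj (h1 x)) * g1 x
           + (h2 x * cnj (h x) + 2 * h1 x * cnj (h1 x) + h x * cnj (h2 x)) * g x) * w x)
      - (h x * cnj (h x) * g1 x * w1 x + (h x * cnj (h x) * g2 x + (h1 x * cnj (h x) + h x * cnj (h1 x)) * g1 x) * w x)
      + ((of_real \<alpha> * (h x * cnj (h1 x)) + 2 * of_real \<beta> * (cnj (h x) * h1 x)) * (g x * w1 x + g1 x * w x)
         + (of_real \<alpha> * (h1 x * cnj (h1 x) + h x * cnj (h2 x)) + 2 * of_real \<beta> * (cnj (h1 x) * h1 x + cnj (h x) * h2 x)) * g x * w x)
      + ((of_real \<alpha> * (h x * cnj (w1 x)) + of_real \<beta> * (cnj (h x) * w1 x)) * (g x * w1 x + g1 x * w x)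
         + (of_real \<alpha> * (h1 x * cnj (w1 x) + h x * cnj (w2 x)) + of_real \<beta> * (cnj (h1 x) * w1 x + cnj (h x) * w2 x)) * g x * w x)
      + (of_real \<alpha> * (h x * h1 x) * (g x * cnj (w1 x) + g1 x * cnj (w x)) + of_real \<alpha> * (h1 x * h1 x + h x * h2 x) * g x * cnj (w x)))" for x
  have Xd: "((\<lambda>x. Re (Xc x)) has_real_derivative Re (X' x)) (at x within {p..q})" if x: "x \<in> {p..q}" for x
  proof (rule has_vector_derivative_Re)
    show "(Xc has_vector_derivative X' x) (at x within {p..q})"
      unfolding Xc_def[abs_def] X'_def
      by (rule has_vector_derivative_eq_rhs, (rule has_vector_derivative_cmult has_vector_derivative_add has_vector_derivative_diff
          has_vector_derivative_mult has_vector_derivative_const has_vector_derivative_cnj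
          h[OF x] h1[OF x] w[OF x] w1[OF x] g[OF x] g1[OF x])+, algebra)
  qed
  have kX: "?k x \<le> Re (X' x) + e x" if x: "x \<in> {p..q}" for x
  proof -
    define dg where "dg = of_real \<alpha> * (h1 x * h1 x + h x * h2 x) * g x + of_real \<alpha> * h x * h1 x * g1 x"
    define R1 where "R1 = \<i> * ((h2 x * cnj (h x) + 2 * h1 x * cnj (h1 x) + h x * cnj (h2 x)) * g x
             + 2 * (h1 x * cnj (h x) + h x * cnj (h1 x)) * g1 x + h x * cnj (h x) * g2 x)
          - \<i> * ((of_real \<alpha> * (h1 x * cnj (h1 x) + h x * cnj (h2 x)) + 2 * of_real \<beta> * (cnj (h1 x) * h1 x + cnj (h x) * h2 x)) * g x
             + (of_real \<alpha> * h x * cnj (h1 x) + 2 * of_real \<beta> * cnj (h x) * h1 x) * g1 x)"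
    define R2 where "R2 = gt x
          - \<i> * ((of_real \<alpha> * (h1 x * cnj (w1 x) + h x * cnj (w2 x)) + of_real \<beta> * (cnj (h1 x) * w1 x + cnj (h x) * w2 x)) * g x
             + (of_real \<alpha> * h x * cnj (w1 x) + of_real \<beta> * cnj (h x) * w1 x) * g1 x)"
    define Z where "Z = ZZ \<alpha> \<beta> \<mu> (h x) (h2 x) (w x) (h1 x + w1 x) (h2 x + w2 x)"
    have Rx: "norm (R1 + \<i> * cnj dg + R2) * norm (w x) + norm Z * norm (g x) \<le> e x"
      using R[OF x] unfolding R1_def R2_def dg_def Z_def by (simp only: add_diff_eq)
    have "\<i> * (NN \<alpha> \<beta> \<mu> (h x + w x) (h1 x + w1 x) (h2 x + w2 x) - NN \<alpha> \<beta> \<mu> (h x) (h1 x) (h2 x)) * g x + w x * gt x - X' x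
       = (R1 + R2) * w x + (- \<i> * (dg * cnj (w x))) + \<i> * Z * g x"
      unfolding NN_diff Z_def[symmetric] unfolding R1_def R2_def X'_def dg_def by algebra
    then have "?k x - Re (X' x) = Re ((R1 + R2) * w x) + Re (- \<i> * (dg * cnj (w x))) + Re (\<i> * Z * g x)"
      unfolding minus_complex.sel[symmetric] plus_complex.sel[symmetric] by (simp only:)
    also have "Re (- \<i> * (dg * cnj (w x))) = Re (\<i> * cnj dg * w x)" by simp
    also have "Re ((R1 + R2) * w x) + Re (\<i> * cnj dg * w x) = Re ((R1 + \<i> * cnj dg + R2) * w x)"
      unfolding plus_complex.sel[symmetric] by (rule arg_cong[where f=Re]) algebra
    also have "\<dots> \<le> norm (R1 + \<i> * cnj dg + R2) * norm (w x)"
      unfolding norm_mult[symmetric] by (rule complex_Re_le_cmod)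
    also have "Re (\<i> * Z * g x) \<le> norm Z * norm (g x)"
      using complex_Re_le_cmod[of "\<i> * Z * g x"] by (simp only: norm_mult norm_ii mult_1)
    finally show ?thesis using Rx by linarith
  qed
  have "integral {p..q} ?k \<le> Re (Xc q) - Re (Xc p) + integral {p..q} e"
    by (rule integral_le_of_derivative[OF pq Xd ki ei kX])
  moreover have "Xc q = 0" "Xc p = 0" unfolding Xc_def g0 by simp_all
  ultimately show ?thesis by simp
qed

text \<open>Replacing h by its linearization a0 * x at the zero: on the packet, x <= 2 m^(-8) and t <= m^(-3) make the error
  of size m, against the frequency m^4.\<close>

lemma packet_pointwise:
  fixes h h1 h2 w1 w2 g g1 g2 gt a a0 :: complex and x t A K L m C \<Gamma> :: real
  assumes K: "K \<ge> 1" and m: "m \<ge> 1" and L: "L \<ge> 1 + \<bar>\<alpha>\<bar> + \<bar>\<beta>\<bar>"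
    and x: "0 < x" "x * m ^ 8 \<le> 2" and t: "0 \<le> t" "t * m ^ 3 \<le> 1"
    and h: "norm (h - a * x) \<le> K * x\<^sup>2" "norm (h1 - a) \<le> K * x" "norm h2 \<le> K" "norm h \<le> K * x" "norm h1 \<le> K"
    and a: "norm a \<le> K" "norm a0 \<le> K" "(norm a)\<^sup>2 = A" "norm (a - a0) \<le> L * K ^ 3 * t"
    and w: "norm w1 \<le> 2 * K * x" "norm w2 \<le> 2 * K"
    and g: "norm g \<le> \<Gamma>" "x * norm g1 \<le> m ^ 4 * \<Gamma>" "x\<^sup>2 * norm g2 \<le> m ^ 8 * \<Gamma>"
    and model: "norm (gt + \<i> * A * (x * (x * g2) + 4 * (x * g1) + 2 * g) - \<i> * of_real ((\<alpha> + 2 * \<beta>) * A) * (x * g1 + g)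
       + \<i> * \<alpha> * cnj (a0 * a0 * (x * g1 + g))) \<le> C * \<Gamma>"
  shows "norm (\<i> * ((h2 * cnj h + 2 * h1 * cnj h1 + h * cnj h2) * g
             + 2 * (h1 * cnj h + h * cnj h1) * g1 + h * cnj h * g2)
          - \<i> * ((of_real \<alpha> * (h1 * cnj h1 + h * cnj h2) + 2 * of_real \<beta> * (cnj h1 * h1 + cnj h * h2)) * g
             + (of_real \<alpha> * h * cnj h1 + 2 * of_real \<beta> * cnj h * h1) * g1)
          + \<i> * cnj (of_real \<alpha> * (h1 * h1 + h * h2) * g + of_real \<alpha> * h * h1 * g1) + gt
          - \<i> * ((of_real \<alpha> * (h1 * cnj w1 + h * cnj w2) + of_real \<beta> * (cnj h1 * w1 + cnj h * w2)) * g
             + (of_real \<alpha> * h * cnj w1 + of_real \<beta> * cnj h * w1) * g1)) \<le> (C + 90 * L\<^sup>2 * K ^ 4 * m) * \<Gamma>"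
proof -
  have G0: "0 \<le> \<Gamma>" using g(1) norm_ge_zero order_trans by blast
  have L1: "L \<ge> 1" "\<bar>\<alpha>\<bar> \<le> L" "\<bar>\<beta>\<bar> \<le> L" "\<bar>\<alpha>\<bar> + \<bar>\<beta>\<bar> \<le> L" "\<bar>\<alpha>\<bar> + 2 * \<bar>\<beta>\<bar> \<le> 2 * L" using L by auto
  have K0: "0 \<le> K" using K by simp
  have x0: "0 \<le> x" using x by simp
  define p where "p = h - a * x"
  define r where "r = h1 - a"
  have hp: "h = a * x + p" and hr: "h1 = a + r" by (simp_all add: p_def r_def)
  have pb: "norm p \<le> K * x\<^sup>2" and rb: "norm r \<le> K * x" using h by (simp_all add: p_def r_def)
  have cb: "norm (cnj p) \<le> K * x\<^sup>2" "norm (cnj r) \<le> K * x" "norm (cnj h) \<le> K * x" "norm (cnj h1) \<le> K"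
    "norm (cnj h2) \<le> K" "norm (cnj a) \<le> K" "norm (cnj w1) \<le> 2 * K * x" "norm (cnj w2) \<le> 2 * K"
    using pb rb h a w by simp_all
  have xb: "norm (complex_of_real x) \<le> x" using x by simp
  have aA: "a * cnj a = of_real A" using a(3) by (simp flip: complex_norm_square)
  have nb: "norm (2 :: complex) \<le> 2" by simp
  have alb: "norm (complex_of_real \<alpha>) \<le> \<bar>\<alpha>\<bar>" "norm (complex_of_real \<beta>) \<le> \<bar>\<beta>\<bar>" by simp_all
  \<comment> \<open>\<open>e\<close>, \<open>f\<close>, \<open>l\<close>, \<open>u\<close>,
    \<open>v\<close> are the errors in the products of h and h1 with each other or their conjugates,
    compared with the case h = a x. Each gains a power of x, and where a is replaced by
    \<open>a0\<close> there is also a part with a factor t.\<close>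
  define e where "e = p * cnj h + a * x * cnj p"
  have e: "h * cnj h = of_real (A * x\<^sup>2) + e"
    unfolding e_def by (subst (1) hp) (simp add: hp aA[symmetric] algebra_simps power2_eq_square)
  have eb: "norm e \<le> 2 * K\<^sup>2 * x ^ 3"
  proof -
    have "norm e \<le> K * x\<^sup>2 * (K * x) + K * x * (K * x\<^sup>2)"
      unfolding e_def by (intro norm_add_le norm_mult_le pb cb a xb)
    also have "\<dots> = 2 * K\<^sup>2 * x ^ 3" by (simp add: algebra_simps power2_eq_square power3_eq_cube)
    finally show ?thesis .
  qed
  define f where "f = r * cnj h + a * cnj p"
  have f: "h1 * cnj h = of_real (A * x) + f"
    unfolding f_def by (subst (1) hr) (simp add: hp aA[symmetric] algebra_simps)
  have fb: "norm f \<le> 2 * K\<^sup>2 * x\<^sup>2"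
  proof -
    have "norm f \<le> K * x * (K * x) + K * (K * x\<^sup>2)"
      unfolding f_def by (intro norm_add_le norm_mult_le rb cb a)
    also have "\<dots> = 2 * K\<^sup>2 * x\<^sup>2" by (simp add: algebra_simps power2_eq_square)
    finally show ?thesis .
  qed
  have f': "h * cnj h1 = of_real (A * x) + cnj f" using arg_cong[OF f, of cnj] by (simp add: mult.commute)
  have fb': "norm (cnj f) \<le> 2 * K\<^sup>2 * x\<^sup>2" using fb by simp
  define l where "l = r * cnj h1 + a * cnj r"
  have l: "h1 * cnj h1 = of_real A + l"
    unfolding l_def by (subst (1) hr) (simp add: hr aA[symmetric] algebra_simps)
  have lb: "norm l \<le> 2 * K\<^sup>2 * x"
  proof -
    have "norm l \<le> K * x * K + K * (K * x)"
      unfolding l_def by (intro norm_add_le norm_mult_le rb cb a)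
    also have "\<dots> = 2 * K\<^sup>2 * x" by (simp add: algebra_simps power2_eq_square)
    finally show ?thesis .
  qed
  \<comment> \<open>Only the product a * a sees the argument of a, so only here does the slope have
    to be frozen at its initial value; the modulus of a is constant in time.\<close>
  define d where "d = (a - a0) * a + a0 * (a - a0)"
  have d: "a * a = a0 * a0 + d" by (simp add: d_def algebra_simps)
  have db: "norm d \<le> 2 * L * K ^ 4 * t"
  proof -
    have "norm d \<le> L * K ^ 3 * t * K + K * (L * K ^ 3 * t)"
      unfolding d_def by (intro norm_add_le norm_mult_le a)
    also have "\<dots> = 2 * L * K ^ 4 * t" by (simp add: eval_nat_numeral)
    finally show ?thesis .
  qed
  define u where "u = r * h + a * p + d * x"
  have u: "h * h1 = a0 * a0 * x + u"
  proof -
    have "h * h1 = r * h + a * p + (a * a) * x" by (simp add: hr hp algebra_simps)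
    then show ?thesis unfolding u_def d by (simp add: algebra_simps)
  qed
  have ub: "norm u \<le> 2 * K\<^sup>2 * x\<^sup>2 + 2 * L * K ^ 4 * t * x"
  proof -
    have "norm u \<le> K * x * (K * x) + K * (K * x\<^sup>2) + 2 * L * K ^ 4 * t * x"
      unfolding u_def by (intro norm_add_le norm_mult_le rb pb h a xb db)
    also have "\<dots> = 2 * K\<^sup>2 * x\<^sup>2 + 2 * L * K ^ 4 * t * x" by (simp add: algebra_simps power2_eq_square)
    finally show ?thesis .
  qed
  define v where "v = r * h1 + a * r + d"
  have v: "h1 * h1 = a0 * a0 + v"
  proof -
    have "h1 * h1 = r * h1 + a * r + a * a" by (simp add: hr algebra_simps)
    then show ?thesis unfolding v_def d by (simp add: algebra_simps)
  qed
  have vb: "norm v \<le> 2 * K\<^sup>2 * x + 2 * L * K ^ 4 * t"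
  proof -
    have "norm v \<le> K * x * K + K * (K * x) + 2 * L * K ^ 4 * t"
      unfolding v_def by (intro norm_add_le norm_mult_le rb h a db)
    also have "\<dots> = 2 * K\<^sup>2 * x + 2 * L * K ^ 4 * t" by (simp add: algebra_simps power2_eq_square)
    finally show ?thesis .
  qed
  define M where "M = gt + \<i> * A * (x * (x * g2) + 4 * (x * g1) + 2 * g) - \<i> * of_real ((\<alpha> + 2 * \<beta>) * A) * (x * g1 + g)
       + \<i> * \<alpha> * cnj (a0 * a0 * (x * g1 + g))"
  define T1 where "T1 = (h2 * cnj h + 2 * l + h * cnj h2) * g + 2 * (f + cnj f) * g1 + e * g2"
  define T2 where "T2 = (of_real \<alpha> * (l + h * cnj h2) + 2 * of_real \<beta> * (l + cnj h * h2)) * g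
      + (of_real \<alpha> * cnj f + 2 * of_real \<beta> * f) * g1"
  define T3 where "T3 = of_real \<alpha> * (v + h * h2) * g + of_real \<alpha> * u * g1"
  define T4 where "T4 = (of_real \<alpha> * (h1 * cnj w1 + h * cnj w2) + of_real \<beta> * (cnj h1 * w1 + cnj h * w2)) * g
             + (of_real \<alpha> * h * cnj w1 + of_real \<beta> * cnj h * w1) * g1"
  have E1: "(h2 * cnj h + 2 * h1 * cnj h1 + h * cnj h2) * g + 2 * (h1 * cnj h + h * cnj h1) * g1 + h * cnj h * g2
      = of_real A * (x * (x * g2) + 4 * (x * g1) + 2 * g) + T1"
    unfolding T1_def e f f' mult.assoc[of 2 h1] l by (simp add: algebra_simps power2_eq_square)
  have E2: "(of_real \<alpha> * (h1 * cnj h1 + h * cnj h2) + 2 * of_real \<beta> * (cnj h1 * h1 + cnj h * h2)) * g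
             + (of_real \<alpha> * h * cnj h1 + 2 * of_real \<beta> * cnj h * h1) * g1
      = of_real ((\<alpha> + 2 * \<beta>) * A) * (x * g1 + g) + T2"
  proof -
    have c: "cnj h1 * h1 = of_real A + l" "cnj h * h1 = of_real (A * x) + f" using l f by (simp_all add: mult.commute)
    have c2: "of_real \<alpha> * h * cnj h1 = of_real \<alpha> * (of_real (A * x) + cnj f)"
      "2 * of_real \<beta> * cnj h * h1 = 2 * of_real \<beta> * (of_real (A * x) + f)"
      unfolding c(2)[symmetric] f'[symmetric] by (simp_all only: mult.assoc)
    show ?thesis unfolding T2_def c2 l c by (simp add: algebra_simps)
  qed
  have E3: "of_real \<alpha> * (h1 * h1 + h * h2) * g + of_real \<alpha> * h * h1 * g1
      = of_real \<alpha> * (a0 * a0 * (x * g1 + g)) + T3"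
    unfolding T3_def v mult.assoc[of "of_real \<alpha>" h h1] u by (simp add: algebra_simps)
  have R: "\<i> * ((h2 * cnj h + 2 * h1 * cnj h1 + h * cnj h2) * g
             + 2 * (h1 * cnj h + h * cnj h1) * g1 + h * cnj h * g2)
          - \<i> * ((of_real \<alpha> * (h1 * cnj h1 + h * cnj h2) + 2 * of_real \<beta> * (cnj h1 * h1 + cnj h * h2)) * g
             + (of_real \<alpha> * h * cnj h1 + 2 * of_real \<beta> * cnj h * h1) * g1)
          + \<i> * cnj (of_real \<alpha> * (h1 * h1 + h * h2) * g + of_real \<alpha> * h * h1 * g1) + gt
          - \<i> * ((of_real \<alpha> * (h1 * cnj w1 + h * cnj w2) + of_real \<beta> * (cnj h1 * w1 + cnj h * w2)) * g
             + (of_real \<alpha> * h * cnj w1 + of_real \<beta> * cnj h * w1) * g1)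
      = M + \<i> * (T1 - T2 + cnj T3 - T4)"
    unfolding E1 E2 E3 T4_def[symmetric] M_def complex_cnj_add complex_cnj_mult[of "of_real \<alpha>"] complex_cnj_complex_of_real
    by (simp only: of_real_mult of_real_power of_real_add) algebra
  have m1: "1 \<le> m ^ 4" "1 \<le> m ^ 8" "m ^ 4 \<le> m ^ 8" "0 < m" using m by (auto intro: power_increasing one_le_power)
  have x2: "x \<le> 2" "x * m ^ 4 \<le> 2"
  proof -
    have "x * 1 \<le> x * m ^ 8" "x * m ^ 4 \<le> x * m ^ 8"
      by (rule mult_left_mono[OF m1(2) x0], rule mult_left_mono[OF m1(3) x0])
    then show "x \<le> 2" "x * m ^ 4 \<le> 2" using x by linarith+
  qed
  have tm: "t * m ^ 4 \<le> m" "t \<le> m"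
  proof -
    have "t * m ^ 4 = (t * m ^ 3) * m" by (simp add: eval_nat_numeral)
    also have "\<dots> \<le> 1 * m" using t m1 by (intro mult_right_mono) auto
    finally show a: "t * m ^ 4 \<le> m" by simp
    have "t * 1 \<le> t * m ^ 4" by (rule mult_left_mono[OF m1(1) t(1)])
    then show "t \<le> m" using a by linarith
  qed
  have xg: "x * norm g \<le> 2 * \<Gamma>" using g(1) x2 x0 G0 by (intro mult_mono) auto
  have xg1: "x\<^sup>2 * norm g1 \<le> 2 * \<Gamma>"
  proof -
    have "x\<^sup>2 * norm g1 = x * (x * norm g1)" by (simp add: power2_eq_square)
    also have "\<dots> \<le> x * (m ^ 4 * \<Gamma>)" using g x0 by (intro mult_left_mono) auto
    also have "\<dots> = (x * m ^ 4) * \<Gamma>" by simp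
    also have "\<dots> \<le> 2 * \<Gamma>" using x2 G0 by (intro mult_right_mono) auto
    finally show ?thesis .
  qed
  \<comment> \<open>The critical term: the error x^3 in |h|^2 against the second derivative of the
    packet, kept bounded by x m^8 \<le> 2.\<close>
  have xg2: "x ^ 3 * norm g2 \<le> 2 * \<Gamma>"
  proof -
    have "x ^ 3 * norm g2 = x * (x\<^sup>2 * norm g2)" by (simp add: eval_nat_numeral)
    also have "\<dots> \<le> x * (m ^ 8 * \<Gamma>)" using g x0 by (intro mult_left_mono) auto
    also have "\<dots> = (x * m ^ 8) * \<Gamma>" by simp
    also have "\<dots> \<le> 2 * \<Gamma>" using x G0 by (intro mult_right_mono) auto
    finally show ?thesis .
  qed
  have tg: "t * norm g \<le> m * \<Gamma>" using g(1) tm t G0 m by (intro mult_mono) auto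
  have tg1: "t * (x * norm g1) \<le> m * \<Gamma>"
  proof -
    have "t * (x * norm g1) \<le> t * (m ^ 4 * \<Gamma>)" using g t by (intro mult_left_mono) auto
    also have "\<dots> = (t * m ^ 4) * \<Gamma>" by simp
    also have "\<dots> \<le> m * \<Gamma>" using tm G0 by (intro mult_right_mono) auto
    finally show ?thesis .
  qed
  have gg: "norm g \<le> norm g" "norm g1 \<le> norm g1" "norm g2 \<le> norm g2" by auto
  have B1: "norm T1 \<le> 32 * (K\<^sup>2 * \<Gamma>)"
  proof -
    have "norm T1 \<le> (K * (K * x) + 2 * (2 * K\<^sup>2 * x) + K * x * K) * norm g
        + 2 * (2 * K\<^sup>2 * x\<^sup>2 + 2 * K\<^sup>2 * x\<^sup>2) * norm g1 + 2 * K\<^sup>2 * x ^ 3 * norm g2"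
      unfolding T1_def by (intro norm_add_le norm_mult_le h cb lb fb fb' eb nb gg)
    also have "\<dots> = K\<^sup>2 * (6 * (x * norm g) + 8 * (x\<^sup>2 * norm g1) + 2 * (x ^ 3 * norm g2))"
      by (simp add: algebra_simps power2_eq_square)
    also have "\<dots> \<le> K\<^sup>2 * (32 * \<Gamma>)" using xg xg1 xg2 by (intro mult_left_mono) auto
    finally show ?thesis by simp
  qed
  have B2: "norm T2 \<le> 20 * (L * (K\<^sup>2 * \<Gamma>))"
  proof -
    have "norm T2 \<le> (\<bar>\<alpha>\<bar> * (2 * K\<^sup>2 * x + K * x * K) + 2 * \<bar>\<beta>\<bar> * (2 * K\<^sup>2 * x + K * x * K)) * norm g
        + (\<bar>\<alpha>\<bar> * (2 * K\<^sup>2 * x\<^sup>2) + 2 * \<bar>\<beta>\<bar> * (2 * K\<^sup>2 * x\<^sup>2)) * norm g1"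
      unfolding T2_def by (intro norm_add_le norm_mult_le h cb lb fb fb' nb alb gg)
    also have "\<dots> = (\<bar>\<alpha>\<bar> + 2 * \<bar>\<beta>\<bar>) * (K\<^sup>2 * (3 * (x * norm g) + 2 * (x\<^sup>2 * norm g1)))"
      by (simp add: algebra_simps power2_eq_square)
    also have "\<dots> \<le> (2 * L) * (K\<^sup>2 * (10 * \<Gamma>))" using xg xg1 L1 x0 by (intro mult_mono mult_left_mono) auto
    finally show ?thesis by simp
  qed
  have B3: "norm T3 \<le> 10 * (L * (K\<^sup>2 * \<Gamma>)) + 4 * (L\<^sup>2 * (K ^ 4 * (m * \<Gamma>)))"
  proof -
    have "norm T3 \<le> \<bar>\<alpha>\<bar> * (2 * K\<^sup>2 * x + 2 * L * K ^ 4 * t + K * x * K) * norm g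
        + \<bar>\<alpha>\<bar> * (2 * K\<^sup>2 * x\<^sup>2 + 2 * L * K ^ 4 * t * x) * norm g1"
      unfolding T3_def by (intro norm_add_le norm_mult_le h vb ub alb gg)
    also have "\<dots> = \<bar>\<alpha>\<bar> * (K\<^sup>2 * (3 * (x * norm g) + 2 * (x\<^sup>2 * norm g1)) + 2 * L * K ^ 4 * (t * norm g + t * (x * norm g1)))"
      by (simp add: algebra_simps power2_eq_square)
    also have "\<dots> \<le> L * (K\<^sup>2 * (10 * \<Gamma>) + 2 * L * K ^ 4 * (2 * (m * \<Gamma>)))"
      using xg xg1 tg tg1 L1 x0 t K0 by (intro mult_mono add_mono mult_left_mono) auto
    also have "\<dots> = 10 * (L * (K\<^sup>2 * \<Gamma>)) + 4 * (L\<^sup>2 * (K ^ 4 * (m * \<Gamma>)))" by (simp add: algebra_simps power2_eq_square)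
    finally show ?thesis .
  qed
  \<comment> \<open>The quadratic terms are no worse than the linear errors because w1 =
    O(x).\<close>
  have B4: "norm T4 \<le> 12 * (L * (K\<^sup>2 * \<Gamma>))"
  proof -
    have "norm T4 \<le> (\<bar>\<alpha>\<bar> * (K * (2 * K * x) + K * x * (2 * K)) + \<bar>\<beta>\<bar> * (K * (2 * K * x) + K * x * (2 * K))) * norm g
        + (\<bar>\<alpha>\<bar> * (K * x) * (2 * K * x) + \<bar>\<beta>\<bar> * (K * x) * (2 * K * x)) * norm g1"
      unfolding T4_def by (intro norm_add_le norm_mult_le h cb w alb gg)
    also have "\<dots> = (\<bar>\<alpha>\<bar> + \<bar>\<beta>\<bar>) * (K\<^sup>2 * (4 * (x * norm g) + 2 * (x\<^sup>2 * norm g1)))"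
      by (simp add: algebra_simps power2_eq_square)
    also have "\<dots> \<le> L * (K\<^sup>2 * (12 * \<Gamma>))" using xg xg1 L1 x0 by (intro mult_mono mult_left_mono) auto
    finally show ?thesis by simp
  qed
  define U where "U = L\<^sup>2 * (K ^ 4 * (m * \<Gamma>))"
  have U0: "K\<^sup>2 * \<Gamma> \<le> U" "L * (K\<^sup>2 * \<Gamma>) \<le> U"
  proof -
    have k2: "K\<^sup>2 \<le> K ^ 4" using K by (intro power_increasing) auto
    have l2: "1 \<le> L\<^sup>2" "L \<le> L\<^sup>2" using L1 by (auto simp: power2_eq_square intro: order_trans[OF _ mult_left_mono[of 1 L]])
    have "\<Gamma> \<le> m * \<Gamma>" using mult_right_mono[OF m G0] by simp
    then have km: "K\<^sup>2 * \<Gamma> \<le> K ^ 4 * (m * \<Gamma>)" using k2 G0 K0 by (intro mult_mono) auto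
    have p: "0 \<le> K\<^sup>2 * \<Gamma>" using G0 by simp
    show "K\<^sup>2 * \<Gamma> \<le> U" unfolding U_def using mult_mono[OF l2(1) km] p L1 by simp
    show "L * (K\<^sup>2 * \<Gamma>) \<le> U" unfolding U_def using mult_mono[OF l2(2) km] p L1 by simp
  qed
  have "norm (M + \<i> * (T1 - T2 + cnj T3 - T4)) \<le> C * \<Gamma> + 1 * (32 * (K\<^sup>2 * \<Gamma>) + 20 * (L * (K\<^sup>2 * \<Gamma>))
      + (10 * (L * (K\<^sup>2 * \<Gamma>)) + 4 * (L\<^sup>2 * (K ^ 4 * (m * \<Gamma>)))) + 12 * (L * (K\<^sup>2 * \<Gamma>)))"
    by (intro norm_add_le norm_mult_le norm_diff_le B1 B2 B4) (use model B3 in \<open>simp_all add: M_def\<close>)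
  also have "\<dots> \<le> C * \<Gamma> + 90 * U"
  proof -
    have aux: "c + 1 * (32 * a + 20 * b + (10 * b + 4 * u) + 12 * b) \<le> c + 90 * u"
      if "a \<le> u" "b \<le> u" "0 \<le> u" for a b c u :: real using that by (simp add: algebra_simps)
    have "0 \<le> U" using order_trans[OF _ U0(1), of 0] G0 by simp
    from aux[OF U0 this] show ?thesis unfolding U_def[symmetric] .
  qed
  also have "\<dots> = (C + 90 * L\<^sup>2 * K ^ 4 * m) * \<Gamma>" by (simp add: U_def algebra_simps)
  finally show ?thesis unfolding R .
qed

text \<open>In y = ln x the operator x^2 d_xx is d_yy - d_y, so a packet is x^s times an envelope
  moving with velocity - 2 A m^4 in y and a phase of frequency m^4. The second summand, with the
  opposite phase, is there to absorb the coupling to the complex conjugate.\<close>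

definition wave :: "real \<Rightarrow> real \<Rightarrow> real \<Rightarrow> (real \<Rightarrow> complex) \<Rightarrow> (real \<Rightarrow> complex) \<Rightarrow> real \<Rightarrow> real \<Rightarrow> complex" where
  "wave s A m P Q t x = of_real (x powr s) * (P (m ^ 8 * x * exp (2 * A * m ^ 4 * t)) * cis (m ^ 4 * ln (m ^ 8 * x) + A * m ^ 8 * t)
     + Q (m ^ 8 * x * exp (2 * A * m ^ 4 * t)) * cis (- (m ^ 4 * ln (m ^ 8 * x) + A * m ^ 8 * t)))"

lemma has_vector_derivative_compose_real:
  fixes P :: "real \<Rightarrow> complex"
  assumes "(z has_real_derivative z') (at x)" "(P has_vector_derivative P') (at (z x))"
  shows "((\<lambda>x. P (z x)) has_vector_derivative of_real z' * P') (at x)"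
  using vector_diff_chain_at[OF assms(1)[unfolded has_real_derivative_iff_has_vector_derivative] assms(2)]
  by (simp add: o_def scaleR_conv_of_real)

text \<open>The operator x d/dx preserves the form of a wave and acts on the envelopes only, so two
  applications give all the derivatives of the test function that are needed.\<close>

lemma wave_dx:
  fixes P P' Q Q' :: "real \<Rightarrow> complex"
  assumes x: "x > 0" and m: "m \<ge> 1"
    and P: "\<And>z. (P has_vector_derivative P' z) (at z)" and Q: "\<And>z. (Q has_vector_derivative Q' z) (at z)"
  shows "(wave s A m P Q t has_vector_derivative
    wave s A m (\<lambda>z. (s + \<i> * m ^ 4) * P z + z * P' z) (\<lambda>z. (s - \<i> * m ^ 4) * Q z + z * Q' z) t x / x) (at x)"
proof -
  define z where "z x = m ^ 8 * x * exp (2 * A * m ^ 4 * t)" for x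
  define \<theta> where "\<theta> x = m ^ 4 * ln (m ^ 8 * x) + A * m ^ 8 * t" for x
  have mp: "m ^ 8 * x > 0" using x m by simp
  have 1: "((\<lambda>x. complex_of_real (x powr s)) has_vector_derivative of_real (s * (x powr s / x))) (at x)"
  proof -
    have "((\<lambda>x. x powr s) has_real_derivative s * (x powr s / x)) (at x)"
      using x by (auto intro!: derivative_eq_intros simp: powr_diff)
    from has_vector_derivative_of_real[OF this] show ?thesis .
  qed
  have z: "(z has_real_derivative z x / x) (at x)"
    unfolding z_def[abs_def] using x by (auto intro!: derivative_eq_intros)
  have th: "(\<theta> has_real_derivative m ^ 4 / x) (at x)"
    unfolding \<theta>_def[abs_def] using x mp by (auto intro!: derivative_eq_intros simp: field_simps)
  have th': "((\<lambda>x. - \<theta> x) has_real_derivative - (m ^ 4 / x)) (at x)" by (rule DERIV_minus[OF th])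
  have "wave s A m P Q t = (\<lambda>x. of_real (x powr s) * (P (z x) * cis (\<theta> x) + Q (z x) * cis (- \<theta> x)))"
    by (simp add: fun_eq_iff wave_def z_def \<theta>_def)
  moreover have "((\<lambda>x. of_real (x powr s) * (P (z x) * cis (\<theta> x) + Q (z x) * cis (- \<theta> x))) has_vector_derivative
     of_real (x powr s) * ((P (z x) * ((m ^ 4 / x) *\<^sub>R (\<i> * cis (\<theta> x))) + of_real (z x / x) * P' (z x) * cis (\<theta> x))
       + (Q (z x) * ((- (m ^ 4 / x)) *\<^sub>R (\<i> * cis (- \<theta> x))) + of_real (z x / x) * Q' (z x) * cis (- \<theta> x)))
      + of_real (s * (x powr s / x)) * (P (z x) * cis (\<theta> x) + Q (z x) * cis (- \<theta> x))) (at x)"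
    by (intro has_vector_derivative_mult has_vector_derivative_add 1 has_vector_derivative_cis_compose th th'
        has_vector_derivative_compose_real z P Q)
  moreover have "of_real (x powr s) * ((P (z x) * ((m ^ 4 / x) *\<^sub>R (\<i> * cis (\<theta> x))) + of_real (z x / x) * P' (z x) * cis (\<theta> x))
       + (Q (z x) * ((- (m ^ 4 / x)) *\<^sub>R (\<i> * cis (- \<theta> x))) + of_real (z x / x) * Q' (z x) * cis (- \<theta> x)))
      + of_real (s * (x powr s / x)) * (P (z x) * cis (\<theta> x) + Q (z x) * cis (- \<theta> x))
    = wave s A m (\<lambda>z. (s + \<i> * m ^ 4) * P z + z * P' z) (\<lambda>z. (s - \<i> * m ^ 4) * Q z + z * Q' z) t x / x"
    using x unfolding wave_def z_def[symmetric] \<theta>_def[symmetric]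
    by (simp add: scaleR_conv_of_real field_simps)
  ultimately show ?thesis by simp
qed

lemma wave_dt:
  fixes P P' Q Q' :: "real \<Rightarrow> complex"
  assumes P: "\<And>z. (P has_vector_derivative P' z) (at z)" and Q: "\<And>z. (Q has_vector_derivative Q' z) (at z)"
  shows "((\<lambda>t. wave s A m P Q t x) has_vector_derivative
    wave s A m (\<lambda>z. 2 * complex_of_real A * complex_of_real m ^ 4 * (z * P' z) + \<i> * A * complex_of_real m ^ 8 * P z)
      (\<lambda>z. 2 * complex_of_real A * complex_of_real m ^ 4 * (z * Q' z) - \<i> * A * complex_of_real m ^ 8 * Q z) t x) (at t)"
proof -
  define z where "z t = m ^ 8 * x * exp (2 * A * m ^ 4 * t)" for t
  define \<theta> where "\<theta> t = m ^ 4 * ln (m ^ 8 * x) + A * m ^ 8 * t" for t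
  have z: "(z has_real_derivative 2 * A * m ^ 4 * z t) (at t)"
    unfolding z_def[abs_def] by (auto intro!: derivative_eq_intros)
  have th: "(\<theta> has_real_derivative A * m ^ 8) (at t)"
    unfolding \<theta>_def[abs_def] by (auto intro!: derivative_eq_intros)
  have th': "((\<lambda>x. - \<theta> x) has_real_derivative - (A * m ^ 8)) (at t)" by (rule DERIV_minus[OF th])
  have "((\<lambda>t. of_real (x powr s) * (P (z t) * cis (\<theta> t) + Q (z t) * cis (- \<theta> t))) has_vector_derivative
     of_real (x powr s) * ((P (z t) * ((A * m ^ 8) *\<^sub>R (\<i> * cis (\<theta> t))) + of_real (2 * A * m ^ 4 * z t) * P' (z t) * cis (\<theta> t))
       + (Q (z t) * ((- (A * m ^ 8)) *\<^sub>R (\<i> * cis (- \<theta> t))) + of_real (2 * A * m ^ 4 * z t) * Q' (z t) * cis (- \<theta> t)))) (at t)"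
    by (intro has_vector_derivative_mult has_vector_derivative_cmult has_vector_derivative_add has_vector_derivative_cis_compose th th'
        has_vector_derivative_compose_real z P Q)
  then show ?thesis unfolding wave_def z_def[symmetric] \<theta>_def[symmetric]
    by (rule has_vector_derivative_eq_rhs) (simp add: scaleR_conv_of_real algebra_simps)
qed

lemma wave_norm_le:
  assumes "norm (P (m ^ 8 * x * exp (2 * A * m ^ 4 * t))) + norm (Q (m ^ 8 * x * exp (2 * A * m ^ 4 * t))) \<le> B"
  shows "norm (wave s A m P Q t x) \<le> x powr s * B"
proof -
  have "norm (P (m ^ 8 * x * exp (2 * A * m ^ 4 * t)) * cis (m ^ 4 * ln (m ^ 8 * x) + A * m ^ 8 * t)
     + Q (m ^ 8 * x * exp (2 * A * m ^ 4 * t)) * cis (- (m ^ 4 * ln (m ^ 8 * x) + A * m ^ 8 * t))) \<le> B"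
    by (rule order_trans[OF norm_triangle_ineq]) (use assms in \<open>simp add: norm_mult\<close>)
  then show ?thesis unfolding wave_def norm_mult by (auto intro: mult_left_mono)
qed

text \<open>The terms of order \<xi>^2 cancel by the dispersion relation, those of order \<xi> with
  u by the choice of the group velocity, and those of order \<xi> with v by the choice of s. Here
  \<open>v\<close>, \<open>u\<close>, \<open>w\<close> stand for the envelope, z times its
  derivative and z^2 times its second derivative.\<close>

lemma model_P_identity:
  fixes s A \<sigma> \<alpha> \<beta> \<xi> :: real and v u w c b e :: complex
  assumes s: "s = - \<sigma> - 1 / 2" and sg: "\<sigma> = 1 - \<alpha> / 2 - \<beta>" and e: "e = s + \<i> * \<xi>"
  shows "2 * A * \<xi> * u + \<i> * A * \<xi>\<^sup>2 * v + \<i> * A * ((e * e * v + (2 * e + 1) * u + w) - (e * v + u) + 4 * (e * v + u) + 2 * v)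
      - \<i> * of_real ((\<alpha> + 2 * \<beta>) * A) * (e * v + u + v) + X
    = \<i> * A * ((s * s + (1 + 2 * \<sigma>) * s + 2 * \<sigma>) * v + u + w) + X"
proof -
  have ab: "\<alpha> + 2 * \<beta> = 2 - 2 * \<sigma>" using sg by simp
  have sg2: "\<sigma> = - s - 1 / 2" using s by simp
  show ?thesis unfolding ab e unfolding sg2
    by (simp add: algebra_simps power2_eq_square)
qed

text \<open>For the opposite phase the terms of order \<xi>^2 add up instead of cancelling. The
  coefficient b exploits this to remove the conjugate of the main wave, which is only of order
  \<xi>: so b is of order 1 / \<xi>, and the remaining terms of order \<xi> are harmless after
  multiplication by b.\<close>

lemma model_Q_identity:
  fixes s A \<sigma> \<alpha> \<beta> \<xi> :: real and v u w c b e :: complex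
  assumes s: "s = - \<sigma> - 1 / 2" and sg: "\<sigma> = 1 - \<alpha> / 2 - \<beta>" and e: "e = s - \<i> * \<xi>"
    and b: "2 * \<i> * A * \<xi> * b = \<alpha> * c"
  shows "b * (2 * A * \<xi> * u - \<i> * A * \<xi>\<^sup>2 * v + \<i> * A * ((e * e * v + (2 * e + 1) * u + w) - (e * v + u) + 4 * (e * v + u) + 2 * v)
      - \<i> * of_real ((\<alpha> + 2 * \<beta>) * A) * (e * v + u + v)) + \<i> * \<alpha> * c * (e * v + u + v)
    = b * (4 * A * \<xi> * u + \<i> * A * ((s * s + (1 + 2 * \<sigma>) * s + 2 * \<sigma>) * v + u + w)) + \<i> * \<alpha> * c * ((s + 1) * v + u)"
proof -
  have ab: "\<alpha> + 2 * \<beta> = 2 - 2 * \<sigma>" using sg by simp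
  have sg2: "\<sigma> = - s - 1 / 2" using s by simp
  have "2 * A * \<xi> * u - \<i> * A * \<xi>\<^sup>2 * v + \<i> * A * ((e * e * v + (2 * e + 1) * u + w) - (e * v + u) + 4 * (e * v + u) + 2 * v)
      - \<i> * of_real ((\<alpha> + 2 * \<beta>) * A) * (e * v + u + v)
     = 4 * A * \<xi> * u + \<i> * A * ((s * s + (1 + 2 * \<sigma>) * s + 2 * \<sigma>) * v + u + w) - \<xi> * v * (2 * \<i> * A * \<xi>)"
    unfolding ab e unfolding sg2 by (simp add: algebra_simps power2_eq_square)
  then have "b * (2 * A * \<xi> * u - \<i> * A * \<xi>\<^sup>2 * v + \<i> * A * ((e * e * v + (2 * e + 1) * u + w) - (e * v + u) + 4 * (e * v + u) + 2 * v)
      - \<i> * of_real ((\<alpha> + 2 * \<beta>) * A) * (e * v + u + v))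
     = b * (4 * A * \<xi> * u + \<i> * A * ((s * s + (1 + 2 * \<sigma>) * s + 2 * \<sigma>) * v + u + w)) - \<xi> * v * (2 * \<i> * A * \<xi> * b)"
    by (simp only: right_diff_distrib mult_ac)
  also have "\<dots> = b * (4 * A * \<xi> * u + \<i> * A * ((s * s + (1 + 2 * \<sigma>) * s + 2 * \<sigma>) * v + u + w)) - \<xi> * v * (\<alpha> * c)"
    by (simp only: b)
  finally have eq: "b * (2 * A * \<xi> * u - \<i> * A * \<xi>\<^sup>2 * v + \<i> * A * ((e * e * v + (2 * e + 1) * u + w) - (e * v + u) + 4 * (e * v + u) + 2 * v)
      - \<i> * of_real ((\<alpha> + 2 * \<beta>) * A) * (e * v + u + v))
     = b * (4 * A * \<xi> * u + \<i> * A * ((s * s + (1 + 2 * \<sigma>) * s + 2 * \<sigma>) * v + u + w)) - \<xi> * v * (\<alpha> * c)" .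
  have "\<i> * \<alpha> * c * (e * v + u + v) = \<i> * \<alpha> * c * ((s + 1) * v + u) + \<xi> * v * (\<alpha> * c)"
    unfolding e by (simp add: algebra_simps)
  then show ?thesis unfolding eq by simp
qed

lemma bump_derivatives_bounded:
  obtains V1 V2 B where "\<And>z. (bump has_real_derivative V1 z) (at z)" "\<And>z. (V1 has_real_derivative V2 z) (at z)"
    "continuous_on UNIV V2" "\<And>z. z < 1 \<or> z > 2 \<Longrightarrow> V1 z = 0 \<and> V2 z = 0" "B \<ge> 1"
    "\<And>z. \<bar>bump z\<bar> \<le> B \<and> \<bar>z * V1 z\<bar> \<le> B \<and> \<bar>z * z * V2 z\<bar> \<le> B"
proof -
  obtain V1 V2 where V: "\<And>z. (bump has_real_derivative V1 z) (at z)" "\<And>z. (V1 has_real_derivative V2 z) (at z)"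
    "continuous_on UNIV V2" using bump_has_derivatives by metis
  have lz: "f' = 0" if "(f has_real_derivative f') (at z)" "\<And>y. y \<in> S \<Longrightarrow> f y = 0" "open S" "z \<in> S" for f f' z S
  proof -
    have "(f has_real_derivative 0) (at z)"
      by (rule has_field_derivative_transform_within_open[of "\<lambda>_. 0" 0 z S]) (use that in auto)
    then show ?thesis using that(1) DERIV_unique by blast
  qed
  have op: "open ({..<1} \<union> {2<..} :: real set)" by (intro open_Un) auto
  have z1: "V1 z = 0" if "z < 1 \<or> z > 2" for z
    by (rule lz[OF V(1) _ op]) (use that in \<open>auto simp: bump_zero\<close>)
  have z2: "V2 z = 0" if "z < 1 \<or> z > 2" for z
    by (rule lz[OF V(2) _ op]) (use that in \<open>auto intro: z1\<close>)
  have "continuous_on UNIV bump"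
    by (intro continuous_at_imp_continuous_on ballI) (rule DERIV_isCont[OF V(1)])
  moreover have "continuous_on UNIV V1"
    by (intro continuous_at_imp_continuous_on ballI) (rule DERIV_isCont[OF V(2)])
  ultimately have c: "continuous_on {1..2} bump" "continuous_on {1..2} V1" "continuous_on {1..2} V2"
    using V(3) continuous_on_subset[OF _ subset_UNIV] by blast+
  have cN: "continuous_on {1..2} (\<lambda>z. \<bar>bump z\<bar> + \<bar>z * V1 z\<bar> + \<bar>z * z * V2 z\<bar>)"
    by (intro continuous_intros c)
  obtain N where N: "\<And>z. z \<in> {1..2} \<Longrightarrow> norm (\<bar>bump z\<bar> + \<bar>z * V1 z\<bar> + \<bar>z * z * V2 z\<bar>) \<le> N"
    using continuous_on_Icc_norm_bound[OF cN] by blast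
  have "\<bar>bump z\<bar> \<le> \<bar>N\<bar> + 1 \<and> \<bar>z * V1 z\<bar> \<le> \<bar>N\<bar> + 1 \<and> \<bar>z * z * V2 z\<bar> \<le> \<bar>N\<bar> + 1" for z
  proof (cases "z < 1 \<or> z > 2")
    case True
    then show ?thesis using z1[OF True] z2[OF True] by (auto simp: bump_zero)
  next
    case False
    then have "\<bar>\<bar>bump z\<bar> + \<bar>z * V1 z\<bar> + \<bar>z * z * V2 z\<bar>\<bar> \<le> N" using N[of z] by simp
    then show ?thesis by linarith
  qed
  moreover have "V1 z = 0 \<and> V2 z = 0" if "z < 1 \<or> z > 2" for z using z1[OF that] z2[OF that] by simp
  ultimately show ?thesis by (intro that[of V1 V2 "\<bar>N\<bar> + 1"] V) simp_all
qed

lemma continuous_on_wave: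
  assumes "continuous_on UNIV P" "continuous_on UNIV Q" "m \<ge> 1"
  shows "continuous_on {0<..} (wave s A m P Q t)" "continuous_on UNIV (\<lambda>t. wave s A m P Q t x)"
proof -
  have c: "continuous_on S (\<lambda>x. P (z x))" "continuous_on S (\<lambda>x. Q (z x))" if "continuous_on S z"
    for z :: "real \<Rightarrow> real" and S
    using continuous_on_compose2[OF assms(1) that] continuous_on_compose2[OF assms(2) that] by auto
  show "continuous_on {0<..} (wave s A m P Q t)"
    unfolding wave_def[abs_def] using assms(3)
    by (intro continuous_intros c) (auto simp: less_le)
  show "continuous_on UNIV (\<lambda>t. wave s A m P Q t x)"
    unfolding wave_def by (intro continuous_intros c)
qed

section \<open>The dual packet\<close>

text \<open>An approximate solution of the adjoint equation with h replaced by a0 x. Its residual is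
  bounded by C x^s without any power of m, although its derivatives are of size m^4 and m^8;
  \<open>\<Gamma>\<close> records size and support at once. That C is independent of m is the point,
  so the envelope and its scaled derivatives are bounded before m is fixed.\<close>

lemma packet_test_function:
  fixes A \<sigma> \<alpha> \<beta> s :: real and a0 :: complex
  assumes A: "A > 0" "(cmod a0)\<^sup>2 = A" and sg: "\<sigma> = 1 - \<alpha> / 2 - \<beta>" and s: "s = - \<sigma> - 1 / 2"
  obtains C where "C \<ge> 1" "\<And>m. m \<ge> 1 \<Longrightarrow> \<exists>g g1 g2 gt b. norm b \<le> C / m ^ 4
    \<and> (\<forall>x. g 0 x = of_real (x powr s * bump (m ^ 8 * x)) * (cis (m ^ 4 * ln (m ^ 8 * x)) + b * cis (- (m ^ 4 * ln (m ^ 8 * x)))))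
    \<and> (\<forall>t x. x > 0 \<longrightarrow> (g t has_vector_derivative g1 t x) (at x) \<and> (g1 t has_vector_derivative g2 t x) (at x)
          \<and> ((\<lambda>t. g t x) has_vector_derivative gt t x) (at t))
    \<and> (\<forall>t. continuous_on {0<..} (g2 t) \<and> continuous_on {0<..} (gt t)) \<and> (\<forall>x. continuous_on UNIV (\<lambda>t. gt t x))
    \<and> (\<forall>t x \<Gamma>. x > 0 \<longrightarrow> \<Gamma> = (if m ^ 8 * x * exp (2 * A * m ^ 4 * t) \<in> {1..2} then C * x powr s else 0) \<longrightarrow>
          norm (g t x) \<le> \<Gamma> \<and> x * norm (g1 t x) \<le> m ^ 4 * \<Gamma> \<and> x\<^sup>2 * norm (g2 t x) \<le> m ^ 8 * \<Gamma>
          \<and> norm (gt t x + \<i> * A * (x * (x * g2 t x) + 4 * (x * g1 t x) + 2 * g t x) - \<i> * of_real ((\<alpha> + 2 * \<beta>) * A) * (x * g1 t x + g t x)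
               + \<i> * \<alpha> * cnj (a0 * a0 * (x * g1 t x + g t x))) \<le> \<Gamma>)"
proof -
  obtain V1 V2 B where V: "\<And>z. (bump has_real_derivative V1 z) (at z)" "\<And>z. (V1 has_real_derivative V2 z) (at z)"
    "continuous_on UNIV V2" "\<And>z. z < 1 \<or> z > 2 \<Longrightarrow> V1 z = 0 \<and> V2 z = 0" and B: "B \<ge> 1"
    "\<And>z. \<bar>bump z\<bar> \<le> B \<and> \<bar>z * V1 z\<bar> \<le> B \<and> \<bar>z * z * V2 z\<bar> \<le> B"
    using bump_derivatives_bounded by metis
  define S where "S = \<bar>s\<bar> + 4"
  define k where "k = \<bar>s * s + (1 + 2 * \<sigma>) * s + 2 * \<sigma>\<bar> + 2"
  define C where "C = 1 + \<bar>\<alpha>\<bar> + 2 * (1 + \<bar>\<alpha>\<bar>) * S\<^sup>2 * B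
     + (A * k + \<bar>\<alpha>\<bar> * A * \<bar>\<alpha>\<bar> * S + \<bar>\<alpha>\<bar> * (4 * A) + \<bar>\<alpha>\<bar> * (A * k) + \<bar>\<alpha>\<bar> * A * S) * B"
  have S4: "S \<ge> 4" by (simp add: S_def)
  have k2: "k \<ge> 0" by (simp add: k_def)
  have Cge: "C \<ge> 1 + \<bar>\<alpha>\<bar>" "C \<ge> 2 * (1 + \<bar>\<alpha>\<bar>) * S\<^sup>2 * B"
    "C \<ge> (A * k + \<bar>\<alpha>\<bar> * A * \<bar>\<alpha>\<bar> * S + \<bar>\<alpha>\<bar> * (4 * A) + \<bar>\<alpha>\<bar> * (A * k) + \<bar>\<alpha>\<bar> * A * S) * B"
  proof -
    have "0 \<le> 2 * (1 + \<bar>\<alpha>\<bar>) * S\<^sup>2 * B" "0 \<le> (A * k + \<bar>\<alpha>\<bar> * A * \<bar>\<alpha>\<bar> * S + \<bar>\<alpha>\<bar> * (4 * A) + \<bar>\<alpha>\<bar> * (A * k) + \<bar>\<alpha>\<bar> * A * S) * B"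
      using A(1) S4 k2 B(1) by (auto intro!: mult_nonneg_nonneg add_nonneg_nonneg)
    then show "C \<ge> 1 + \<bar>\<alpha>\<bar>" "C \<ge> 2 * (1 + \<bar>\<alpha>\<bar>) * S\<^sup>2 * B"
    "C \<ge> (A * k + \<bar>\<alpha>\<bar> * A * \<bar>\<alpha>\<bar> * S + \<bar>\<alpha>\<bar> * (4 * A) + \<bar>\<alpha>\<bar> * (A * k) + \<bar>\<alpha>\<bar> * A * S) * B"
      unfolding C_def by linarith+
  qed
  show ?thesis
  proof (rule that)
    show "C \<ge> 1" using Cge(1) by simp
    fix m :: real assume m: "m \<ge> 1"
    define \<xi> where "\<xi> = m ^ 4"
    have xi: "\<xi> \<ge> 1" "m ^ 8 = \<xi>\<^sup>2" using m by (auto simp: \<xi>_def one_le_power simp flip: power_mult)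
    define c where "c = cnj (a0 * a0)"
    \<comment> \<open>The solution of the cancellation condition in
      \<open>model_Q_identity\<close>.\<close>
    define b where "b = of_real (\<alpha> / (2 * A * \<xi>)) * (- \<i> * c)"
    have nc: "norm c = A" using A(2) by (simp add: c_def norm_mult power2_eq_square)
    have nb: "norm b = \<bar>\<alpha>\<bar> / (2 * \<xi>)" using A xi nc by (simp add: b_def norm_mult norm_divide abs_mult)
    have nb1: "norm b \<le> \<bar>\<alpha>\<bar>" "norm b * \<xi> \<le> \<bar>\<alpha>\<bar>" "norm b \<le> C / \<xi>"
    proof -
      show "norm b * \<xi> \<le> \<bar>\<alpha>\<bar>" unfolding nb using xi by simp
      then have "norm b \<le> \<bar>\<alpha>\<bar> / \<xi>" using xi by (simp add: pos_le_divide_eq)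
      moreover have "\<bar>\<alpha>\<bar> / \<xi> \<le> \<bar>\<alpha>\<bar> / 1" using xi by (intro divide_left_mono) auto
      moreover have "\<bar>\<alpha>\<bar> / \<xi> \<le> C / \<xi>" using xi Cge(1) by (intro divide_right_mono) auto
      ultimately show "norm b \<le> \<bar>\<alpha>\<bar>" "norm b \<le> C / \<xi>" by simp_all
    qed
    have bc: "2 * \<i> * A * \<xi> * b = \<alpha> * c" using A xi by (simp add: b_def field_simps)
    define v where "v z = complex_of_real (bump z)" for z
    define d1 where "d1 z = complex_of_real (V1 z)" for z
    define d2 where "d2 z = complex_of_real (V2 z)" for z
    have v': "(v has_vector_derivative d1 z) (at z)" "(d1 has_vector_derivative d2 z) (at z)" for z
      unfolding v_def[abs_def] d1_def[abs_def] d2_def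
      by (rule has_vector_derivative_of_real[OF V(1)], rule has_vector_derivative_of_real[OF V(2)])
    define e where "e = s + \<i> * \<xi>"
    define e' where "e' = s - \<i> * \<xi>"
    have ee: "cnj e' = e" "cnj e = e'" by (simp_all add: e_def e'_def)
    \<comment> \<open>\<open>p1\<close> and \<open>p2\<close> are the envelopes after one and two
      applications of x d/dx, as functions of the exponent, which is \<open>e\<close> for the main
      phase and \<open>e'\<close> for the opposite one. The difference of the two applications is
      x^2 times the second derivative.\<close>
    define p1 where "p1 e z = e * v z + z * d1 z" for e z
    define p2 where "p2 e z = e * e * v z + (2 * e + 1) * (z * d1 z) + z * z * d2 z" for e z
    have p1': "(p1 e has_vector_derivative (e * d1 z + (z * d2 z + d1 z))) (at z)" for e z
      unfolding p1_def[abs_def]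
      by (rule has_vector_derivative_eq_rhs,
          (rule has_vector_derivative_cmult has_vector_derivative_add has_vector_derivative_mult v'
            has_vector_derivative_of_real[OF DERIV_ident])+) simp
    have cv: "continuous_on UNIV v" "continuous_on UNIV d1" "continuous_on UNIV d2"
      using v' V(3) by (auto simp: d2_def[abs_def] intro!: continuous_intros continuous_at_imp_continuous_on
          dest: has_vector_derivative_continuous)
    have cp: "continuous_on UNIV (p1 e)" "continuous_on UNIV (p2 e)" for e
      unfolding p1_def[abs_def] p2_def[abs_def] by (intro continuous_intros cv)+
    let ?W = "wave s A m"
    define g where "g = ?W v (\<lambda>z. b * v z)"
    define G1 where "G1 = ?W (p1 e) (\<lambda>z. b * p1 e' z)"
    define G2 where "G2 = ?W (p2 e) (\<lambda>z. b * p2 e' z)"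
    define g1 where "g1 t x = G1 t x / x" for t x
    define g2 where "g2 t x = (G2 t x - G1 t x) / x\<^sup>2" for t x
    define gt where "gt = ?W (\<lambda>z. 2 * complex_of_real A * complex_of_real m ^ 4 * (z * d1 z) + \<i> * A * complex_of_real m ^ 8 * v z)
       (\<lambda>z. 2 * complex_of_real A * complex_of_real m ^ 4 * (z * (b * d1 z)) - \<i> * A * complex_of_real m ^ 8 * (b * v z))"
    have gx: "(g t has_vector_derivative g1 t x) (at x)" if "x > 0" for t x
    proof -
      have eq: "(\<lambda>z. (complex_of_real s + \<i> * complex_of_real m ^ 4) * v z + z * d1 z) = p1 e" "(\<lambda>z. (complex_of_real s - \<i> * complex_of_real m ^ 4) * (b * v z) + z * (b * d1 z)) = (\<lambda>z. b * p1 e' z)"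
        by (auto simp: p1_def e_def e'_def \<xi>_def fun_eq_iff algebra_simps)
      from wave_dx[OF that m v'(1) has_vector_derivative_cmult[OF v'(1), of b], of s A t]
      show ?thesis unfolding eq g_def g1_def G1_def .
    qed
    have G1x: "(G1 t has_vector_derivative G2 t x / x) (at x)" if "x > 0" for t x
    proof -
      have eq: "(\<lambda>z. (complex_of_real s + \<i> * complex_of_real m ^ 4) * p1 e z + z * (e * d1 z + (z * d2 z + d1 z))) = p2 e"
        "(\<lambda>z. (complex_of_real s - \<i> * complex_of_real m ^ 4) * (b * p1 e' z) + z * (b * (e' * d1 z + (z * d2 z + d1 z)))) = (\<lambda>z. b * p2 e' z)"
        by (auto simp: p1_def p2_def e_def e'_def \<xi>_def fun_eq_iff algebra_simps)
      from wave_dx[OF that m p1'[of e] has_vector_derivative_cmult[OF p1'[of e'], of b], of s A t]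
      show ?thesis unfolding eq G1_def G2_def .
    qed
    have g1x: "(g1 t has_vector_derivative g2 t x) (at x)" if x: "x > 0" for t x
    proof -
      have "((\<lambda>x. inverse x) has_real_derivative - (inverse x * inverse x)) (at x)"
        using x by (auto intro!: derivative_eq_intros)
      from has_vector_derivative_mult[OF G1x[OF x, of t] has_vector_derivative_of_real[OF this]]
      show ?thesis unfolding g1_def[abs_def] g2_def using x
        by (simp add: divide_inverse power2_eq_square algebra_simps)
    qed
    have gtt: "((\<lambda>t. g t x) has_vector_derivative gt t x) (at t)" for t x
      unfolding g_def gt_def by (rule wave_dt[OF v'(1) has_vector_derivative_cmult[OF v'(1), of b]])
    have c2: "continuous_on {0<..} (g2 t)" for t
      unfolding g2_def[abs_def] G1_def G2_def
      by (intro continuous_intros continuous_on_wave m cp) auto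
    have ct: "continuous_on {0<..} (gt t)" "continuous_on UNIV (\<lambda>t. gt t x)" for t x
      unfolding gt_def by (intro continuous_on_wave continuous_intros m cv)+
    have g0: "g 0 x = of_real (x powr s * bump (m ^ 8 * x)) * (cis (m ^ 4 * ln (m ^ 8 * x)) + b * cis (- (m ^ 4 * ln (m ^ 8 * x))))" for x
      by (simp add: g_def wave_def v_def algebra_simps)
    have bounds: "norm (g t x) \<le> \<Gamma> \<and> x * norm (g1 t x) \<le> m ^ 4 * \<Gamma> \<and> x\<^sup>2 * norm (g2 t x) \<le> m ^ 8 * \<Gamma>
          \<and> norm (gt t x + \<i> * A * (x * (x * g2 t x) + 4 * (x * g1 t x) + 2 * g t x) - \<i> * of_real ((\<alpha> + 2 * \<beta>) * A) * (x * g1 t x + g t x)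
               + \<i> * \<alpha> * cnj (a0 * a0 * (x * g1 t x + g t x))) \<le> \<Gamma>"
      if x: "x > 0" and \<Gamma>: "\<Gamma> = (if m ^ 8 * x * exp (2 * A * m ^ 4 * t) \<in> {1..2} then C * x powr s else 0)" for t x \<Gamma>
    proof -
      define z where "z = m ^ 8 * x * exp (2 * A * m ^ 4 * t)"
      define th where "th = m ^ 4 * ln (m ^ 8 * x) + A * m ^ 8 * t"
      have xg1: "x * g1 t x = G1 t x" and xg2: "x * (x * g2 t x) = G2 t x - G1 t x"
        using x by (simp_all add: g1_def g2_def power2_eq_square)
      define u where "u = z * d1 z"
      define w where "w = z * z * d2 z"
      have P1: "p1 e z = e * v z + u" "p2 e z = e * e * v z + (2 * e + 1) * u + w" for e
        by (simp_all add: p1_def p2_def u_def w_def)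
      \<comment> \<open>\<open>Pm\<close> and \<open>Qm\<close> are the coefficients of the two
        phases in the residual. After the cancellations \<xi> occurs, explicitly or inside
        \<open>e\<close>, only next to b or its conjugate, which are O(1 / \<xi>).\<close>
      define Pm where "Pm = \<i> * A * ((s * s + (1 + 2 * \<sigma>) * s + 2 * \<sigma>) * v z + u + w) + \<i> * \<alpha> * c * cnj b * (e * v z + u + v z)"
      define Qm where "Qm = b * (4 * A * \<xi> * u + \<i> * A * ((s * s + (1 + 2 * \<sigma>) * s + 2 * \<sigma>) * v z + u + w)) + \<i> * \<alpha> * c * ((s + 1) * v z + u)"
      have wv: "?W P Q t x = of_real (x powr s) * (P z * cis th + Q z * cis (- th))" for P Q
        by (simp add: wave_def z_def th_def)
      have real: "cnj (v z) = v z" "cnj u = u" by (simp_all add: v_def u_def d1_def)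
      have m8: "complex_of_real m ^ 8 = \<xi>\<^sup>2" "complex_of_real m ^ 4 = \<xi>"
        using xi(2) by (metis of_real_power, simp add: \<xi>_def)
      define E where "E = cis th"
      define F where "F = cis (- th)"
      have cE: "cnj E = F" "cnj F = E" by (simp_all add: E_def F_def cis_cnj)
      define X where "X = complex_of_real (x powr s)"
      have cX: "cnj X = X" by (simp add: X_def)
      have model: "gt t x + \<i> * A * (x * (x * g2 t x) + 4 * (x * g1 t x) + 2 * g t x) - \<i> * of_real ((\<alpha> + 2 * \<beta>) * A) * (x * g1 t x + g t x)
               + \<i> * \<alpha> * cnj (a0 * a0 * (x * g1 t x + g t x)) = X * (Pm * E + Qm * F)"
      proof -
        note 1 = xg1 xg2
        have Pe: "Pm = 2 * A * \<xi> * u + \<i> * A * \<xi>\<^sup>2 * v z + \<i> * A * ((e * e * v z + (2 * e + 1) * u + w) - (e * v z + u) + 4 * (e * v z + u) + 2 * v z)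
            - \<i> * of_real ((\<alpha> + 2 * \<beta>) * A) * (e * v z + u + v z) + \<i> * \<alpha> * c * cnj b * (e * v z + u + v z)"
          unfolding Pm_def by (rule model_P_identity[OF s sg e_def, symmetric])
        have Qe: "Qm = b * (2 * A * \<xi> * u - \<i> * A * \<xi>\<^sup>2 * v z + \<i> * A * ((e' * e' * v z + (2 * e' + 1) * u + w) - (e' * v z + u) + 4 * (e' * v z + u) + 2 * v z)
            - \<i> * of_real ((\<alpha> + 2 * \<beta>) * A) * (e' * v z + u + v z)) + \<i> * \<alpha> * c * (e' * v z + u + v z)"
          unfolding Qm_def by (rule model_Q_identity[OF s sg e'_def bc, symmetric])
        have cc: "cnj (a0 * a0 * y) = c * cnj y" for y by (simp add: c_def)
        have cG: "cnj (X * ((e * v z + u) * E + b * (e' * v z + u) * F) + X * (v z * E + b * v z * F))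
           = X * (cnj b * (e * v z + u + v z) * E + (e' * v z + u + v z) * F)"
          unfolding complex_cnj_add complex_cnj_mult cX cE ee real by algebra
        have G1X: "G1 t x = X * ((e * v z + u) * E + b * (e' * v z + u) * F)"
          unfolding G1_def wv P1 X_def E_def F_def ..
        have gX: "g t x = X * (v z * E + b * v z * F)"
          unfolding g_def wv X_def E_def F_def ..
        have G2X: "G2 t x = X * ((e * e * v z + (2 * e + 1) * u + w) * E + b * (e' * e' * v z + (2 * e' + 1) * u + w) * F)"
          unfolding G2_def wv P1 X_def E_def F_def ..
        have gtX: "gt t x = X * ((2 * A * \<xi> * u + \<i> * A * \<xi>\<^sup>2 * v z) * E + b * (2 * A * \<xi> * u - \<i> * A * \<xi>\<^sup>2 * v z) * F)"
          unfolding gt_def wv X_def E_def F_def m8 u_def by (simp add: algebra_simps)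
        show ?thesis unfolding 1 cc Pe Qe unfolding G1X gX G2X gtX cG by algebra
      qed
      show ?thesis
      proof (cases "z \<in> {1..2}")
        case False
        then have "v z = 0" "u = 0" "w = 0" using V(4)[of z]
          by (auto simp: v_def u_def w_def d1_def d2_def bump_zero)
        then have "Pm = 0" "Qm = 0" "g t x = 0" "G1 t x = 0" "G2 t x = 0"
          unfolding Pm_def Qm_def g_def G1_def G2_def wv P1 by simp_all
        moreover have "\<Gamma> = 0" unfolding \<Gamma> z_def[symmetric] by (rule if_not_P[OF False])
        ultimately show ?thesis unfolding model by (simp add: g1_def g2_def)
      next
        case True
        then have G: "\<Gamma> = C * x powr s" unfolding \<Gamma> z_def by simp
        have xs: "0 \<le> x powr s" by simp
        have vb: "norm (v z) \<le> B" "norm u \<le> B" "norm w \<le> B"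
          using B(2)[of z] unfolding v_def u_def w_def d1_def d2_def of_real_mult[symmetric] norm_of_real by auto
        have sb: "norm (complex_of_real s) \<le> S - 4" by (simp add: S_def)
        have ix: "norm (\<i> * complex_of_real \<xi>) \<le> \<xi>" using xi by (simp add: norm_mult)
        \<comment> \<open>S exceeds |s| by 4 so that the exponent plus the small integers in the
          envelopes is still at most S \<xi>.\<close>
        have sx: "S - 4 + \<xi> + 3 \<le> S * \<xi>"
        proof -
          have "(S - 1) * 1 \<le> (S - 1) * \<xi>" using S4 xi by (intro mult_left_mono) auto
          then show ?thesis by (simp add: algebra_simps)
        qed
        have eb: "norm e \<le> S - 4 + \<xi>" "norm e' \<le> S - 4 + \<xi>"
          unfolding e_def e'_def by (intro norm_add_le norm_diff_le sb ix)+
        have one: "norm (1 :: complex) \<le> 1" "norm (2 :: complex) \<le> 2" by simp_all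
        have B0: "0 \<le> B" using B(1) by simp
        have q1: "norm (e * v z + u) \<le> S * \<xi> * B" if "norm e \<le> S - 4 + \<xi>" for e
        proof -
          have "norm (e * v z + u) \<le> (S - 4 + \<xi>) * B + B" by (intro norm_add_le norm_mult_le that vb)
          also have "\<dots> = (S - 4 + \<xi> + 1) * B" by (simp add: algebra_simps)
          also have "\<dots> \<le> S * \<xi> * B" using sx B0 by (intro mult_right_mono) auto
          finally show ?thesis .
        qed
        have q2: "norm (e * e * v z + (2 * e + 1) * u + w) \<le> (S * \<xi>)\<^sup>2 * B" if "norm e \<le> S - 4 + \<xi>" for e
        proof -
          let ?f = "S - 4 + \<xi>"
          have f0: "0 \<le> ?f" using S4 xi by simp
          have "norm (e * e * v z + (2 * e + 1) * u + w) \<le> ?f * ?f * B + (2 * ?f + 1) * B + B"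
            by (intro norm_add_le norm_mult_le that vb one)
          also have "\<dots> = ((?f + 1) * (?f + 1) + 1) * B" by (simp add: algebra_simps)
          also have "\<dots> \<le> ((?f + 3) * (?f + 3)) * B"
            using f0 B0 by (intro mult_right_mono) (auto simp: algebra_simps)
          also have "\<dots> \<le> ((S * \<xi>) * (S * \<xi>)) * B" using sx f0 B0 by (intro mult_right_mono mult_mono) auto
          finally show ?thesis by (simp add: power2_eq_square)
        qed
        have Sx1: "1 \<le> S * \<xi>" using mult_mono[of 1 S 1 \<xi>] S4 xi by simp
        have w1: "norm (?W P (\<lambda>z. b * Q z) t x) \<le> x powr s * ((1 + \<bar>\<alpha>\<bar>) * q)"
          if "norm (P z) \<le> q" "norm (Q z) \<le> q" for P Q q
        proof (rule wave_norm_le)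
          have q0: "0 \<le> q" using that(1) norm_ge_zero order_trans by blast
          have "norm (b * Q z) \<le> \<bar>\<alpha>\<bar> * q" by (rule norm_mult_le[OF nb1(1) that(2)])
          then show "norm (P (m ^ 8 * x * exp (2 * A * m ^ 4 * t))) + norm (b * Q (m ^ 8 * x * exp (2 * A * m ^ 4 * t))) \<le> (1 + \<bar>\<alpha>\<bar>) * q"
            using that(1) unfolding z_def by (simp add: algebra_simps)
        qed
        have ng: "norm (g t x) \<le> x powr s * ((1 + \<bar>\<alpha>\<bar>) * B)" unfolding g_def by (rule w1) (rule vb)+
        have nG1: "norm (G1 t x) \<le> x powr s * ((1 + \<bar>\<alpha>\<bar>) * (S * \<xi> * B))"
          unfolding G1_def by (rule w1) (unfold P1, (rule q1 eb)+)
        have nG2: "norm (G2 t x) \<le> x powr s * ((1 + \<bar>\<alpha>\<bar>) * ((S * \<xi>)\<^sup>2 * B))"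
          unfolding G2_def by (rule w1) (unfold P1, (rule q2 eb)+)
        define a1 where "a1 = (1 + \<bar>\<alpha>\<bar>) * B"
        have a0: "0 \<le> a1" using B0 by (simp add: a1_def)
        have SS: "1 \<le> S\<^sup>2" "S \<le> S\<^sup>2" using S4 by (auto simp: power2_eq_square intro: order_trans[OF _ mult_left_mono[of 1 S S]])
        have a1C: "2 * S\<^sup>2 * a1 \<le> C" using Cge(2) unfolding a1_def by (simp only: mult_ac)
        have aC: "a1 \<le> C" "S * a1 \<le> C"
        proof -
          have "1 * a1 \<le> S\<^sup>2 * a1" "S * a1 \<le> S\<^sup>2 * a1" by (rule mult_right_mono[OF SS(1) a0], rule mult_right_mono[OF SS(2) a0])
          moreover have "0 \<le> S\<^sup>2 * a1" using a0 by simp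
          ultimately show "a1 \<le> C" "S * a1 \<le> C" using a1C by linarith+
        qed
        have r1: "norm (g t x) \<le> \<Gamma>"
        proof -
          have "norm (g t x) \<le> x powr s * a1" using ng unfolding a1_def .
          also have "\<dots> \<le> x powr s * C" by (rule mult_left_mono[OF aC(1) xs])
          finally show ?thesis unfolding G by (simp only: mult.commute)
        qed
        have r2: "x * norm (g1 t x) \<le> m ^ 4 * \<Gamma>"
        proof -
          have "x * norm (g1 t x) = norm (G1 t x)" using x by (simp add: g1_def norm_divide)
          also have "\<dots> \<le> (x powr s * \<xi>) * (S * a1)" using nG1 unfolding a1_def by (simp only: mult_ac)
          also have "\<dots> \<le> (x powr s * \<xi>) * C" using aC(2) xs xi by (intro mult_left_mono) auto
          finally show ?thesis unfolding G by (simp add: \<xi>_def mult_ac)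
        qed
        have r3: "x\<^sup>2 * norm (g2 t x) \<le> m ^ 8 * \<Gamma>"
        proof -
          have "x\<^sup>2 * norm (g2 t x) = norm (G2 t x - G1 t x)" using x by (simp add: g2_def norm_divide norm_power)
          also have "\<dots> \<le> x powr s * ((S * \<xi>)\<^sup>2 * a1) + x powr s * ((S * \<xi>) * a1)"
            by (rule norm_diff_le) (use nG1 nG2 in \<open>simp_all only: a1_def mult_ac\<close>)
          also have "\<dots> \<le> x powr s * ((S * \<xi>)\<^sup>2 * a1) + x powr s * ((S * \<xi>)\<^sup>2 * a1)"
          proof -
            have "S * \<xi> \<le> (S * \<xi>)\<^sup>2" using Sx1 mult_left_mono[OF Sx1, of "S * \<xi>"] by (simp add: power2_eq_square)
            then show ?thesis using xs a0 by (intro add_left_mono mult_left_mono mult_right_mono) auto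
          qed
          also have "\<dots> = (x powr s * \<xi>\<^sup>2) * (2 * S\<^sup>2 * a1)" by (simp add: power_mult_distrib)
          also have "\<dots> \<le> (x powr s * \<xi>\<^sup>2) * C" using a1C xs by (intro mult_left_mono) auto
          finally show ?thesis unfolding G xi(2) by (simp add: mult_ac)
        qed
        have A0: "0 \<le> A" using A by simp
        have cons: "norm (complex_of_real (s * s + (1 + 2 * \<sigma>) * s + 2 * \<sigma>)) \<le> k - 2" "norm (complex_of_real \<alpha>) \<le> \<bar>\<alpha>\<bar>" "norm c \<le> A"
          "norm (complex_of_real A) \<le> A" "norm \<i> \<le> 1" "norm (4 :: complex) \<le> 4" "norm (cnj b) \<le> norm b" "norm b \<le> norm b"
          "norm (complex_of_real \<xi>) \<le> \<xi>"
          using nc A xi unfolding norm_of_real by (auto simp: k_def)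
        have sb1: "norm (complex_of_real (s + 1)) \<le> S - 3"
          unfolding norm_of_real by (simp add: S_def)
        have m1: "norm (complex_of_real (s * s + (1 + 2 * \<sigma>) * s + 2 * \<sigma>) * v z + u + w) \<le> (k - 2) * B + B + B"
          by (intro norm_add_le norm_mult_le cons vb)
        have Pb: "norm Pm \<le> 1 * A * ((k - 2) * B + B + B) + 1 * \<bar>\<alpha>\<bar> * A * norm b * (S * \<xi> * B)"
          unfolding Pm_def
        proof (intro norm_add_le[of "\<i> * complex_of_real A * _"] norm_mult_le cons m1)
          have "norm (e * v z + u + v z) \<le> (S - 4 + \<xi>) * B + B + B" by (intro norm_add_le norm_mult_le eb vb)
          also have "\<dots> = (S - 4 + \<xi> + 2) * B" by (simp add: algebra_simps)
          also have "\<dots> \<le> S * \<xi> * B" using sx B0 by (intro mult_right_mono) auto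
          finally show "norm (e * v z + u + v z) \<le> S * \<xi> * B" .
        qed
        have c4: "norm (complex_of_real (4 * A * \<xi>)) \<le> 4 * A * \<xi>"
          using A0 xi unfolding norm_of_real by simp
        have Qb: "norm Qm \<le> norm b * (4 * A * \<xi> * B + 1 * A * ((k - 2) * B + B + B)) + 1 * \<bar>\<alpha>\<bar> * A * ((S - 3) * B + B)"
          unfolding Qm_def by (intro norm_add_le norm_mult_le cons m1 sb1 vb c4)
        have "norm (Pm * E + Qm * F) \<le> norm Pm + norm Qm"
          by (rule order_trans[OF norm_triangle_ineq]) (simp add: norm_mult E_def F_def)
        also have "\<dots> \<le> A * k * B + \<bar>\<alpha>\<bar> * A * (norm b * \<xi>) * S * B + (norm b * \<xi>) * (4 * A) * B + norm b * (A * k) * B + \<bar>\<alpha>\<bar> * A * (S - 2) * B"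
          using add_mono[OF Pb Qb] by (simp add: algebra_simps)
        also have "\<dots> \<le> A * k * B + \<bar>\<alpha>\<bar> * A * \<bar>\<alpha>\<bar> * S * B + \<bar>\<alpha>\<bar> * (4 * A) * B + \<bar>\<alpha>\<bar> * (A * k) * B + \<bar>\<alpha>\<bar> * A * S * B"
          using nb1 A0 B0 S4 k2 xi by (intro add_mono mult_right_mono mult_left_mono) auto
        also have "\<dots> \<le> C" using Cge(3) by (simp add: algebra_simps)
        finally have "x powr s * norm (Pm * E + Qm * F) \<le> x powr s * C" by (rule mult_left_mono[OF _ xs])
        then have r4: "norm (X * (Pm * E + Qm * F)) \<le> \<Gamma>" unfolding G X_def norm_mult by (simp add: mult.commute)
        show ?thesis unfolding model using r1 r2 r3 r4 by blast
      qed
    qed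
    show "\<exists>g g1 g2 gt b. norm b \<le> C / m ^ 4
    \<and> (\<forall>x. g 0 x = of_real (x powr s * bump (m ^ 8 * x)) * (cis (m ^ 4 * ln (m ^ 8 * x)) + b * cis (- (m ^ 4 * ln (m ^ 8 * x)))))
    \<and> (\<forall>t x. x > 0 \<longrightarrow> (g t has_vector_derivative g1 t x) (at x) \<and> (g1 t has_vector_derivative g2 t x) (at x)
          \<and> ((\<lambda>t. g t x) has_vector_derivative gt t x) (at t))
    \<and> (\<forall>t. continuous_on {0<..} (g2 t) \<and> continuous_on {0<..} (gt t)) \<and> (\<forall>x. continuous_on UNIV (\<lambda>t. gt t x))
    \<and> (\<forall>t x \<Gamma>. x > 0 \<longrightarrow> \<Gamma> = (if m ^ 8 * x * exp (2 * A * m ^ 4 * t) \<in> {1..2} then C * x powr s else 0) \<longrightarrow>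
          norm (g t x) \<le> \<Gamma> \<and> x * norm (g1 t x) \<le> m ^ 4 * \<Gamma> \<and> x\<^sup>2 * norm (g2 t x) \<le> m ^ 8 * \<Gamma>
          \<and> norm (gt t x + \<i> * A * (x * (x * g2 t x) + 4 * (x * g1 t x) + 2 * g t x) - \<i> * of_real ((\<alpha> + 2 * \<beta>) * A) * (x * g1 t x + g t x)
               + \<i> * \<alpha> * cnj (a0 * a0 * (x * g1 t x + g t x))) \<le> \<Gamma>)"
      by (rule exI[of _ g], rule exI[of _ g1], rule exI[of _ g2], rule exI[of _ gt], rule exI[of _ b],
          rule conjI, rule nb1(3)[unfolded \<xi>_def], rule conjI, intro allI, rule g0,
          rule conjI, intro allI impI conjI, erule gx, erule g1x, rule gtt,
          rule conjI, intro allI conjI, rule c2, rule ct(1), rule conjI, intro allI, rule ct(2),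
          intro allI impI, rule bounds)
  qed
qed

section \<open>Solutions near a degenerate zero\<close>

text \<open>The x-derivatives are carried as a family \<open>u j\<close> under a single bound K: two
  solutions are then compared with the same constants, and the degenerate point can be moved to 0 by
  a translation.\<close>

definition nls_sol :: "real \<Rightarrow> real \<Rightarrow> complex \<Rightarrow> nat \<Rightarrow> real \<Rightarrow> real \<Rightarrow> (nat \<Rightarrow> real \<Rightarrow> real \<Rightarrow> complex) \<Rightarrow> bool" where
  "nls_sol \<alpha> \<beta> \<mu> k T K u \<longleftrightarrow>
    (\<forall>t\<in>{0..T}. \<forall>x. (\<forall>j<k. (u j t has_vector_derivative u (Suc j) t x) (at x)) \<and>
       (\<forall>j\<le>k. isCont (u j t) x \<and> norm (u j t x) \<le> K \<and> u j t (x + 2 * pi) = u j t x)) \<and>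
    (\<forall>x. has_rate T (\<lambda>t. u 0 t x) (\<lambda>t. \<i> * NN \<alpha> \<beta> \<mu> (u 0 t x) (u 1 t x) (u 2 t x)))"

lemma nls_solD:
  assumes "nls_sol \<alpha> \<beta> \<mu> k T K u"
  shows "t \<in> {0..T} \<Longrightarrow> j < k \<Longrightarrow> (u j t has_vector_derivative u (Suc j) t x) (at x)"
    and "t \<in> {0..T} \<Longrightarrow> j \<le> k \<Longrightarrow> isCont (u j t) x"
    and "t \<in> {0..T} \<Longrightarrow> j \<le> k \<Longrightarrow> norm (u j t x) \<le> K"
    and "t \<in> {0..T} \<Longrightarrow> j \<le> k \<Longrightarrow> u j t (x + 2 * pi) = u j t x"
    and "has_rate T (\<lambda>t. u 0 t x) (\<lambda>t. \<i> * NN \<alpha> \<beta> \<mu> (u 0 t x) (u 1 t x) (u 2 t x))"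
  using assms unfolding nls_sol_def by blast+

lemma has_rate_mono:
  assumes "has_rate T u k" "0 \<le> T'" "T' \<le> T"
  shows "has_rate T' u k"
proof -
  obtain M where M: "\<And>\<tau>. \<tau> \<in> {0..T} \<Longrightarrow> norm (k \<tau>) \<le> M" using has_rate_bounded[OF assms(1)] by blast
  show ?thesis unfolding has_rate_def
  proof (intro conjI exI[of _ M] ballI)
    show "set_integrable lborel {0..T'} k"
      by (rule set_integrable_Icc_mono[OF has_rate_integrable[OF assms(1)]]) (use assms in auto)
    show "norm (k \<tau>) \<le> M" if "\<tau> \<in> {0..T'}" for \<tau> using M that assms by auto
    show "u t = u 0 + (LINT \<tau>:{0..t}|lborel. k \<tau>)" if "t \<in> {0..T'}" for t
      by (rule has_rate_eq[OF assms(1)]) (use that assms in auto)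
  qed
qed

lemma nls_sol_mono:
  assumes "nls_sol \<alpha> \<beta> \<mu> k T K u" "0 \<le> T'" "T' \<le> T"
  shows "nls_sol \<alpha> \<beta> \<mu> k T' K u"
proof -
  have "{0..T'} \<subseteq> {0..T}" using assms by auto
  then show ?thesis using assms has_rate_mono[OF nls_solD(5)[OF assms(1)] assms(2,3)]
    unfolding nls_sol_def by blast
qed

lemma has_rate_norm_diff_le:
  assumes "has_rate T u k" "t \<in> {0..T}" "\<And>\<tau>. \<tau> \<in> {0..T} \<Longrightarrow> norm (k \<tau>) \<le> M"
  shows "norm (u t - u 0) \<le> M * t"
  using has_rate_lipschitz[OF assms(1,3), of 0 t] assms(2) by simp

text \<open>This replaces Gronwall on short times. The supremum S of f is finite beforehand, and S
  \<le> a + S / 2 gives S \<le> 2 a; the argument applies to functions of time that are merely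
  bounded above.\<close>

lemma sup_absorb:
  fixes f :: "real \<Rightarrow> real"
  assumes "\<And>t. t \<in> {0..T} \<Longrightarrow> f t \<le> B"
    and "\<And>S t. (\<And>s. s \<in> {0..T} \<Longrightarrow> f s \<le> S) \<Longrightarrow> t \<in> {0..T} \<Longrightarrow> f t \<le> a + S / 2"
    and t: "t \<in> {0..T}"
  shows "f t \<le> 2 * a"
proof -
  define S where "S = (SUP s\<in>{0..T}. f s)"
  have bdd: "bdd_above (f ` {0..T})" using assms(1) by (auto simp: bdd_above_def intro!: exI[of _ B])
  have S: "f s \<le> S" if "s \<in> {0..T}" for s
    unfolding S_def by (rule cSUP_upper[OF that bdd])
  have "S \<le> a + S / 2"
    unfolding S_def by (rule cSUP_least) (use t assms(2)[OF S] in \<open>auto simp: S_def\<close>)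
  then show ?thesis using S[OF t] by simp
qed

text \<open>The rate at x is O(|u|) at the same x, so the supremum of |u| over the short time
  interval is controlled by the initial value there. In particular zeros stay zeros and nonzero
  values stay nonzero.\<close>

lemma nls_sol_comparable:
  assumes u: "nls_sol \<alpha> \<beta> \<mu> k T K u" and k: "k \<ge> 2" and t: "t \<in> {0..T}"
    and L: "L = 1 + \<bar>\<alpha>\<bar> + \<bar>\<beta>\<bar> + norm \<mu>" and small: "L * K\<^sup>2 * T \<le> 1 / 4"
  shows "norm (u 0 t x - u 0 0 x) \<le> norm (u 0 0 x) / 2"
proof -
  have T0: "0 \<in> {0..T}" using t by auto
  have L0: "0 \<le> L * K\<^sup>2" using L by simp
  have inc: "norm (u 0 t x - u 0 0 x) \<le> S / 4" if S: "\<And>s. s \<in> {0..T} \<Longrightarrow> norm (u 0 s x) \<le> S" and t: "t \<in> {0..T}" for S t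
  proof -
    have S0: "0 \<le> S" using S[OF t] norm_ge_zero order_trans by blast
    have "norm (u 0 t x - u 0 0 x) \<le> (L * K\<^sup>2 * S) * t"
    proof (rule has_rate_norm_diff_le[OF nls_solD(5)[OF u] t])
      fix \<tau> assume \<tau>: "\<tau> \<in> {0..T}"
      have "norm (\<i> * NN \<alpha> \<beta> \<mu> (u 0 \<tau> x) (u 1 \<tau> x) (u 2 \<tau> x)) \<le> L * K\<^sup>2 * norm (u 0 \<tau> x)"
        unfolding norm_mult L using k by (simp, intro NN_bound nls_solD(3)[OF u \<tau>]) auto
      also have "\<dots> \<le> L * K\<^sup>2 * S" by (rule mult_left_mono[OF S[OF \<tau>] L0])
      finally show "norm (\<i> * NN \<alpha> \<beta> \<mu> (u 0 \<tau> x) (u 1 \<tau> x) (u 2 \<tau> x)) \<le> L * K\<^sup>2 * S" .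
    qed
    also have "\<dots> \<le> (L * K\<^sup>2 * S) * T" using t L0 S0 by (intro mult_left_mono) auto
    also have "\<dots> = (L * K\<^sup>2 * T) * S" by simp
    also have "\<dots> \<le> 1 / 4 * S" by (rule mult_right_mono[OF small S0])
    finally show ?thesis by simp
  qed
  have "norm (u 0 t x) \<le> 2 * norm (u 0 0 x)" if t: "t \<in> {0..T}" for t
  proof (rule sup_absorb[OF _ _ t])
    show "norm (u 0 t x) \<le> K" if "t \<in> {0..T}" for t using nls_solD(3)[OF u that] by simp
    fix S s assume S: "\<And>s. s \<in> {0..T} \<Longrightarrow> norm (u 0 s x) \<le> S" and s: "s \<in> {0..T}"
    have "0 \<le> S" using S[OF s] norm_ge_zero order_trans by blast
    then show "norm (u 0 s x) \<le> norm (u 0 0 x) + S / 2"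
      using inc[OF S s] norm_triangle_ineq2[of "u 0 s x" "u 0 0 x"] by linarith
  qed
  from inc[OF this t] show ?thesis by simp
qed

section \<open>Taylor expansion at the degenerate zero\<close>

lemma power_vanish_bound:
  fixes g :: "real \<Rightarrow> complex"
  assumes d: "\<And>x. (g has_vector_derivative g' x) (at x)" and g0: "g 0 = 0"
    and b: "\<And>x. norm (g' x) \<le> M * \<bar>x\<bar> ^ n"
  shows "norm (g x) \<le> M * \<bar>x\<bar> ^ Suc n"
proof -
  have M: "0 \<le> M" using order_trans[OF norm_ge_zero b[of 1]] by simp
  have "norm (g x - g 0) \<le> (M * \<bar>x\<bar> ^ n) * norm (x - 0)"
  proof (rule differentiable_bound[of "closed_segment 0 x" g "\<lambda>y h. h *\<^sub>R g' y"])
    show "(g has_derivative (\<lambda>h. h *\<^sub>R g' y)) (at y within closed_segment 0 x)" for y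
      by (rule has_derivative_at_withinI[OF d[of y, unfolded has_vector_derivative_def]])
    fix y assume y: "y \<in> closed_segment 0 x"
    have "\<bar>y\<bar> \<le> \<bar>x\<bar>" using segment_bound1[OF y] by simp
    then have "norm (g' y) \<le> M * \<bar>x\<bar> ^ n"
      using b[of y] M by (meson abs_ge_zero mult_left_mono order_trans power_mono)
    then show "onorm (\<lambda>h. h *\<^sub>R g' y) \<le> M * \<bar>x\<bar> ^ n"
      by (intro onorm_le) (simp add: mult.commute mult_left_mono)
  qed auto
  then show ?thesis using g0 by (simp add: mult_ac)
qed

lemma taylor_flat:
  fixes G :: "nat \<Rightarrow> real \<Rightarrow> complex"
  assumes d: "\<And>i x. i < n \<Longrightarrow> (G i has_vector_derivative G (Suc i) x) (at x)"
    and z: "\<And>i. i < n \<Longrightarrow> G i 0 = 0" and M: "\<And>x. norm (G n x) \<le> M" and i: "i \<le> n"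
  shows "norm (G i x) \<le> M * \<bar>x\<bar> ^ (n - i)"
  using i
proof (induction "n - i" arbitrary: i x)
  case 0
  then show ?case using M by simp
next
  case (Suc m)
  then have i: "i < n" "m = n - Suc i" by auto
  have "norm (G i x) \<le> M * \<bar>x\<bar> ^ Suc m"
  proof (rule power_vanish_bound[OF d[OF i(1)] z[OF i(1)]])
    show "norm (G (Suc i) x) \<le> M * \<bar>x\<bar> ^ m" for x
      using Suc.hyps(1)[of "Suc i" x] i by simp
  qed
  then show ?case using Suc.hyps(2) by simp
qed

text \<open>Subtracting the leading monomial and its derivatives yields a family that is flat to one
  order more, to which \<open>taylor_flat\<close> applies.\<close>

lemma taylor_lead:
  fixes G :: "nat \<Rightarrow> real \<Rightarrow> complex"
  assumes d: "\<And>i x. i \<le> j \<Longrightarrow> (G i has_vector_derivative G (Suc i) x) (at x)"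
    and z: "\<And>i. i < j \<Longrightarrow> G i 0 = 0" and M: "\<And>x. norm (G (Suc j) x) \<le> M" and i: "i \<le> j"
  shows "norm (G i x - G j 0 * of_real (x ^ (j - i) / fact (j - i))) \<le> M * \<bar>x\<bar> ^ (Suc j - i)"
proof -
  \<comment> \<open>Above order j nothing is subtracted, since the monomial has degree j.\<close>
  define H where "H i x = G i x - (if i \<le> j then G j 0 * of_real (x ^ (j - i) / fact (j - i)) else 0)" for i x
  have "norm (H i x) \<le> M * \<bar>x\<bar> ^ (Suc j - i)"
  proof (rule taylor_flat)
    fix i x assume "i < Suc j"
    then have i: "i \<le> j" by simp
    have "((\<lambda>x. x ^ (j - i) / fact (j - i)) has_real_derivative (if i = j then 0 else x ^ (j - Suc i) / fact (j - Suc i))) (at x)"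
    proof (cases "i = j")
      case False
      then obtain m where m: "j - i = Suc m" "j - Suc i = m" using i by (metis Suc_diff_Suc le_antisym not_less)
      have "((\<lambda>x. x ^ Suc m / fact (Suc m)) has_real_derivative (real (Suc m) * x ^ m / fact (Suc m))) (at x)"
        using DERIV_cdivide[OF DERIV_pow[of "Suc m" x UNIV], of "fact (Suc m)"] by (simp del: fact_Suc of_nat_Suc)
      also have "real (Suc m) * x ^ m / fact (Suc m) = x ^ m / fact m"
        by (subst fact_Suc) (simp del: of_nat_Suc fact_Suc)
      finally show ?thesis using m False by simp
    qed simp
    from has_vector_derivative_cmult[OF has_vector_derivative_of_real[OF this], of "G j 0"]
    have "((\<lambda>x. G i x - G j 0 * of_real (x ^ (j - i) / fact (j - i))) has_vector_derivative
       G (Suc i) x - G j 0 * of_real (if i = j then 0 else x ^ (j - Suc i) / fact (j - Suc i))) (at x)"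
      by (intro has_vector_derivative_diff d i)
    moreover have "H i = (\<lambda>x. G i x - G j 0 * of_real (x ^ (j - i) / fact (j - i)))" using i by (simp add: H_def fun_eq_iff)
    moreover have "H (Suc i) x = G (Suc i) x - G j 0 * of_real (if i = j then 0 else x ^ (j - Suc i) / fact (j - Suc i))"
      using i by (auto simp: H_def)
    ultimately show "(H i has_vector_derivative H (Suc i) x) (at x)" by simp
    show "H i 0 = 0" using i z by (cases "i = j") (auto simp: H_def)
  next
    show "norm (H (Suc j) x) \<le> M" for x using M by (simp add: H_def)
  qed (use i in auto)
  then show ?thesis using i by (simp add: H_def)
qed

text \<open>Letting x tend to 0 stands in for differentiating the equation at the zero, for which
  there are not enough derivatives.\<close>

lemma le_of_le_add_small:
  fixes a b c r :: real
  assumes "r > 0" "\<And>x. 0 < x \<Longrightarrow> x < r \<Longrightarrow> a \<le> b + c * x"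
  shows "a \<le> b"
proof (rule tendsto_lowerbound)
  show "((\<lambda>x. b + c * x) \<longlongrightarrow> b) (at_right 0)"
    by (rule tendsto_eq_intros refl)+ simp
  show "\<forall>\<^sub>F x in at_right 0. a \<le> b + c * x"
    using assms by (auto simp: eventually_at_right_field intro!: exI[of _ r])
qed simp

text \<open>Near the zero h is O(y), so w2 and w1 come with the factors y^2 and y. All terms on the
  right then have the same order of vanishing, which is what closes the system for the jets.\<close>

lemma NN_diff_bound:
  assumes "norm h \<le> K" "norm h1 \<le> K" "norm (h + w) \<le> K" "norm (h1 + w1) \<le> K" "norm (h2 + w2) \<le> K" "norm h \<le> K * y"
    and K: "K \<ge> 1" and y: "0 \<le> y" and L: "L = 1 + \<bar>\<alpha>\<bar> + \<bar>\<beta>\<bar> + norm \<mu>"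
  shows "norm (NN \<alpha> \<beta> \<mu> (h + w) (h1 + w1) (h2 + w2) - NN \<alpha> \<beta> \<mu> h h1 h2)
      \<le> 4 * L * K\<^sup>2 * (y\<^sup>2 * norm w2 + y * norm w1 + norm w)"
proof -
  have w1: "norm w1 \<le> 2 * K" using norm_triangle_ineq4[of "h1 + w1" h1] assms(2,4) by simp
  have c: "norm (cnj h) \<le> K * y" "norm (cnj h1) \<le> K" "norm (cnj w1) \<le> 2 * K" "norm w \<le> norm w" "norm w2 \<le> norm w2" "norm w1 \<le> norm w1"
    "norm (cnj w1) \<le> norm w1" "norm (2::complex) \<le> 2"
    "norm (complex_of_real \<alpha>) \<le> \<bar>\<alpha>\<bar>" "norm (complex_of_real \<beta>) \<le> \<bar>\<beta>\<bar>"
    using assms w1 by auto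
  have Z: "norm (ZZ \<alpha> \<beta> \<mu> h h2 w (h1 + w1) (h2 + w2)) \<le> 3 * L * K\<^sup>2 * norm w"
    unfolding L by (rule ZZ_bound) (use assms in auto)
  have "norm (NN \<alpha> \<beta> \<mu> (h + w) (h1 + w1) (h2 + w2) - NN \<alpha> \<beta> \<mu> h h1 h2)
    \<le> K * y * (K * y) * norm w2 + (\<bar>\<alpha>\<bar> * (K * y) * K + 2 * \<bar>\<beta>\<bar> * (K * y) * K) * norm w1
      + \<bar>\<alpha>\<bar> * (K * y) * K * norm w1 + (\<bar>\<alpha>\<bar> * (K * y) * (2 * K) + \<bar>\<beta>\<bar> * (K * y) * (2 * K)) * norm w1 + 3 * L * K\<^sup>2 * norm w"
    unfolding NN_diff by (intro norm_add_le norm_mult_le assms c w1 Z)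
  also have "\<dots> = 1 * (K\<^sup>2 * (y\<^sup>2 * norm w2)) + (4 * \<bar>\<alpha>\<bar> + 4 * \<bar>\<beta>\<bar>) * (K\<^sup>2 * (y * norm w1)) + 3 * L * (K\<^sup>2 * norm w)"
    by (simp add: algebra_simps power2_eq_square)
  also have "\<dots> \<le> (4 * L) * (K\<^sup>2 * (y\<^sup>2 * norm w2)) + (4 * L) * (K\<^sup>2 * (y * norm w1)) + (4 * L) * (K\<^sup>2 * norm w)"
    using y L by (intro add_mono mult_right_mono) auto
  finally show ?thesis by (simp add: algebra_simps)
qed

text \<open>The jets of the difference at the degenerate point obey a closed linear system of ODEs, order by order,
  so they stay zero.\<close>

lemma difference_jets_vanish:
  fixes \<phi> h :: "nat \<Rightarrow> real \<Rightarrow> real \<Rightarrow> complex"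
  assumes \<phi>: "nls_sol \<alpha> \<beta> \<mu> k T K \<phi>" and h: "nls_sol \<alpha> \<beta> \<mu> k T K h" and k: "k \<ge> 2" and K: "K \<ge> 1"
    and L: "L = 1 + \<bar>\<alpha>\<bar> + \<bar>\<beta>\<bar> + norm \<mu>" and small: "24 * fact k * L * K\<^sup>2 * T \<le> 1"
    and h0: "h 0 0 0 = 0" and r: "r > 0" "\<And>x. \<bar>x\<bar> < r \<Longrightarrow> \<phi> 0 0 x = h 0 0 x"
    and j: "j < k" and t: "t \<in> {0..T}"
  shows "\<phi> j t 0 = h j t 0"
  using j t
proof (induction j arbitrary: t rule: less_induct)
  case (less j)
  have L0: "L \<ge> 1" "0 \<le> L * K\<^sup>2" using L by auto
  have T0: "0 \<le> T" using less.prems by auto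
  have fk: "(1 :: real) \<le> fact k" by (rule fact_ge_1)
  have small4: "L * K\<^sup>2 * T \<le> 1 / 4"
  proof -
    have "L * K\<^sup>2 * T * 24 \<le> L * K\<^sup>2 * T * (24 * fact k)" using L0 T0 fk by (intro mult_left_mono) auto
    also have "\<dots> = 24 * fact k * L * K\<^sup>2 * T" by (simp only: mult_ac)
    finally have "L * K\<^sup>2 * T * 24 \<le> 1" using small by (rule order_trans)
    moreover have "y * 24 \<le> 1 \<Longrightarrow> y \<le> 1 / 4" for y :: real by simp
    ultimately show ?thesis by blast
  qed
  have ht0: "h 0 t 0 = 0" if "t \<in> {0..T}" for t
    using nls_sol_comparable[OF h k that L small4, of 0] h0 by simp
  have \<phi>t0: "\<phi> 0 t 0 = 0" if "t \<in> {0..T}" for t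
    using nls_sol_comparable[OF \<phi> k that L small4, of 0] h0 r(2)[of 0] r(1) by simp
  show ?case
  proof (cases "j = 0")
    case True
    then show ?thesis using ht0 \<phi>t0 less.prems by simp
  next
    case False
    define w where "w i t x = \<phi> i t x - h i t x" for i t x
    have wd: "(w i t has_vector_derivative w (Suc i) t x) (at x)" if "i < k" "t \<in> {0..T}" for i t x
      unfolding w_def[abs_def] using that by (intro has_vector_derivative_diff nls_solD(1)[OF \<phi>] nls_solD(1)[OF h])
    have wb: "norm (w i t x) \<le> 2 * K" if "i \<le> k" "t \<in> {0..T}" for i t x
      unfolding w_def using norm_diff_le[OF nls_solD(3)[OF \<phi> that(2,1)] nls_solD(3)[OF h that(2,1)]] by simp
    have wz: "w i t 0 = 0" if "i < j" "t \<in> {0..T}" for i t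
      using less.IH[OF that(1) _ that(2)] that less.prems by (simp add: w_def)
    have lead: "norm (w i t x - w j t 0 * of_real (x ^ (j - i) / fact (j - i))) \<le> 2 * K * \<bar>x\<bar> ^ (Suc j - i)"
      if "i \<le> j" "t \<in> {0..T}" for i t x
      by (rule taylor_lead) (use that less.prems wd wb wz in auto)
    have "norm (w j t 0) \<le> 2 * 0" if t: "t \<in> {0..T}" for t
    proof (rule sup_absorb[OF _ _ t])
      show "norm (w j t 0) \<le> 2 * K" if "t \<in> {0..T}" for t using wb that less.prems by simp
      fix S t assume S: "\<And>s. s \<in> {0..T} \<Longrightarrow> norm (w j s 0) \<le> S" and t: "t \<in> {0..T}"
      have S0: "0 \<le> S" using S[OF t] norm_ge_zero order_trans by blast
      \<comment> \<open>The 12 is the constant 4 of \<open>NN_diff_bound\<close> times the three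
        derivatives involved.\<close>
      define q where "q = 12 * L * K\<^sup>2 * T"
      have q0: "0 \<le> q" using L0 T0 by (simp add: q_def)
      have "norm (w j t 0) / fact j \<le> q * S + (q * (2 * K) + 2 * K) * x" if x: "0 < x" "x < min r 1" for x
      proof -
        \<comment> \<open>Multiplying the i-th derivative by x^i restores the order of vanishing, so
          one bound serves i = 0, 1, 2. The second summand is the Taylor remainder.\<close>
        define R where "R = x ^ j * S + 2 * K * x ^ Suc j"
        have R0: "0 \<le> R" using x S0 K by (simp add: R_def)
        have wi: "x ^ i * norm (w i s x) \<le> R" if "i \<le> 2" "s \<in> {0..T}" for i s
        proof (cases "i \<le> j")
          case True
          have "norm (w i s x) \<le> norm (w j s 0 * of_real (x ^ (j - i) / fact (j - i))) + 2 * K * \<bar>x\<bar> ^ (Suc j - i)"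
            using lead[OF True that(2), of x] norm_triangle_sub[of "w i s x"] by (smt (verit))
          also have "norm (w j s 0 * of_real (x ^ (j - i) / fact (j - i))) \<le> S * (x ^ (j - i) / 1)"
            unfolding norm_mult norm_of_real using x S[OF that(2)] S0 fact_ge_1[of "j - i", where 'a=real]
            by (intro mult_mono) (auto simp: divide_le_eq intro: mult_left_mono[of 1 _ "x ^ (j - i)", simplified])
          finally have "x ^ i * norm (w i s x) \<le> x ^ i * (S * x ^ (j - i) + 2 * K * x ^ (Suc j - i))"
            using x by (intro mult_left_mono) auto
          also have "\<dots> = R"
          proof -
            have "x ^ i * x ^ (j - i) = x ^ j" "x ^ i * x ^ (Suc j - i) = x ^ Suc j"
              using True by (simp_all flip: power_add)
            then show ?thesis unfolding R_def by (metis (no_types, lifting) distrib_left mult.assoc mult.commute)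
          qed
          finally show ?thesis .
        next
          \<comment> \<open>Only j = 1, i = 2 is left. The second derivative need not be small
            there, but x^2 * 2 K is already the remainder in \<open>R\<close>.\<close>
          case F: False
          then have ij: "i = 2" "j = 1" using that(1) \<open>j \<noteq> 0\<close> by auto
          have "x ^ i * norm (w i s x) \<le> x ^ i * (2 * K)"
            using wb[of i s x] that k x by (intro mult_left_mono) auto
          also have "\<dots> \<le> R" using x S0 by (simp add: R_def ij numeral_2_eq_2 mult_ac)
          finally show ?thesis .
        qed
        have rate: "has_rate T (\<lambda>t. w 0 t x) (\<lambda>t. \<i> * NN \<alpha> \<beta> \<mu> (\<phi> 0 t x) (\<phi> 1 t x) (\<phi> 2 t x) + - (\<i> * NN \<alpha> \<beta> \<mu> (h 0 t x) (h 1 t x) (h 2 t x)))"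
          using has_rate_add[OF nls_solD(5)[OF \<phi>] has_rate_linear[OF bounded_linear_minus[OF bounded_linear_ident] nls_solD(5)[OF h]]]
          by (simp add: w_def)
        have "norm (w 0 t x - w 0 0 x) \<le> (q / T * R) * t" if "T > 0"
        proof (rule has_rate_norm_diff_le[OF rate t])
          fix s assume s: "s \<in> {0..T}"
          have hx: "norm (h 0 s x) \<le> K * x"
            using power_vanish_bound[of "h 0 s" "h 1 s" K 0 x] nls_solD(1)[OF h s, of 0] nls_solD(3)[OF h s, of 1] ht0[OF s] k x by simp
          have \<phi>w: "\<phi> i s x = h i s x + w i s x" for i by (simp add: w_def)
          have "norm (\<i> * NN \<alpha> \<beta> \<mu> (\<phi> 0 s x) (\<phi> 1 s x) (\<phi> 2 s x) + - (\<i> * NN \<alpha> \<beta> \<mu> (h 0 s x) (h 1 s x) (h 2 s x)))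
            = norm (NN \<alpha> \<beta> \<mu> (\<phi> 0 s x) (\<phi> 1 s x) (\<phi> 2 s x) - NN \<alpha> \<beta> \<mu> (h 0 s x) (h 1 s x) (h 2 s x))"
            by (simp add: norm_mult flip: right_diff_distrib)
          also have "\<dots> \<le> 4 * L * K\<^sup>2 * (x\<^sup>2 * norm (w 2 s x) + x * norm (w 1 s x) + norm (w 0 s x))"
            unfolding \<phi>w
            by (rule NN_diff_bound[OF _ _ _ _ _ hx K _ L])
              (use nls_solD(3)[OF h s] nls_solD(3)[OF \<phi> s] k x in \<open>auto simp flip: \<phi>w\<close>)
          also have "\<dots> \<le> 4 * L * K\<^sup>2 * (R + R + R)"
            using wi[of 2 s] wi[of 1 s] wi[of 0 s] s L0 by (intro mult_left_mono add_mono) auto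
          also have "\<dots> = q / T * R" using that by (simp add: q_def)
          finally show "norm (\<i> * NN \<alpha> \<beta> \<mu> (\<phi> 0 s x) (\<phi> 1 s x) (\<phi> 2 s x) + - (\<i> * NN \<alpha> \<beta> \<mu> (h 0 s x) (h 1 s x) (h 2 s x))) \<le> q / T * R" .
        qed
        moreover have "(q / T * R) * t \<le> q * R" if "T > 0"
        proof -
          have "(q / T * R) * t \<le> (q / T * R) * T" using t q0 R0 that by (intro mult_left_mono) auto
          then show ?thesis using that by simp
        qed
        moreover have w00: "w 0 0 x = 0" using r x by (simp add: w_def)
        ultimately have w0: "norm (w 0 t x) \<le> q * R"
        proof (cases "T > 0")
          case False
          then have "t = 0" using t by auto
          then show ?thesis using w00 q0 R0 by simp
        qed auto
        have "norm (w j t 0 * of_real (x ^ j / fact j)) \<le> norm (w 0 t x) + 2 * K * x ^ Suc j"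
          using lead[OF _ t, of 0 x] x norm_triangle_sub[of "w j t 0 * of_real (x ^ j / fact j)" "w 0 t x"]
          by (simp add: norm_minus_commute)
        then have "norm (w j t 0) * (x ^ j / fact j) \<le> q * R + 2 * K * x ^ Suc j"
          using w0 x by (simp add: norm_mult norm_divide norm_power)
        also have "\<dots> = (q * S + (q * (2 * K) + 2 * K) * x) * x ^ j" by (simp add: R_def algebra_simps)
        also have "norm (w j t 0) * (x ^ j / fact j) = (norm (w j t 0) / fact j) * x ^ j" by simp
        finally show ?thesis by (rule mult_right_le_imp_le) (use x in simp)
      qed
      \<comment> \<open>After division by x^j and passage to the limit all remainders are gone, and
        a closed inequality for the j-th jets at 0 is left, ready for
        \<open>sup_absorb\<close>.\<close>
      then have "norm (w j t 0) / fact j \<le> q * S"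
        by (rule le_of_le_add_small[of "min r 1", rotated]) (use r in auto)
      then have "norm (w j t 0) \<le> q * S * fact j" by (simp add: divide_le_eq)
      also have "\<dots> = (q * fact j) * S" by simp
      also have "\<dots> \<le> 1 / 2 * S"
      proof (rule mult_right_mono[OF _ S0])
        have "q * fact j \<le> q * fact k" using less.prems q0 by (intro mult_left_mono fact_mono) auto
        also have "\<dots> \<le> 1 / 2" using small by (simp add: q_def mult_ac)
        finally show "q * fact j \<le> 1 / 2" .
      qed
      finally show "norm (w j t 0) \<le> 0 + S / 2" by simp
    qed
    then show ?thesis using less.prems by (simp add: w_def)
  qed
qed

text \<open>The last claim keeps the coefficient A of the model equation constant. In the rate of
  |h|^2 the \<alpha> term is real and drops out, and the \<beta> term is the imaginary part of (cnj
  h * h1)^2, where cnj h * h1 equals |a|^2 x up to O(x^2). So |h|^2 changes by O(t x^3) only, which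
  is invisible in |a|^2 x^2 as x tends to 0.\<close>

lemma slope_at_zero:
  fixes h :: "nat \<Rightarrow> real \<Rightarrow> real \<Rightarrow> complex"
  assumes h: "nls_sol \<alpha> \<beta> \<mu> k T K h" and k: "k \<ge> 2" and K: "K \<ge> 1"
    and L: "L = 1 + \<bar>\<alpha>\<bar> + \<bar>\<beta>\<bar> + norm \<mu>" and small: "L * K\<^sup>2 * T \<le> 1 / 4"
    and h0: "h 0 0 0 = 0" and t: "t \<in> {0..T}"
  shows "h 0 t 0 = 0" "norm (h 0 t x) \<le> K * \<bar>x\<bar>" "norm (h 0 t x - h 1 t 0 * x) \<le> K * x\<^sup>2" "norm (h 1 t x - h 1 t 0) \<le> K * \<bar>x\<bar>"
    "norm (h 1 t 0 - h 1 0 0) \<le> L * K ^ 3 * t" "norm (h 1 t 0) = norm (h 1 0 0)"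
proof -
  have T0: "0 \<in> {0..T}" using t by auto
  have K0: "0 \<le> K" using K by simp
  have L0: "L \<ge> 1" "0 \<le> L * K\<^sup>2" using L by auto
  have z: "h 0 s 0 = 0" if "s \<in> {0..T}" for s
    using nls_sol_comparable[OF h k that L small, of 0] h0 by simp
  have hb: "norm (h 0 s x) \<le> K * \<bar>x\<bar>" if "s \<in> {0..T}" for s x
    using power_vanish_bound[of "h 0 s" "h 1 s" K 0 x] nls_solD(1)[OF h that, of 0] nls_solD(3)[OF h that, of 1] z[OF that] k by simp
  have d01: "(h i s has_vector_derivative h (Suc i) s x) (at x)" if "i \<le> 1" "s \<in> {0..T}" for i s x
    using nls_solD(1)[OF h that(2)] that(1) k by simp
  have h2: "norm (h (Suc 1) s x) \<le> K" if "s \<in> {0..T}" for s x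
    using nls_solD(3)[OF h that, of 2] k by (simp add: numeral_2_eq_2)
  have tl: "norm (h 0 s x - h 1 s 0 * x) \<le> K * x\<^sup>2" if s: "s \<in> {0..T}" for s x
    using taylor_lead[of 1 "\<lambda>i. h i s" K 0 x] d01[OF _ s] z[OF s] h2[OF s] by (auto simp: numeral_2_eq_2)
  have tl1: "norm (h 1 s x - h 1 s 0) \<le> K * \<bar>x\<bar>" if s: "s \<in> {0..T}" for s x
    using taylor_lead[of 1 "\<lambda>i. h i s" K 1 x] d01[OF _ s] z[OF s] h2[OF s] by auto
  show "h 0 t 0 = 0" "norm (h 0 t x) \<le> K * \<bar>x\<bar>" "norm (h 0 t x - h 1 t 0 * x) \<le> K * x\<^sup>2" "norm (h 1 t x - h 1 t 0) \<le> K * \<bar>x\<bar>"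
    using z hb tl tl1 t by blast+
  show "norm (h 1 t 0 - h 1 0 0) \<le> L * K ^ 3 * t"
  proof (rule le_of_le_add_small[of 1 _ _ "2 * K"])
    fix x :: real assume x: "0 < x"
    have "norm (h 0 t x - h 0 0 x) \<le> (L * K\<^sup>2 * (K * x)) * t"
    proof (rule has_rate_norm_diff_le[OF nls_solD(5)[OF h] t])
      fix \<tau> assume \<tau>: "\<tau> \<in> {0..T}"
      have "norm (\<i> * NN \<alpha> \<beta> \<mu> (h 0 \<tau> x) (h 1 \<tau> x) (h 2 \<tau> x)) \<le> L * K\<^sup>2 * norm (h 0 \<tau> x)"
        unfolding norm_mult L using k by (simp, intro NN_bound nls_solD(3)[OF h \<tau>]) auto
      also have "\<dots> \<le> L * K\<^sup>2 * (K * x)" using hb[OF \<tau>, of x] x by (intro mult_left_mono L0) simp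
      finally show "norm (\<i> * NN \<alpha> \<beta> \<mu> (h 0 \<tau> x) (h 1 \<tau> x) (h 2 \<tau> x)) \<le> L * K\<^sup>2 * (K * x)" .
    qed
    moreover have "norm ((h 1 t 0 - h 1 0 0) * x) \<le> norm (h 0 t x - h 0 0 x) + (K * x\<^sup>2 + K * x\<^sup>2)"
    proof -
      have "(h 1 t 0 - h 1 0 0) * x = (h 0 t x - h 0 0 x) + ((h 0 0 x - h 1 0 0 * x) - (h 0 t x - h 1 t 0 * x))" by (simp add: algebra_simps)
      then show ?thesis using tl[OF t, of x] tl[OF T0, of x] by (metis norm_add_le norm_diff_le order_refl)
    qed
    ultimately have "norm ((h 1 t 0 - h 1 0 0) * x) \<le> (L * K\<^sup>2 * (K * x)) * t + (K * x\<^sup>2 + K * x\<^sup>2)"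
      by (meson add_right_mono order_trans)
    also have "\<dots> = (L * K ^ 3 * t + 2 * K * x) * x"
      by (simp add: algebra_simps power2_eq_square power3_eq_cube)
    also have "norm ((h 1 t 0 - h 1 0 0) * x) = norm (h 1 t 0 - h 1 0 0) * x"
      unfolding norm_mult using x by simp
    finally have "norm (h 1 t 0 - h 1 0 0) * x \<le> (L * K ^ 3 * t + 2 * K * x) * x" .
    then show "norm (h 1 t 0 - h 1 0 0) \<le> L * K ^ 3 * t + 2 * K * x" using x by simp
  qed simp
  have sq: "\<bar>(cmod (h 0 s x))\<^sup>2 - (cmod (h 1 s 0))\<^sup>2 * x\<^sup>2\<bar> \<le> 2 * K\<^sup>2 * x ^ 3" if s: "s \<in> {0..T}" and x: "0 < x" for s x
  proof -
    have a: "norm (h 1 s 0) \<le> K" using nls_solD(3)[OF h s, of 1] k by simp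
    have ax: "norm (h 1 s 0 * x) \<le> K * x" using a x by (simp add: norm_mult)
    have "(cmod (h 0 s x))\<^sup>2 - (cmod (h 1 s 0))\<^sup>2 * x\<^sup>2 = (cmod (h 0 s x) - cmod (h 1 s 0 * x)) * (cmod (h 0 s x) + cmod (h 1 s 0 * x))"
      using x by (simp add: norm_mult power2_eq_square algebra_simps)
    also have "\<bar>\<dots>\<bar> \<le> (K * x\<^sup>2) * (K * x + K * x)"
      unfolding abs_mult using tl[OF s, of x] hb[OF s, of x] ax x norm_triangle_ineq3[of "h 0 s x" "h 1 s 0 * x"] K0
      by (intro mult_mono) auto
    also have "\<dots> = 2 * K\<^sup>2 * x ^ 3" by (simp add: power2_eq_square power3_eq_cube)
    finally show ?thesis .
  qed
  have "\<bar>(cmod (h 1 t 0))\<^sup>2 - (cmod (h 1 0 0))\<^sup>2\<bar> \<le> 0"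
  proof (rule le_of_le_add_small[of 1 _ _ "4 * K\<^sup>2 + 20 * L * K ^ 4 * t"])
    fix x :: real assume x: "0 < x" "x < 1"
    let ?N = "\<lambda>s. NN \<alpha> \<beta> \<mu> (h 0 s x) (h 1 s x) (h 2 s x)"
    have rate: "has_rate T (\<lambda>s. Re (h 0 s x * cnj (h 0 s x))) (\<lambda>s. Re (h 0 s x * cnj (\<i> * ?N s) + \<i> * ?N s * cnj (h 0 s x)))"
      by (intro has_rate_linear[OF bounded_linear_Re] has_rate_bilinear[OF bounded_bilinear_mult] has_rate_linear[OF bounded_linear_cnj] nls_solD(5)[OF h])
    have "norm (Re (h 0 t x * cnj (h 0 t x)) - Re (h 0 0 x * cnj (h 0 0 x))) \<le> (20 * L * K ^ 4 * x ^ 3) * t"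
    proof (rule has_rate_norm_diff_le[OF rate t])
      fix s assume s: "s \<in> {0..T}"
      define u where "u = h 0 s x"
      define u1 where "u1 = h 1 s x"
      define u2 where "u2 = h 2 s x"
      have ub: "norm u \<le> K * x" "norm u1 \<le> K" "norm u2 \<le> K" "norm (cnj u) \<le> K * x" "norm (cnj u1) \<le> K"
        unfolding u_def u1_def u2_def using hb[OF s, of x] nls_solD(3)[OF h s] k x by auto
      define a where "a = h 1 s 0"
      have aK: "norm a \<le> K" "norm (cnj a) \<le> K" unfolding a_def using nls_solD(3)[OF h s, of 1] k by auto
      \<comment> \<open>The main part of cnj u * u1 is real, so the imaginary part of its square
        contains \<open>f\<close> and is O(x^3).\<close>
      define f where "f = cnj u * (u1 - a) + cnj (u - a * x) * a"
      have f: "cnj u * u1 = of_real ((cmod a)\<^sup>2 * x) + f"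
        unfolding of_real_mult complex_norm_square f_def by (simp add: algebra_simps)
      have fb: "norm f \<le> 2 * K\<^sup>2 * x\<^sup>2"
      proof -
        have "norm f \<le> K * x * (K * x) + K * x\<^sup>2 * K"
          unfolding f_def using tl[OF s, of x] tl1[OF s, of x] x
          by (intro norm_add_le norm_mult_le ub aK) (auto simp: u_def u1_def a_def simp flip: complex_cnj_diff complex_cnj_mult)
        then show ?thesis by (simp add: algebra_simps power2_eq_square)
      qed
      have ca: "norm (complex_of_real ((cmod a)\<^sup>2 * x)) \<le> K\<^sup>2 * x"
        unfolding norm_of_real using aK x by (simp add: power_mono abs_mult mult_right_mono)
      have "Re (u * cnj (\<i> * ?N s) + \<i> * ?N s * cnj u) = - 2 * Im (cnj u * ?N s)" by (simp add: algebra_simps)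
      also have "cnj u * ?N s = of_real ((cmod u)\<^sup>2) * (cnj u * u2) + of_real \<alpha> * of_real ((cmod u)\<^sup>2 * (cmod u1)\<^sup>2)
          + of_real \<beta> * ((cnj u * u1) * (cnj u * u1)) + \<mu> * of_real ((cmod u)\<^sup>2 * (cmod u)\<^sup>2)"
        unfolding NN_def u_def[symmetric] u1_def[symmetric] u2_def[symmetric] of_real_mult complex_norm_square by (simp add: algebra_simps power2_eq_square)
      also have "(cnj u * u1) * (cnj u * u1) = of_real (((cmod a)\<^sup>2 * x)\<^sup>2) + (2 * of_real ((cmod a)\<^sup>2 * x) * f + f * f)"
        unfolding f by (simp add: algebra_simps power2_eq_square)
      finally have "Re (u * cnj (\<i> * ?N s) + \<i> * ?N s * cnj u) =
         - 2 * Im (of_real ((cmod u)\<^sup>2) * (cnj u * u2) + of_real \<beta> * (2 * of_real ((cmod a)\<^sup>2 * x) * f + f * f) + \<mu> * of_real ((cmod u)\<^sup>2 * (cmod u)\<^sup>2))"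
        by (simp add: algebra_simps)
      also have "\<bar>\<dots>\<bar> \<le> 2 * norm (of_real ((cmod u)\<^sup>2) * (cnj u * u2) + of_real \<beta> * (2 * of_real ((cmod a)\<^sup>2 * x) * f + f * f) + \<mu> * of_real ((cmod u)\<^sup>2 * (cmod u)\<^sup>2))"
        unfolding abs_mult by (intro mult_mono abs_Im_le_cmod) auto
      also have "\<dots> \<le> 2 * (K * x * (K * x) * (K * x * K) + \<bar>\<beta>\<bar> * (2 * (K\<^sup>2 * x) * (2 * K\<^sup>2 * x\<^sup>2) + 2 * K\<^sup>2 * x\<^sup>2 * (2 * K\<^sup>2 * x\<^sup>2)) + norm \<mu> * (K * x * (K * x) * (K * x * (K * x))))"
        unfolding of_real_mult[of "(cmod u)\<^sup>2"] complex_norm_square[of u]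
        by (intro mult_left_mono norm_add_le norm_mult_le ub fb ca) auto
      also have "\<dots> = 2 * (1 + 4 * \<bar>\<beta>\<bar> + (4 * \<bar>\<beta>\<bar> + norm \<mu>) * x) * (K ^ 4 * x ^ 3)"
        by (simp add: algebra_simps power2_eq_square power3_eq_cube eval_nat_numeral)
      also have "\<dots> \<le> 20 * L * (K ^ 4 * x ^ 3)"
      proof (rule mult_right_mono)
        have "(4 * \<bar>\<beta>\<bar> + norm \<mu>) * x \<le> (4 * \<bar>\<beta>\<bar> + norm \<mu>) * 1" using x by (intro mult_left_mono) auto
        moreover have "2 * (1 + 4 * b + y) \<le> 20 * (1 + a + b + c)" if "y \<le> (4 * b + c) * 1" "0 \<le> a" "0 \<le> b" "0 \<le> c" for a b c y :: real
          using that by simp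
        ultimately show "2 * (1 + 4 * \<bar>\<beta>\<bar> + (4 * \<bar>\<beta>\<bar> + norm \<mu>) * x) \<le> 20 * L"
          unfolding L by (metis abs_ge_zero norm_ge_zero)
      qed (use x K0 in auto)
      finally show "norm (Re (h 0 s x * cnj (\<i> * ?N s) + \<i> * ?N s * cnj (h 0 s x))) \<le> 20 * L * K ^ 4 * x ^ 3"
        unfolding u_def by (simp add: mult_ac)
    qed
    then have hh: "\<bar>(cmod (h 0 t x))\<^sup>2 - (cmod (h 0 0 x))\<^sup>2\<bar> \<le> 20 * L * K ^ 4 * x ^ 3 * t"
      by (simp flip: complex_norm_square)
    have "\<bar>(cmod (h 1 t 0))\<^sup>2 * x\<^sup>2 - (cmod (h 1 0 0))\<^sup>2 * x\<^sup>2\<bar> \<le> 20 * L * K ^ 4 * x ^ 3 * t + 2 * K\<^sup>2 * x ^ 3 + 2 * K\<^sup>2 * x ^ 3"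
      using hh sq[OF t x(1)] sq[OF T0 x(1)] by linarith
    also have "\<dots> = ((4 * K\<^sup>2 + 20 * L * K ^ 4 * t) * x) * x\<^sup>2" by (simp add: algebra_simps power2_eq_square power3_eq_cube)
    finally have "\<bar>(cmod (h 1 t 0))\<^sup>2 - (cmod (h 1 0 0))\<^sup>2\<bar> * x\<^sup>2 \<le> ((4 * K\<^sup>2 + 20 * L * K ^ 4 * t) * x) * x\<^sup>2"
      by (simp add: abs_mult flip: left_diff_distrib)
    then show "\<bar>(cmod (h 1 t 0))\<^sup>2 - (cmod (h 1 0 0))\<^sup>2\<bar> \<le> 0 + (4 * K\<^sup>2 + 20 * L * K ^ 4 * t) * x"
      using x by (simp add: mult_le_cancel_right)
  qed simp
  then show "norm (h 1 t 0) = norm (h 1 0 0)" by (simp add: power2_eq_iff_nonneg)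
qed

section \<open>Evolution of the energy and of the pairing\<close>

lemma powr_le_endpoints:
  fixes c z K p :: real
  assumes "0 < c" "c \<le> z" "z \<le> K"
  shows "z powr p \<le> c powr p + K powr p"
proof (cases "p \<ge> 0")
  case True
  then have "z powr p \<le> K powr p" using assms by (intro powr_mono2) auto
  then show ?thesis using powr_ge_zero[of c p] by linarith
next
  case False
  then have "z powr p \<le> c powr p" using assms by (intro powr_mono2') auto
  then show ?thesis using powr_ge_zero[of K p] by linarith
qed

lemma square_powr: "0 \<le> y \<Longrightarrow> ((y::real)\<^sup>2) powr p = y powr (2 * p)"
  by (simp add: powr_powr flip: powr_numeral)

text \<open>Near the zero the weight is a power of the distance. \<open>W\<close> adds the values at
  both ends of the range for both exponents, so that one constant fits either sign of
  \<sigma>.\<close>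

lemma weight_comparable:
  fixes c K \<sigma> :: real
  assumes "0 < c" "c \<le> K"
  obtains W where "W > 0"
    "\<And>x z. 0 < x \<Longrightarrow> c * x \<le> cmod z \<Longrightarrow> cmod z \<le> K * x \<Longrightarrow> weight \<sigma> z \<le> W * x powr (- 2 * \<sigma>) \<and> x powr (- 2 * \<sigma>) \<le> W * weight \<sigma> z"
proof -
  define W where "W = c powr (- 2 * \<sigma>) + K powr (- 2 * \<sigma>) + c powr (2 * \<sigma>) + K powr (2 * \<sigma>)"
  have pos: "0 < c powr p" "0 < K powr p" for p using assms by auto
  have "W > 0" unfolding W_def using pos by (intro add_pos_pos)
  moreover have "weight \<sigma> z \<le> W * x powr (- 2 * \<sigma>) \<and> x powr (- 2 * \<sigma>) \<le> W * weight \<sigma> z"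
    if x: "0 < x" and z: "c * x \<le> cmod z" "cmod z \<le> K * x" for x z
  proof -
    define y where "y = cmod z / x"
    have y: "c \<le> y" "y \<le> K" "cmod z = x * y" using x z by (auto simp: y_def field_simps)
    have y0: "0 < y" using assms y by linarith
    have w: "weight \<sigma> z = x powr (- 2 * \<sigma>) * y powr (- 2 * \<sigma>)"
    proof -
      have "weight \<sigma> z = (cmod z) powr (2 * (- \<sigma>))" by (simp only: weight_def square_powr[OF norm_ge_zero])
      then show ?thesis unfolding y(3) using x y0 by (simp add: powr_mult)
    qed
    have b: "y powr p \<le> c powr p + K powr p" for p by (rule powr_le_endpoints[OF assms(1) y(1,2)])
    have b1: "y powr (- 2 * \<sigma>) \<le> W" using b[of "- 2 * \<sigma>"] pos[of "2 * \<sigma>"] unfolding W_def by linarith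
    have b2: "y powr (2 * \<sigma>) \<le> W" using b[of "2 * \<sigma>"] pos[of "- 2 * \<sigma>"] unfolding W_def by linarith
    have inv: "y powr (2 * \<sigma>) * y powr (- 2 * \<sigma>) = 1" using y0 by (simp flip: powr_add)
    have "x powr (- 2 * \<sigma>) = (y powr (2 * \<sigma>) * y powr (- 2 * \<sigma>)) * x powr (- 2 * \<sigma>)" by (simp only: inv mult_1)
    also have "\<dots> = y powr (2 * \<sigma>) * weight \<sigma> z" unfolding w by (simp only: mult_ac)
    also have "\<dots> \<le> W * weight \<sigma> z" by (rule mult_right_mono[OF b2 weight_nonneg])
    finally show ?thesis unfolding w using b1 mult_left_mono[OF b1 powr_ge_zero[of x "- 2 * \<sigma>"]] by (simp add: mult.commute)
  qed
  ultimately show ?thesis using that by blast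
qed

lemma has_rate_weight:
  assumes h: "has_rate T h ht" and b: "\<And>t. t \<in> {0..T} \<Longrightarrow> a \<le> (cmod (h t))\<^sup>2 \<and> (cmod (h t))\<^sup>2 \<le> b" and a: "0 < a"
  shows "has_rate T (\<lambda>t. weight \<sigma> (h t)) (\<lambda>t. weight' \<sigma> (h t) (ht t))"
proof -
  have "has_rate T (\<lambda>t. Re (h t * cnj (h t))) (\<lambda>t. Re (h t * cnj (ht t) + ht t * cnj (h t)))"
    by (intro has_rate_linear[OF bounded_linear_Re] has_rate_bilinear[OF bounded_bilinear_mult] has_rate_linear[OF bounded_linear_cnj] h)
  moreover have "Re (h t * cnj (ht t) + ht t * cnj (h t)) = 2 * Re (cnj (h t) * ht t)" for t by simp
  moreover have "Re (h t * cnj (h t)) = (cmod (h t))\<^sup>2" for t by (simp flip: complex_norm_square)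
  ultimately have r: "has_rate T (\<lambda>t. (cmod (h t))\<^sup>2) (\<lambda>t. 2 * Re (cnj (h t) * ht t))" by (simp only:)
  have "continuous_on {a..b} (\<lambda>r. - \<sigma> * ((- \<sigma> - 1) * r powr (- \<sigma> - 2)))"
    using a by (intro continuous_intros) auto
  then obtain C where C: "\<And>r. r \<in> {a..b} \<Longrightarrow> norm (- \<sigma> * ((- \<sigma> - 1) * r powr (- \<sigma> - 2))) \<le> C"
    using continuous_on_Icc_norm_bound by blast
  have "has_rate T (\<lambda>t. ((cmod (h t))\<^sup>2) powr (- \<sigma>)) (\<lambda>t. (- \<sigma> * ((cmod (h t))\<^sup>2) powr (- \<sigma> - 1)) * (2 * Re (cnj (h t) * ht t)))"
  proof (rule has_rate_compose[OF r, of "{a..b}"])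
    show "((\<lambda>r. r powr - \<sigma>) has_real_derivative - \<sigma> * x powr (- \<sigma> - 1)) (at x within {a..b})" if "x \<in> {a..b}" for x
      using that a by (intro has_field_derivative_at_within[OF has_real_derivative_powr]) auto
    show "\<bar>- \<sigma> * x powr (- \<sigma> - 1) - - \<sigma> * y powr (- \<sigma> - 1)\<bar> \<le> C * \<bar>x - y\<bar>" if "x \<in> {a..b}" "y \<in> {a..b}" for x y
    proof -
      have "norm (- \<sigma> * x powr (- \<sigma> - 1) - - \<sigma> * y powr (- \<sigma> - 1)) \<le> C * norm (x - y)"
      proof (rule field_differentiable_bound[of "{a..b}" "\<lambda>r. - \<sigma> * r powr (- \<sigma> - 1)"])
        show "((\<lambda>r. - \<sigma> * r powr (- \<sigma> - 1)) has_field_derivative - \<sigma> * ((- \<sigma> - 1) * r powr (- \<sigma> - 2))) (at r within {a..b})"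
          if "r \<in> {a..b}" for r
        proof -
          have "r > 0" using that a by auto
          from DERIV_cmult[OF has_field_derivative_at_within[OF has_real_derivative_powr[OF this, of "- \<sigma> - 1"]], of "- \<sigma>" "{a..b}"]
          show ?thesis by (simp add: diff_diff_eq)
        qed
      qed (use that C in auto)
      then show ?thesis by simp
    qed
  qed (use b in auto)
  then show ?thesis by (simp only: weight_def weight'_def)
qed

text \<open>Differentiation under the integral sign in integrated form: a bound on the spatial
  integral of the rate at each time is enough.\<close>

lemma evolution_integral_le:
  fixes U kk :: "real \<Rightarrow> real \<Rightarrow> real"
  assumes pq: "p \<le> q" and r: "\<And>x. x \<in> {p..q} \<Longrightarrow> has_rate T (\<lambda>t. U t x) (\<lambda>t. kk t x)"
    and cU: "\<And>t. t \<in> {0..T} \<Longrightarrow> continuous_on {p..q} (U t)"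
    and ck: "\<And>t. t \<in> {0..T} \<Longrightarrow> continuous_on {p..q} (kk t)"
    and M: "\<And>t x. t \<in> {0..T} \<Longrightarrow> x \<in> {p..q} \<Longrightarrow> \<bar>kk t x\<bar> \<le> M"
    and B: "\<And>t. t \<in> {0..T} \<Longrightarrow> integral {p..q} (kk t) \<le> B"
    and t: "t \<in> {0..T}"
  shows "integral {p..q} (U t) \<le> integral {p..q} (U 0) + B * t"
proof -
  have T0: "0 \<in> {0..T}" using t by auto
  have sub: "\<tau> \<in> {0..T}" if "\<tau> \<in> {0..t}" for \<tau> using that t by auto
  have "integral {p..q} (U t) - integral {p..q} (U 0) = integral {p..q} (\<lambda>x. U t x - U 0 x)"
    by (rule integral_diff[symmetric]) (use cU t T0 in \<open>auto intro: integrable_continuous_real\<close>)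
  also have "\<dots> = integral {p..q} (\<lambda>x. LINT \<tau>:{0..t}|lborel. kk \<tau> x)"
  proof (rule integral_cong)
    show "U t x - U 0 x = (LINT \<tau>:{0..t}|lborel. kk \<tau> x)" if "x \<in> {p..q}" for x
      unfolding has_rate_eq[OF r[OF that] t] by (rule add_diff_cancel_left')
  qed
  also have "\<dots> \<le> B * t"
  proof (rule integral_time_space_le[where M=M])
    show "set_integrable lborel {0..t} (\<lambda>\<tau>. kk \<tau> x)" if "x \<in> {p..q}" for x
      by (rule set_integrable_Icc_mono[OF has_rate_integrable[OF r[OF that]]]) (use t in auto)
  qed (use t pq ck M B sub in auto)
  finally show ?thesis by simp
qed

lemma nls_sol_continuous_on:
  assumes "nls_sol \<alpha> \<beta> \<mu> k T K u" "t \<in> {0..T}" "j \<le> k"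
  shows "continuous_on S (u j t)"
  using nls_solD(2)[OF assms] by (intro continuous_at_imp_continuous_on) blast

lemma continuous_on_NN:
  assumes "continuous_on S u" "continuous_on S u1" "continuous_on S u2"
  shows "continuous_on S (\<lambda>x. NN \<alpha> \<beta> \<mu> (u x) (u1 x) (u2 x))"
  unfolding NN_def by (intro continuous_intros assms)

lemma continuous_on_weight:
  assumes "continuous_on S z" "\<And>x. x \<in> S \<Longrightarrow> z x \<noteq> 0"
  shows "continuous_on S (\<lambda>x. weight \<sigma> (z x))"
  unfolding weight_def by (intro continuous_intros assms(1)) (use assms(2) in auto)

lemma continuous_on_weight':
  assumes "continuous_on S z" "continuous_on S z'" "\<And>x. x \<in> S \<Longrightarrow> z x \<noteq> 0"
  shows "continuous_on S (\<lambda>x. weight' \<sigma> (z x) (z' x))"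
  unfolding weight'_def by (intro continuous_intros assms(1,2)) (use assms(3) in auto)

text \<open>Away from an \<eta>-neighbourhood of the zero the weight is finite and the energy
  identity applies; the price is the flux at the two ends. It is at most a constant times \<eta>^(2
  (k - \<sigma>) + 1), because h = O(x), w = O(x^k) and w1 = O(x^(k-1)), and it tends to 0 with
  \<eta> when k > \<sigma> - 1 / 2. Periodicity identifies the right end with the left side of the
  zero.\<close>

lemma energy_bound:
  fixes \<phi> h :: "nat \<Rightarrow> real \<Rightarrow> real \<Rightarrow> complex"
  assumes \<phi>: "nls_sol \<alpha> \<beta> \<mu> k T K \<phi>" and h: "nls_sol \<alpha> \<beta> \<mu> k T K h" and k: "k \<ge> 2" and K: "K \<ge> 1"
    and L: "L = 1 + \<bar>\<alpha>\<bar> + \<bar>\<beta>\<bar> + norm \<mu>" and sg: "\<sigma> = 1 - \<alpha> / 2 - \<beta>"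
    and small: "40 * (1 + \<bar>\<sigma>\<bar>) * L * K\<^sup>2 * T \<le> 1"
    and h0: "h 0 0 0 = 0" "\<And>x. 0 < x \<Longrightarrow> x < 2 * pi \<Longrightarrow> h 0 0 x \<noteq> 0"
    and flat: "\<And>t x i. t \<in> {0..T} \<Longrightarrow> i \<le> 2 \<Longrightarrow> norm (\<phi> i t x - h i t x) \<le> 2 * K * \<bar>x\<bar> ^ (k - i)"
    and W: "\<And>t x. t \<in> {0..T} \<Longrightarrow> 0 < \<bar>x\<bar> \<Longrightarrow> \<bar>x\<bar> \<le> x1 \<Longrightarrow> weight \<sigma> (h 0 t x) \<le> W * \<bar>x\<bar> powr (- 2 * \<sigma>)"
    and W0: "W > 0" and \<eta>: "0 < \<eta>" "\<eta> \<le> x1" "\<eta> \<le> 1" and t: "t \<in> {0..T}"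
  shows "integral {\<eta>..2*pi-\<eta>} (\<lambda>x. weight \<sigma> (h 0 t x) * (cmod (\<phi> 0 t x - h 0 t x))\<^sup>2)
    \<le> 2 * (integral {\<eta>..2*pi-\<eta>} (\<lambda>x. weight \<sigma> (h 0 0 x) * (cmod (\<phi> 0 0 x - h 0 0 x))\<^sup>2)
       + 16 * L * K * (8 * W * K ^ 4 * \<eta> powr (2 * (k - \<sigma>) + 1)) * T)"
proof -
  define p where "p = \<eta>"
  define q where "q = 2 * pi - \<eta>"
  have pq: "p \<le> q" using \<eta> pi_gt3 by (simp add: p_def q_def)
  have sub: "0 < x \<and> x < 2 * pi" if "x \<in> {p..q}" for x using that \<eta> by (auto simp: p_def q_def)
  have T0: "0 \<le> T" "0 \<in> {0..T}" using t by auto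
  have L0: "L \<ge> 1" using L by simp
  have K0: "0 \<le> K" using K by simp
  have small4: "L * K\<^sup>2 * T \<le> 1 / 4"
  proof -
    have "L * K\<^sup>2 * T * 40 \<le> L * K\<^sup>2 * T * (40 * (1 + \<bar>\<sigma>\<bar>))" using L0 T0 by (intro mult_left_mono) auto
    also have "\<dots> = 40 * (1 + \<bar>\<sigma>\<bar>) * L * K\<^sup>2 * T" by (simp only: mult_ac)
    finally have "L * K\<^sup>2 * T * 40 \<le> 1" using small by (rule order_trans)
    moreover have "y * 40 \<le> 1 \<Longrightarrow> y \<le> 1 / 4" for y :: real by simp
    ultimately show ?thesis by blast
  qed
  define w where "w i t x = \<phi> i t x - h i t x" for i t x
  have \<phi>w: "\<phi> i t x = h i t x + w i t x" for i t x by (simp add: w_def)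
  have hK: "norm (h i t x) \<le> K" "norm (\<phi> i t x) \<le> K" if "t \<in> {0..T}" "i \<le> 2" for i t x
    using nls_solD(3)[OF h that(1), of i] nls_solD(3)[OF \<phi> that(1), of i] that k by auto
  have wK: "norm (w i t x) \<le> 2 * K" if "t \<in> {0..T}" "i \<le> 2" for i t x
    unfolding w_def using norm_diff_le[OF hK(2)[OF that] hK(1)[OF that]] by simp
  have ch: "continuous_on S (h i t)" "continuous_on S (\<phi> i t)" "continuous_on S (w i t)" if "t \<in> {0..T}" "i \<le> 2" for i t S
    unfolding w_def[abs_def] using that k
    by (auto intro!: nls_sol_continuous_on[OF h] nls_sol_continuous_on[OF \<phi>] continuous_on_diff)
  have hl: "norm (h 0 0 x) / 2 \<le> norm (h 0 t x)" if "t \<in> {0..T}" for t x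
    using nls_sol_comparable[OF h k that L small4, of x] norm_triangle_ineq2[of "h 0 0 x" "h 0 t x"] by (simp add: norm_minus_commute)
  have hn: "h 0 t x \<noteq> 0" if "t \<in> {0..T}" "x \<in> {p..q}" for t x
    using hl[OF that(1), of x] h0(2)[of x] sub[OF that(2)] by auto
  have "continuous_on {p..q} (\<lambda>x. norm (h 0 0 x))" by (intro continuous_intros ch T0) simp
  then obtain xm where xm: "xm \<in> {p..q}" "\<And>x. x \<in> {p..q} \<Longrightarrow> norm (h 0 0 xm) \<le> norm (h 0 0 x)"
    using continuous_attains_inf[of "{p..q}" "\<lambda>x. norm (h 0 0 x)"] pq by auto
  define m0 where "m0 = norm (h 0 0 xm) / 2"
  have m0: "0 < m0" using hn[OF T0(2) xm(1)] by (simp add: m0_def)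
  have m0h: "m0 \<le> norm (h 0 t x)" if "t \<in> {0..T}" "x \<in> {p..q}" for t x
    using hl[OF that(1), of x] xm(2)[OF that(2)] by (simp add: m0_def)
  define Wm where "Wm = (m0\<^sup>2) powr (- \<sigma>) + (K\<^sup>2) powr (- \<sigma>)"
  have wWm: "weight \<sigma> (h 0 t x) \<le> Wm" if "t \<in> {0..T}" "x \<in> {p..q}" for t x
    unfolding weight_def Wm_def
    by (rule powr_le_endpoints) (use m0 m0h[OF that] hK(1)[OF that(1), of 0 x] in \<open>auto intro: power_mono\<close>)
  define nh where "nh t x = NN \<alpha> \<beta> \<mu> (h 0 t x) (h 1 t x) (h 2 t x)" for t x
  define np where "np t x = NN \<alpha> \<beta> \<mu> (\<phi> 0 t x) (\<phi> 1 t x) (\<phi> 2 t x)" for t x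
  have nhb: "norm (nh t x) \<le> L * K\<^sup>2 * norm (h 0 t x)" "norm (np t x) \<le> L * K\<^sup>2 * norm (\<phi> 0 t x)" if "t \<in> {0..T}" for t x
    unfolding nh_def np_def L using hK that by (auto intro!: NN_bound)
  define U where "U t x = weight \<sigma> (h 0 t x) * (cmod (w 0 t x))\<^sup>2" for t x
  define kk where "kk t x = weight \<sigma> (h 0 t x) * (2 * Re (cnj (w 0 t x) * (\<i> * (np t x - nh t x)))) + weight' \<sigma> (h 0 t x) (\<i> * nh t x) * (cmod (w 0 t x))\<^sup>2" for t x
  have rh: "has_rate T (\<lambda>t. h 0 t x) (\<lambda>t. \<i> * nh t x)" "has_rate T (\<lambda>t. \<phi> 0 t x) (\<lambda>t. \<i> * np t x)" for x
    unfolding nh_def np_def by (rule nls_solD(5)[OF h], rule nls_solD(5)[OF \<phi>])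
  have rw: "has_rate T (\<lambda>t. w 0 t x) (\<lambda>t. \<i> * (np t x - nh t x))" for x
    using has_rate_add[OF rh(2) has_rate_linear[OF bounded_linear_minus[OF bounded_linear_ident] rh(1)], of x x]
    by (simp add: w_def right_diff_distrib)
  have rU: "has_rate T (\<lambda>t. U t x) (\<lambda>t. kk t x)" if x: "x \<in> {p..q}" for x
  proof -
    have 1: "has_rate T (\<lambda>t. weight \<sigma> (h 0 t x)) (\<lambda>t. weight' \<sigma> (h 0 t x) (\<i> * nh t x))"
      by (rule has_rate_weight[OF rh(1), where a="m0\<^sup>2" and b="K\<^sup>2"]) (use m0 m0h[OF _ x] hK(1)[of _ 0 x] in \<open>auto intro: power_mono\<close>)
    have "has_rate T (\<lambda>t. Re (w 0 t x * cnj (w 0 t x))) (\<lambda>t. Re (w 0 t x * cnj (\<i> * (np t x - nh t x)) + \<i> * (np t x - nh t x) * cnj (w 0 t x)))"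
      by (intro has_rate_linear[OF bounded_linear_Re] has_rate_bilinear[OF bounded_bilinear_mult] has_rate_linear[OF bounded_linear_cnj] rw)
    moreover have "Re (w 0 t x * cnj (\<i> * (np t x - nh t x)) + \<i> * (np t x - nh t x) * cnj (w 0 t x)) = 2 * Re (cnj (w 0 t x) * (\<i> * (np t x - nh t x)))" for t
      by (simp add: algebra_simps)
    moreover have "Re (w 0 t x * cnj (w 0 t x)) = (cmod (w 0 t x))\<^sup>2" for t by (simp flip: complex_norm_square)
    ultimately have 2: "has_rate T (\<lambda>t. (cmod (w 0 t x))\<^sup>2) (\<lambda>t. 2 * Re (cnj (w 0 t x) * (\<i> * (np t x - nh t x))))" by (simp only:)
    show ?thesis unfolding U_def kk_def by (rule has_rate_bilinear[OF bounded_bilinear_mult 1 2])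
  qed
  have cn: "continuous_on S (nh t)" "continuous_on S (np t)" if "t \<in> {0..T}" for t S
    unfolding nh_def[abs_def] np_def[abs_def] by (intro continuous_on_NN ch that; simp)+
  have cU: "continuous_on {p..q} (U t)" if "t \<in> {0..T}" for t
    unfolding U_def[abs_def] using that hn[OF that]
    by (intro continuous_intros continuous_on_weight ch) auto
  have ck: "continuous_on {p..q} (kk t)" if "t \<in> {0..T}" for t
    unfolding kk_def[abs_def] using that hn[OF that]
    by (intro continuous_intros continuous_on_weight continuous_on_weight' ch cn) auto
  have kM: "\<bar>kk t x\<bar> \<le> Wm * (2 * (2 * K * (2 * (L * K\<^sup>2 * K)))) + 2 * \<bar>\<sigma>\<bar> * (L * K\<^sup>2) * Wm * (2 * K)\<^sup>2" if tt: "t \<in> {0..T}" "x \<in> {p..q}" for t x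
  proof -
    obtain s where s: "weight' \<sigma> (h 0 t x) (\<i> * nh t x) = s * weight \<sigma> (h 0 t x)" "\<bar>s\<bar> * cmod (h 0 t x) \<le> 2 * \<bar>\<sigma>\<bar> * cmod (\<i> * nh t x)"
      using weight'_eq[OF hn[OF tt]] by metis
    have "\<bar>s\<bar> * cmod (h 0 t x) \<le> (2 * \<bar>\<sigma>\<bar> * (L * K\<^sup>2)) * cmod (h 0 t x)"
      using order_trans[OF s(2) mult_left_mono[of "cmod (\<i> * nh t x)" "L * K\<^sup>2 * norm (h 0 t x)" "2 * \<bar>\<sigma>\<bar>"]] nhb(1)[OF tt(1), of x]
      by (simp add: norm_mult mult_ac)
    then have s': "\<bar>s\<bar> \<le> 2 * \<bar>\<sigma>\<bar> * (L * K\<^sup>2)" using hn[OF tt] by simp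
    have Wp: "0 \<le> Wm" using wWm[OF tt] weight_nonneg order_trans by blast
    have D: "norm (\<i> * (np t x - nh t x)) \<le> 2 * (L * K\<^sup>2 * K)"
    proof -
      have "norm (np t x - nh t x) \<le> L * K\<^sup>2 * K + L * K\<^sup>2 * K"
      proof (rule norm_diff_le)
        have LK: "0 \<le> L * K\<^sup>2" using L0 by simp
        show "norm (np t x) \<le> L * K\<^sup>2 * K"
          by (rule order_trans[OF nhb(2)[OF tt(1)] mult_left_mono[OF hK(2)[OF tt(1)] LK]]) simp
        show "norm (nh t x) \<le> L * K\<^sup>2 * K"
          by (rule order_trans[OF nhb(1)[OF tt(1)] mult_left_mono[OF hK(1)[OF tt(1)] LK]]) simp
      qed
      then show ?thesis unfolding norm_mult norm_ii by linarith
    qed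
    have "\<bar>Re (cnj (w 0 t x) * (\<i> * (np t x - nh t x)))\<bar> \<le> 2 * K * (2 * (L * K\<^sup>2 * K))"
      by (rule order_trans[OF abs_Re_le_cmod norm_mult_le[OF _ D]]) (use wK[OF tt(1), of 0 x] in simp)
    then have a: "\<bar>weight \<sigma> (h 0 t x) * (2 * Re (cnj (w 0 t x) * (\<i> * (np t x - nh t x))))\<bar> \<le> Wm * (2 * (2 * K * (2 * (L * K\<^sup>2 * K))))"
      unfolding abs_mult using wWm[OF tt] weight_nonneg Wp by (intro mult_mono) auto
    have "\<bar>s * weight \<sigma> (h 0 t x) * (cmod (w 0 t x))\<^sup>2\<bar> \<le> 2 * \<bar>\<sigma>\<bar> * (L * K\<^sup>2) * Wm * (2 * K)\<^sup>2"
      unfolding abs_mult abs_power2 abs_norm_cancel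
    proof (intro mult_mono)
      show "\<bar>weight \<sigma> (h 0 t x)\<bar> \<le> Wm" using wWm[OF tt] by (simp add: weight_nonneg)
      show "(cmod (w 0 t x))\<^sup>2 \<le> (2 * K)\<^sup>2" using power_mono[OF wK[OF tt(1), of 0 x], of 2] by simp
    qed (use s' Wp L0 K0 in simp_all)
    then show ?thesis unfolding kk_def s(1) using a by (rule_tac order_trans[OF abs_triangle_ineq add_mono])
  qed
  define b where "b = 8 * W * K ^ 4 * \<eta> powr (2 * (k - \<sigma>) + 1)"
  have bb: "weight \<sigma> (h 0 t x) * ((cmod (h 0 t x))\<^sup>2 * cmod (w 0 t x) * cmod (w 1 t x) + cmod (h 0 t x) * (cmod (w 0 t x))\<^sup>2) \<le> b"
    if tt: "t \<in> {0..T}" and x: "\<bar>x\<bar> = \<eta>" for t x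
  proof -
    have hx: "norm (h 0 t x) \<le> K * \<eta>" using slope_at_zero(2)[OF h k K L small4 h0(1) tt, of x] x by simp
    have wx: "norm (w 0 t x) \<le> 2 * K * \<eta> ^ k" "norm (w 1 t x) \<le> 2 * K * \<eta> ^ (k - 1)"
      using flat[OF tt, of 0 x] flat[OF tt, of 1 x] x by (auto simp: w_def)
    have e0: "0 \<le> \<eta>" using \<eta> by simp
    have "(cmod (h 0 t x))\<^sup>2 * cmod (w 0 t x) * cmod (w 1 t x) + cmod (h 0 t x) * (cmod (w 0 t x))\<^sup>2
      \<le> (K * \<eta>)\<^sup>2 * (2 * K * \<eta> ^ k) * (2 * K * \<eta> ^ (k - 1)) + K * \<eta> * (2 * K * \<eta> ^ k)\<^sup>2"
    proof -
      have a1: "(cmod (h 0 t x))\<^sup>2 \<le> (K * \<eta>)\<^sup>2" by (rule power_mono[OF hx]) simp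
      have a2: "(cmod (w 0 t x))\<^sup>2 \<le> (2 * K * \<eta> ^ k)\<^sup>2" by (rule power_mono[OF wx(1)]) simp
      show ?thesis by (intro add_mono mult_mono a1 a2 hx wx) (use K0 e0 in simp_all)
    qed
    also have "\<dots> = 4 * K ^ 4 * \<eta> ^ (2 * k + 1) + 4 * K ^ 3 * \<eta> ^ (2 * k + 1)"
    proof -
      have X: "\<eta> ^ k = \<eta> * \<eta> ^ (k - 1)" using k by (metis Suc_1 Suc_le_D diff_Suc_1 power_Suc)
      have Z: "\<eta> ^ (2 * k + 1) = \<eta> * \<eta> ^ k * \<eta> ^ k" by (simp add: power_add mult_2)
      have "(K * \<eta>)\<^sup>2 * (2 * K * (\<eta> * Y)) * (2 * K * Y) + K * \<eta> * (2 * K * (\<eta> * Y))\<^sup>2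
         = 4 * K ^ 4 * (\<eta> * (\<eta> * Y) * (\<eta> * Y)) + 4 * K ^ 3 * (\<eta> * (\<eta> * Y) * (\<eta> * Y))" for Y
        by algebra
      then show ?thesis unfolding Z X .
    qed
    also have "\<dots> \<le> 8 * K ^ 4 * \<eta> ^ (2 * k + 1)"
    proof -
      have "K ^ 3 * \<eta> ^ (2 * k + 1) \<le> K ^ 4 * \<eta> ^ (2 * k + 1)" using K e0 by (intro mult_right_mono power_increasing) auto
      then show ?thesis unfolding mult.assoc by linarith
    qed
    finally have "weight \<sigma> (h 0 t x) * ((cmod (h 0 t x))\<^sup>2 * cmod (w 0 t x) * cmod (w 1 t x) + cmod (h 0 t x) * (cmod (w 0 t x))\<^sup>2)
      \<le> (W * \<eta> powr (- 2 * \<sigma>)) * (8 * K ^ 4 * \<eta> ^ (2 * k + 1))"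
      using W[OF tt, of x] x \<eta> W0 by (intro mult_mono) simp_all
    also have "\<eta> ^ (2 * k + 1) = \<eta> powr (2 * k + 1)" by (subst powr_realpow[OF \<eta>(1), symmetric]) simp
    also have "(W * \<eta> powr (- 2 * \<sigma>)) * (8 * K ^ 4 * \<eta> powr (2 * k + 1)) = 8 * W * K ^ 4 * (\<eta> powr (- 2 * \<sigma>) * \<eta> powr (2 * k + 1))" by simp
    also have "\<dots> = b" unfolding b_def by (simp add: algebra_simps flip: powr_add)
    finally show ?thesis .
  qed
  have per: "u j t (2 * pi - \<eta>) = u j t (- \<eta>)" if "nls_sol \<alpha> \<beta> \<mu> k T K u" "t \<in> {0..T}" "j \<le> k" for u :: "nat \<Rightarrow> real \<Rightarrow> real \<Rightarrow> complex" and j t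
    using nls_solD(4)[OF that, of "- \<eta>"] by simp
  have bd: "weight \<sigma> (h 0 t x) * ((cmod (h 0 t x))\<^sup>2 * cmod (w 0 t x) * cmod (w 1 t x) + cmod (h 0 t x) * (cmod (w 0 t x))\<^sup>2) \<le> b"
    if tt: "t \<in> {0..T}" and x: "x \<in> {p, q}" for t x
  proof (cases "x = p")
    case True
    then show ?thesis using bb[OF tt, of x] \<eta> by (simp add: p_def)
  next
    case False
    then have x: "x = 2 * pi - \<eta>" using x by (simp add: q_def)
    have "0 \<le> k" "1 \<le> k" using k by auto
    then have e: "h 0 t x = h 0 t (- \<eta>)" "w 0 t x = w 0 t (- \<eta>)" "w 1 t x = w 1 t (- \<eta>)"
      unfolding x w_def by (simp_all add: per[OF h tt] per[OF \<phi> tt])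
    show ?thesis unfolding e using bb[OF tt, of "- \<eta>"] \<eta> by simp
  qed
  define E where "E t = integral {p..q} (U t)" for t
  have kE: "integral {p..q} (kk t) \<le> 16 * L * K * b + 20 * (1 + \<bar>\<sigma>\<bar>) * L * K\<^sup>2 * E t" if tt: "t \<in> {0..T}" for t
  proof -
    have kk': "kk t = (\<lambda>x. weight \<sigma> (h 0 t x) * (2 * Re (cnj (w 0 t x) * (\<i> * (NN \<alpha> \<beta> \<mu> (h 0 t x + w 0 t x) (h 1 t x + w 1 t x) (h 2 t x + w 2 t x)
          - NN \<alpha> \<beta> \<mu> (h 0 t x) (h 1 t x) (h 2 t x))))) + weight' \<sigma> (h 0 t x) (\<i> * nh t x) * (cmod (w 0 t x))\<^sup>2)"
      unfolding kk_def[abs_def] nh_def np_def \<phi>w by (rule refl)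
    have dh: "(h j t has_vector_derivative h (Suc j) t x) (at x within {p..q})" if "j \<le> 1" for j x
      by (rule has_vector_derivative_at_within[OF nls_solD(1)[OF h tt]]) (use that k in simp)
    have dw: "(w j t has_vector_derivative w (Suc j) t x) (at x within {p..q})" if "j \<le> 1" for j x
      unfolding w_def[abs_def]
      by (rule has_vector_derivative_diff[OF has_vector_derivative_at_within[OF nls_solD(1)[OF \<phi> tt]] has_vector_derivative_at_within[OF nls_solD(1)[OF h tt]]])
        (use that k in simp_all)
    show ?thesis unfolding E_def kk' U_def[abs_def]
    proof (rule energy_fixed_time[where h="h 0 t" and ?h1.0="h 1 t" and ?h2.0="h 2 t" and w="w 0 t" and ?w1.0="w 1 t" and ?w2.0="w 2 t" and ht="\<lambda>x. \<i> * nh t x" and \<mu>=\<mu>, OF pq sg])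
      show "(h 0 t has_vector_derivative h 1 t x) (at x within {p..q})" "(h 1 t has_vector_derivative h 2 t x) (at x within {p..q})"
        "(w 0 t has_vector_derivative w 1 t x) (at x within {p..q})" "(w 1 t has_vector_derivative w 2 t x) (at x within {p..q})" for x
        using dh[of 0 x] dh[of 1 x] dw[of 0 x] dw[of 1 x] by (simp_all add: numeral_2_eq_2)
      show "norm (h 0 t x) \<le> K \<and> norm (h 1 t x) \<le> K \<and> norm (h 2 t x) \<le> K" for x using hK(1)[OF tt] by simp
      show "norm (h 0 t x + w 0 t x) \<le> K \<and> norm (h 1 t x + w 1 t x) \<le> K \<and> norm (h 2 t x + w 2 t x) \<le> K" for x
        using hK(2)[OF tt] by (simp flip: \<phi>w)
      show "norm (\<i> * nh t x) \<le> L * K\<^sup>2 * norm (h 0 t x)" for x using nhb(1)[OF tt] by (simp add: norm_mult)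
      show "(\<lambda>x. weight \<sigma> (h 0 t x) * (2 * Re (cnj (w 0 t x) * (\<i> * (NN \<alpha> \<beta> \<mu> (h 0 t x + w 0 t x) (h 1 t x + w 1 t x) (h 2 t x + w 2 t x)
          - NN \<alpha> \<beta> \<mu> (h 0 t x) (h 1 t x) (h 2 t x))))) + weight' \<sigma> (h 0 t x) (\<i> * nh t x) * (cmod (w 0 t x))\<^sup>2) integrable_on {p..q}"
        unfolding kk'[symmetric] by (rule integrable_continuous_real[OF ck[OF tt]])
      show "(\<lambda>x. weight \<sigma> (h 0 t x) * (cmod (w 0 t x))\<^sup>2) integrable_on {p..q}"
        unfolding U_def[abs_def, symmetric] by (rule integrable_continuous_real) (use cU[OF tt] in \<open>simp add: U_def[abs_def]\<close>)
    qed (use hn[OF tt] bd[OF tt] L K in auto)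
  qed
  have E0: "E t \<le> Wm * (2 * K)\<^sup>2 * (q - p)" if tt: "t \<in> {0..T}" for t
  proof -
    have "E t \<le> integral {p..q} (\<lambda>_. Wm * (2 * K)\<^sup>2)" unfolding E_def
    proof (rule integral_le)
      show "U t x \<le> Wm * (2 * K)\<^sup>2" if "x \<in> {p..q}" for x
        unfolding U_def
        by (intro mult_mono wWm[OF tt that] power_mono[OF wK[OF tt, of 0 x]] order_trans[OF weight_nonneg wWm[OF tt that]]) auto
    qed (auto intro: integrable_continuous_real[OF cU[OF tt]])
    then show ?thesis using pq by (simp add: mult_ac)
  qed
  have Epos: "0 \<le> E t" if "t \<in> {0..T}" for t unfolding E_def
    by (rule integral_nonneg) (auto simp: U_def weight_nonneg intro: integrable_continuous_real[OF cU[OF that]])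
  have b0: "0 \<le> b" using W0 K0 by (simp add: b_def)
  \<comment> \<open>The 40 in the smallness condition is twice the 20 of
    \<open>energy_fixed_time\<close>, so that the energy contributes half of its supremum over the
    time interval.\<close>
  have "E t \<le> 2 * (E 0 + 16 * L * K * b * T)"
  proof (rule sup_absorb[OF E0 _ t])
    fix S s assume S: "\<And>s. s \<in> {0..T} \<Longrightarrow> E s \<le> S" and s: "s \<in> {0..T}"
    have S0: "0 \<le> S" using S[OF s] Epos[OF s] by linarith
    define B where "B = 16 * L * K * b + 20 * (1 + \<bar>\<sigma>\<bar>) * L * K\<^sup>2 * S"
    have B0: "0 \<le> B" unfolding B_def using L0 K0 b0 S0 by (intro add_nonneg_nonneg mult_nonneg_nonneg) auto
    have "E s \<le> E 0 + B * s" unfolding E_def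
    proof (rule evolution_integral_le[OF pq rU cU ck kM _ s])
      fix t assume tt: "t \<in> {0..T}"
      have "20 * (1 + \<bar>\<sigma>\<bar>) * L * K\<^sup>2 * E t \<le> 20 * (1 + \<bar>\<sigma>\<bar>) * L * K\<^sup>2 * S"
        using S[OF tt] L0 by (intro mult_left_mono) auto
      then show "integral {p..q} (kk t) \<le> B" using kE[OF tt] by (simp add: B_def)
    qed
    also have "B * s \<le> B * T" using s B0 by (intro mult_left_mono) auto
    also have "B * T = 16 * L * K * b * T + (40 * (1 + \<bar>\<sigma>\<bar>) * L * K\<^sup>2 * T) * (S / 2)" by (simp add: B_def algebra_simps)
    also have "(40 * (1 + \<bar>\<sigma>\<bar>) * L * K\<^sup>2 * T) * (S / 2) \<le> 1 * (S / 2)" using small S0 by (intro mult_right_mono) auto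
    finally show "E s \<le> E 0 + 16 * L * K * b * T + S / 2" by simp
  qed
  then show ?thesis unfolding E_def U_def[abs_def] w_def p_def q_def b_def by simp
qed

lemma difference_rate:
  assumes \<phi>: "nls_sol \<alpha> \<beta> \<mu> k T K \<phi>" and h: "nls_sol \<alpha> \<beta> \<mu> k T K h"
  shows "has_rate T (\<lambda>t. \<phi> 0 t x - h 0 t x) (\<lambda>t. \<i> * (NN \<alpha> \<beta> \<mu> (\<phi> 0 t x) (\<phi> 1 t x) (\<phi> 2 t x) - NN \<alpha> \<beta> \<mu> (h 0 t x) (h 1 t x) (h 2 t x)))"
  using has_rate_add[OF nls_solD(5)[OF \<phi>] has_rate_linear[OF bounded_linear_minus[OF bounded_linear_ident] nls_solD(5)[OF h]], of x x]
  by (simp add: right_diff_distrib)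

lemma integral_indicator_reciprocal:
  fixes a :: real
  assumes "0 < a" "p \<le> a" "2 * a \<le> q"
  shows "(\<lambda>x. if x \<in> {a..2*a} then 1 / a else 0) integrable_on {p..q}"
    "integral {p..q} (\<lambda>x. if x \<in> {a..2*a} then 1 / a else 0) = 1"
proof -
  have "((\<lambda>x. 1 / a) has_integral (1 / a) * (2 * a - a)) {a..2*a}"
    using has_integral_const_real[of "1 / a" a "2 * a"] assms by (simp add: mult.commute)
  then have "((\<lambda>x. if x \<in> {a..2*a} then 1 / a else 0) has_integral 1) {p..q}"
    using assms by (subst has_integral_restrict) auto
  then show "(\<lambda>x. if x \<in> {a..2*a} then 1 / a else 0) integrable_on {p..q}"
    "integral {p..q} (\<lambda>x. if x \<in> {a..2*a} then 1 / a else 0) = 1"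
    by (auto simp: integral_unique)
qed

lemma packet_support:
  fixes A m t x :: real
  assumes "m > 0"
  shows "m ^ 8 * x * exp (2 * A * m ^ 4 * t) \<in> {1..2} \<longleftrightarrow> x \<in> {exp (- (2 * A * m ^ 4 * t)) / m ^ 8 .. 2 * (exp (- (2 * A * m ^ 4 * t)) / m ^ 8)}"
  using assms by (auto simp: exp_minus field_simps)

text \<open>The parameter l is the one of the AM-GM inequality that splits the error term.\<close>

lemma pairing_bound:
  fixes \<phi> h :: "nat \<Rightarrow> real \<Rightarrow> real \<Rightarrow> complex" and m T :: real
  assumes \<phi>: "nls_sol \<alpha> \<beta> \<mu> k T K \<phi>" and h: "nls_sol \<alpha> \<beta> \<mu> k T K h" and k: "k \<ge> 2" and K: "K \<ge> 1"
    and L: "L = 1 + \<bar>\<alpha>\<bar> + \<bar>\<beta>\<bar> + norm \<mu>" and sg: "\<sigma> = 1 - \<alpha> / 2 - \<beta>" and s: "s = - \<sigma> - 1 / 2"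
    and small: "L * K\<^sup>2 * T \<le> 1 / 4"
    and h0: "h 0 0 0 = 0" and A: "A = (cmod (h 1 0 0))\<^sup>2" and A0: "A > 0"
    and flat: "\<And>t x i. t \<in> {0..T} \<Longrightarrow> i \<le> 2 \<Longrightarrow> norm (\<phi> i t x - h i t x) \<le> 2 * K * \<bar>x\<bar> ^ (k - i)"
    and m: "m \<ge> 1" "m ^ 8 * x1 \<ge> 2" "x1 \<le> 1" "T * m ^ 3 \<le> 1"
    and W: "\<And>t x. t \<in> {0..T} \<Longrightarrow> 0 < x \<Longrightarrow> x \<le> x1 \<Longrightarrow> x powr (- 2 * \<sigma>) \<le> W * weight \<sigma> (h 0 t x)"
    and W0: "W > 0" and \<eta>: "0 < \<eta>" "\<And>t. t \<in> {0..T} \<Longrightarrow> \<eta> < exp (- (2 * A * m ^ 4 * t)) / m ^ 8" and \<eta>1: "\<eta> \<le> 1"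
    and hn: "\<And>t x. t \<in> {0..T} \<Longrightarrow> x \<in> {\<eta>..2*pi-\<eta>} \<Longrightarrow> h 0 t x \<noteq> 0"
    and g: "\<And>t x. x > 0 \<Longrightarrow> (g t has_vector_derivative g1 t x) (at x)" "\<And>t x. x > 0 \<Longrightarrow> (g1 t has_vector_derivative g2 t x) (at x)"
      "\<And>t x. x > 0 \<Longrightarrow> ((\<lambda>t. g t x) has_vector_derivative gt t x) (at t)"
      "\<And>t. continuous_on {0<..} (g2 t)" "\<And>t. continuous_on {0<..} (gt t)" "\<And>x. continuous_on UNIV (\<lambda>t. gt t x)"
    and gb: "\<And>t x \<Gamma>. x > 0 \<Longrightarrow> \<Gamma> = (if m ^ 8 * x * exp (2 * A * m ^ 4 * t) \<in> {1..2} then C * x powr s else 0) \<Longrightarrow>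
          norm (g t x) \<le> \<Gamma> \<and> x * norm (g1 t x) \<le> m ^ 4 * \<Gamma> \<and> x\<^sup>2 * norm (g2 t x) \<le> m ^ 8 * \<Gamma>
          \<and> norm (gt t x + \<i> * A * (x * (x * g2 t x) + 4 * (x * g1 t x) + 2 * g t x) - \<i> * of_real ((\<alpha> + 2 * \<beta>) * A) * (x * g1 t x + g t x)
               + \<i> * \<alpha> * cnj (h 1 0 0 * h 1 0 0 * (x * g1 t x + g t x))) \<le> \<Gamma>"
    and C: "C \<ge> 1" and l: "l > 0"
    and E: "\<And>t. t \<in> {0..T} \<Longrightarrow> integral {\<eta>..2*pi-\<eta>} (\<lambda>x. weight \<sigma> (h 0 t x) * (cmod (\<phi> 0 t x - h 0 t x))\<^sup>2) \<le> E"
    and t: "t \<in> {0..T}"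
  shows "integral {\<eta>..2*pi-\<eta>} (\<lambda>x. - Re ((\<phi> 0 t x - h 0 t x) * g t x)) \<le> integral {\<eta>..2*pi-\<eta>} (\<lambda>x. - Re ((\<phi> 0 0 x - h 0 0 x) * g 0 x))
     + (94 * L\<^sup>2 * K ^ 4 * m * C * (l * W * E + 1 / l)) * t"
proof -
  define p where "p = \<eta>"
  define q where "q = 2 * pi - \<eta>"
  have x1: "2 / m ^ 8 \<le> x1" using m by (simp add: divide_le_eq mult.commute)
  have pq: "p \<le> q" using \<eta> \<eta>1 pi_gt3 by (simp add: p_def q_def)
  have qb: "q \<ge> 4" "q < 2 * pi" using \<eta> \<eta>1 pi_gt3 by (simp_all add: q_def)
  have pos: "0 < x" if "x \<in> {p..q}" for x using that \<eta> by (simp add: p_def)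
  have T0: "0 \<le> T" "0 \<in> {0..T}" using t by auto
  have L0: "L \<ge> 1" using L by simp
  have K0: "0 \<le> K" using K by simp
  define w where "w i t x = \<phi> i t x - h i t x" for i t x
  have \<phi>w: "\<phi> i t x = h i t x + w i t x" for i t x by (simp add: w_def)
  have hK: "norm (h i t x) \<le> K" "norm (\<phi> i t x) \<le> K" if "t \<in> {0..T}" "i \<le> 2" for i t x
    using nls_solD(3)[OF h that(1), of i] nls_solD(3)[OF \<phi> that(1), of i] that k by auto
  have wK: "norm (w i t x) \<le> 2 * K" if "t \<in> {0..T}" "i \<le> 2" for i t x
    unfolding w_def using norm_diff_le[OF hK(2)[OF that] hK(1)[OF that]] by simp
  have ch: "continuous_on S (h i t)" "continuous_on S (\<phi> i t)" "continuous_on S (w i t)" if "t \<in> {0..T}" "i \<le> 2" for i t S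
    unfolding w_def[abs_def] using that k
    by (auto intro!: nls_sol_continuous_on[OF h] nls_sol_continuous_on[OF \<phi>] continuous_on_diff)
  \<comment> \<open>The left end of the support of the test function, which is the single octave
    [xt, 2 xt].\<close>
  define xt where "xt t = exp (- (2 * A * m ^ 4 * t)) / m ^ 8" for t
  have xt: "0 < xt t" "\<eta> < xt t" "xt t * m ^ 8 \<le> 1" "2 * xt t \<le> x1" if "t \<in> {0..T}" for t
  proof -
    show "0 < xt t" using m by (simp add: xt_def)
    show "\<eta> < xt t" unfolding xt_def by (rule \<eta>(2)[OF that])
    have "0 \<le> 2 * A * m ^ 4 * t" using A0 m that by simp
    then have "exp (- (2 * A * m ^ 4 * t)) \<le> 1" by simp
    then show "xt t * m ^ 8 \<le> 1" using m by (simp add: xt_def)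
    then have "2 * xt t \<le> 2 / m ^ 8" using m by (simp add: pos_le_divide_eq)
    then show "2 * xt t \<le> x1" using x1 by linarith
  qed
  have supp: "m ^ 8 * x * exp (2 * A * m ^ 4 * t) \<in> {1..2} \<longleftrightarrow> x \<in> {xt t..2 * xt t}" for t x
    unfolding xt_def by (rule packet_support) (use m in simp)
  define G where "G t x = (if x \<in> {xt t..2 * xt t} then C * x powr s else 0)" for t x
  note gb' = gb[unfolded supp, folded G_def, OF _ refl]
  define np where "np t x = NN \<alpha> \<beta> \<mu> (\<phi> 0 t x) (\<phi> 1 t x) (\<phi> 2 t x) - NN \<alpha> \<beta> \<mu> (h 0 t x) (h 1 t x) (h 2 t x)" for t x
  \<comment> \<open>With this sign an upper bound on the evolution is a lower bound on the
    pairing.\<close>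
  define U where "U t x = - Re (w 0 t x * g t x)" for t x
  define kk where "kk t x = - Re (\<i> * np t x * g t x + w 0 t x * gt t x)" for t x
  have rU: "has_rate T (\<lambda>t. U t x) (\<lambda>t. kk t x)" if x: "x \<in> {p..q}" for x
  proof -
    have 1: "has_rate T (\<lambda>t. w 0 t x) (\<lambda>t. \<i> * np t x)"
      unfolding w_def np_def by (rule difference_rate[OF \<phi> h])
    have 2: "has_rate T (\<lambda>t. g t x) (\<lambda>t. gt t x)"
      by (rule has_rate_C1) (auto intro: has_vector_derivative_at_within[OF g(3)[OF pos[OF x]]] continuous_on_subset[OF g(6)])
    have "has_rate T (\<lambda>t. - Re (w 0 t x * g t x)) (\<lambda>t. - Re (w 0 t x * gt t x + \<i> * np t x * g t x))"
      by (rule has_rate_linear[OF bounded_linear_minus[OF bounded_linear_Re] has_rate_bilinear[OF bounded_bilinear_mult 1 2]])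
    then show ?thesis unfolding U_def kk_def by (simp only: add.commute)
  qed
  have cg: "continuous_on {p..q} (g t)" "continuous_on {p..q} (g1 t)" "continuous_on {p..q} (g2 t)" "continuous_on {p..q} (gt t)" for t
  proof -
    have "isCont (g t) x" "isCont (g1 t) x" if "x \<in> {p..q}" for x
      using has_vector_derivative_continuous[OF g(1)[OF pos[OF that]]] has_vector_derivative_continuous[OF g(2)[OF pos[OF that]]] by auto
    then show "continuous_on {p..q} (g t)" "continuous_on {p..q} (g1 t)" by (simp_all add: continuous_at_imp_continuous_on)
    have "{p..q} \<subseteq> {0<..}" using pos by auto
    then show "continuous_on {p..q} (g2 t)" "continuous_on {p..q} (gt t)"
      using continuous_on_subset[OF g(4)] continuous_on_subset[OF g(5)] by blast+
  qed
  have cnp: "continuous_on S (np t)" if "t \<in> {0..T}" for t S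
    unfolding np_def[abs_def] by (intro continuous_on_diff continuous_on_NN ch that; simp)
  have cU: "continuous_on {p..q} (U t)" if "t \<in> {0..T}" for t
    unfolding U_def[abs_def] by (intro continuous_intros cg ch that) simp
  have ck: "continuous_on {p..q} (kk t)" if "t \<in> {0..T}" for t
    unfolding kk_def[abs_def] by (intro continuous_intros cg ch cnp that) simp
  \<comment> \<open>A crude bound, uniform in time and space, for the exchange of integrations; it
    may depend on \<eta> and m.\<close>
  have Gle: "\<exists>M. \<forall>t\<in>{0..T}. \<forall>x\<in>{p..q}. \<bar>kk t x\<bar> \<le> M"
  proof -
    define P where "P = C * (p powr s + q powr s)"
    have Pp: "0 \<le> P" using C by (simp add: P_def)
    have GP: "0 \<le> G t x" "G t x \<le> P" if "x \<in> {p..q}" for t x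
    proof -
      have "x powr s \<le> p powr s + q powr s" using powr_le_endpoints[of p x q s] that \<eta> by (simp add: p_def)
      then have "C * x powr s \<le> P" unfolding P_def using C by (intro mult_left_mono) auto
      then show "0 \<le> G t x" "G t x \<le> P" using Pp C by (auto simp: G_def)
    qed
    have ab: "norm (complex_of_real \<alpha>) \<le> \<bar>\<alpha>\<bar>" "norm (complex_of_real A) \<le> A" "norm \<i> \<le> 1" "norm (4::complex) \<le> 4" "norm (2::complex) \<le> 2"
      using A0 by auto
    have ab2: "norm (complex_of_real ((\<alpha> + 2 * \<beta>) * A)) \<le> \<bar>(\<alpha> + 2 * \<beta>) * A\<bar>" by (simp only: norm_of_real)
    have aK: "norm (h 1 0 0) \<le> K" using hK(1)[OF T0(2), of 1 0] by simp
    have gtb: "norm (gt t x) \<le> P + (1 * A * (m ^ 8 * P + 4 * (m ^ 4 * P) + 2 * P)) + 1 * \<bar>(\<alpha> + 2 * \<beta>) * A\<bar> * (m ^ 4 * P + P) + 1 * \<bar>\<alpha>\<bar> * (K * K * (m ^ 4 * P + P))"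
      if "x \<in> {p..q}" for t x
    proof -
      note b = gb'[OF pos[OF that], of t]
      have m0: "0 \<le> m ^ 4" "0 \<le> m ^ 8" using m by auto
      have x0: "0 < x" by (rule pos[OF that])
      have n: "norm (g t x) \<le> P" "norm (x * g1 t x) \<le> m ^ 4 * P" "norm (x * (x * g2 t x)) \<le> m ^ 8 * P"
        using b GP[OF that, of t] m0 x0 mult_left_mono[OF GP(2)[OF that, of t] m0(1)] mult_left_mono[OF GP(2)[OF that, of t] m0(2)]
        by (auto simp: norm_mult power2_eq_square mult.assoc intro: order_trans)
      define M where "M = gt t x + \<i> * A * (x * (x * g2 t x) + 4 * (x * g1 t x) + 2 * g t x) - \<i> * of_real ((\<alpha> + 2 * \<beta>) * A) * (x * g1 t x + g t x)
               + \<i> * \<alpha> * cnj (h 1 0 0 * h 1 0 0 * (x * g1 t x + g t x))"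
      have Mb: "norm M \<le> P" unfolding M_def using b GP(2)[OF that, of t] by (meson order_trans)
      have "gt t x = M - \<i> * A * (x * (x * g2 t x) + 4 * (x * g1 t x) + 2 * g t x) + \<i> * of_real ((\<alpha> + 2 * \<beta>) * A) * (x * g1 t x + g t x)
               - \<i> * \<alpha> * cnj (h 1 0 0 * h 1 0 0 * (x * g1 t x + g t x))" unfolding M_def by algebra
      also have "norm \<dots> \<le> P + (1 * A * (m ^ 8 * P + 4 * (m ^ 4 * P) + 2 * P)) + 1 * \<bar>(\<alpha> + 2 * \<beta>) * A\<bar> * (m ^ 4 * P + P) + 1 * \<bar>\<alpha>\<bar> * (K * K * (m ^ 4 * P + P))"
        by (intro norm_diff_le norm_add_le norm_mult_le Mb ab ab2 n, subst complex_mod_cnj, intro norm_mult_le norm_add_le aK n)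
      finally show ?thesis .
    qed
    have npb: "norm (np t x) \<le> L * K\<^sup>2 * K + L * K\<^sup>2 * K" if "t \<in> {0..T}" for t x
    proof -
      have LK: "0 \<le> L * K\<^sup>2" using L0 by simp
      have "norm (NN \<alpha> \<beta> \<mu> (u 0 t x) (u 1 t x) (u 2 t x)) \<le> L * K\<^sup>2 * K" if u: "\<And>i. i \<le> 2 \<Longrightarrow> norm (u i t x) \<le> K" for u :: "nat \<Rightarrow> real \<Rightarrow> real \<Rightarrow> complex"
        using order_trans[OF NN_bound[of "u 0 t x" K "u 1 t x" "u 2 t x" \<alpha> \<beta> \<mu>] mult_left_mono[OF u[of 0] LK[unfolded L]]] u unfolding L by simp
      then show ?thesis unfolding np_def using hK that by (intro norm_diff_le) auto
    qed
    show ?thesis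
    proof (intro exI ballI)
      fix t x assume tt: "t \<in> {0..T}" and x: "x \<in> {p..q}"
      have "norm (g t x) \<le> P" using gb'[OF pos[OF x], of t] GP(2)[OF x, of t] by linarith
      then have "norm (\<i> * np t x * g t x + w 0 t x * gt t x) \<le> 1 * (L * K\<^sup>2 * K + L * K\<^sup>2 * K) * P + 2 * K * (P + (1 * A * (m ^ 8 * P + 4 * (m ^ 4 * P) + 2 * P)) + 1 * \<bar>(\<alpha> + 2 * \<beta>) * A\<bar> * (m ^ 4 * P + P) + 1 * \<bar>\<alpha>\<bar> * (K * K * (m ^ 4 * P + P)))"
        by (intro norm_add_le norm_mult_le npb[OF tt] gtb[OF x] ab wK[OF tt]) simp_all
      then show "\<bar>kk t x\<bar> \<le> 1 * (L * K\<^sup>2 * K + L * K\<^sup>2 * K) * P + 2 * K * (P + (1 * A * (m ^ 8 * P + 4 * (m ^ 4 * P) + 2 * P)) + 1 * \<bar>(\<alpha> + 2 * \<beta>) * A\<bar> * (m ^ 4 * P + P) + 1 * \<bar>\<alpha>\<bar> * (K * K * (m ^ 4 * P + P)))"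
        unfolding kk_def abs_minus_cancel by (rule order_trans[OF abs_Re_le_cmod])
    qed
  qed
  then obtain M where M: "\<And>t x. t \<in> {0..T} \<Longrightarrow> x \<in> {p..q} \<Longrightarrow> \<bar>kk t x\<bar> \<le> M" by blast
  define D where "D = 94 * L\<^sup>2 * K ^ 4 * m * C"
  have D0: "0 \<le> D" using m C K0 by (simp add: D_def)
  have kE: "integral {p..q} (kk t) \<le> D * (l * W * E + 1 / l)" if tt: "t \<in> {0..T}" for t
  proof -
    \<comment> \<open>The error density is D x^s |w|, and x^s |w| is x^(-\<sigma>) |w| times
      x^(-1/2). The square of the first factor is the energy density up to \<open>W\<close>; the
      square of the second is at most 1 / xt on an interval of length xt, so it integrates to at
      most 1.\<close>
    define e where "e x = D * (l * W) * (weight \<sigma> (h 0 t x) * (cmod (w 0 t x))\<^sup>2) + D / l * (if x \<in> {xt t..2 * xt t} then 1 / xt t else 0)" for x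
    have i1: "(\<lambda>x. weight \<sigma> (h 0 t x) * (cmod (w 0 t x))\<^sup>2) integrable_on {p..q}"
      by (rule integrable_continuous_real, intro continuous_intros continuous_on_weight ch tt) (use hn[OF tt] in \<open>auto simp: p_def q_def\<close>)
    have i2: "(\<lambda>x. if x \<in> {xt t..2 * xt t} then 1 / xt t else 0) integrable_on {p..q}"
      "integral {p..q} (\<lambda>x. if x \<in> {xt t..2 * xt t} then 1 / xt t else 0) = 1"
      using integral_indicator_reciprocal[of "xt t" p q] xt[OF tt] m(3) qb by (auto simp: p_def)
    have ei: "e integrable_on {p..q}" unfolding e_def[abs_def]
      by (intro integrable_add integrable_on_mult_right i1 i2)
    have dh: "(h j t has_vector_derivative h (Suc j) t x) (at x within {p..q})" if "j \<le> 1" for j x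
      by (rule has_vector_derivative_at_within[OF nls_solD(1)[OF h tt]]) (use that k in simp)
    have dw: "(w j t has_vector_derivative w (Suc j) t x) (at x within {p..q})" if "j \<le> 1" for j x
      unfolding w_def[abs_def]
      by (rule has_vector_derivative_diff[OF has_vector_derivative_at_within[OF nls_solD(1)[OF \<phi> tt]] has_vector_derivative_at_within[OF nls_solD(1)[OF h tt]]])
        (use that k in simp_all)
    have dg: "((\<lambda>x. - g t x) has_vector_derivative - g1 t x) (at x within {p..q})" "((\<lambda>x. - g1 t x) has_vector_derivative - g2 t x) (at x within {p..q})" if "x \<in> {p..q}" for x
      by (rule has_vector_derivative_minus, rule has_vector_derivative_at_within, rule g(1)[OF pos[OF that]],
          rule has_vector_derivative_minus, rule has_vector_derivative_at_within, rule g(2)[OF pos[OF that]])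
    have zero: "g t x = 0 \<and> g1 t x = 0 \<and> g2 t x = 0 \<and> gt t x = 0" if "0 < x" "x \<notin> {xt t..2 * xt t}" for x
    proof -
      have G0: "G t x = 0" by (simp only: G_def that(2) if_False)
      note b = gb'[OF that(1), of t, unfolded G0 mult_zero_right]
      have z: "v = 0" if "c * norm v \<le> 0" "0 < c" for c :: real and v :: complex
        using that by (simp add: mult_le_0_iff)
      have g: "g t x = 0" "g1 t x = 0" "g2 t x = 0"
        using b z[of x] z[of "x\<^sup>2"] that(1) by auto
      have "norm (gt t x) \<le> 0" using b unfolding g by simp
      then show ?thesis using g by simp
    qed
    have pz: "p \<notin> {xt t..2 * xt t}" "q \<notin> {xt t..2 * xt t}" using xt[OF tt] qb m(3) by (auto simp: p_def)
    have kk': "kk t = (\<lambda>x. Re (\<i> * (NN \<alpha> \<beta> \<mu> (h 0 t x + w 0 t x) (h 1 t x + w 1 t x) (h 2 t x + w 2 t x)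
          - NN \<alpha> \<beta> \<mu> (h 0 t x) (h 1 t x) (h 2 t x)) * (- g t x) + w 0 t x * (- gt t x)))"
      unfolding kk_def[abs_def] np_def \<phi>w by (simp add: fun_eq_iff)
    have "integral {p..q} (kk t) \<le> integral {p..q} e"
      unfolding kk'
    proof (rule duality_fixed_time[where h="h 0 t" and ?h1.0="h 1 t" and ?h2.0="h 2 t" and w="w 0 t" and ?w1.0="w 1 t" and ?w2.0="w 2 t"
          and g="\<lambda>x. - g t x" and ?g1.0="\<lambda>x. - g1 t x" and ?g2.0="\<lambda>x. - g2 t x" and gt="\<lambda>x. - gt t x", OF pq])
      show "(h 0 t has_vector_derivative h 1 t x) (at x within {p..q})" "(h 1 t has_vector_derivative h 2 t x) (at x within {p..q})"
        "(w 0 t has_vector_derivative w 1 t x) (at x within {p..q})" "(w 1 t has_vector_derivative w 2 t x) (at x within {p..q})" for x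
        using dh[of 0 x] dh[of 1 x] dw[of 0 x] dw[of 1 x] by (simp_all add: numeral_2_eq_2)
      show "- g t p = 0" "- g1 t p = 0" "- g t q = 0" "- g1 t q = 0"
        using zero[of p] zero[of q] pz pos[of p] pos[of q] pq by auto
      show "(\<lambda>x. Re (\<i> * (NN \<alpha> \<beta> \<mu> (h 0 t x + w 0 t x) (h 1 t x + w 1 t x) (h 2 t x + w 2 t x)
          - NN \<alpha> \<beta> \<mu> (h 0 t x) (h 1 t x) (h 2 t x)) * (- g t x) + w 0 t x * (- gt t x))) integrable_on {p..q}"
        unfolding kk'[symmetric] by (rule integrable_continuous_real[OF ck[OF tt]])
      fix x assume x: "x \<in> {p..q}"
      note b = gb'[OF pos[OF x], of t]
      have x0: "0 < x" by (rule pos[OF x])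
      have Zb: "norm (ZZ \<alpha> \<beta> \<mu> (h 0 t x) (h 2 t x) (w 0 t x) (h 1 t x + w 1 t x) (h 2 t x + w 2 t x)) \<le> 3 * L * K\<^sup>2 * norm (w 0 t x)"
        unfolding L by (rule ZZ_bound) (use hK[OF tt] in \<open>auto simp flip: \<phi>w\<close>)
      show "norm (\<i> * ((h 2 t x * cnj (h 0 t x) + 2 * h 1 t x * cnj (h 1 t x) + h 0 t x * cnj (h 2 t x)) * (- g t x)
             + 2 * (h 1 t x * cnj (h 0 t x) + h 0 t x * cnj (h 1 t x)) * (- g1 t x) + h 0 t x * cnj (h 0 t x) * (- g2 t x))
          - \<i> * ((of_real \<alpha> * (h 1 t x * cnj (h 1 t x) + h 0 t x * cnj (h 2 t x)) + 2 * of_real \<beta> * (cnj (h 1 t x) * h 1 t x + cnj (h 0 t x) * h 2 t x)) * (- g t x)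
             + (of_real \<alpha> * h 0 t x * cnj (h 1 t x) + 2 * of_real \<beta> * cnj (h 0 t x) * h 1 t x) * (- g1 t x))
          + \<i> * cnj (of_real \<alpha> * (h 1 t x * h 1 t x + h 0 t x * h 2 t x) * (- g t x) + of_real \<alpha> * h 0 t x * h 1 t x * (- g1 t x)) + (- gt t x)
          - \<i> * ((of_real \<alpha> * (h 1 t x * cnj (w 1 t x) + h 0 t x * cnj (w 2 t x)) + of_real \<beta> * (cnj (h 1 t x) * w 1 t x + cnj (h 0 t x) * w 2 t x)) * (- g t x)
             + (of_real \<alpha> * h 0 t x * cnj (w 1 t x) + of_real \<beta> * cnj (h 0 t x) * w 1 t x) * (- g1 t x))) * norm (w 0 t x)
        + norm (ZZ \<alpha> \<beta> \<mu> (h 0 t x) (h 2 t x) (w 0 t x) (h 1 t x + w 1 t x) (h 2 t x + w 2 t x)) * norm (- g t x) \<le> e x"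
        (is "norm ?R * _ + _ \<le> _")
      proof (cases "x \<in> {xt t..2 * xt t}")
        case False
        have g0: "g t x = 0" "g1 t x = 0" "g2 t x = 0" "gt t x = 0"
          using zero[OF x0 False] by blast+
        have "0 \<le> e x" unfolding e_def using D0 l W0 False by (simp add: weight_nonneg)
        then show ?thesis unfolding g0 by simp
      next
        case True
        then have G: "G t x = C * x powr s" by (simp add: G_def)
        have x8: "x * m ^ 8 \<le> 2" and xx1: "x \<le> x1" and xxt: "xt t \<le> x"
        proof -
          have "x * m ^ 8 \<le> (2 * xt t) * m ^ 8" using True m by (intro mult_right_mono) auto
          then show "x * m ^ 8 \<le> 2" using xt(3)[OF tt] by linarith
          show "x \<le> x1" using xt(4)[OF tt] True by auto
          show "xt t \<le> x" using True by simp
        qed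
        have x1': "x \<le> 1" using xx1 m(3) by simp
        have sl: "norm (h 0 t x - h 1 t 0 * x) \<le> K * x\<^sup>2" "norm (h 1 t x - h 1 t 0) \<le> K * x" "norm (h 0 t x) \<le> K * x"
          "(norm (h 1 t 0))\<^sup>2 = A" "norm (h 1 t 0 - h 1 0 0) \<le> L * K ^ 3 * t"
          using slope_at_zero(2-4)[OF h k K L small h0 tt, of x] slope_at_zero(5,6)[OF h k K L small h0 tt] x0 by (simp_all add: A)
        have tm: "0 \<le> t" "t * m ^ 3 \<le> 1"
          using tt order_trans[OF mult_right_mono[of t T "m ^ 3"] m(4)] m(1) by auto
        \<comment> \<open>Here k \<ge> 2 makes the first derivative of the difference O(x), as the
          estimate of the quadratic terms requires.\<close>
        have w1b: "norm (w 1 t x) \<le> 2 * K * x" "norm (w 2 t x) \<le> 2 * K"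
        proof -
          have "x ^ (k - 1) \<le> x ^ 1" using x0 x1' k by (intro power_decreasing) auto
          then have "2 * K * \<bar>x\<bar> ^ (k - 1) \<le> 2 * K * x" using x0 K0 by (simp add: mult_left_mono)
          then show "norm (w 1 t x) \<le> 2 * K * x" using flat[OF tt, of 1 x] by (simp add: w_def)
          show "norm (w 2 t x) \<le> 2 * K" by (rule wK[OF tt]) simp
        qed
        have LL: "L \<ge> 1 + \<bar>\<alpha>\<bar> + \<bar>\<beta>\<bar>" using L by simp
        have "norm (- ?R) \<le> (1 + 90 * L\<^sup>2 * K ^ 4 * m) * G t x"
        proof -
          have "- ?R = \<i> * ((h 2 t x * cnj (h 0 t x) + 2 * h 1 t x * cnj (h 1 t x) + h 0 t x * cnj (h 2 t x)) * g t x
             + 2 * (h 1 t x * cnj (h 0 t x) + h 0 t x * cnj (h 1 t x)) * g1 t x + h 0 t x * cnj (h 0 t x) * g2 t x)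
          - \<i> * ((of_real \<alpha> * (h 1 t x * cnj (h 1 t x) + h 0 t x * cnj (h 2 t x)) + 2 * of_real \<beta> * (cnj (h 1 t x) * h 1 t x + cnj (h 0 t x) * h 2 t x)) * g t x
             + (of_real \<alpha> * h 0 t x * cnj (h 1 t x) + 2 * of_real \<beta> * cnj (h 0 t x) * h 1 t x) * g1 t x)
          + \<i> * cnj (of_real \<alpha> * (h 1 t x * h 1 t x + h 0 t x * h 2 t x) * g t x + of_real \<alpha> * h 0 t x * h 1 t x * g1 t x) + gt t x
          - \<i> * ((of_real \<alpha> * (h 1 t x * cnj (w 1 t x) + h 0 t x * cnj (w 2 t x)) + of_real \<beta> * (cnj (h 1 t x) * w 1 t x + cnj (h 0 t x) * w 2 t x)) * g t x
             + (of_real \<alpha> * h 0 t x * cnj (w 1 t x) + of_real \<beta> * cnj (h 0 t x) * w 1 t x) * g1 t x)"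
            unfolding complex_cnj_add complex_cnj_mult complex_cnj_minus by algebra
          moreover have "norm \<dots> \<le> (1 + 90 * L\<^sup>2 * K ^ 4 * m) * G t x"
            by (rule packet_pointwise[where a="h 1 t 0" and ?a0.0="h 1 0 0" and A=A, OF K m(1) LL x0 x8 tm sl(1,2) _ sl(3) _ _ _ sl(4,5) w1b])
              (use b hK(1)[OF tt] hK(1)[OF T0(2)] in auto)
          ultimately show ?thesis by (simp only:)
        qed
        then have Rb: "norm ?R \<le> (1 + 90 * L\<^sup>2 * K ^ 4 * m) * G t x" by (simp only: norm_minus_cancel)
        have G0: "0 \<le> G t x" using C by (simp add: G)
        have "norm ?R * norm (w 0 t x) + norm (ZZ \<alpha> \<beta> \<mu> (h 0 t x) (h 2 t x) (w 0 t x) (h 1 t x + w 1 t x) (h 2 t x + w 2 t x)) * norm (- g t x)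
           \<le> (1 + 90 * L\<^sup>2 * K ^ 4 * m) * G t x * norm (w 0 t x) + (3 * L * K\<^sup>2 * norm (w 0 t x)) * G t x"
          using Rb Zb b G0 L0 by (intro add_mono mult_mono mult_right_mono) auto
        also have "\<dots> = (1 + 90 * L\<^sup>2 * K ^ 4 * m + 3 * L * K\<^sup>2) * (G t x * norm (w 0 t x))" by (simp add: algebra_simps)
        \<comment> \<open>94 = 1 + 90 + 3: the residual of the model, the linearization and
          quadratic errors, and the terms without derivatives of w.\<close>
        also have "\<dots> \<le> (94 * L\<^sup>2 * K ^ 4 * m) * (G t x * norm (w 0 t x))"
        proof (rule mult_right_mono)
          have k2: "1 \<le> K\<^sup>2" "K\<^sup>2 \<le> K ^ 4" using K by (auto intro: power_increasing)
          have l2: "1 \<le> L\<^sup>2" "L \<le> L\<^sup>2" using L0 self_le_power[of L 2] by auto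
          have "L * K\<^sup>2 * 1 \<le> L\<^sup>2 * K ^ 4 * m" using l2 k2 m L0 by (intro mult_mono) auto
          moreover have "1 * 1 * 1 \<le> L\<^sup>2 * K ^ 4 * m" using l2 k2 m L0 by (intro mult_mono) auto
          moreover have "1 + 90 * z + 3 * y \<le> 94 * z" if "y * 1 \<le> z" "1 * 1 * 1 \<le> z" for y z :: real using that by simp
          ultimately have "1 + 90 * (L\<^sup>2 * K ^ 4 * m) + 3 * (L * K\<^sup>2) \<le> 94 * (L\<^sup>2 * K ^ 4 * m)" by blast
          then show "1 + 90 * L\<^sup>2 * K ^ 4 * m + 3 * L * K\<^sup>2 \<le> 94 * L\<^sup>2 * K ^ 4 * m" by (simp only: mult.assoc)
        qed (use G0 in simp)
        also have "\<dots> = D * (x powr s * norm (w 0 t x))" by (simp add: D_def G)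
        also have "\<dots> \<le> D * (l * W * (weight \<sigma> (h 0 t x) * (cmod (w 0 t x))\<^sup>2) + 1 / l * (1 / xt t))"
        proof (rule mult_left_mono[OF _ D0])
          define y where "y = x powr (- \<sigma>) * norm (w 0 t x)"
          define z where "z = x powr (- 1 / 2)"
          have yz: "x powr s * norm (w 0 t x) = y * z" unfolding y_def z_def s using x0 by (simp add: powr_add[symmetric] algebra_simps)
          have y2: "y\<^sup>2 \<le> W * (weight \<sigma> (h 0 t x) * (cmod (w 0 t x))\<^sup>2)"
          proof -
            have "y\<^sup>2 = x powr (- 2 * \<sigma>) * (cmod (w 0 t x))\<^sup>2"
              unfolding y_def power_mult_distrib using x0 by (simp add: powr_powr mult.commute flip: powr_numeral)
            also have "\<dots> \<le> (W * weight \<sigma> (h 0 t x)) * (cmod (w 0 t x))\<^sup>2" by (rule mult_right_mono[OF W[OF tt x0 xx1]]) simp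
            finally show ?thesis by simp
          qed
          have z2: "z\<^sup>2 \<le> 1 / xt t"
          proof -
            have "z\<^sup>2 = 1 / x" unfolding z_def power2_eq_square powr_add[symmetric] using x0 by (simp add: powr_minus_divide)
            also have "\<dots> \<le> 1 / xt t" using xxt xt(1)[OF tt] x0 by (intro divide_left_mono) auto
            finally show ?thesis .
          qed
          have "0 \<le> (l * y - z)\<^sup>2" by simp
          then have "2 * l * (y * z) \<le> l\<^sup>2 * y\<^sup>2 + z\<^sup>2" by (simp add: power2_eq_square algebra_simps)
          then have "2 * (y * z) \<le> l * y\<^sup>2 + 1 / l * z\<^sup>2" using l by (simp add: field_simps power2_eq_square)
          moreover have "0 \<le> l * y\<^sup>2" "0 \<le> 1 / l * z\<^sup>2" using l by auto
          ultimately have "y * z \<le> l * y\<^sup>2 + 1 / l * z\<^sup>2" by linarith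
          also have "\<dots> \<le> l * (W * (weight \<sigma> (h 0 t x) * (cmod (w 0 t x))\<^sup>2)) + 1 / l * (1 / xt t)"
            using y2 z2 l by (intro add_mono mult_left_mono) auto
          finally show "x powr s * norm (w 0 t x) \<le> l * W * (weight \<sigma> (h 0 t x) * (cmod (w 0 t x))\<^sup>2) + 1 / l * (1 / xt t)"
            unfolding yz by simp
        qed
        also have "\<dots> = e x" unfolding e_def using True by (simp add: algebra_simps)
        finally show ?thesis .
      qed
    qed (use dg ei in auto)
    also have "integral {p..q} e = D * (l * W) * integral {p..q} (\<lambda>x. weight \<sigma> (h 0 t x) * (cmod (w 0 t x))\<^sup>2) + D / l * 1"
      unfolding e_def[abs_def] by (subst integral_add[OF integrable_on_mult_right[OF i1] integrable_on_mult_right[OF i2(1)]]) (simp only: integral_mult_right i2(2))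
    also have "\<dots> \<le> D * (l * W) * E + D / l * 1"
      using E[OF tt] D0 l W0 by (intro add_right_mono mult_left_mono) (auto simp: p_def q_def w_def)
    finally show ?thesis by (simp add: algebra_simps)
  qed
  have "integral {p..q} (U t) \<le> integral {p..q} (U 0) + (D * (l * W * E + 1 / l)) * t"
    by (rule evolution_integral_le[OF pq rU cU ck M kE t])
  then show ?thesis by (simp add: U_def[abs_def] w_def p_def q_def D_def)
qed

section \<open>Instability of a degenerate zero\<close>

lemma packet_eq: "0 \<le> x \<Longrightarrow> x < 2 * pi \<Longrightarrow> packet m x = of_real (bump (m ^ 8 * x)) * cis (- (m ^ 4 * ln (m ^ 8 * x)))"
  by (simp add: packet_def periodize_eq)

text \<open>The two solutions then have the same jets at the zero initially. Negative x matter as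
  well; there the value comes from the far end of the period, which lies beyond the support.\<close>

lemma packet_eq_zero:
  assumes m: "m \<ge> 1" and x: "\<bar>x\<bar> < 1 / m ^ 8"
  shows "packet m x = 0"
proof -
  have m8: "1 \<le> m ^ 8" using m by (rule one_le_power)
  then have i: "1 / m ^ 8 \<le> 1" by (simp add: divide_le_eq)
  have x1: "\<bar>x\<bar> < 1" using x i by linarith
  have x2: "\<bar>x\<bar> * m ^ 8 < 1" using x m8 pos_less_divide_eq[of "m ^ 8" "\<bar>x\<bar>" 1] by linarith
  show ?thesis
  proof (cases "x \<ge> 0")
    case True
    have "packet m x = of_real (bump (m ^ 8 * x)) * cis (- (m ^ 4 * ln (m ^ 8 * x)))"
      by (rule packet_eq) (use True x1 pi_gt3 in auto)
    then show ?thesis using x2 True by (simp add: bump_zero mult.commute)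
  next
    case False
    have "packet m x = packet m (x + 2 * pi)" by (simp only: packet_def periodize_periodic)
    also have "\<dots> = of_real (bump (m ^ 8 * (x + 2 * pi))) * cis (- (m ^ 4 * ln (m ^ 8 * (x + 2 * pi))))"
      by (rule packet_eq) (use False x1 pi_gt3 in auto)
    also have "bump (m ^ 8 * (x + 2 * pi)) = 0"
    proof (rule bump_zero(2))
      have "1 * 2 \<le> m ^ 8 * (x + 2 * pi)" using m8 x1 pi_gt3 by (intro mult_mono) auto
      then show "2 \<le> m ^ 8 * (x + 2 * pi)" by simp
    qed
    finally show ?thesis by simp
  qed
qed

section \<open>Size of the packet, of its energy and of the pairing\<close>

lemma bump_le_1: "bump z \<le> 1"
proof -
  have "flat_exp 0 y \<le> 1" for y using flat_exp_le[of 0 y 0] by simp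
  then show ?thesis unfolding bump_def by (intro mult_le_one flat_exp_nonneg)
qed

lemma bump_lower:
  assumes "5 / 4 \<le> z" "z \<le> 7 / 4"
  shows "exp (- 8) \<le> bump z"
proof -
  have "exp (- 4) \<le> flat_exp 0 y" if "1 / 4 \<le> y" for y
  proof -
    have "1 / y \<le> 4" using that by (simp add: field_simps)
    then show ?thesis using that by (simp add: flat_exp_def)
  qed
  then have "exp (- 4) * exp (- 4) \<le> bump z" unfolding bump_def using assms by (intro mult_mono flat_exp_nonneg) auto
  then show ?thesis by (simp flip: exp_add)
qed

text \<open>On an octave every power is constant up to a factor that depends on the exponent only,
  so weights can be evaluated at the left end.\<close>

lemma octave_powr:
  fixes r x p :: real
  assumes "0 < r" "x \<in> {r..2*r}"
  shows "x powr p \<le> (1 + 2 powr p) * r powr p" "r powr p \<le> (1 + 2 powr (- p)) * x powr p"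
proof -
  have *: "x powr q \<le> (1 + 2 powr q) * r powr q" for q
    using powr_le_endpoints[of r x "2 * r" q] assms by (simp add: powr_mult algebra_simps)
  show "x powr p \<le> (1 + 2 powr p) * r powr p" by (rule *)
  have "r powr p = x powr (- p) * (r powr p * x powr p)" using assms by (simp add: powr_minus)
  also have "\<dots> \<le> ((1 + 2 powr (- p)) * r powr (- p)) * (r powr p * x powr p)" by (rule mult_right_mono[OF *]) simp
  also have "\<dots> = (1 + 2 powr (- p)) * x powr p" using assms by (simp add: powr_minus)
  finally show "r powr p \<le> (1 + 2 powr (- p)) * x powr p" .
qed

lemma packet_norm_le:
  assumes m: "m > 0" and x: "0 \<le> x" "x < 2 * pi"
  shows "cmod (packet m x) \<le> 1" "x \<notin> {1 / m ^ 8..2 * (1 / m ^ 8)} \<Longrightarrow> packet m x = 0"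
proof -
  show "cmod (packet m x) \<le> 1"
    unfolding packet_eq[OF x] norm_mult norm_of_real norm_cis using bump_le_1[of "m ^ 8 * x"] bump_nonneg[of "m ^ 8 * x"] by simp
  assume "x \<notin> {1 / m ^ 8..2 * (1 / m ^ 8)}"
  then have "m ^ 8 * x \<le> 1 \<or> m ^ 8 * x \<ge> 2" using m by (auto simp: field_simps)
  then show "packet m x = 0" unfolding packet_eq[OF x] by (auto simp: bump_zero)
qed

text \<open>The packet has height at most \<kappa> on an interval of length r, where the weight is
  about r^(-2 \<sigma>). This gives \<kappa>^2 r^(1 - 2 \<sigma>), the square of the same amplitude
  \<kappa> r^(s + 1) that appears in the initial pairing when s = - \<sigma> - 1 / 2.\<close>

lemma initial_energy:
  fixes w h :: "real \<Rightarrow> complex"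
  assumes m: "m \<ge> 1" and r: "r = 1 / m ^ 8" and \<eta>: "0 < \<eta>" "\<eta> \<le> r" and W: "W > 0"
    and wt: "\<And>x. x \<in> {r..2*r} \<Longrightarrow> weight \<sigma> (h x) \<le> W * x powr (- 2 * \<sigma>)"
    and h: "continuous_on {\<eta>..2*pi-\<eta>} h" "\<And>x. x \<in> {\<eta>..2*pi-\<eta>} \<Longrightarrow> h x \<noteq> 0"
    and w: "continuous_on {\<eta>..2*pi-\<eta>} w" "\<And>x. w x = of_real \<kappa> * packet m x"
  shows "integral {\<eta>..2*pi-\<eta>} (\<lambda>x. weight \<sigma> (h x) * (cmod (w x))\<^sup>2) \<le> W * (1 + 2 powr (- 2 * \<sigma>)) * (\<kappa> * r powr (1 / 2 - \<sigma>))\<^sup>2"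
proof -
  have m8: "1 \<le> m ^ 8" using m by (rule one_le_power)
  then have r0: "0 < r" "r \<le> 1" and mr: "m ^ 8 * r = 1" using r by (auto simp: divide_le_eq)
  define B where "B = W * (1 + 2 powr (- 2 * \<sigma>)) * (\<kappa> * r powr (1 / 2 - \<sigma>))\<^sup>2"
  have B0: "0 \<le> B" using W by (simp add: B_def)
  have sq: "(r powr (1 / 2 - \<sigma>))\<^sup>2 = r * r powr (- 2 * \<sigma>)"
  proof -
    have "(r powr (1 / 2 - \<sigma>))\<^sup>2 = r powr (1 / 2 - \<sigma> + (1 / 2 - \<sigma>))" by (simp only: power2_eq_square powr_add)
    also have "1 / 2 - \<sigma> + (1 / 2 - \<sigma>) = 1 + (- 2 * \<sigma>)" by simp
    also have "r powr (1 + (- 2 * \<sigma>)) = r powr 1 * r powr (- 2 * \<sigma>)" by (rule powr_add)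
    finally show ?thesis using r0 by simp
  qed
  have i: "r \<le> 1" "2 * r \<le> 2 * pi - \<eta>" using r0 \<eta> pi_gt3 by linarith+
  note ind = integral_indicator_reciprocal[OF r0(1) \<eta>(2) i(2)]
  have "integral {\<eta>..2*pi-\<eta>} (\<lambda>x. weight \<sigma> (h x) * (cmod (w x))\<^sup>2) \<le> integral {\<eta>..2*pi-\<eta>} (\<lambda>x. B * (if x \<in> {r..2*r} then 1 / r else 0))"
  proof (rule integral_le)
    show "(\<lambda>x. weight \<sigma> (h x) * (cmod (w x))\<^sup>2) integrable_on {\<eta>..2*pi-\<eta>}"
      by (rule integrable_continuous_real) (intro continuous_intros continuous_on_weight h w(1), assumption+)
    show "(\<lambda>x. B * (if x \<in> {r..2*r} then 1 / r else 0)) integrable_on {\<eta>..2*pi-\<eta>}"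
      by (rule integrable_on_mult_right[OF ind(1)])
    fix x assume "x \<in> {\<eta>..2*pi-\<eta>}"
    then have x: "0 \<le> x" "x < 2 * pi" using \<eta> by auto
    show "weight \<sigma> (h x) * (cmod (w x))\<^sup>2 \<le> B * (if x \<in> {r..2*r} then 1 / r else 0)"
    proof (cases "x \<in> {r..2*r}")
      case False
      then have "packet m x = 0" using packet_norm_le(2)[OF _ x, of m] m unfolding r by simp
      then show ?thesis using B0 r0 by (simp add: w(2))
    next
      case True
      have "weight \<sigma> (h x) \<le> W * ((1 + 2 powr (- 2 * \<sigma>)) * r powr (- 2 * \<sigma>))"
        by (rule order_trans[OF wt[OF True] mult_left_mono[OF octave_powr(1)[OF r0(1) True]]]) (use W in simp)
      moreover have "(cmod (w x))\<^sup>2 \<le> \<kappa>\<^sup>2"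
      proof -
        have "\<bar>\<kappa>\<bar> * cmod (packet m x) \<le> \<bar>\<kappa>\<bar> * 1" using packet_norm_le(1)[OF _ x, of m] m by (intro mult_left_mono) auto
        then have "cmod (w x) \<le> \<bar>\<kappa>\<bar>" by (simp add: w(2) norm_mult)
        from power_mono[OF this norm_ge_zero, of 2] show ?thesis by simp
      qed
      ultimately have "weight \<sigma> (h x) * (cmod (w x))\<^sup>2 \<le> W * ((1 + 2 powr (- 2 * \<sigma>)) * r powr (- 2 * \<sigma>)) * \<kappa>\<^sup>2"
        using W by (intro mult_mono) (auto intro!: mult_nonneg_nonneg add_nonneg_nonneg)
      also have "\<dots> = B * (1 / r)" unfolding B_def power_mult_distrib sq using r0 by simp
      finally show ?thesis using True by simp
    qed
  qed
  also have "\<dots> = B" using ind(2) by (simp only: integral_mult_right mult_1_right)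
  finally show ?thesis unfolding B_def .
qed

text \<open>The phases of the packet and of the main part of its dual are opposite, so their product
  does not oscillate; the second wave costs at most a half since |b| \<le> 1 / 2. On the middle half
  of the octave the bump is at least exp (-8), and it enters squared. The 4 combines the lost half
  with the length r / 2.\<close>

lemma initial_pairing:
  fixes w g :: "real \<Rightarrow> complex"
  assumes m: "m \<ge> 1" and r: "r = 1 / m ^ 8" and \<eta>: "0 < \<eta>" "\<eta> \<le> r" and \<kappa>: "\<kappa> > 0"
    and w: "continuous_on {\<eta>..2*pi-\<eta>} w" "\<And>x. w x = of_real \<kappa> * packet m x"
    and g: "continuous_on {\<eta>..2*pi-\<eta>} g" "\<And>x. g x = of_real (x powr s * bump (m ^ 8 * x)) * (cis (m ^ 4 * ln (m ^ 8 * x)) + b * cis (- (m ^ 4 * ln (m ^ 8 * x))))"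
    and b: "norm b \<le> 1 / 2"
  shows "integral {\<eta>..2*pi-\<eta>} (\<lambda>x. - Re (w x * g x)) \<le> - (\<kappa> * r powr (s + 1) * (exp (- 16) / (4 * (1 + 2 powr (- s)))))"
proof -
  have m8: "1 \<le> m ^ 8" using m by (rule one_le_power)
  then have r0: "0 < r" "r \<le> 1" and mr: "m ^ 8 * r = 1" using r by (auto simp: divide_le_eq)
  define S where "S = 1 + 2 powr (- s)"
  have S: "S > 0" unfolding S_def by (rule add_pos_nonneg) auto
  have low: "\<kappa> * x powr s * (bump (m ^ 8 * x))\<^sup>2 / 2 \<le> Re (w x * g x)" if x: "x \<in> {\<eta>..2*pi-\<eta>}" for x
  proof -
    have x: "0 \<le> x" "x < 2 * pi" using \<eta> x by auto
    define \<theta> where "\<theta> = m ^ 4 * ln (m ^ 8 * x)"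
    define v where "v = bump (m ^ 8 * x)"
    have "w x * g x = of_real (\<kappa> * x powr s * v\<^sup>2) * (cis (- \<theta>) * cis \<theta> + b * (cis (- \<theta>) * cis (- \<theta>)))"
      unfolding w(2) g(2) packet_eq[OF x] \<theta>_def[symmetric] v_def[symmetric] of_real_mult of_real_power power2_eq_square
      by (simp only: algebra_simps)
    also have "cis (- \<theta>) * cis \<theta> = 1" by (simp add: cis_mult)
    finally have "Re (w x * g x) = (\<kappa> * x powr s * v\<^sup>2) * (1 + Re (b * (cis (- \<theta>) * cis (- \<theta>))))"
      by (simp only: Re_complex_of_real Im_complex_of_real times_complex.sel plus_complex.sel one_complex.sel mult_zero_left diff_zero)
    moreover have "1 / 2 \<le> 1 + Re (b * (cis (- \<theta>) * cis (- \<theta>)))"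
    proof -
      have "cmod (b * (cis (- \<theta>) * cis (- \<theta>))) \<le> 1 / 2" using b by (simp add: norm_mult)
      then show ?thesis using abs_Re_le_cmod[of "b * (cis (- \<theta>) * cis (- \<theta>))"] by linarith
    qed
    then have "(\<kappa> * x powr s * v\<^sup>2) * (1 / 2) \<le> (\<kappa> * x powr s * v\<^sup>2) * (1 + Re (b * (cis (- \<theta>) * cis (- \<theta>))))"
      using \<kappa> by (intro mult_left_mono) auto
    ultimately show ?thesis by (simp add: v_def)
  qed
  have ci: "continuous_on {\<eta>..2*pi-\<eta>} (\<lambda>x. Re (w x * g x))" by (intro continuous_intros w g)
  have sub: "{5 / 4 * r..7 / 4 * r} \<subseteq> {\<eta>..2*pi-\<eta>}" using r0 \<eta> pi_gt3 by auto
  have "\<kappa> * r powr (s + 1) * (exp (- 16) / (4 * S)) = integral {5 / 4 * r..7 / 4 * r} (\<lambda>x. \<kappa> * (r powr s / S) * exp (- 16) / 2)"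
    using r0 S by (simp add: powr_add field_simps)
  also have "\<dots> \<le> integral {5 / 4 * r..7 / 4 * r} (\<lambda>x. Re (w x * g x))"
  proof (rule integral_le)
    show "(\<lambda>x. Re (w x * g x)) integrable_on {5 / 4 * r..7 / 4 * r}"
      by (rule integrable_continuous_real[OF continuous_on_subset[OF ci sub]])
    fix x assume x: "x \<in> {5 / 4 * r..7 / 4 * r}"
    have "m ^ 8 * (5 / 4 * r) \<le> m ^ 8 * x" "m ^ 8 * x \<le> m ^ 8 * (7 / 4 * r)" by (rule mult_left_mono, use x m8 in force, use m8 in linarith)+
    then have "5 / 4 \<le> m ^ 8 * x" "m ^ 8 * x \<le> 7 / 4" using mr by (simp_all add: mult.left_commute)
    then have "exp (- 8) \<le> bump (m ^ 8 * x)" by (rule bump_lower)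
    from power_mono[OF this exp_ge_zero, of 2] have v: "exp (- 16) \<le> (bump (m ^ 8 * x))\<^sup>2" by (simp flip: exp_of_nat_mult)
    have "r powr s \<le> S * x powr s" unfolding S_def by (rule octave_powr(2)[OF r0(1)]) (use x r0 in auto)
    then have "r powr s / S \<le> x powr s" using S by (simp add: field_simps)
    then have "\<kappa> * (r powr s / S) * exp (- 16) / 2 \<le> \<kappa> * x powr s * (bump (m ^ 8 * x))\<^sup>2 / 2"
      using v \<kappa> S by (intro divide_right_mono mult_mono mult_left_mono) auto
    then show "\<kappa> * (r powr s / S) * exp (- 16) / 2 \<le> Re (w x * g x)" using low[of x] x sub by fastforce
  qed auto
  also have "\<dots> \<le> integral {\<eta>..2*pi-\<eta>} (\<lambda>x. Re (w x * g x))"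
  proof (rule integral_subset_le[OF sub])
    show "\<forall>x\<in>{\<eta>..2*pi-\<eta>}. 0 \<le> Re (w x * g x)"
      by (rule ballI, rule order_trans[OF _ low]) (use \<kappa> in auto)
  qed (rule integrable_continuous_real[OF continuous_on_subset[OF ci sub]], rule integrable_continuous_real[OF ci])
  finally show ?thesis unfolding integral_neg S_def[symmetric] neg_le_iff_le .
qed

text \<open>On the octave at xt the flatness x^k meets the singular amplitude x^s, and the length of
  the interval supplies one more power. Flatness is the only information about the final state that
  is used.\<close>

lemma final_pairing:
  fixes w g :: "real \<Rightarrow> complex"
  assumes xt: "0 < xt" "\<eta> \<le> xt" "2 * xt \<le> 1" and \<eta>: "0 < \<eta>"  and K: "K \<ge> 0" and C: "C \<ge> 0"
    and w: "continuous_on {\<eta>..2*pi-\<eta>} w" "\<And>x. x > 0 \<Longrightarrow> norm (w x) \<le> 2 * K * x ^ k"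
    and g: "continuous_on {\<eta>..2*pi-\<eta>} g" "\<And>x. x > 0 \<Longrightarrow> norm (g x) \<le> (if x \<in> {xt..2*xt} then C * x powr s else 0)"
  shows "- (2 * K * C * (1 + 2 powr (k + s)) * xt powr (k + s + 1)) \<le> integral {\<eta>..2*pi-\<eta>} (\<lambda>x. - Re (w x * g x))"
proof -
  define B where "B = 2 * K * C * (1 + 2 powr (k + s)) * xt powr (k + s + 1)"
  have B0: "0 \<le> B" unfolding B_def using K C by (intro mult_nonneg_nonneg add_nonneg_nonneg) auto
  have i: "2 * xt \<le> 2 * pi - \<eta>" using xt pi_gt3 by linarith
  note ind = integral_indicator_reciprocal[OF xt(1,2) i]
  have "integral {\<eta>..2*pi-\<eta>} (\<lambda>x. - B * (if x \<in> {xt..2*xt} then 1 / xt else 0)) \<le> integral {\<eta>..2*pi-\<eta>} (\<lambda>x. - Re (w x * g x))"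
  proof (rule integral_le)
    show "(\<lambda>x. - Re (w x * g x)) integrable_on {\<eta>..2*pi-\<eta>}"
      by (rule integrable_continuous_real) (intro continuous_intros w g)
    show "(\<lambda>x. - B * (if x \<in> {xt..2*xt} then 1 / xt else 0)) integrable_on {\<eta>..2*pi-\<eta>}"
      by (rule integrable_on_mult_right[OF ind(1)])
    fix x assume "x \<in> {\<eta>..2*pi-\<eta>}"
    then have x: "0 < x" using \<eta> by auto
    have "Re (w x * g x) \<le> B * (if x \<in> {xt..2*xt} then 1 / xt else 0)"
    proof (cases "x \<in> {xt..2*xt}")
      case False
      then have "g x = 0" using g(2)[OF x] by (simp only: if_False norm_le_zero_iff)
      then show ?thesis using False by (simp only: mult_zero_right if_False zero_complex.sel order_refl)
    next
      case True
      have "Re (w x * g x) \<le> norm (w x) * norm (g x)" using complex_Re_le_cmod[of "w x * g x"] by (simp add: norm_mult)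
      also have "\<dots> \<le> (2 * K * x ^ k) * (C * x powr s)" using w(2)[OF x] g(2)[OF x] True K x by (intro mult_mono) auto
      also have "\<dots> = 2 * K * C * x powr (k + s)" using x by (simp add: powr_add powr_realpow)
      also have "\<dots> \<le> 2 * K * C * ((1 + 2 powr (k + s)) * xt powr (k + s))"
        using octave_powr(1)[OF xt(1) True, of "k + s"] K C by (intro mult_left_mono) auto
      also have "\<dots> = B * (1 / xt)" using xt by (simp add: B_def powr_add)
      finally show ?thesis using True by simp
    qed
    then show "- B * (if x \<in> {xt..2*xt} then 1 / xt else 0) \<le> - Re (w x * g x)" by simp
  qed
  moreover have "integral {\<eta>..2*pi-\<eta>} (\<lambda>x. - B * (if x \<in> {xt..2*xt} then 1 / xt else 0)) = - B"
    using ind(2) by (simp only: integral_mult_right mult_1_right)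
  ultimately show ?thesis unfolding B_def by (simp only:)
qed

text \<open>One half of the slope is given up to the quadratic remainder and another half to the
  change in time, which leaves a / 4 uniformly on the time interval.\<close>

lemma nls_sol_slope:
  assumes h: "nls_sol \<alpha> \<beta> \<mu> k T K h" and k: "k \<ge> 2" and K: "K \<ge> 1"
    and L: "L = 1 + \<bar>\<alpha>\<bar> + \<bar>\<beta>\<bar> + norm \<mu>" and small: "L * K\<^sup>2 * T \<le> 1 / 4"
    and h0: "h 0 0 0 = 0" and t: "t \<in> {0..T}" and a: "a = norm (h 1 0 0)" "a > 0"
    and x: "\<bar>x\<bar> \<le> a / (2 * K)"
  shows "a / 4 * \<bar>x\<bar> \<le> norm (h 0 t x)" "norm (h 0 t x) \<le> K * \<bar>x\<bar>"
proof -
  have T0: "0 \<in> {0..T}" using t by auto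
  note s = slope_at_zero[OF h k K L small h0]
  show "norm (h 0 t x) \<le> K * \<bar>x\<bar>" by (rule s(2)[OF t])
  have "norm (h 0 0 x - h 1 0 0 * x) \<le> K * x\<^sup>2" by (rule s(3)[OF T0])
  moreover have "norm (h 1 0 0 * x) = a * \<bar>x\<bar>" by (simp add: norm_mult a)
  moreover have "K * x\<^sup>2 \<le> a / 2 * \<bar>x\<bar>"
  proof -
    have "K * \<bar>x\<bar> \<le> a / 2" using x K by (simp add: field_simps)
    from mult_right_mono[OF this abs_ge_zero[of x]] show ?thesis by (simp add: power2_eq_square)
  qed
  ultimately have "a / 2 * \<bar>x\<bar> \<le> norm (h 0 0 x)" using norm_triangle_sub[of "h 1 0 0 * x" "h 0 0 x"] by (simp add: norm_minus_commute)
  moreover have "norm (h 0 0 x) / 2 \<le> norm (h 0 t x)"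
    using nls_sol_comparable[OF h k t L small, of x] norm_triangle_sub[of "h 0 0 x" "h 0 t x"] by (simp add: norm_minus_commute)
  ultimately show "a / 4 * \<bar>x\<bar> \<le> norm (h 0 t x)" by simp
qed

text \<open>Energy and pairing scale alike: with \<kappa>' = \<kappa> r^(s+1) the energy is
  O(\<kappa>'^2), while the pairing starts above c1 \<kappa>' and loses at most half of this. The
  final pairing is O(xt^(k+s+1)) with xt = r exp (- 2 A m). The power r^(s+1) divides out, the
  remaining r^k is at most 1, and exp (- 2 A (k+s+1) m) is what bounds \<kappa>.\<close>

theorem packet_instability:
  fixes h :: "nat \<Rightarrow> real \<Rightarrow> real \<Rightarrow> complex"
  assumes h: "nls_sol \<alpha> \<beta> \<mu> k T0 K h" and T0: "T0 > 0" and k: "k \<ge> 2" "real k > \<sigma> - 1 / 2" and K: "K \<ge> 1"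
    and sg: "\<sigma> = 1 - \<alpha> / 2 - \<beta>"
    and h0: "h 0 0 0 = 0" "h 1 0 0 \<noteq> 0" "\<And>x. 0 < x \<Longrightarrow> x < 2 * pi \<Longrightarrow> h 0 0 x \<noteq> 0"
  shows "\<exists>C c m0. c > 0 \<and> (\<forall>m \<kappa> \<phi>. m \<ge> m0 \<longrightarrow> \<kappa> > 0 \<longrightarrow> nls_sol \<alpha> \<beta> \<mu> k (1 / m ^ 3) K \<phi> \<longrightarrow>
       (\<forall>x. \<phi> 0 0 x = h 0 0 x + of_real \<kappa> * packet m x) \<longrightarrow> \<kappa> \<le> C * exp (- c * m))"
proof -
  define L where L: "L = 1 + \<bar>\<alpha>\<bar> + \<bar>\<beta>\<bar> + norm \<mu>"
  have L0: "L \<ge> 1" by (simp add: L)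
  define a where a: "a = norm (h 1 0 0)"
  have a0: "a > 0" using h0(2) by (simp add: a)
  define A where A: "A = (cmod (h 1 0 0))\<^sup>2"
  have A0: "A > 0" using a0 by (simp add: A a)
  have aK: "a \<le> K" unfolding a by (rule nls_solD(3)[OF h]) (use T0 k in auto)
  \<comment> \<open>Up to \<open>x1\<close> the quadratic remainder of h is at most half of its
    linear part.\<close>
  define x1 where "x1 = min 1 (a / (2 * K))"
  have x1: "0 < x1" "x1 \<le> 1" "x1 \<le> a / (2 * K)" using a0 K by (auto simp: x1_def)
  obtain W where W: "W > 0" "\<And>x z. 0 < x \<Longrightarrow> a / 4 * x \<le> cmod z \<Longrightarrow> cmod z \<le> K * x \<Longrightarrow>
      weight \<sigma> z \<le> W * x powr (- 2 * \<sigma>) \<and> x powr (- 2 * \<sigma>) \<le> W * weight \<sigma> z"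
    using weight_comparable[of "a / 4" K \<sigma>] a0 aK K by (auto intro: that)
  define s where s: "s = - \<sigma> - 1 / 2"
  obtain Cg where Cg: "Cg \<ge> 1" and test: "\<And>m. m \<ge> 1 \<Longrightarrow> \<exists>g g1 g2 gt b. norm b \<le> Cg / m ^ 4
    \<and> (\<forall>x. g 0 x = of_real (x powr s * bump (m ^ 8 * x)) * (cis (m ^ 4 * ln (m ^ 8 * x)) + b * cis (- (m ^ 4 * ln (m ^ 8 * x)))))
    \<and> (\<forall>t x. x > 0 \<longrightarrow> (g t has_vector_derivative g1 t x) (at x) \<and> (g1 t has_vector_derivative g2 t x) (at x)
          \<and> ((\<lambda>t. g t x) has_vector_derivative gt t x) (at t))
    \<and> (\<forall>t. continuous_on {0<..} (g2 t) \<and> continuous_on {0<..} (gt t)) \<and> (\<forall>x. continuous_on UNIV (\<lambda>t. gt t x))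
    \<and> (\<forall>t x \<Gamma>. x > 0 \<longrightarrow> \<Gamma> = (if m ^ 8 * x * exp (2 * A * m ^ 4 * t) \<in> {1..2} then Cg * x powr s else 0) \<longrightarrow>
          norm (g t x) \<le> \<Gamma> \<and> x * norm (g1 t x) \<le> m ^ 4 * \<Gamma> \<and> x\<^sup>2 * norm (g2 t x) \<le> m ^ 8 * \<Gamma>
          \<and> norm (gt t x + \<i> * A * (x * (x * g2 t x) + 4 * (x * g1 t x) + 2 * g t x) - \<i> * of_real ((\<alpha> + 2 * \<beta>) * A) * (x * g1 t x + g t x)
               + \<i> * \<alpha> * cnj (h 1 0 0 * h 1 0 0 * (x * g1 t x + g t x))) \<le> \<Gamma>)"
    by (rule packet_test_function[OF A0 A[symmetric] sg s]) (rule that, assumption, simp only:)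
  define c1 where "c1 = exp (- 16) / (4 * (1 + 2 powr (- s)))"
  have "0 < 1 + 2 powr (- s)" by (rule add_pos_nonneg) auto
  then have c1: "c1 > 0" by (simp add: c1_def)
  define E1 where "E1 = 2 * (W * (1 + 2 powr (- 2 * \<sigma>)) + 1)"
  have E1: "0 \<le> E1" unfolding E1_def using W(1) by (intro mult_nonneg_nonneg add_nonneg_nonneg) auto
  define Q where "Q = 94 * L\<^sup>2 * K ^ 4 * Cg * (W * E1 + 1)"
  have Q: "0 \<le> Q" unfolding Q_def using W(1) E1 Cg by (intro mult_nonneg_nonneg add_nonneg_nonneg) auto
  define \<rho> where "\<rho> = k + s + 1"
  \<comment> \<open>The order k of flatness beats the critical one: \<rho> = k - \<sigma> + 1 / 2.
    The exponent of \<eta> in the boundary flux is 2 \<rho>, so the same inequality makes the flux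
    vanish in the limit.\<close>
  have \<rho>: "\<rho> > 0" using k by (simp add: \<rho>_def s)
  have \<rho>2: "0 < 2 * (k - \<sigma>) + 1" using k by simp
  define C where "C = 2 * K * Cg * (1 + 2 powr (k + s)) * 2 / c1"
  \<comment> \<open>One summand for each requirement on m: T \<le> T0, the support inside
    \<open>x1\<close>, |b| \<le> 1 / 2, a loss of at most half of the pairing, and the two smallness
    conditions on T for the energy and for the jets.\<close>
  define m0 where "m0 = 1 + 1 / T0 + 2 / x1 + 2 * Cg + 2 * Q / c1 + 40 * (1 + \<bar>\<sigma>\<bar>) * L * K\<^sup>2 + 24 * fact k * L * K\<^sup>2"
  have pos: "0 \<le> 1 / T0" "0 \<le> 2 / x1" "0 \<le> 2 * Cg" "0 \<le> 2 * Q / c1" "0 \<le> 40 * (1 + \<bar>\<sigma>\<bar>) * L * K\<^sup>2" "0 \<le> 24 * fact k * L * K\<^sup>2"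
    using T0 x1 Cg Q c1 L0 by auto
  have m0: "m0 \<ge> 1" unfolding m0_def using pos by linarith
  have main: "\<kappa> \<le> C * exp (- (2 * A * \<rho>) * m)"
    if m: "m \<ge> m0" and \<kappa>: "\<kappa> > 0" and \<phi>: "nls_sol \<alpha> \<beta> \<mu> k (1 / m ^ 3) K \<phi>"
      and \<phi>h: "\<And>x. \<phi> 0 0 x = h 0 0 x + of_real \<kappa> * packet m x" for m \<kappa> \<phi>
  proof -
    have m1: "m \<ge> 1" using m m0 by linarith
    have mb: "1 / T0 \<le> m" "2 / x1 \<le> m" "2 * Cg \<le> m" "2 * Q / c1 \<le> m" "40 * (1 + \<bar>\<sigma>\<bar>) * L * K\<^sup>2 \<le> m" "24 * fact k * L * K\<^sup>2 \<le> m"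
      using m pos unfolding m0_def by linarith+
    have mp: "m \<le> m ^ 3" "m \<le> m ^ 4" "m \<le> m ^ 8" using m1 by (auto intro: self_le_power)
    define T where "T = 1 / m ^ 3"
    have T: "0 < T" "T * m ^ 3 = 1" using m1 by (auto simp: T_def)
    have Tz: "z * T \<le> 1" if "z \<le> m" for z
    proof -
      have "z * T \<le> m ^ 3 * T" using that mp T by (intro mult_right_mono) auto
      then show ?thesis using T(2) by (simp add: mult.commute)
    qed
    have TT: "T \<le> T0" using Tz[OF mb(1)] T0 by (simp add: field_simps)
    have small: "40 * (1 + \<bar>\<sigma>\<bar>) * L * K\<^sup>2 * T \<le> 1" "24 * fact k * L * K\<^sup>2 * T \<le> 1" by (rule Tz[OF mb(5)], rule Tz[OF mb(6)])
    have small4: "L * K\<^sup>2 * T \<le> 1 / 4"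
    proof -
      have "(L * K\<^sup>2 * T) * 40 \<le> (L * K\<^sup>2 * T) * (40 * (1 + \<bar>\<sigma>\<bar>))" using L0 T by (intro mult_left_mono) auto
      also have "\<dots> = 40 * (1 + \<bar>\<sigma>\<bar>) * L * K\<^sup>2 * T" by (simp only: mult_ac)
      finally have "(L * K\<^sup>2 * T) * 40 \<le> 1" using small(1) by (rule order_trans)
      moreover have "y * 40 \<le> 1 \<Longrightarrow> y \<le> 1 / 4" for y :: real by simp
      ultimately show ?thesis by blast
    qed
    have hT: "nls_sol \<alpha> \<beta> \<mu> k T K h" by (rule nls_sol_mono[OF h]) (use T TT in auto)
    note \<phi>T = \<phi>[folded T_def]
    have tT: "T \<in> {0..T}" "0 \<in> {0..T}" using T by auto
    define r where r: "r = 1 / m ^ 8"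
    have r0: "0 < r" "r \<le> 1" using m1 by (auto simp: r divide_le_eq)
    have mx1: "m ^ 8 * x1 \<ge> 2"
    proof -
      have "2 \<le> m * x1" using mb(2) x1 by (simp add: field_simps)
      also have "\<dots> \<le> m ^ 8 * x1" using mp x1 by (intro mult_right_mono) auto
      finally show ?thesis .
    qed
    have r2: "2 * r \<le> x1" using mx1 m1 by (simp add: r field_simps)
    define w where "w i t x = \<phi> i t x - h i t x" for i t x
    have flat: "norm (\<phi> i t x - h i t x) \<le> 2 * K * \<bar>x\<bar> ^ (k - i)" if t: "t \<in> {0..T}" and i: "i \<le> 2" for t x i
    proof (rule taylor_flat[of k "\<lambda>i x. \<phi> i t x - h i t x"])
      show "((\<lambda>x. \<phi> i t x - h i t x) has_vector_derivative \<phi> (Suc i) t x - h (Suc i) t x) (at x)" if "i < k" for i x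
        by (rule has_vector_derivative_diff[OF nls_solD(1)[OF \<phi>T t that] nls_solD(1)[OF hT t that]])
      show "\<phi> i t 0 - h i t 0 = 0" if "i < k" for i
        using difference_jets_vanish[OF \<phi>T hT k(1) K L small(2) h0(1) r0(1) _ that t] packet_eq_zero[OF m1] by (simp add: \<phi>h r)
      show "norm (\<phi> k t x - h k t x) \<le> 2 * K" for x
        using norm_diff_le[OF nls_solD(3)[OF \<phi>T t, of k x] nls_solD(3)[OF hT t, of k x]] by simp
    qed (use i k in simp)
    have sl: "a / 4 * \<bar>x\<bar> \<le> norm (h 0 t x)" "norm (h 0 t x) \<le> K * \<bar>x\<bar>" if "t \<in> {0..T}" "\<bar>x\<bar> \<le> x1" for t x
      using nls_sol_slope[OF hT k(1) K L small4 h0(1) that(1) a a0, of x] that(2) x1(3) by auto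
    have W1: "weight \<sigma> (h 0 t x) \<le> W * \<bar>x\<bar> powr (- 2 * \<sigma>)" if "t \<in> {0..T}" "0 < \<bar>x\<bar>" "\<bar>x\<bar> \<le> x1" for t x
      using W(2)[OF that(2) sl[OF that(1,3)]] by blast
    have W2: "x powr (- 2 * \<sigma>) \<le> W * weight \<sigma> (h 0 t x)" if "t \<in> {0..T}" "0 < x" "x \<le> x1" for t x
      using W(2)[of "\<bar>x\<bar>" "h 0 t x"] sl[OF that(1), of x] that by simp
    define \<kappa>' where "\<kappa>' = \<kappa> * r powr (s + 1)"
    have \<kappa>': "\<kappa>' > 0" using \<kappa> r0 by (simp add: \<kappa>'_def)
    have s1: "s + 1 = 1 / 2 - \<sigma>" by (simp add: s)
    define xt where "xt = exp (- (2 * A * m)) / m ^ 8"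
    have xt: "0 < xt" "xt \<le> r"
    proof -
      show "0 < xt" using m1 by (simp add: xt_def)
      have "exp (- (2 * A * m)) \<le> 1" using A0 m1 by simp
      then show "xt \<le> r" unfolding xt_def r using m1 by (intro divide_right_mono) auto
    qed
    define Y where "Y = 16 * L * K * (8 * W * K ^ 4)"
    have Y: "Y > 0" using L0 K W by (simp add: Y_def)
    \<comment> \<open>The cutoff is chosen last, after m and \<kappa>: the boundary flux has to be
      below the squared amplitude of the packet, and the cutoff has to stay to the left of the
      support up to the final time.\<close>
    obtain \<eta> where \<eta>: "0 < \<eta>" "\<eta> < xt" "Y * \<eta> powr (2 * (k - \<sigma>) + 1) * T \<le> \<kappa>'\<^sup>2"
    proof -
      have "((\<lambda>x::real. x powr (2 * (k - \<sigma>) + 1)) \<longlongrightarrow> 0 powr (2 * (k - \<sigma>) + 1)) (at_right 0)"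
        by (intro tendsto_intros) (use \<rho>2 in \<open>auto simp: eventually_at_filter\<close>)
      then have "((\<lambda>x::real. Y * x powr (2 * (k - \<sigma>) + 1) * T) \<longlongrightarrow> Y * 0 * T) (at_right 0)"
        by (intro tendsto_intros) simp
      then have "eventually (\<lambda>x. Y * x powr (2 * (k - \<sigma>) + 1) * T < \<kappa>'\<^sup>2) (at_right 0)"
        by (rule order_tendstoD) (use \<kappa>' in simp)
      moreover have "eventually (\<lambda>x. x < xt) (at_right 0)" by (rule order_tendstoD(2)[OF tendsto_ident_at xt(1)])
      moreover have "eventually (\<lambda>x::real. 0 < x) (at_right 0)" by (rule eventually_at_right_less)
      ultimately have "eventually (\<lambda>x. 0 < x \<and> x < xt \<and> Y * x powr (2 * (k - \<sigma>) + 1) * T \<le> \<kappa>'\<^sup>2) (at_right 0)"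
        by eventually_elim auto
      from eventually_happens'[OF trivial_limit_at_right_real this] show ?thesis using that by blast
    qed
    have \<eta>r: "\<eta> \<le> r" "\<eta> \<le> x1" "\<eta> \<le> 1" using \<eta> xt r2 r0 x1 by linarith+
    have hn: "h 0 t x \<noteq> 0" if "t \<in> {0..T}" "x \<in> {\<eta>..2*pi-\<eta>}" for t x
    proof -
      have "h 0 0 x \<noteq> 0" using h0(3)[of x] that \<eta>(1) by auto
      then show ?thesis using nls_sol_comparable[OF hT k(1) that(1) L small4, of x] by auto
    qed
    have ch: "continuous_on S (h 0 t)" "continuous_on S (\<lambda>x. \<phi> 0 t x - h 0 t x)" if "t \<in> {0..T}" for t S
      using that by (auto intro!: nls_sol_continuous_on[OF hT] nls_sol_continuous_on[OF \<phi>T] continuous_on_diff)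
    have w0: "\<phi> 0 0 x - h 0 0 x = of_real \<kappa> * packet m x" for x by (simp add: \<phi>h)
    have E: "integral {\<eta>..2*pi-\<eta>} (\<lambda>x. weight \<sigma> (h 0 t x) * (cmod (\<phi> 0 t x - h 0 t x))\<^sup>2) \<le> E1 * \<kappa>'\<^sup>2" if t: "t \<in> {0..T}" for t
    proof -
      have "integral {\<eta>..2*pi-\<eta>} (\<lambda>x. weight \<sigma> (h 0 t x) * (cmod (\<phi> 0 t x - h 0 t x))\<^sup>2)
        \<le> 2 * (integral {\<eta>..2*pi-\<eta>} (\<lambda>x. weight \<sigma> (h 0 0 x) * (cmod (\<phi> 0 0 x - h 0 0 x))\<^sup>2)
         + 16 * L * K * (8 * W * K ^ 4 * \<eta> powr (2 * (k - \<sigma>) + 1)) * T)"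
        by (rule energy_bound[OF \<phi>T hT k(1) K L sg small(1) h0(1,3) flat W1 W(1) \<eta>(1) \<eta>r(2,3) t])
      also have "\<dots> \<le> 2 * (W * (1 + 2 powr (- 2 * \<sigma>)) * \<kappa>'\<^sup>2 + \<kappa>'\<^sup>2)"
      proof (intro mult_left_mono add_mono)
        show "integral {\<eta>..2*pi-\<eta>} (\<lambda>x. weight \<sigma> (h 0 0 x) * (cmod (\<phi> 0 0 x - h 0 0 x))\<^sup>2) \<le> W * (1 + 2 powr (- 2 * \<sigma>)) * \<kappa>'\<^sup>2"
          unfolding \<kappa>'_def s1
        proof (rule initial_energy[OF m1 r \<eta>(1) \<eta>r(1) W(1)])
          show "weight \<sigma> (h 0 0 x) \<le> W * x powr (- 2 * \<sigma>)" if "x \<in> {r..2*r}" for x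
            using W1[OF tT(2), of x] that r0 r2 by auto
        qed (use ch[OF tT(2)] hn[OF tT(2)] w0 in auto)
        show "16 * L * K * (8 * W * K ^ 4 * \<eta> powr (2 * (k - \<sigma>) + 1)) * T \<le> \<kappa>'\<^sup>2"
          using \<eta>(3) unfolding Y_def by (simp only: mult_ac)
      qed simp
      also have "\<dots> = E1 * \<kappa>'\<^sup>2" by (simp add: E1_def algebra_simps)
      finally show ?thesis .
    qed
    obtain g g1 g2 gt b where b: "norm b \<le> Cg / m ^ 4"
      and g0: "\<And>x. g 0 x = of_real (x powr s * bump (m ^ 8 * x)) * (cis (m ^ 4 * ln (m ^ 8 * x)) + b * cis (- (m ^ 4 * ln (m ^ 8 * x))))"
      and gd: "\<And>t x. x > 0 \<Longrightarrow> (g t has_vector_derivative g1 t x) (at x)" "\<And>t x. x > 0 \<Longrightarrow> (g1 t has_vector_derivative g2 t x) (at x)"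
          "\<And>t x. x > 0 \<Longrightarrow> ((\<lambda>t. g t x) has_vector_derivative gt t x) (at t)"
          "\<And>t. continuous_on {0<..} (g2 t)" "\<And>t. continuous_on {0<..} (gt t)" "\<And>x. continuous_on UNIV (\<lambda>t. gt t x)"
      and gb: "\<And>t x \<Gamma>. x > 0 \<Longrightarrow> \<Gamma> = (if m ^ 8 * x * exp (2 * A * m ^ 4 * t) \<in> {1..2} then Cg * x powr s else 0) \<Longrightarrow>
          norm (g t x) \<le> \<Gamma> \<and> x * norm (g1 t x) \<le> m ^ 4 * \<Gamma> \<and> x\<^sup>2 * norm (g2 t x) \<le> m ^ 8 * \<Gamma>
          \<and> norm (gt t x + \<i> * A * (x * (x * g2 t x) + 4 * (x * g1 t x) + 2 * g t x) - \<i> * of_real ((\<alpha> + 2 * \<beta>) * A) * (x * g1 t x + g t x)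
               + \<i> * \<alpha> * cnj (h 1 0 0 * h 1 0 0 * (x * g1 t x + g t x))) \<le> \<Gamma>"
      using test[OF m1] by (elim exE conjE) (rule that; blast)
    have b2: "norm b \<le> 1 / 2"
    proof -
      have "2 * Cg \<le> m ^ 4" using mb(3) mp(2) by linarith
      then have "Cg / m ^ 4 \<le> 1 / 2" using m1 by (simp add: divide_le_eq)
      then show ?thesis using b by linarith
    qed
    have cg: "continuous_on {\<eta>..2*pi-\<eta>} (g t)" for t
    proof (rule continuous_at_imp_continuous_on, rule ballI)
      fix x assume "x \<in> {\<eta>..2*pi-\<eta>}"
      then have "x > 0" using \<eta>(1) by auto
      then show "isCont (g t) x" by (rule has_vector_derivative_continuous[OF gd(1)])
    qed
    have m4T: "m ^ 4 * T = m" "m * T \<le> 1 / m"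
    proof -
      show "m ^ 4 * T = m" using m1 by (simp add: T_def eval_nat_numeral)
      have "m * T = 1 / m\<^sup>2" using m1 by (simp add: T_def eval_nat_numeral)
      also have "\<dots> \<le> 1 / m" using m1 self_le_power[OF m1, of 2] by (intro divide_left_mono) auto
      finally show "m * T \<le> 1 / m" .
    qed
    \<comment> \<open>The choice l = 1 / \<kappa>' balances the two parts of the error, as the
      energy is O(\<kappa>'^2): both become O(\<kappa>').\<close>
    have "integral {\<eta>..2*pi-\<eta>} (\<lambda>x. - Re ((\<phi> 0 T x - h 0 T x) * g T x))
       \<le> integral {\<eta>..2*pi-\<eta>} (\<lambda>x. - Re ((\<phi> 0 0 x - h 0 0 x) * g 0 x))
       + (94 * L\<^sup>2 * K ^ 4 * m * Cg * (1 / \<kappa>' * W * (E1 * \<kappa>'\<^sup>2) + 1 / (1 / \<kappa>'))) * T"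
    proof (rule pairing_bound[OF \<phi>T hT k(1) K L sg s small4 h0(1) A A0 flat m1 mx1 x1(2) _ W2 W(1) \<eta>(1) _ \<eta>r(3) hn gd gb Cg _ E tT(1)])
      show "T * m ^ 3 \<le> 1" using T by simp
      show "\<eta> < exp (- (2 * A * m ^ 4 * t)) / m ^ 8" if "t \<in> {0..T}" for t
      proof -
        have "m ^ 4 * t \<le> m ^ 4 * T" using that m1 by (intro mult_left_mono) auto
        then have "2 * A * (m ^ 4 * t) \<le> 2 * A * m" unfolding m4T(1) using A0 by (intro mult_left_mono) auto
        then have "exp (- (2 * A * m)) \<le> exp (- (2 * A * m ^ 4 * t))" by (simp add: mult.assoc)
        then have "xt \<le> exp (- (2 * A * m ^ 4 * t)) / m ^ 8" unfolding xt_def using m1 by (intro divide_right_mono) auto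
        then show ?thesis using \<eta>(2) by linarith
      qed
      show "0 < 1 / \<kappa>'" using \<kappa>' by simp
    qed
    also have "\<dots> \<le> - (\<kappa>' * c1) + \<kappa>' * (c1 / 2)"
    proof (rule add_mono)
      show "integral {\<eta>..2*pi-\<eta>} (\<lambda>x. - Re ((\<phi> 0 0 x - h 0 0 x) * g 0 x)) \<le> - (\<kappa>' * c1)"
        unfolding \<kappa>'_def c1_def by (rule initial_pairing[OF m1 r \<eta>(1) \<eta>r(1) \<kappa> ch(2)[OF tT(2)] w0 cg g0 b2])
      have "(94 * L\<^sup>2 * K ^ 4 * m * Cg * (1 / \<kappa>' * W * (E1 * \<kappa>'\<^sup>2) + 1 / (1 / \<kappa>'))) * T = \<kappa>' * (Q * (m * T))"
        using \<kappa>' by (simp add: Q_def field_simps power2_eq_square)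
      also have "\<dots> \<le> \<kappa>' * (c1 / 2)"
      proof (rule mult_left_mono)
        have "Q * (m * T) \<le> Q * (1 / m)" by (rule mult_left_mono[OF m4T(2) Q])
        also have "\<dots> \<le> c1 / 2" using mb(4) c1 m1 by (simp add: field_simps)
        finally show "Q * (m * T) \<le> c1 / 2" .
      qed (use \<kappa>' in simp)
      finally show "(94 * L\<^sup>2 * K ^ 4 * m * Cg * (1 / \<kappa>' * W * (E1 * \<kappa>'\<^sup>2) + 1 / (1 / \<kappa>'))) * T \<le> \<kappa>' * (c1 / 2)" .
    qed
    finally have up: "integral {\<eta>..2*pi-\<eta>} (\<lambda>x. - Re ((\<phi> 0 T x - h 0 T x) * g T x)) \<le> - (\<kappa>' * c1) + \<kappa>' * (c1 / 2)" .
    have "- (2 * K * Cg * (1 + 2 powr (k + s)) * xt powr (k + s + 1)) \<le> integral {\<eta>..2*pi-\<eta>} (\<lambda>x. - Re ((\<phi> 0 T x - h 0 T x) * g T x))"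
    proof (rule final_pairing[OF xt(1) _ _ \<eta>(1) _ _ ch(2)[OF tT(1)] _ cg])
      show "\<eta> \<le> xt" "2 * xt \<le> 1" "K \<ge> 0" "Cg \<ge> 0" using \<eta> xt r2 x1 K Cg by linarith+
      show "norm (\<phi> 0 T x - h 0 T x) \<le> 2 * K * x ^ k" if "x > 0" for x using flat[OF tT(1), of 0 x] that by simp
      have e: "2 * A * m ^ 4 * T = 2 * A * m" using m4T(1) by (simp only: mult.assoc)
      have supp: "m ^ 8 * x * exp (2 * A * m ^ 4 * T) \<in> {1..2} \<longleftrightarrow> x \<in> {xt..2 * xt}" for x
        unfolding xt_def e by (rule packet_support[of m _ A T, unfolded e]) (use m1 in simp)
      show "norm (g T x) \<le> (if x \<in> {xt..2*xt} then Cg * x powr s else 0)" if "x > 0" for x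
        using gb[OF that refl, of T] unfolding supp by (rule conjunct1)
    qed
    with up have "- (2 * K * Cg * (1 + 2 powr (k + s)) * xt powr \<rho>) \<le> - (\<kappa>' * c1) + \<kappa>' * (c1 / 2)" unfolding \<rho>_def by linarith
    then have "\<kappa>' * (c1 / 2) \<le> 2 * K * Cg * (1 + 2 powr (k + s)) * xt powr \<rho>" by simp
    then have "\<kappa>' \<le> C * xt powr \<rho>" using c1 by (simp add: C_def field_simps)
    also have "xt powr \<rho> = r powr (s + 1) * (r ^ k * exp (- (2 * A * \<rho>) * m))"
    proof -
      have "xt = r * exp (- (2 * A * m))" by (simp add: xt_def r)
      then have "xt powr \<rho> = r powr \<rho> * exp (- (2 * A * m)) powr \<rho>" using r0 by (simp only: powr_mult)
      also have "exp (- (2 * A * m)) powr \<rho> = exp (- (2 * A * \<rho>) * m)" by (simp add: powr_def mult_ac)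
      also have "r powr \<rho> = r powr (s + 1) * r ^ k" unfolding \<rho>_def using r0 by (simp add: powr_realpow[symmetric] powr_add[symmetric] add_ac)
      finally show ?thesis by (simp only: mult.assoc)
    qed
    finally have "r powr (s + 1) * \<kappa> \<le> r powr (s + 1) * (C * (r ^ k * exp (- (2 * A * \<rho>) * m)))"
      unfolding \<kappa>'_def by (simp only: mult_ac)
    then have "\<kappa> \<le> C * (r ^ k * exp (- (2 * A * \<rho>) * m))" using r0 by (simp only: mult_le_cancel_left_pos powr_gt_zero)
    also have "\<dots> \<le> C * (1 * exp (- (2 * A * \<rho>) * m))"
    proof (intro mult_left_mono mult_right_mono)
      show "r ^ k \<le> 1" using r0 by (intro power_le_one) auto
      show "0 \<le> C" unfolding C_def using K Cg c1 by (intro divide_nonneg_pos mult_nonneg_nonneg add_nonneg_nonneg) auto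
    qed simp
    finally show ?thesis by simp
  qed
  show ?thesis
  proof (intro exI conjI allI impI)
    show "0 < 2 * A * \<rho>" using A0 \<rho> by simp
    show "\<kappa> \<le> C * exp (- (2 * A * \<rho>) * m)"
      if "m \<ge> m0" "\<kappa> > 0" "nls_sol \<alpha> \<beta> \<mu> k (1 / m ^ 3) K \<phi>" "\<forall>x. \<phi> 0 0 x = h 0 0 x + of_real \<kappa> * packet m x" for m \<kappa> \<phi>
      by (rule main[OF that(1-3)]) (use that(4) in blast)
  qed
qed

section \<open>Reduction of the torus problem\<close>

lemma has_vector_derivative_translate:
  assumes "(g has_vector_derivative D) (at (a + x))"
  shows "((\<lambda>x. g (a + x)) has_vector_derivative D) (at (x::real))"
proof -
  have "((\<lambda>x. a + x) has_vector_derivative 1) (at x)" by (auto intro!: derivative_eq_intros)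
  from vector_diff_chain_at[OF this assms] show ?thesis by (simp add: o_def)
qed

text \<open>Derivatives are unique, so any chain of genuine derivatives coincides with
  \<open>dx\<close>. Membership and formulas for \<open>dx\<close> thus come from writing down the
  chain.\<close>

lemma Cs_chain:
  assumes p: "periodic_T g" and G0: "G 0 = g"
    and d: "\<And>i x. i < s \<Longrightarrow> (G i has_vector_derivative G (Suc i) x) (at x)"
    and c: "\<And>i. i \<le> s \<Longrightarrow> continuous_on UNIV (G i)"
  shows "Cs s g" and "j \<le> s \<Longrightarrow> dx j g = G j"
proof -
  have *: "dx j g = G j" if "j \<le> s" for j
    using that
  proof (induction j)
    case (Suc j)
    then have "dx j g = G j" by simp
    then show ?case using vector_derivative_at[OF d[of j]] Suc.prems by (intro ext) (simp add: dx_Suc)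
  qed (simp add: G0)
  then show "j \<le> s \<Longrightarrow> dx j g = G j" .
  show "Cs s g" unfolding Cs_def using p d c * by simp
qed

section \<open>Arithmetic and norms of the spaces C^s on the torus\<close>

lemma CsD:
  assumes "Cs s g"
  shows "g (x + 2 * pi) = g x" "j < s \<Longrightarrow> (dx j g has_vector_derivative dx (Suc j) g x) (at x)"
    "j \<le> s \<Longrightarrow> continuous_on UNIV (dx j g)"
  using assms by (auto simp: Cs_def periodic_T_def)

lemma Cs_mono: "Cs s g \<Longrightarrow> s' \<le> s \<Longrightarrow> Cs s' g"
  by (auto simp: Cs_def)

lemma Cs_add:
  assumes "Cs s g" "Cs s h"
  shows "Cs s (\<lambda>x. g x + h x)" "j \<le> s \<Longrightarrow> dx j (\<lambda>x. g x + h x) = (\<lambda>x. dx j g x + dx j h x)"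
  by (rule Cs_chain[where G="\<lambda>j x. dx j g x + dx j h x"]; (simp add: periodic_T_def CsD(1)[OF assms(1)] CsD(1)[OF assms(2)]
      | rule has_vector_derivative_add CsD(2)[OF assms(1)] CsD(2)[OF assms(2)] continuous_on_add CsD(3)[OF assms(1)] CsD(3)[OF assms(2)] | assumption)+)+

lemma Cs_scale:
  assumes "Cs s g"
  shows "Cs s (\<lambda>x. c * g x)" "j \<le> s \<Longrightarrow> dx j (\<lambda>x. c * g x) = (\<lambda>x. c * dx j g x)"
  by (rule Cs_chain[where G="\<lambda>j x. c * dx j g x"]; (simp add: periodic_T_def CsD(1)[OF assms(1)]
      | rule has_vector_derivative_mult_right CsD(2)[OF assms(1)] continuous_on_mult_left CsD(3)[OF assms(1)] | assumption)+)+

lemma Cs_diff: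
  assumes "Cs s g" "Cs s h"
  shows "Cs s (\<lambda>x. g x - h x)" "j \<le> s \<Longrightarrow> dx j (\<lambda>x. g x - h x) = (\<lambda>x. dx j g x - dx j h x)"
  using Cs_add[OF assms(1) Cs_scale(1)[OF assms(2), of "- 1"]] Cs_scale(2)[OF assms(2), of _ "- 1"] by simp_all

lemma dx_periodic:
  assumes "Cs s g" "j \<le> s"
  shows "dx j g (x + 2 * pi) = dx j g x"
  using assms(2)
proof (induction j arbitrary: x)
  case 0
  then show ?case using CsD(1)[OF assms(1)] by simp
next
  case (Suc j)
  have "(dx j g has_vector_derivative dx (Suc j) g (2 * pi + x)) (at (2 * pi + x))"
    using CsD(2)[OF assms(1), of j] Suc.prems by simp
  from has_vector_derivative_translate[OF this]
  have "((\<lambda>x. dx j g (x + 2 * pi)) has_vector_derivative dx (Suc j) g (2 * pi + x)) (at x)" by (simp only: add.commute)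
  then have "(dx j g has_vector_derivative dx (Suc j) g (2 * pi + x)) (at x)" using Suc by simp
  from vector_derivative_unique_at[OF this CsD(2)[OF assms(1), of j x]] Suc.prems show ?case by (simp add: add.commute)
qed

text \<open>A supremum in \<open>Cnorm\<close> says something only about a set that is bounded
  above; periodicity reduces this to one compact period.\<close>

lemma dx_bounded:
  assumes "Cs s g" "j \<le> s"
  shows "bdd_above (range (\<lambda>x. norm (dx j g x)))"
proof -
  have "continuous_on {0..2*pi} (dx j g)" using CsD(3)[OF assms] continuous_on_subset by blast
  then obtain B where B: "\<And>x. x \<in> {0..2*pi} \<Longrightarrow> norm (dx j g x) \<le> B" using continuous_on_Icc_norm_bound by blast
  have "norm (dx j g x) \<le> B" for x
  proof -
    interpret periodic_fun_simple "dx j g" "2 * pi" by unfold_locales (rule dx_periodic[OF assms])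
    define n where "n = \<lfloor>x / (2 * pi)\<rfloor>"
    define y where "y = x - of_int n * (2 * pi)"
    have f: "of_int n \<le> x / (2 * pi)" "x / (2 * pi) < of_int n + 1" unfolding n_def by linarith+
    have "y \<in> {0..2*pi}"
      using f pi_gt_zero unfolding y_def by (simp add: field_simps)
    moreover have "dx j g x = dx j g y" unfolding y_def by (rule minus_of_int[symmetric])
    ultimately show ?thesis using B by simp
  qed
  then show ?thesis by (auto simp: bdd_above_def)
qed

lemma dx_le_Cnorm:
  assumes "Cs s g" "j \<le> s"
  shows "norm (dx j g x) \<le> Cnorm s g"
proof -
  have up: "norm (dx i g y) \<le> (SUP x. norm (dx i g x))" if "i \<le> s" for i y
    by (rule cSUP_upper[OF UNIV_I dx_bounded[OF assms(1) that]])
  have "(SUP x. norm (dx j g x)) \<le> Cnorm s g"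
    unfolding Cnorm_def
  proof (rule member_le_sum)
    show "0 \<le> (SUP x. norm (dx i g x))" if "i \<in> {..s} - {j}" for i
      using up[of i 0] that norm_ge_zero order_trans by blast
  qed (use assms in auto)
  then show ?thesis using up[OF assms(2), of x] by linarith
qed

lemma Cnorm_le:
  assumes "\<And>j x. j \<le> s \<Longrightarrow> norm (dx j g x) \<le> B"
  shows "Cnorm s g \<le> real (s + 1) * B"
proof -
  have "Cnorm s g \<le> real (card {..s}) * B"
    unfolding Cnorm_def by (rule sum_bounded_above) (auto intro!: cSUP_least assms)
  then show ?thesis by simp
qed

lemma Nl_eq_NN: "Nl \<alpha> \<beta> \<mu> u x = NN \<alpha> \<beta> \<mu> (dx 0 u x) (dx 1 u x) (dx 2 u x)"
  by (simp add: Nl_def NN_def)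

text \<open>The degenerate point is moved to 0. The rate in time gets its bound, which
  \<open>has_rate\<close> demands, from the bound on the spatial 2-jet.\<close>

lemma solves_nls_sol:
  assumes s: "solves \<alpha> \<beta> \<mu> T' \<phi>" and T: "0 \<le> T" "T \<le> T'" and k: "k \<ge> 2"
    and C: "\<And>t. t \<in> {0..T} \<Longrightarrow> Cs k (\<phi> t)"
    and K: "\<And>t j x. t \<in> {0..T} \<Longrightarrow> j \<le> k \<Longrightarrow> norm (dx j (\<phi> t) x) \<le> K"
  shows "nls_sol \<alpha> \<beta> \<mu> k T K (\<lambda>j t x. dx j (\<phi> t) (x0 + x))"
  unfolding nls_sol_def
proof (intro conjI ballI allI impI)
  fix t x j assume t: "t \<in> {0..T}"
  show "((\<lambda>x. dx j (\<phi> t) (x0 + x)) has_vector_derivative dx (Suc j) (\<phi> t) (x0 + x)) (at x)" if "j < k"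
    by (rule has_vector_derivative_translate[OF CsD(2)[OF C[OF t] that]])
  assume j: "j \<le> k"
  show "isCont (\<lambda>x. dx j (\<phi> t) (x0 + x)) x"
  proof (rule isCont_o2[where f="\<lambda>x. x0 + x"])
    show "isCont (\<lambda>x. x0 + x) x" by (intro continuous_intros)
    show "isCont (dx j (\<phi> t)) (x0 + x)" using CsD(3)[OF C[OF t] j] by (simp add: continuous_on_eq_continuous_at)
  qed
  show "norm (dx j (\<phi> t) (x0 + x)) \<le> K" by (rule K[OF t j])
  show "dx j (\<phi> t) (x0 + (x + 2 * pi)) = dx j (\<phi> t) (x0 + x)"
    using dx_periodic[OF C[OF t] j, of "x0 + x"] by (simp only: add.assoc)
next
  fix x
  define n where "n \<tau> = Nl \<alpha> \<beta> \<mu> (\<phi> \<tau>) (x0 + x)" for \<tau>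
  have n: "set_integrable lborel {0..t} n" "\<phi> t (x0 + x) = \<phi> 0 (x0 + x) + \<i> * (LINT \<tau>:{0..t}|lborel. n \<tau>)" if "t \<in> {0..T}" for t
  proof -
    have "t \<in> {0..T'}" using that T by simp
    from s[unfolded solves_def, rule_format, OF this, of "x0 + x"]
    show "set_integrable lborel {0..t} n" "\<phi> t (x0 + x) = \<phi> 0 (x0 + x) + \<i> * (LINT \<tau>:{0..t}|lborel. n \<tau>)"
      unfolding n_def[abs_def] by blast+
  qed
  have nb: "norm (n \<tau>) \<le> (1 + \<bar>\<alpha>\<bar> + \<bar>\<beta>\<bar> + norm \<mu>) * K\<^sup>2 * K" if "\<tau> \<in> {0..T}" for \<tau>
  proof -
    have "norm (n \<tau>) \<le> (1 + \<bar>\<alpha>\<bar> + \<bar>\<beta>\<bar> + norm \<mu>) * K\<^sup>2 * norm (dx 0 (\<phi> \<tau>) (x0 + x))"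
      unfolding n_def Nl_eq_NN by (rule NN_bound) (use K[OF that, of 0 "x0 + x"] K[OF that, of 1 "x0 + x"] K[OF that, of 2 "x0 + x"] k in simp_all)
    also have "\<dots> \<le> (1 + \<bar>\<alpha>\<bar> + \<bar>\<beta>\<bar> + norm \<mu>) * K\<^sup>2 * K" by (rule mult_left_mono[OF K[OF that]]) auto
    finally show ?thesis .
  qed
  have "has_rate T (\<lambda>t. \<phi> t (x0 + x)) (\<lambda>\<tau>. \<i> * n \<tau>)"
    unfolding has_rate_def
  proof (intro conjI exI ballI)
    show "set_integrable lborel {0..T} (\<lambda>\<tau>. \<i> * n \<tau>)" using n(1)[of T] T by simp
    show "norm (\<i> * n \<tau>) \<le> (1 + \<bar>\<alpha>\<bar> + \<bar>\<beta>\<bar> + norm \<mu>) * K\<^sup>2 * K" if "\<tau> \<in> {0..T}" for \<tau>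
      using nb[OF that] by (simp add: norm_mult)
    show "\<phi> t (x0 + x) = \<phi> 0 (x0 + x) + (LINT \<tau>:{0..t}|lborel. \<i> * n \<tau>)" if "t \<in> {0..T}" for t
      using n(2)[OF that] by simp
  qed
  then show "has_rate T (\<lambda>t. dx 0 (\<phi> t) (x0 + x)) (\<lambda>t. \<i> * NN \<alpha> \<beta> \<mu> (dx 0 (\<phi> t) (x0 + x)) (dx 1 (\<phi> t) (x0 + x)) (dx 2 (\<phi> t) (x0 + x)))"
    unfolding n_def Nl_eq_NN dx_0 .
qed

text \<open>The supremum runs over the open interval (0, \<delta>'), so t = 0 is treated through the
  data and T stays below \<delta>'. To read a pointwise bound off the supremum, the norms must be
  bounded above beforehand; that follows from \<open>Linf_Cs\<close> for the perturbed solution and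
  from the bound on f.\<close>

lemma perturbed_nls_sol:
  assumes k: "k \<ge> 2" and T: "0 \<le> T" "T < \<delta>'" "\<delta>' \<le> \<delta>"
    and f: "\<And>t. t \<in> {0..\<delta>} \<Longrightarrow> Cs k (f t)" "\<And>t j x. t \<in> {0..\<delta>} \<Longrightarrow> j \<le> k \<Longrightarrow> norm (dx j (f t) x) \<le> F"
    and \<phi>: "Linf_Cs \<delta>' k \<phi>" "solves \<alpha> \<beta> \<mu> \<delta>' \<phi>" "\<phi> 0 = (\<lambda>x. f 0 x + \<psi> x)"
    and M: "(SUP t\<in>{0<..<\<delta>'}. Cnorm k (\<lambda>x. \<phi> t x - f t x)) \<le> M" "0 \<le> M"
    and \<psi>: "Cs k \<psi>" "\<And>j x. j \<le> k \<Longrightarrow> norm (dx j \<psi> x) \<le> \<epsilon>" and K: "F + M + \<epsilon> \<le> K"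
  shows "nls_sol \<alpha> \<beta> \<mu> k T K (\<lambda>j t x. dx j (\<phi> t) (x0 + x))"
proof (rule solves_nls_sol[OF \<phi>(2) T(1) _ k])
  show "T \<le> \<delta>'" using T by simp
  obtain P where P: "\<And>t. t \<in> {0..\<delta>'} \<Longrightarrow> Cs k (\<phi> t) \<and> Cnorm k (\<phi> t) \<le> P" using \<phi>(1) unfolding Linf_Cs_def by blast
  show "Cs k (\<phi> t)" if "t \<in> {0..T}" for t using P[of t] that T by simp
  fix t j x assume t: "t \<in> {0..T}" and j: "j \<le> k"
  have e0: "0 \<le> \<epsilon>" using \<psi>(2)[of 0 0] norm_ge_zero[of "dx 0 \<psi> 0"] by linarith
  show "norm (dx j (\<phi> t) x) \<le> K"
  proof (cases "t = 0")
    case True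
    have "dx j (\<phi> 0) x = dx j (f 0) x + dx j \<psi> x"
      unfolding \<phi>(3) using Cs_add(2)[OF f(1) \<psi>(1) j, of 0] T by simp
    also have "norm \<dots> \<le> F + \<epsilon>" using f(2)[of 0 j x] \<psi>(2)[OF j, of x] T j by (intro norm_triangle_mono) auto
    finally show ?thesis using True K M(2) by simp
  next
    case False
    have t': "t \<in> {0<..<\<delta>'}" using t T False by auto
    have d: "Cs k (\<lambda>x. \<phi> \<tau> x - f \<tau> x)" "\<And>j. j \<le> k \<Longrightarrow> dx j (\<lambda>x. \<phi> \<tau> x - f \<tau> x) = (\<lambda>x. dx j (\<phi> \<tau>) x - dx j (f \<tau>) x)" if "\<tau> \<in> {0<..<\<delta>'}" for \<tau>
      using Cs_diff[of k "\<phi> \<tau>" "f \<tau>"] P[of \<tau>] f(1)[of \<tau>] that T by auto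
    have "bdd_above ((\<lambda>t. Cnorm k (\<lambda>x. \<phi> t x - f t x)) ` {0<..<\<delta>'})"
    proof (rule bdd_aboveI2)
      fix \<tau> assume \<tau>: "\<tau> \<in> {0<..<\<delta>'}"
      show "Cnorm k (\<lambda>x. \<phi> \<tau> x - f \<tau> x) \<le> real (k + 1) * (P + F)"
      proof (rule Cnorm_le)
        fix i y assume i: "i \<le> k"
        have "norm (dx i (\<phi> \<tau>) y) \<le> P" using dx_le_Cnorm[of k "\<phi> \<tau>" i y] P[of \<tau>] \<tau> i by fastforce
        moreover have "norm (dx i (f \<tau>) y) \<le> F" using f(2)[OF _ i] \<tau> T by auto
        ultimately show "norm (dx i (\<lambda>x. \<phi> \<tau> x - f \<tau> x) y) \<le> P + F" unfolding d(2)[OF \<tau> i] by (rule norm_diff_le)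
      qed
    qed
    from cSUP_upper[OF t' this] M(1) have c: "Cnorm k (\<lambda>x. \<phi> t x - f t x) \<le> M" by linarith
    have "norm (dx j (\<phi> t) x - dx j (f t) x) \<le> M"
      using dx_le_Cnorm[OF d(1)[OF t'] j, of x] c unfolding d(2)[OF t' j] by linarith
    moreover have "norm (dx j (f t) x) \<le> F" using f(2)[OF _ j] t T by auto
    ultimately show ?thesis using norm_triangle_sub[of "dx j (\<phi> t) x" "dx j (f t) x"] K e0 by linarith
  qed
qed

text \<open>The function 1 - cos (x - x0) vanishes together with its derivative at x0, so adding it
  keeps the simple zero of the data and its slope. Differentiating a cosine shifts it by pi / 2,
  which covers all orders by one formula; the constant 1 survives at order 0 only.\<close>

lemma Cs_one_minus_cos:
  fixes c :: complex
  shows "Cs s (\<lambda>x. c * (1 - of_real (cos (x - x0))))"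
    and "j \<le> s \<Longrightarrow> norm (dx j (\<lambda>x. c * (1 - of_real (cos (x - x0)))) x) \<le> 2 * norm c"
    and "dx 1 (\<lambda>x. c * (1 - of_real (cos (x - x0)))) x0 = 0"
proof -
  define G where "G i x = c * ((if i = 0 then 1 else 0) - of_real (cos (x - x0 + real i * (pi / 2))))" for i x
  have d: "(G i has_vector_derivative G (Suc i) x) (at x)" for i x
  proof -
    have "((\<lambda>x. (if i = 0 then 1 else 0) - cos (x - x0 + real i * (pi / 2))) has_real_derivative sin (x - x0 + real i * (pi / 2))) (at x)"
      by (auto intro!: derivative_eq_intros)
    moreover have "sin (x - x0 + real i * (pi / 2)) = - cos (x - x0 + real (Suc i) * (pi / 2))"
    proof -
      have "x - x0 + real (Suc i) * (pi / 2) = (x - x0 + real i * (pi / 2)) + pi / 2" by (simp add: algebra_simps)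
      then show ?thesis by (simp only: cos_add) simp
    qed
    ultimately have "((\<lambda>x. (if i = 0 then 1 else 0) - cos (x - x0 + real i * (pi / 2))) has_real_derivative - cos (x - x0 + real (Suc i) * (pi / 2))) (at x)"
      by (simp only:)
    note 1 = has_vector_derivative_mult_right[OF has_vector_derivative_of_real[OF this], of c]
    have e: "complex_of_real ((if i = 0 then 1 else 0) - y) = (if i = 0 then 1 else 0) - complex_of_real y"
      "complex_of_real (- y) = (if Suc i = 0 then 1 else 0) - complex_of_real y" for y by simp_all
    show ?thesis using 1 unfolding G_def[abs_def] by (simp only: e)
  qed
  have G0: "G 0 = (\<lambda>x. c * (1 - of_real (cos (x - x0))))" by (simp add: G_def fun_eq_iff)
  have p: "periodic_T (\<lambda>x. c * (1 - of_real (cos (x - x0))))"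
  proof -
    have "cos (x + 2 * pi - x0) = cos (x - x0)" for x using cos_periodic[of "x - x0"] by (simp add: algebra_simps)
    then show ?thesis by (simp add: periodic_T_def)
  qed
  have c: "continuous_on UNIV (G i)" for i unfolding G_def[abs_def] by (intro continuous_intros)
  note ch = Cs_chain[OF p G0 d c]
  show "Cs s (\<lambda>x. c * (1 - of_real (cos (x - x0))))" by (rule ch(1))
  have "norm (G j x) \<le> 2 * norm c" for j x
  proof -
    have "norm ((if j = 0 then 1 else 0) - complex_of_real (cos (x - x0 + real j * (pi / 2)))) \<le> 1 + 1"
      by (rule norm_diff_le) (simp_all add: abs_cos_le_one)
    then show ?thesis unfolding G_def norm_mult by (simp add: mult.commute mult_left_mono)
  qed
  then show "j \<le> s \<Longrightarrow> norm (dx j (\<lambda>x. c * (1 - of_real (cos (x - x0)))) x) \<le> 2 * norm c" using ch(2)[of j s] by simp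
  show "dx 1 (\<lambda>x. c * (1 - of_real (cos (x - x0)))) x0 = 0" using ch(2)[of 1 1] by (simp add: G_def)
qed

text \<open>A single perturbation removes all zeros other than x0: the coefficients that fail lie on the curve
  - g / (1 - cos (x - x0)) in the complex plane, which is a null set.\<close>

lemma generic_perturbation:
  assumes g: "Cs 1 g" and r: "r > 0"
  obtains c where "norm c < r" "\<And>x. x0 < x \<Longrightarrow> x < x0 + 2 * pi \<Longrightarrow> g x + c * (1 - of_real (cos (x - x0))) \<noteq> 0"
proof -
  define q where "q x = - (g x / of_real (1 - cos (x - x0)))" for x
  have nz: "cos (x - x0) \<noteq> 1" if "x0 < x" "x < x0 + 2 * pi" for x
  proof -
    define y where "y = (x - x0) / 2"
    have y: "x - x0 = 2 * y" by (simp add: y_def)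
    have "sin y > 0" using that by (intro sin_gt_zero) (auto simp: y_def)
    then show ?thesis unfolding y cos_double_sin by simp
  qed
  have "q differentiable_on {x0<..<x0+2*pi}"
    unfolding differentiable_on_def
  proof
    fix x assume "x \<in> {x0<..<x0+2*pi}"
    then have x: "cos (x - x0) \<noteq> 1" using nz by auto
    have gd: "g differentiable (at x)" using CsD(2)[OF g, of 0 x] by (auto intro: differentiableI_vector)
    have "((\<lambda>x. inverse (1 - cos (x - x0))) has_real_derivative - (sin (x - x0) / (1 - cos (x - x0))\<^sup>2)) (at x)"
      using x by (auto intro!: derivative_eq_intros simp: power2_eq_square field_simps)
    then have "((\<lambda>x. complex_of_real (inverse (1 - cos (x - x0)))) has_vector_derivative of_real (- (sin (x - x0) / (1 - cos (x - x0))\<^sup>2))) (at x)"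
      by (rule has_vector_derivative_of_real)
    then have "(\<lambda>x. complex_of_real (inverse (1 - cos (x - x0)))) differentiable (at x)" by (rule differentiableI_vector)
    then have d: "(\<lambda>x. - (g x * complex_of_real (inverse (1 - cos (x - x0))))) differentiable (at x)"
      by (intro differentiable_minus differentiable_mult gd)
    have e: "q = (\<lambda>x. - (g x * complex_of_real (inverse (1 - cos (x - x0)))))"
      by (simp add: fun_eq_iff q_def divide_inverse)
    show "q differentiable (at x within {x0<..<x0+2*pi})"
      unfolding e by (rule differentiable_at_withinI[OF d])
  qed
  then have "negligible (q ` {x0<..<x0+2*pi})" by (intro negligible_differentiable_image_lowdim) simp_all
  moreover have "\<not> negligible (ball (0::complex) r)" using r by (simp add: negligible_convex_interior interior_open)
  ultimately have "\<not> ball 0 r \<subseteq> q ` {x0<..<x0+2*pi}" using negligible_subset by blast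
  then obtain c where c: "norm c < r" "c \<notin> q ` {x0<..<x0+2*pi}" by (auto simp: subset_eq)
  show ?thesis
  proof (rule that[OF c(1)])
    fix x assume x: "x0 < x" "x < x0 + 2 * pi"
    show "g x + c * (1 - of_real (cos (x - x0))) \<noteq> 0"
    proof
      assume z: "g x + c * (1 - of_real (cos (x - x0))) = 0"
      have "of_real (1 - cos (x - x0)) \<noteq> (0::complex)" using nz[OF x] by (simp del: of_real_diff)
      then have "c = q x" using z unfolding q_def by (simp add: field_simps add_eq_0_iff)
      then show False using c(2) x by auto
    qed
  qed
qed

lemma power_exp_small:
  fixes c e C :: real
  assumes "c > 0" "e > 0"
  obtains m where "m \<ge> m0" "m \<ge> 1" "C * m ^ N * exp (- c * m) < e"
proof -
  have "((\<lambda>x. C / c ^ N * (x ^ N / exp x)) \<longlongrightarrow> C / c ^ N * 0) at_top"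
    by (intro tendsto_mult_left tendsto_power_div_exp_0)
  then have "eventually (\<lambda>x. C / c ^ N * (x ^ N / exp x) < e) at_top"
    by (rule order_tendstoD) (use assms in simp)
  then obtain X where X: "\<And>x. x \<ge> X \<Longrightarrow> C / c ^ N * (x ^ N / exp x) < e" by (auto simp: eventually_at_top_linorder)
  define m where "m = max (max m0 1) (X / c)"
  have "X / c \<le> m" by (simp add: m_def)
  then have "X \<le> c * m" using assms by (simp add: pos_divide_le_eq mult.commute)
  from X[OF this] have "C * m ^ N * exp (- c * m) < e" using assms by (simp add: power_mult_distrib exp_minus field_simps)
  then show ?thesis by (rule that[rotated 2]) (auto simp: m_def)
qed

text \<open>Adding 1 to the floor makes the inequality strict even when \<sigma> - 1 / 2 is an
  integer; where \<open>nat\<close> cuts off a negative value, the 2 in the maximum is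
  enough.\<close>

lemma s_c_bounds: "s_c \<alpha> \<beta> \<ge> 2" "real (s_c \<alpha> \<beta>) > sigma_c \<alpha> \<beta> - 1 / 2"
  unfolding s_c_def by linarith+

text \<open>The solvability hypothesis is applied twice. The perturbation c (1 - cos (x - x0))
  yields the reference solution; the same perturbation plus a packet yields its competitor. Both
  obey one bound K that does not involve the packet, so the constants of
  \<open>packet_instability\<close> are fixed before m and \<kappa> are chosen.\<close>

lemma no_controlled_solutions:
  fixes f :: "real \<Rightarrow> real \<Rightarrow> complex"
  assumes k: "k \<ge> 2" "real k > \<sigma> - 1 / 2" and sg: "\<sigma> = 1 - \<alpha> / 2 - \<beta>" and \<delta>: "0 < \<delta>'" "\<delta>' \<le> \<delta>"
    and f: "\<And>t. t \<in> {0..\<delta>} \<Longrightarrow> Cs k (f t)" "\<And>t j x. t \<in> {0..\<delta>} \<Longrightarrow> j \<le> k \<Longrightarrow> norm (dx j (f t) x) \<le> F"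
    and f0: "f 0 x0 = 0" "dx 1 (f 0) x0 \<noteq> 0" and \<epsilon>: "\<epsilon> > 0" and M: "M \<ge> 0" and s0: "s0 \<ge> k"
    and sol: "\<And>\<psi>. Cinf \<psi> \<Longrightarrow> Cnorm s0 \<psi> \<le> \<epsilon> \<Longrightarrow> \<exists>\<phi>. Linf_Cs \<delta>' k \<phi> \<and> solves \<alpha> \<beta> \<mu> \<delta>' \<phi>
        \<and> \<phi> 0 = (\<lambda>x. f 0 x + \<psi> x) \<and> (SUP t\<in>{0<..<\<delta>'}. Cnorm k (\<lambda>x. \<phi> t x - f t x)) \<le> M"
  shows False
proof -
  \<comment> \<open>Half of \<delta>' keeps the whole closed time interval inside the range of the
    supremum, apart from t = 0.\<close>
  define T0 where "T0 = \<delta>' / 2"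
  have T0: "0 < T0" "T0 < \<delta>'" using \<delta> by (simp_all add: T0_def)
  have z: "0 \<in> {0..\<delta>}" using \<delta> by simp
  have F: "0 \<le> F" using f(2)[OF z, of 0 0] norm_ge_zero[of "dx 0 (f 0) 0"] by linarith
  define K where "K = 1 + (F + M + \<epsilon>)"
  have K: "K \<ge> 1" "F + M + \<epsilon> \<le> K" using F M \<epsilon> by (simp_all add: K_def)
  \<comment> \<open>Half of \<epsilon> for each of the two parts of the perturbation, shared among
    the s0 + 1 suprema that make up the norm.\<close>
  define e1 where "e1 = \<epsilon> / (2 * real (s0 + 1))"
  have "r * (2 * (\<epsilon> / (2 * r))) = \<epsilon>" if "r \<noteq> 0" for r using that by simp
  from this[of "real (s0 + 1)"] have e1: "0 < e1" "real (s0 + 1) * (2 * e1) = \<epsilon>" using \<epsilon> unfolding e1_def by auto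
  have "1 * (2 * e1) \<le> real (s0 + 1) * (2 * e1)" using e1(1) by (intro mult_right_mono) auto
  then have e12: "2 * e1 \<le> \<epsilon>" using e1(2) by simp
  have f1: "Cs 1 (f 0)" by (rule Cs_mono[OF f(1)[OF z]]) (use k in simp)
  have "0 < e1 / 2" using e1 by simp
  then obtain c where c: "norm c < e1 / 2" "\<And>x. x0 < x \<Longrightarrow> x < x0 + 2 * pi \<Longrightarrow> f 0 x + c * (1 - of_real (cos (x - x0))) \<noteq> 0"
    using generic_perturbation[OF f1] by blast
  define \<psi>1 where "\<psi>1 = (\<lambda>x. c * (1 - complex_of_real (cos (x - x0))))"
  have \<psi>1C: "Cs s \<psi>1" for s unfolding \<psi>1_def by (rule Cs_one_minus_cos)
  have \<psi>1b: "norm (dx j \<psi>1 x) \<le> e1" for j x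
    using Cs_one_minus_cos(2)[of j j c x0 x] c(1) unfolding \<psi>1_def by simp
  have \<psi>1e: "norm (dx j \<psi>1 x) \<le> \<epsilon>" for j x using \<psi>1b[of j x] e1(1) e12 by linarith
  have "Cinf \<psi>1" using \<psi>1C by (simp add: Cinf_def)
  moreover have "Cnorm s0 \<psi>1 \<le> \<epsilon>"
  proof -
    have "norm (dx j \<psi>1 x) \<le> 2 * e1" for j x using \<psi>1b[of j x] e1(1) by linarith
    then show ?thesis using Cnorm_le[of s0 \<psi>1 "2 * e1"] unfolding e1(2) by blast
  qed
  ultimately obtain \<phi>1 where \<phi>1: "Linf_Cs \<delta>' k \<phi>1" "solves \<alpha> \<beta> \<mu> \<delta>' \<phi>1" "\<phi>1 0 = (\<lambda>x. f 0 x + \<psi>1 x)"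
      "(SUP t\<in>{0<..<\<delta>'}. Cnorm k (\<lambda>x. \<phi>1 t x - f t x)) \<le> M"
    using sol by blast
  define h where "h j t x = dx j (\<phi>1 t) (x0 + x)" for j t x
  have h: "nls_sol \<alpha> \<beta> \<mu> k T0 K h"
    unfolding h_def[abs_def]
    by (rule perturbed_nls_sol[OF k(1) _ T0(2) \<delta>(2) f \<phi>1 M \<psi>1C _ K(2)])
      (use T0 \<psi>1e in auto)
  have h00: "h 0 0 0 = 0" using f0(1) by (simp add: h_def \<phi>1(3) \<psi>1_def)
  have "dx 1 (\<phi>1 0) = (\<lambda>x. dx 1 (f 0) x + dx 1 \<psi>1 x)" unfolding \<phi>1(3) by (rule Cs_add(2)[OF f1 \<psi>1C]) simp
  then have h10: "h 1 0 0 \<noteq> 0" using f0(2) Cs_one_minus_cos(3)[of c x0] by (simp add: h_def \<psi>1_def)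
  have hx: "h 0 0 x \<noteq> 0" if "0 < x" "x < 2 * pi" for x
    using c(2)[of "x0 + x"] that by (simp add: h_def \<phi>1(3) \<psi>1_def)
  have "\<exists>C c m0. c > 0 \<and> (\<forall>m \<kappa> \<phi>. m \<ge> m0 \<longrightarrow> \<kappa> > 0 \<longrightarrow> nls_sol \<alpha> \<beta> \<mu> k (1 / m ^ 3) K \<phi> \<longrightarrow>
       (\<forall>x. \<phi> 0 0 x = h 0 0 x + of_real \<kappa> * packet m x) \<longrightarrow> \<kappa> \<le> C * exp (- c * m))"
    (is "\<exists>C c m0. _ \<and> ?P C c m0")
    by (rule packet_instability[OF h T0(1) k K(1) sg h00 h10]) (rule hx)
  then obtain C c' m0 where c': "c' > 0" and bound: "?P C c' m0" by (elim exE conjE) (rule that)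
  define P where "P n x = packet n (x - x0)" for n x
  have PB: "PB j P" for j
    using PB_affine[OF PB_packet, of "\<lambda>_. 1" 1 0 j "\<lambda>_. - x0"] by (simp add: P_def[abs_def])
  have Pp: "P n (x + 2 * pi) = P n x" for n x
    using periodize_periodic[of _ "x - x0"] by (simp add: P_def packet_def algebra_simps)
  obtain D N where D: "D > 0" "\<And>n x j. n \<ge> 1 \<Longrightarrow> j \<le> s0 \<Longrightarrow> norm (dx j (P n) x) \<le> D * n ^ (N::nat)"
    using PB_dx_bound[OF PB, of s0] by blast
  have "0 < e1 / D" using e1 D by simp
  then obtain m where m: "m \<ge> max m0 (1 / T0)" "m \<ge> 1" "C * m ^ N * exp (- c' * m) < e1 / D"
    using power_exp_small[OF c', of "e1 / D" "max m0 (1 / T0)" C N] by blast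
  have PC: "Cs s (P m)" for s using PB_Cs[OF PB Pp m(2)] by (simp add: Cinf_def)
  \<comment> \<open>The amplitude for which the bound D m^N on the derivatives of the packet uses up
    exactly the budget \<open>e1\<close>. It decays like a power of m, against the exponential bound
    of \<open>packet_instability\<close>.\<close>
  define \<kappa> where "\<kappa> = e1 / (D * m ^ N)"
  have \<kappa>: "\<kappa> > 0" "\<kappa> * (D * m ^ N) = e1" using e1 D m(2) by (simp_all add: \<kappa>_def)
  define \<psi> where "\<psi> = (\<lambda>x. \<psi>1 x + of_real \<kappa> * P m x)"
  note sc = Cs_scale[OF PC, where c="complex_of_real \<kappa>"]
  have \<psi>C: "Cs s \<psi>" for s unfolding \<psi>_def by (rule Cs_add(1)[OF \<psi>1C sc(1)])
  have \<psi>b: "norm (dx j \<psi> x) \<le> 2 * e1" if "j \<le> s0" for j x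
  proof -
    have "dx j \<psi> x = dx j \<psi>1 x + of_real \<kappa> * dx j (P m) x"
      unfolding \<psi>_def Cs_add(2)[OF \<psi>1C sc(1) that] sc(2)[OF that] ..
    also have "norm \<dots> \<le> e1 + \<kappa> * (D * m ^ N)"
      by (intro norm_add_le norm_mult_le \<psi>1b D(2)[OF m(2) that]) (use \<kappa>(1) in simp)
    finally show ?thesis unfolding \<kappa>(2) by simp
  qed
  have "Cinf \<psi>" using \<psi>C by (simp add: Cinf_def)
  moreover have "Cnorm s0 \<psi> \<le> \<epsilon>" using Cnorm_le[of s0 \<psi> "2 * e1"] \<psi>b unfolding e1(2) by blast
  ultimately obtain \<phi> where \<phi>: "Linf_Cs \<delta>' k \<phi>" "solves \<alpha> \<beta> \<mu> \<delta>' \<phi>" "\<phi> 0 = (\<lambda>x. f 0 x + \<psi> x)"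
      "(SUP t\<in>{0<..<\<delta>'}. Cnorm k (\<lambda>x. \<phi> t x - f t x)) \<le> M"
    using sol by blast
  have T: "0 \<le> 1 / m ^ 3" "1 / m ^ 3 < \<delta>'"
  proof -
    show "0 \<le> 1 / m ^ 3" using m(2) by simp
    have "1 / m ^ 3 \<le> 1 / m" using m(2) self_le_power[OF m(2), of 3] by (intro divide_left_mono) auto
    also have "\<dots> \<le> T0" using m(1,2) T0(1) by (simp add: field_simps)
    finally show "1 / m ^ 3 < \<delta>'" using T0(2) by simp
  qed
  have "norm (dx j \<psi> x) \<le> \<epsilon>" if "j \<le> k" for j x using \<psi>b[of j x] that s0 e12 by simp
  from perturbed_nls_sol[OF k(1) T \<delta>(2) f \<phi> M \<psi>C this K(2), of x0]
  have u: "nls_sol \<alpha> \<beta> \<mu> k (1 / m ^ 3) K (\<lambda>j t x. dx j (\<phi> t) (x0 + x))" by simp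
  have "\<kappa> \<le> C * exp (- c' * m)"
  proof (rule bound[rule_format, OF _ \<kappa>(1) u])
    show "m0 \<le> m" using m(1) by simp
    show "dx 0 (\<phi> 0) (x0 + x) = h 0 0 x + of_real \<kappa> * packet m x" for x
      by (simp add: h_def \<phi>(3) \<phi>1(3) \<psi>_def P_def)
  qed
  then have "\<kappa> * m ^ N \<le> C * exp (- c' * m) * m ^ N" using m(2) by (intro mult_right_mono) auto
  also have "\<dots> = C * m ^ N * exp (- c' * m)" by (simp only: mult_ac)
  also have "\<dots> < e1 / D" by (rule m(3))
  also have "e1 / D = \<kappa> * m ^ N" using \<kappa>(2) D(1) by (simp add: field_simps)
  finally show False by simp
qed

theorem theorem1p1:
  fixes \<alpha> \<beta> :: real and \<mu> :: complex and f :: "real \<Rightarrow> real \<Rightarrow> complex"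
    and \<delta> x0 :: real
  assumes "\<delta> > 0"
    and "Linf_Ck1 \<delta> (s_c \<alpha> \<beta> + 1) f"
    and "solves \<alpha> \<beta> \<mu> \<delta> f"
    and "f 0 x0 = 0" and "dx 1 (f 0) x0 \<noteq> 0"
  shows "\<exists>c0 > 0. \<forall>\<epsilon> > 0. \<forall>s0 \<ge> s_c \<alpha> \<beta>. \<forall>\<delta>'. 0 < \<delta>' \<and> \<delta>' \<le> \<delta> \<longrightarrow>
    (\<exists>\<psi>. Cinf \<psi> \<and> Cnorm s0 \<psi> \<le> \<epsilon> \<and>
       ((\<not> (\<exists>\<phi>. Linf_Cs \<delta>' (s_c \<alpha> \<beta>) \<phi> \<and> solves \<alpha> \<beta> \<mu> \<delta>' \<phi>
                \<and> \<phi> 0 = (\<lambda>x. f 0 x + \<psi> x)))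
        \<or> (\<forall>\<phi>. Linf_Cs \<delta>' (s_c \<alpha> \<beta>) \<phi> \<and> solves \<alpha> \<beta> \<mu> \<delta>' \<phi>
                \<and> \<phi> 0 = (\<lambda>x. f 0 x + \<psi> x) \<longrightarrow>
             (SUP t\<in>{0<..<\<delta>'}. Cnorm (s_c \<alpha> \<beta>) (\<lambda>x. \<phi> t x - f t x))
               > c0 * \<delta>' powr (-1/2))))"
proof -
  define k where "k = s_c \<alpha> \<beta>"
  obtain F where F: "\<And>t. t \<in> {0..\<delta>} \<Longrightarrow> Cs (k + 1) (f t) \<and> Cnorm (k + 1) (f t) \<le> F"
    using assms(2) unfolding Linf_Ck1_def k_def by blast
  have f: "Cs k (f t)" "j \<le> k \<Longrightarrow> norm (dx j (f t) x) \<le> F" if "t \<in> {0..\<delta>}" for t j x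
    using F[OF that] Cs_mono[of "k + 1" "f t" k] dx_le_Cnorm[of "k + 1" "f t" j x] by auto
  have contra: False
    if \<epsilon>: "\<epsilon> > 0" and s0: "s0 \<ge> k" and \<delta>': "0 < \<delta>' \<and> \<delta>' \<le> \<delta>"
      and neg: "\<not> (\<exists>\<psi>. Cinf \<psi> \<and> Cnorm s0 \<psi> \<le> \<epsilon> \<and>
       ((\<not> (\<exists>\<phi>. Linf_Cs \<delta>' k \<phi> \<and> solves \<alpha> \<beta> \<mu> \<delta>' \<phi> \<and> \<phi> 0 = (\<lambda>x. f 0 x + \<psi> x)))
        \<or> (\<forall>\<phi>. Linf_Cs \<delta>' k \<phi> \<and> solves \<alpha> \<beta> \<mu> \<delta>' \<phi> \<and> \<phi> 0 = (\<lambda>x. f 0 x + \<psi> x) \<longrightarrow>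
             (SUP t\<in>{0<..<\<delta>'}. Cnorm k (\<lambda>x. \<phi> t x - f t x)) > 1 * \<delta>' powr (-1/2))))" for \<epsilon> s0 \<delta>'
  \<comment> \<open>If both alternatives fail for every admissible perturbation, then each of them
    has a solution whose distance to f is at most the given number, which serves as M.\<close>
  proof (rule no_controlled_solutions[where f=f and k=k and F=F and \<delta>=\<delta> and \<delta>'=\<delta>', OF _ _ _ _ _ f(1) f(2) assms(4,5) \<epsilon> _ s0])
    show "k \<ge> 2" "real k > sigma_c \<alpha> \<beta> - 1 / 2" unfolding k_def by (rule s_c_bounds)+
    show "sigma_c \<alpha> \<beta> = 1 - \<alpha> / 2 - \<beta>" by (simp add: sigma_c_def)
    show "0 < \<delta>'" "\<delta>' \<le> \<delta>" using \<delta>' by auto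
    show "0 \<le> 1 * \<delta>' powr (-1/2)" by simp
    show "\<exists>\<phi>. Linf_Cs \<delta>' k \<phi> \<and> solves \<alpha> \<beta> \<mu> \<delta>' \<phi> \<and> \<phi> 0 = (\<lambda>x. f 0 x + \<psi> x)
        \<and> (SUP t\<in>{0<..<\<delta>'}. Cnorm k (\<lambda>x. \<phi> t x - f t x)) \<le> 1 * \<delta>' powr (-1/2)"
      if "Cinf \<psi>" "Cnorm s0 \<psi> \<le> \<epsilon>" for \<psi>
      using neg that unfolding not_less[symmetric] by blast
  qed
  \<comment> \<open>The contradiction is reached for every nonnegative M, so the witness for c0 can
    be 1, whatever f and \<delta>' are.\<close>
  show ?thesis
    by (intro exI[of _ 1] conjI allI impI, simp, rule ccontr, rule contra[unfolded k_def], assumption+)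
qed

end
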